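(* Let $E_h,\mathbf U_h$ be the numerical solutions of the semi-discrete discontinuous Galerkin scheme on a triangular mesh described in the context, for the two-dimensional stochastic Maxwell system $$dE=\nabla\cdot\mathbf U\,dt+F(\mathbf x,t,E,\mathbf U)\,dW_t,\qquad d\mathbf U=\nabla E\,dt+\mathbf G(\mathbf x,t,E,\mathbf U)\,dW_t$$ with periodic boundary conditions, with flux parameters $\beta_1\ge0$, $\beta_2\ge0$. Let $\mathcal P(F)$ and $\mathcal P(\mathbf G)$ be the $L^2$ projections of $F(\cdot,\tau,E_h,\mathbf U_h)$ and $\mathbf G(\cdot,\tau,E_h,\mathbf U_h)$ onto $V_h^k$ and $(V_h^k)^2$. Then $$\mathbb E\Big(\|E_h(\mathbf x,t)\|^2+\|\mathbf U_h(\mathbf x,t)\|^2\Big)\le\|E_h(\mathbf x,0)\|^2+\|\mathbf U_h(\mathbf x,0)\|^2+\int_0^t\mathbb E\Big(\|\mathcal P(F)\|^2+\|\mathcal P(\mathbf G)\|^2\Big)d\tau .$$ Moreover, equality holds when $\beta_1=\beta_2=0$.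
   Context: $W_t$ is a standard one-dimensional Brownian motion on a probability space with its filtration; stochastic integrals are Itô integrals. $D\subset\mathbb R^2$ is the bounded spatial domain with periodic boundary conditions and $\|\cdot\|$ is the $L^2(D)$ norm. $E$ is scalar, $\mathbf U$ is $\mathbb R^2$-valued (for the Maxwell system with unknowns $E,S,T$, $\mathbf U=(T,-S)^T$). $F$ (scalar) and $\mathbf G$ ($\mathbb R^2$-valued) are smooth functions that are globally Lipschitz in $(E,\mathbf U)$ uniformly in $(\mathbf x,t)$ and satisfy $|F|+|\mathbf G|\le C(1+|E|+|\mathbf U|)$. Mesh: $D=\bigcup_{K\in\mathcal T_h}K$ is a quasi-uniform triangulation; $\Gamma$ is the collection of triangle faces $\mathscr F$ (boundary faces identified by periodicity, so each face has two neighbouring cells $K^\pm$). $\mathbf n$ is the outer unit normal on $\partial K$, and $\mathbf n^\pm$ the outer unit normal on $\mathscr F$ with respect to $K^\pm$. $\mathbf n_{\mathscr F}$ is a unit normal across $\mathscr F$ (orientation inessential). It is assumed that there are a unit vector $\mathbf r$ and $\kappa>0$ with $|\mathbf r\cdot\mathbf n_{\mathscr F}|\ge\kappa$ for all faces. $V_h^k=\{w:w|_K\in P^k(K)\ \forall K\}$ where $P^k(K)$ is the space of polynomials of degree at most $k$. With $w^\pm,\mathbf v^\pm$ the traces on $\mathscr F$ from $K^\pm$, set $\{w\}=\frac12(w^++w^-)$, $\{\mathbf v\}=\frac12(\mathbf v^++\mathbf v^-)$, $[w\mathbf n]=w^+\mathbf n^++w^-\mathbf n^-$, $[\mathbf v\cdot\mathbf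 n]=\mathbf v^+\cdot\mathbf n^++\mathbf v^-\cdot\mathbf n^-$. Fluxes: $\boldsymbol{\mathcal F}_1(\mathbf U_h,E_h)=\{\mathbf U_h\}-\boldsymbol\alpha[\mathbf U_h\cdot\mathbf n]-\beta_1[E_h\mathbf n]$, $\mathcal F_2(E_h,\mathbf U_h)=\{E_h\}+\boldsymbol\alpha\cdot[E_h\mathbf n]-\beta_2[\mathbf U_h\cdot\mathbf n]$, where $\boldsymbol\alpha=\alpha\,\mathrm{sgn}(\mathbf r\cdot\mathbf n_{\mathscr F})\,\mathbf n_{\mathscr F}$ for a real number $\alpha$. Scheme: $E_h$ and $\mathbf U_h$ are adapted processes with values in $V_h^k$ and $(V_h^k)^2$, with deterministic initial data, such that for all $\varphi\in V_h^k$, $\boldsymbol\psi\in(V_h^k)^2$ and all $K$, $$\int_K dE_h\,\varphi\,d\mathbf x+\int_K\mathbf U_h\cdot\nabla\varphi\,d\mathbf x\,dt-\int_{\partial K}\boldsymbol{\mathcal F}_1(\mathbf U_h,E_h)\cdot\varphi\mathbf n\,ds\,dt=\int_K F(\mathbf x,t,E_h,\mathbf U_h)\varphi\,d\mathbf x\,dW_t,$$ $$\int_K d\mathbf U_h\cdot\boldsymbol\psi\,d\mathbf x+\int_K E_h\nabla\cdot\boldsymbol\psi\,d\mathbf x\,dt-\int_{\partial K}\mathcal F_2(E_h,\mathbf U_h)\boldsymbol\psi\cdot\mathbf n\,ds\,dt=\int_K\mathbf G(\mathbf x,t,E_h,\mathbf U_h)\cdot\boldsymbol\psi\,d\mathbf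 x\,dW_t,$$ understood in integrated Itô form. *)

theory Defs
  imports "HOL-Probability.Probability"
begin

section \<open>Brownian motion and the Ito integral\<close>

locale brownian_motion = prob_space M + filtration "space M" Fil
  for M :: "'a measure" and Fil :: "real \<Rightarrow> 'a measure" +
  fixes W :: "real \<Rightarrow> 'a \<Rightarrow> real"
  assumes Fil_subalgebra: "\<And>t. subalgebra M (Fil t)"
    and W_adapted: "\<And>t. 0 \<le> t \<Longrightarrow> W t \<in> borel_measurable (Fil t)"
    and W_zero: "AE \<omega> in M. W 0 \<omega> = 0"
    and W_normal: "\<And>s t. 0 \<le> s \<Longrightarrow> s < t \<Longrightarrow>
      distributed M lborel (\<lambda>\<omega>. W t \<omega> - W s \<omega>) (normal_density 0 (sqrt (t - s)))"
    and W_indep: "\<And>s t. 0 \<le> s \<Longrightarrow> s < t \<Longrightarrow>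
      indep_set (sets (Fil s)) {(\<lambda>\<omega>. W t \<omega> - W s \<omega>) -` B \<inter> space M | B. B \<in> sets borel}"
    and W_continuous: "AE \<omega> in M. continuous_on {0..} (\<lambda>t. W t \<omega>)"

text \<open>A simple process is \<open>\<Sum>i<n. \<xi> i \<cdot> 1\<^bsub>(p i, p (i+1)]\<^esub>\<close> with bounded
  \<open>Fil (p i)\<close>-measurable coefficients \<open>\<xi> i\<close>.\<close>

definition simple_process ::
  "'a measure \<Rightarrow> (real \<Rightarrow> 'a measure) \<Rightarrow> nat \<Rightarrow> (nat \<Rightarrow> real) \<Rightarrow> (nat \<Rightarrow> 'a \<Rightarrow> real) \<Rightarrow> bool" where
  "simple_process M Fil n p \<xi> \<longleftrightarrow>
     0 \<le> p 0 \<and> (\<forall>i<n. p i \<le> p (Suc i)) \<and>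
     (\<forall>i<n. \<xi> i \<in> borel_measurable (Fil (p i)) \<and> bounded (\<xi> i ` space M))"

definition simple_value ::
  "nat \<Rightarrow> (nat \<Rightarrow> real) \<Rightarrow> (nat \<Rightarrow> 'a \<Rightarrow> real) \<Rightarrow> real \<Rightarrow> 'a \<Rightarrow> real" where
  "simple_value n p \<xi> s \<omega> = (\<Sum>i<n. \<xi> i \<omega> * indicator {p i<..p (Suc i)} s)"

definition simple_ito ::
  "(real \<Rightarrow> 'a \<Rightarrow> real) \<Rightarrow> nat \<Rightarrow> (nat \<Rightarrow> real) \<Rightarrow> (nat \<Rightarrow> 'a \<Rightarrow> real) \<Rightarrow> real \<Rightarrow> 'a \<Rightarrow> real" where
  "simple_ito W n p \<xi> t \<omega> =
     (\<Sum>i<n. \<xi> i \<omega> * (W (min t (p (Suc i))) \<omega> - W (min t (p i)) \<omega>))"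

definition to_zero_in_prob :: "'a measure \<Rightarrow> (nat \<Rightarrow> 'a \<Rightarrow> ennreal) \<Rightarrow> bool" where
  "to_zero_in_prob M X \<longleftrightarrow>
     (\<forall>\<epsilon>>0. (\<lambda>m. measure M {\<omega> \<in> space M. ennreal \<epsilon> < X m \<omega>}) \<longlonglongrightarrow> 0)"

text \<open>\<open>has_ito_integral M Fil W H t I\<close> says that \<open>I\<close> is (a version of) \<open>\<integral>\<^sub>0\<^sup>t H dW\<close>.  This is the
  integral for measurable adapted integrands with \<open>\<integral>\<^sub>0\<^sup>t H\<^sup>2 ds < \<infinity>\<close> almost surely, that is, the
  limit in probability of integrals of simple processes; for integrands that are
  square integrable over \<open>\<Omega> \<times> [0,t]\<close> it is the usual \<open>L\<^sup>2\<close> integral.\<close>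

definition has_ito_integral ::
  "'a measure \<Rightarrow> (real \<Rightarrow> 'a measure) \<Rightarrow> (real \<Rightarrow> 'a \<Rightarrow> real) \<Rightarrow>
   (real \<Rightarrow> 'a \<Rightarrow> real) \<Rightarrow> real \<Rightarrow> ('a \<Rightarrow> real) \<Rightarrow> bool" where
  "has_ito_integral M Fil W H t I \<longleftrightarrow>
     (\<lambda>(s, \<omega>). H s \<omega>) \<in> borel_measurable (restrict_space lborel {0..t} \<Otimes>\<^sub>M M) \<and>
     (\<forall>s\<in>{0..t}. H s \<in> borel_measurable (Fil s)) \<and>
     (AE \<omega> in M. (\<integral>\<^sup>+s\<in>{0..t}. ennreal ((H s \<omega>)\<^sup>2) \<partial>lborel) < \<infinity>) \<and>
     I \<in> borel_measurable M \<and>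
     (\<exists>n p \<xi>. (\<forall>m. simple_process M Fil (n m) (p m) (\<xi> m)) \<and>
        to_zero_in_prob M
          (\<lambda>m \<omega>. \<integral>\<^sup>+s\<in>{0..t}. ennreal ((simple_value (n m) (p m) (\<xi> m) s \<omega> - H s \<omega>)\<^sup>2) \<partial>lborel) \<and>
        to_zero_in_prob M
          (\<lambda>m \<omega>. ennreal \<bar>simple_ito W (n m) (p m) (\<xi> m) t \<omega> - I \<omega>\<bar>))"


section \<open>Coefficients\<close>

primrec Ck_on :: "nat \<Rightarrow> 'v::real_normed_vector set \<Rightarrow> ('v \<Rightarrow> 'w::real_normed_vector) \<Rightarrow> bool" where
  "Ck_on 0 S f \<longleftrightarrow> continuous_on S f"
| "Ck_on (Suc j) S f \<longleftrightarrow>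
     (\<exists>f'. (\<forall>x\<in>S. (f has_derivative f' x) (at x)) \<and> (\<forall>v. Ck_on j S (\<lambda>x. f' x v)))"

text \<open>Smoothness on an arbitrary (here: closed) set is the existence of a smooth extension to an
  open neighbourhood.\<close>

definition smooth_on :: "'v::real_normed_vector set \<Rightarrow> ('v \<Rightarrow> 'w::real_normed_vector) \<Rightarrow> bool" where
  "smooth_on X f \<longleftrightarrow>
     (\<exists>S g. open S \<and> X \<subseteq> S \<and> (\<forall>j. Ck_on j S g) \<and> (\<forall>x\<in>X. g x = f x))"

definition smooth_coeff ::
  "(real^2) set \<Rightarrow> (real^2 \<Rightarrow> real \<Rightarrow> real \<Rightarrow> real^2 \<Rightarrow> 'b::real_normed_vector) \<Rightarrow> bool" where
  "smooth_coeff D F \<longleftrightarrow>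
     smooth_on (D \<times> {0..} \<times> UNIV \<times> UNIV) (\<lambda>(x, t, e, u). F x t e u)"

definition lipschitz_coeff ::
  "(real^2) set \<Rightarrow> (real^2 \<Rightarrow> real \<Rightarrow> real \<Rightarrow> real^2 \<Rightarrow> 'b::real_normed_vector) \<Rightarrow> bool" where
  "lipschitz_coeff D F \<longleftrightarrow>
     (\<exists>L. \<forall>x\<in>D. \<forall>t\<ge>0. \<forall>e e' u u'.
        norm (F x t e u - F x t e' u') \<le> L * (\<bar>e - e'\<bar> + norm (u - u')))"

definition linear_growth ::
  "(real^2) set \<Rightarrow> (real^2 \<Rightarrow> real \<Rightarrow> real \<Rightarrow> real^2 \<Rightarrow> real) \<Rightarrow>
   (real^2 \<Rightarrow> real \<Rightarrow> real \<Rightarrow> real^2 \<Rightarrow> real^2) \<Rightarrow> bool" where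
  "linear_growth D F G \<longleftrightarrow>
     (\<exists>C. \<forall>x\<in>D. \<forall>t\<ge>0. \<forall>e u. \<bar>F x t e u\<bar> + norm (G x t e u) \<le> C * (1 + \<bar>e\<bar> + norm u))"


section \<open>Periodic triangular meshes\<close>

definition period_lattice :: "(real^2) set \<Rightarrow> bool" where
  "period_lattice \<Lambda> \<longleftrightarrow>
     (\<exists>p q. p \<noteq> q \<and> independent {p, q} \<and>
        \<Lambda> = {of_int m *\<^sub>R p + of_int n *\<^sub>R q | m n. True})"

abbreviation translate :: "real^2 \<Rightarrow> (real^2) set \<Rightarrow> (real^2) set" where
  "translate v S \<equiv> (+) v ` S"

text \<open>Periodic boundary conditions on \<open>D\<close> mean that \<open>D\<close> is a fundamental cell of the lattice \<open>\<Lambda>\<close> of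
  periods (for a rectangle, \<open>\<Lambda>\<close> is spanned by its two sides).  The triangulation is conforming up
  to the identification: its \<open>\<Lambda>\<close>-translates form a conforming triangulation of the plane.  In
  particular each edge \<open>e\<close> of a cell \<open>K\<close> belongs to exactly one other translated cell.\<close>

locale periodic_mesh =
  fixes \<Lambda> D :: "(real^2) set" and Th :: "(real^2) set set"
  assumes lattice: "period_lattice \<Lambda>"
    and D_cover: "(\<Union>v\<in>\<Lambda>. translate v D) = UNIV"
    and D_disjoint: "\<And>v. v \<in> \<Lambda> \<Longrightarrow> v \<noteq> 0 \<Longrightarrow> interior D \<inter> interior (translate v D) = {}"
    and finite_cells: "finite Th"
    and cells_triangle: "\<And>K. K \<in> Th \<Longrightarrow> 2 simplex K"
    and D_eq: "D = \<Union>Th"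
    and conforming: "\<And>K K' v. K \<in> Th \<Longrightarrow> K' \<in> Th \<Longrightarrow> v \<in> \<Lambda> \<Longrightarrow>
      (K \<inter> translate v K') face_of K \<and> (K \<inter> translate v K') face_of (translate v K')"
    and two_neighbours: "\<And>K e. K \<in> Th \<Longrightarrow> e facet_of K \<Longrightarrow>
      \<exists>!(K', v). K' \<in> Th \<and> v \<in> \<Lambda> \<and> (K', v) \<noteq> (K, 0) \<and> e facet_of (translate v K')"

text \<open>Shape regularity and comparability of all cell sizes in one condition; for a family of meshes
  the constant \<open>\<sigma>\<close> is independent of the mesh size \<open>h = Max (diameter ` Th)\<close>.\<close>

definition quasi_uniform :: "real \<Rightarrow> (real^2) set set \<Rightarrow> bool" where
  "quasi_uniform \<sigma> Th \<longleftrightarrow>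
     0 < \<sigma> \<and> (\<forall>K\<in>Th. \<exists>x. ball x (\<sigma> * Max (diameter ` Th)) \<subseteq> K)"

definition outer_normal :: "(real^2) set \<Rightarrow> (real^2) set \<Rightarrow> real^2" where
  "outer_normal K e = (THE n. norm n = 1 \<and> (\<forall>x\<in>e. \<forall>y\<in>K. n \<bullet> (y - x) \<le> 0))"

definition neighbour ::
  "(real^2) set \<Rightarrow> (real^2) set set \<Rightarrow> (real^2) set \<Rightarrow> (real^2) set \<Rightarrow> (real^2) set \<times> (real^2)" where
  "neighbour \<Lambda> Th K e =
     (THE (K', v). K' \<in> Th \<and> v \<in> \<Lambda> \<and> (K', v) \<noteq> (K, 0) \<and> e facet_of (translate v K'))"

text \<open>The arc length integral does not depend on the order of the chosen end points.\<close>

definition edge_integral :: "(real^2) set \<Rightarrow> (real^2 \<Rightarrow> real) \<Rightarrow> real" where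
  "edge_integral e f =
     (let (a, b) = (SOME (a, b). e = closed_segment a b)
      in dist a b * (LINT s:{0..1}|lborel. f (linepath a b s)))"

definition boundary_integral ::
  "(real^2) set \<Rightarrow> ((real^2) set \<Rightarrow> real^2 \<Rightarrow> real) \<Rightarrow> real" where
  "boundary_integral K f = (\<Sum>e | e facet_of K. edge_integral e (f e))"


section \<open>Discontinuous Galerkin spaces\<close>

text \<open>A piecewise function is a family indexed by the cells, so that it may take different values
  from the two sides of an edge.  A polynomial on a triangle is identified with the polynomial on
  the whole plane, whose values on the edges are the traces.  The value type \<open>'b\<close> is \<^typ>\<open>real\<close> or
  \<^typ>\<open>real^2\<close>; a polynomial with coefficients in \<^typ>\<open>real^2\<close> is a pair of scalar polynomials.\<close>

type_synonym 'b piecewise = "(real^2) set \<Rightarrow> real^2 \<Rightarrow> 'b"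

definition poly_space :: "nat \<Rightarrow> (real^2 \<Rightarrow> 'b::real_vector) set" where
  "poly_space k =
     {w. \<exists>c :: nat \<Rightarrow> nat \<Rightarrow> 'b.
        w = (\<lambda>x. \<Sum>(i, j) | i + j \<le> k. ((x $ 1) ^ i * (x $ 2) ^ j) *\<^sub>R c i j)}"

definition dg_space :: "nat \<Rightarrow> (real^2) set set \<Rightarrow> 'b::real_vector piecewise set" where
  "dg_space k Th = (\<Pi>\<^sub>E K\<in>Th. poly_space k)"

definition dg_inner ::
  "(real^2) set set \<Rightarrow> 'b::euclidean_space piecewise \<Rightarrow> 'b piecewise \<Rightarrow> real" where
  "dg_inner Th v w = (\<Sum>K\<in>Th. LINT x:K|lborel. v K x \<bullet> w K x)"

text \<open>The \<open>L\<^sup>2(D)\<close> norm; the edges are null sets.\<close>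

definition dg_norm :: "(real^2) set set \<Rightarrow> 'b::euclidean_space piecewise \<Rightarrow> real" where
  "dg_norm Th w = sqrt (dg_inner Th w w)"

definition L2_projection ::
  "nat \<Rightarrow> (real^2) set set \<Rightarrow> 'b::euclidean_space piecewise \<Rightarrow> 'b piecewise" where
  "L2_projection k Th f =
     (THE w. w \<in> dg_space k Th \<and> (\<forall>\<phi>\<in>dg_space k Th. dg_inner Th w \<phi> = dg_inner Th f \<phi>))"

text \<open>The superposition \<open>F(\<cdot>, t, e, u)\<close> with piecewise functions \<open>e\<close>, \<open>u\<close>.\<close>

definition superpose ::
  "(real^2 \<Rightarrow> real \<Rightarrow> real \<Rightarrow> real^2 \<Rightarrow> 'b) \<Rightarrow> real \<Rightarrow> real piecewise \<Rightarrow> (real^2) piecewise \<Rightarrow>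
   'b piecewise" where
  "superpose F t e u = (\<lambda>K x. F x t (e K x) (u K x))"

definition gradient :: "(real^2 \<Rightarrow> real) \<Rightarrow> real^2 \<Rightarrow> real^2" where
  "gradient f x = (\<Sum>b\<in>Basis. frechet_derivative f (at x) b *\<^sub>R b)"

definition divergence :: "(real^2 \<Rightarrow> real^2) \<Rightarrow> real^2 \<Rightarrow> real" where
  "divergence f x = (\<Sum>b\<in>Basis. frechet_derivative f (at x) b \<bullet> b)"


section \<open>Numerical fluxes\<close>

text \<open>Below, \<open>e\<close> is an edge of the cell \<open>K\<close>, the plus side of \<open>e\<close> is \<open>K\<close> and the minus side is the
  other (translated) cell at \<open>e\<close>.  Averages, jumps and fluxes are symmetric in the two sides.\<close>

definition minus_trace ::
  "(real^2) set \<Rightarrow> (real^2) set set \<Rightarrow> (real^2) set \<Rightarrow> (real^2) set \<Rightarrow> 'b piecewise \<Rightarrow> real^2 \<Rightarrow> 'b" where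
  "minus_trace \<Lambda> Th K e w x = (case neighbour \<Lambda> Th K e of (K', v) \<Rightarrow> w K' (x - v))"

definition minus_normal ::
  "(real^2) set \<Rightarrow> (real^2) set set \<Rightarrow> (real^2) set \<Rightarrow> (real^2) set \<Rightarrow> real^2" where
  "minus_normal \<Lambda> Th K e =
     (case neighbour \<Lambda> Th K e of (K', v) \<Rightarrow> outer_normal (translate v K') e)"

definition avg ::
  "(real^2) set \<Rightarrow> (real^2) set set \<Rightarrow> (real^2) set \<Rightarrow> (real^2) set \<Rightarrow>
   'b::real_vector piecewise \<Rightarrow> real^2 \<Rightarrow> 'b" where
  "avg \<Lambda> Th K e w x = (1/2) *\<^sub>R (w K x + minus_trace \<Lambda> Th K e w x)"

definition jump_normal ::
  "(real^2) set \<Rightarrow> (real^2) set set \<Rightarrow> (real^2) set \<Rightarrow> (real^2) set \<Rightarrow>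
   real piecewise \<Rightarrow> real^2 \<Rightarrow> real^2" where
  "jump_normal \<Lambda> Th K e w x =
     w K x *\<^sub>R outer_normal K e + minus_trace \<Lambda> Th K e w x *\<^sub>R minus_normal \<Lambda> Th K e"

definition jump_dot ::
  "(real^2) set \<Rightarrow> (real^2) set set \<Rightarrow> (real^2) set \<Rightarrow> (real^2) set \<Rightarrow>
   (real^2) piecewise \<Rightarrow> real^2 \<Rightarrow> real" where
  "jump_dot \<Lambda> Th K e v x =
     v K x \<bullet> outer_normal K e + minus_trace \<Lambda> Th K e v x \<bullet> minus_normal \<Lambda> Th K e"

definition alpha_vec :: "real \<Rightarrow> real^2 \<Rightarrow> (real^2) set \<Rightarrow> (real^2) set \<Rightarrow> real^2" where
  "alpha_vec \<alpha> r K e = (\<alpha> * sgn (r \<bullet> outer_normal K e)) *\<^sub>R outer_normal K e"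

definition flux1 ::
  "(real^2) set \<Rightarrow> (real^2) set set \<Rightarrow> real^2 \<Rightarrow> real \<Rightarrow> real \<Rightarrow> (real^2) set \<Rightarrow> (real^2) set \<Rightarrow>
   (real^2) piecewise \<Rightarrow> real piecewise \<Rightarrow> real^2 \<Rightarrow> real^2" where
  "flux1 \<Lambda> Th r \<alpha> \<beta>\<^sub>1 K e U E x =
     avg \<Lambda> Th K e U x - jump_dot \<Lambda> Th K e U x *\<^sub>R alpha_vec \<alpha> r K e
       - \<beta>\<^sub>1 *\<^sub>R jump_normal \<Lambda> Th K e E x"

definition flux2 ::
  "(real^2) set \<Rightarrow> (real^2) set set \<Rightarrow> real^2 \<Rightarrow> real \<Rightarrow> real \<Rightarrow> (real^2) set \<Rightarrow> (real^2) set \<Rightarrow>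
   real piecewise \<Rightarrow> (real^2) piecewise \<Rightarrow> real^2 \<Rightarrow> real" where
  "flux2 \<Lambda> Th r \<alpha> \<beta>\<^sub>2 K e E U x =
     avg \<Lambda> Th K e E x + alpha_vec \<alpha> r K e \<bullet> jump_normal \<Lambda> Th K e E x
       - \<beta>\<^sub>2 * jump_dot \<Lambda> Th K e U x"


section \<open>The semi-discrete scheme\<close>

text \<open>Continuous adapted processes with values in the discontinuous Galerkin space.\<close>

definition dg_process ::
  "'a measure \<Rightarrow> (real \<Rightarrow> 'a measure) \<Rightarrow> nat \<Rightarrow> (real^2) set set \<Rightarrow>
   (real \<Rightarrow> 'a \<Rightarrow> 'b::euclidean_space piecewise) \<Rightarrow> bool" where
  "dg_process M Fil k Th X \<longleftrightarrow>
     (\<forall>t\<ge>0. \<forall>\<omega>\<in>space M. X t \<omega> \<in> dg_space k Th) \<and>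
     (\<forall>K\<in>Th. \<forall>x. \<forall>t\<ge>0. (\<lambda>\<omega>. X t \<omega> K x) \<in> borel_measurable (Fil t)) \<and>
     (\<forall>K\<in>Th. \<forall>x. \<forall>\<omega>\<in>space M. continuous_on {0..} (\<lambda>t. X t \<omega> K x))"

definition dg_solution ::
  "'a measure \<Rightarrow> (real \<Rightarrow> 'a measure) \<Rightarrow> (real \<Rightarrow> 'a \<Rightarrow> real) \<Rightarrow>
   (real^2) set \<Rightarrow> (real^2) set set \<Rightarrow> nat \<Rightarrow> real^2 \<Rightarrow> real \<Rightarrow> real \<Rightarrow> real \<Rightarrow>
   (real^2 \<Rightarrow> real \<Rightarrow> real \<Rightarrow> real^2 \<Rightarrow> real) \<Rightarrow> (real^2 \<Rightarrow> real \<Rightarrow> real \<Rightarrow> real^2 \<Rightarrow> real^2) \<Rightarrow>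
   real piecewise \<Rightarrow> (real^2) piecewise \<Rightarrow>
   (real \<Rightarrow> 'a \<Rightarrow> real piecewise) \<Rightarrow> (real \<Rightarrow> 'a \<Rightarrow> (real^2) piecewise) \<Rightarrow> bool" where
  "dg_solution M Fil W \<Lambda> Th k r \<alpha> \<beta>\<^sub>1 \<beta>\<^sub>2 F G E0 U0 E U \<longleftrightarrow>
     dg_process M Fil k Th E \<and> dg_process M Fil k Th U \<and>
     (AE \<omega> in M. E 0 \<omega> = E0 \<and> U 0 \<omega> = U0) \<and>
     (\<forall>K\<in>Th. \<forall>\<phi>\<in>dg_space k Th. \<forall>t\<ge>0.
        has_ito_integral M Fil W
          (\<lambda>s \<omega>. LINT x:K|lborel. superpose F s (E s \<omega>) (U s \<omega>) K x * \<phi> K x) t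
          (\<lambda>\<omega>. (LINT x:K|lborel. (E t \<omega> K x - E 0 \<omega> K x) * \<phi> K x)
             + (LINT s:{0..t}|lborel.
                  (LINT x:K|lborel. U s \<omega> K x \<bullet> gradient (\<phi> K) x)
                  - boundary_integral K (\<lambda>e x.
                      flux1 \<Lambda> Th r \<alpha> \<beta>\<^sub>1 K e (U s \<omega>) (E s \<omega>) x \<bullet> (\<phi> K x *\<^sub>R outer_normal K e))))) \<and>
     (\<forall>K\<in>Th. \<forall>\<psi>\<in>dg_space k Th. \<forall>t\<ge>0.
        has_ito_integral M Fil W
          (\<lambda>s \<omega>. LINT x:K|lborel. superpose G s (E s \<omega>) (U s \<omega>) K x \<bullet> \<psi> K x) t
          (\<lambda>\<omega>. (LINT x:K|lborel. (U t \<omega> K x - U 0 \<omega> K x) \<bullet> \<psi> K x)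
             + (LINT s:{0..t}|lborel.
                  (LINT x:K|lborel. E s \<omega> K x * divergence (\<psi> K) x)
                  - boundary_integral K (\<lambda>e x.
                      flux2 \<Lambda> Th r \<alpha> \<beta>\<^sub>2 K e (E s \<omega>) (U s \<omega>) x * (\<psi> K x \<bullet> outer_normal K e)))))"

end

(*
Expanding the discrete solution in L^2-orthonormal bases of the polynomial spaces on the cells turns
the scheme into finitely many stochastic differential equations  da_j = - (A a)_j dt + H_j dW  whose
noise H_j is the j-th coefficient of the projected source.  The energy is the sum of the a_j^2.

The quadratic form of A is computed by taking the solution itself as test function: after the
divergence theorem on every triangle only edge terms remain, and adding the contributions of the two
sides of an edge, whose outer normals are opposite, leaves beta_1 |[E n]|^2 + beta_2 [U . n]^2, the
terms with alpha cancelling.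

The energy identity  E|a(t)|^2 = |a(0)|^2 - 2 int E<A a, a> + int E|H|^2  needs no Ito formula: a is
the sum of an absolutely continuous part and the stochastic integral Z, and E[V(t) Z(t)] for
V(t) = int_0^t d is rewritten by the orthogonality of increments as int E[d(s) Z(s)] ds.  Square
integrability comes first, from a Gronwall inequality for E min(N, int (1 + |a|^2)), uniformly in N.
*)
theory Submission
  imports Defs
begin

text \<open>No moment of the solution is given beforehand: each stochastic integral is a limit in
  probability at one fixed time, and its integrand is square integrable only path by path. Isometry
  and orthogonality need E int H^2 < infinity, so the proof turns on producing that bound. Cutting
  simple integrands off at quadratic variation N gives E(Z^2; int H^2 < N) <= E min(N, int H^2)
  without any moment assumption. Linear growth bounds int H^2 by a multiple of R = int (1 + |a|^2),
  and R increases with time; hence E(1 + |a(s)|^2; R(s) <= N) is controlled by E min(N, R(s)), and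
  integrating over s bounds E min(N, R(t)) itself. This loop is what Gronwall closes. Orthonormality
  serves more than the energy: testing the source with a basis function gives exactly a coefficient
  of the projected source, so Parseval yields the norm of the projection with no loss. Nothing is
  estimated in the energy identity; the sign of the edge terms alone separates the inequality from
  the equality.\<close>

section \<open>Simple processes\<close>

context brownian_motion
begin

lemma measurable_Fil_M: "f \<in> borel_measurable (Fil s) \<Longrightarrow> f \<in> borel_measurable M"
  for f :: "'a \<Rightarrow> 'c::topological_space"
  using Fil_subalgebra measurable_from_subalg by blast

lemma measurable_Fil_mono:
  "f \<in> borel_measurable (Fil s) \<Longrightarrow> s \<le> t \<Longrightarrow> f \<in> borel_measurable (Fil t)"
  for f :: "'a \<Rightarrow> 'c::topological_space"
  using sets_F_mono[of s t] space_F by (auto simp: measurable_def)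

lemma W_measurable: "0 \<le> t \<Longrightarrow> W t \<in> borel_measurable M"
  using W_adapted measurable_Fil_M by blast

text \<open>\<open>W_indep\<close> speaks of events. Both families of events are closed under
  intersection, so independence passes to the generated sigma-algebras, and that of Y lies inside
  \<open>Fil s\<close>.\<close>

lemma increment_indep:
  assumes "0 \<le> s" "s < t" and Y: "Y \<in> borel_measurable (Fil s)"
  shows "indep_var borel Y borel (\<lambda>\<omega>. W t \<omega> - W s \<omega>)"
  unfolding indep_var_eq
proof (intro conjI)
  show "random_variable borel Y" using Y by (rule measurable_Fil_M)
  show "random_variable borel (\<lambda>\<omega>. W t \<omega> - W s \<omega>)"
    using W_measurable[of t] W_measurable[of s] assms by simp
  have sub: "{Y -` A \<inter> space M |A. A \<in> sets borel} \<subseteq> sets (Fil s)"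
    using Y space_F by (auto simp: measurable_def)
  have 1: "sigma_sets (space M) {Y -` A \<inter> space M |A. A \<in> sets borel} \<subseteq> sets (Fil s)"
    using sets.sigma_sets_subset[of _ "Fil s", unfolded space_F, OF sub] .
  have ind: "indep_set (sigma_sets (space M) (sets (Fil s)))
    (sigma_sets (space M) {(\<lambda>\<omega>. W t \<omega> - W s \<omega>) -` B \<inter> space M | B. B \<in> sets borel})"
  proof (rule indep_set_sigma_sets[OF W_indep[OF assms(1,2)]])
    show "Int_stable (sets (Fil s))" by (auto simp: Int_stable_def)
    show "Int_stable {(\<lambda>\<omega>. W t \<omega> - W s \<omega>) -` B \<inter> space M | B. B \<in> sets borel}"
      unfolding Int_stable_def
    proof safe
      fix A B :: "real set" assume "A \<in> sets borel" "B \<in> sets borel"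
      then show "\<exists>C. (\<lambda>\<omega>. W t \<omega> - W s \<omega>) -` A \<inter> space M \<inter> ((\<lambda>\<omega>. W t \<omega> - W s \<omega>) -` B \<inter> space M)
          = (\<lambda>\<omega>. W t \<omega> - W s \<omega>) -` C \<inter> space M \<and> C \<in> sets borel"
        by (intro exI[of _ "A \<inter> B"]) auto
    qed
  qed
  then show "indep_set (sigma_sets (space M) {Y -` A \<inter> space M |A. A \<in> sets borel})
    (sigma_sets (space M) {(\<lambda>\<omega>. W t \<omega> - W s \<omega>) -` B \<inter> space M | B. B \<in> sets borel})"
    unfolding indep_set_def
    by (rule indep_sets_mono_sets)
      (use 1 in \<open>auto split: bool.split simp: sigma_sets.Basic subset_eq\<close>)
qed

lemma increment_moments:
  assumes "0 \<le> s" "s \<le> t"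
  shows "integrable M (\<lambda>\<omega>. W t \<omega> - W s \<omega>)" "expectation (\<lambda>\<omega>. W t \<omega> - W s \<omega>) = 0"
    "integrable M (\<lambda>\<omega>. (W t \<omega> - W s \<omega>)\<^sup>2)" "expectation (\<lambda>\<omega>. (W t \<omega> - W s \<omega>)\<^sup>2) = t - s"
proof -
  have "integrable M (\<lambda>\<omega>. W t \<omega> - W s \<omega>) \<and> expectation (\<lambda>\<omega>. W t \<omega> - W s \<omega>) = 0
    \<and> integrable M (\<lambda>\<omega>. (W t \<omega> - W s \<omega>)\<^sup>2) \<and> expectation (\<lambda>\<omega>. (W t \<omega> - W s \<omega>)\<^sup>2) = t - s"
  \<comment> \<open>\<open>W_normal\<close> covers s < t, where the variance is positive; for s = t
    the increment is identically zero.\<close>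
  proof (cases "s = t")
    case False
    then have st: "s < t" using assms by simp
    note d = W_normal[OF assms(1) st]
    have pos: "0 < sqrt (t - s)" using st by simp
    have i1: "integrable M (\<lambda>\<omega>. W t \<omega> - W s \<omega>)"
      using distributed_integrable[OF d, of "\<lambda>x. x"] integrable_normal_moment[of "0" "sqrt (t-s)" 1]
       pos by (simp add: integrable_normal_moment_nz_1)
    have e: "expectation (\<lambda>\<omega>. W t \<omega> - W s \<omega>) = 0"
      using normal_distributed_expectation[OF pos d] .
    have i2: "integrable M (\<lambda>\<omega>. (W t \<omega> - W s \<omega>)\<^sup>2)"
      using distributed_integrable[OF d, of "\<lambda>x. x\<^sup>2"] integrable_normal_moment[of "sqrt (t-s)" 0 2] pos
      by simp
    have "variance (\<lambda>\<omega>. W t \<omega> - W s \<omega>) = (sqrt (t-s))\<^sup>2"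
      using normal_distributed_variance[OF pos d] .
    then have "expectation (\<lambda>\<omega>. (W t \<omega> - W s \<omega>)\<^sup>2) = t - s" using e st by simp
    then show ?thesis using i1 e i2 by simp
  qed simp
  then show "integrable M (\<lambda>\<omega>. W t \<omega> - W s \<omega>)" "expectation (\<lambda>\<omega>. W t \<omega> - W s \<omega>) = 0"
    "integrable M (\<lambda>\<omega>. (W t \<omega> - W s \<omega>)\<^sup>2)" "expectation (\<lambda>\<omega>. (W t \<omega> - W s \<omega>)\<^sup>2) = t - s"
    by auto
qed

text \<open>Y is independent of the increment, so expectations factor. The first pair of claims
  disposes of cross terms in the isometry, the second evaluates its diagonal terms.\<close>

lemma increment_mult:
  assumes "0 \<le> s" "s \<le> t" and Y: "Y \<in> borel_measurable (Fil s)" and iY: "integrable M Y"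
  shows "integrable M (\<lambda>\<omega>. Y \<omega> * (W t \<omega> - W s \<omega>))"
    "expectation (\<lambda>\<omega>. Y \<omega> * (W t \<omega> - W s \<omega>)) = 0"
    "integrable M (\<lambda>\<omega>. Y \<omega> * (W t \<omega> - W s \<omega>)\<^sup>2)"
    "expectation (\<lambda>\<omega>. Y \<omega> * (W t \<omega> - W s \<omega>)\<^sup>2) = expectation Y * (t - s)"
proof -
  have "integrable M (\<lambda>\<omega>. Y \<omega> * (W t \<omega> - W s \<omega>))
    \<and> expectation (\<lambda>\<omega>. Y \<omega> * (W t \<omega> - W s \<omega>)) = 0
    \<and> integrable M (\<lambda>\<omega>. Y \<omega> * (W t \<omega> - W s \<omega>)\<^sup>2)
    \<and> expectation (\<lambda>\<omega>. Y \<omega> * (W t \<omega> - W s \<omega>)\<^sup>2) = expectation Y * (t - s)"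
  proof (cases "s = t")
    case False
    then have st: "s < t" using assms by simp
    note m = increment_moments[OF assms(1,2)]
    note ind = increment_indep[OF assms(1) st Y]
    have ind2: "indep_var borel Y borel (\<lambda>\<omega>. (W t \<omega> - W s \<omega>)\<^sup>2)"
      using indep_var_compose[OF ind, of "\<lambda>x. x" borel "\<lambda>x. x\<^sup>2" borel] by (simp add: o_def)
    show ?thesis
      using indep_var_lebesgue_integral[OF ind iY m(1)] indep_var_integrable[OF ind iY m(1)]
       indep_var_lebesgue_integral[OF ind2 iY m(3)] indep_var_integrable[OF ind2 iY m(3)] m by simp
  qed simp
  then show "integrable M (\<lambda>\<omega>. Y \<omega> * (W t \<omega> - W s \<omega>))"
    "expectation (\<lambda>\<omega>. Y \<omega> * (W t \<omega> - W s \<omega>)) = 0"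
    "integrable M (\<lambda>\<omega>. Y \<omega> * (W t \<omega> - W s \<omega>)\<^sup>2)"
    "expectation (\<lambda>\<omega>. Y \<omega> * (W t \<omega> - W s \<omega>)\<^sup>2) = expectation Y * (t - s)"
    by auto
qed

end

section \<open>Isometry and martingale property of simple integrals\<close>

text \<open>The quadratic variation at t of the simple integral, that is, the integral over [0, t]
  of the squared simple process (\<open>nn_integral_simple_value_sq\<close>). Clipping with
  \<open>min t\<close> avoids splitting the interval that contains t.\<close>

definition simple_qv :: "nat \<Rightarrow> (nat \<Rightarrow> real) \<Rightarrow> (nat \<Rightarrow> 'a \<Rightarrow> real) \<Rightarrow> real \<Rightarrow> 'a \<Rightarrow> real" where
  "simple_qv n p \<xi> t \<omega> = (\<Sum>i<n. (\<xi> i \<omega>)\<^sup>2 * (min t (p (Suc i)) - min t (p i)))"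

lemma simple_process_mono:
  assumes "simple_process M Fil n p \<xi>" "i \<le> j" "j \<le> n" shows "p i \<le> p j"
  using assms(2,3)
proof (induction j rule: dec_induct)
  case (step m)
  then have "p m \<le> p (Suc m)" using assms(1) unfolding simple_process_def by auto
  with step show ?case by auto
qed simp

lemma simple_process_nonneg:
  assumes "simple_process M Fil n p \<xi>" "i \<le> n" shows "0 \<le> p i"
  using simple_process_mono[OF assms(1), of 0 i] assms unfolding simple_process_def by auto

lemma simple_process_Suc: "simple_process M Fil (Suc n) p \<xi> \<Longrightarrow> simple_process M Fil n p \<xi>"
  unfolding simple_process_def by auto

text \<open>The intervals are disjoint, so at each time at most one summand is nonzero and no cross
  terms arise.\<close>

lemma simple_value_sq:
  assumes "simple_process M Fil n p \<xi>"
  shows "(simple_value n p \<xi> s \<omega>)\<^sup>2 = (\<Sum>i<n. (\<xi> i \<omega>)\<^sup>2 * indicator {p i<..p (Suc i)} s)"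
  using assms
proof (induction n)
  case (Suc n)
  have sp: "simple_process M Fil n p \<xi>" using Suc.prems simple_process_Suc by blast
  have z: "simple_value n p \<xi> s \<omega> = 0" if "s \<in> {p n<..p (Suc n)}"
    unfolding simple_value_def
  proof (rule sum.neutral, safe)
    fix i assume "i < n"
    then have "p (Suc i) \<le> p n" using simple_process_mono[OF Suc.prems, of "Suc i" n] by auto
    then show "\<xi> i \<omega> * indicat_real {p i<..p (Suc i)} s = 0" using that by (auto simp: indicator_def)
  qed
  have "simple_value (Suc n) p \<xi> s \<omega> = simple_value n p \<xi> s \<omega> + \<xi> n \<omega> * indicator {p n<..p (Suc n)} s"
    by (simp add: simple_value_def)
  then show ?case using Suc.IH[OF sp] z by (auto simp: indicator_def)
qed (simp add: simple_value_def)

lemma nn_integral_indicator_Ioc: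
  assumes "0 \<le> a" "a \<le> b" "0 \<le> (t::real)"
  shows "(\<integral>\<^sup>+s\<in>{0..t}. indicator {a<..b} s \<partial>lborel) = ennreal (min t b - min t a)"
proof -
  have "(\<integral>\<^sup>+s\<in>{0..t}. indicator {a<..b} s \<partial>lborel) = (\<integral>\<^sup>+s. indicator {min t a<..min t b} s \<partial>lborel)"
    using assms by (intro nn_integral_cong) (auto simp: indicator_def min_def split: if_splits)
  also have "\<dots> = ennreal (min t b - min t a)" using assms by (simp add: min_def)
  finally show ?thesis .
qed

lemma nn_integral_simple_value_sq:
  assumes sp: "simple_process M Fil n p \<xi>" and t: "0 \<le> t"
  shows "(\<integral>\<^sup>+s\<in>{0..t}. ennreal ((simple_value n p \<xi> s \<omega>)\<^sup>2) \<partial>lborel) = ennreal (simple_qv n p \<xi> t \<omega>)"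
proof -
  have pos: "0 \<le> min t (p (Suc i)) - min t (p i)" if "i < n" for i
    using sp that unfolding simple_process_def by (auto simp: min_def)
  have "(\<integral>\<^sup>+s\<in>{0..t}. ennreal ((simple_value n p \<xi> s \<omega>)\<^sup>2) \<partial>lborel) =
     (\<integral>\<^sup>+s. (\<Sum>i<n. ennreal ((\<xi> i \<omega>)\<^sup>2) * (indicator {p i<..p (Suc i)} s * indicator {0..t} s)) \<partial>lborel)"
    unfolding simple_value_sq[OF sp]
    by (intro nn_integral_cong, subst sum_ennreal[symmetric], simp,
        subst sum_distrib_right, intro sum.cong refl)
      (simp only: ennreal_mult zero_le_power2 indicator_pos_le ennreal_indicator mult.assoc)
  also have "\<dots> = (\<Sum>i<n. ennreal ((\<xi> i \<omega>)\<^sup>2) * (\<integral>\<^sup>+s\<in>{0..t}. indicator {p i<..p (Suc i)} s \<partial>lborel))"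
    by (simp add: nn_integral_sum nn_integral_cmult)
  also have "\<dots> = (\<Sum>i<n. ennreal ((\<xi> i \<omega>)\<^sup>2) * ennreal (min t (p (Suc i)) - min t (p i)))"
    using sp t simple_process_nonneg[OF sp] unfolding simple_process_def
    by (intro sum.cong refl) (subst nn_integral_indicator_Ioc, auto)
  also have "\<dots> = ennreal (simple_qv n p \<xi> t \<omega>)"
    unfolding simple_qv_def using pos by (subst sum_ennreal[symmetric]) (auto simp: ennreal_mult)
  finally show ?thesis .
qed

context brownian_motion
begin

lemma simple_coeff:
  assumes "simple_process M Fil n p \<xi>" "i < n"
  shows "\<xi> i \<in> borel_measurable (Fil (p i))" "\<xi> i \<in> borel_measurable M"
    "\<exists>B. \<forall>\<omega>\<in>space M. \<bar>\<xi> i \<omega>\<bar> \<le> B"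
  using assms measurable_Fil_M unfolding simple_process_def bounded_iff by auto

lemma integrable_bounded_mult:
  fixes f :: "'a \<Rightarrow> real"
  assumes "f \<in> borel_measurable M" "\<forall>\<omega>\<in>space M. \<bar>f \<omega>\<bar> \<le> B" "integrable M g"
  shows "integrable M (\<lambda>\<omega>. f \<omega> * g \<omega>)"
proof (rule Bochner_Integration.integrable_bound[where f="\<lambda>\<omega>. B * g \<omega>"])
  have "norm (f \<omega> * g \<omega>) \<le> norm (B * g \<omega>)" if "\<omega> \<in> space M" for \<omega>
  proof -
    have "\<bar>f \<omega>\<bar> \<le> \<bar>B\<bar>" using assms(2) that by force
    then show ?thesis by (simp add: abs_mult mult_right_mono)
  qed
  then show "AE \<omega> in M. norm (f \<omega> * g \<omega>) \<le> norm (B * g \<omega>)" by (rule AE_I2)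
  show "integrable M (\<lambda>\<omega>. B * g \<omega>)" using assms(3) by simp
  show "(\<lambda>\<omega>. f \<omega> * g \<omega>) \<in> borel_measurable M"
    using assms(1) borel_measurable_integrable[OF assms(3)] by (rule borel_measurable_times)
qed

text \<open>The integral is known at time t, and also at \<open>p n\<close>, after which it no
  longer changes. The disjunction allows r = min t (p n), the time at which the induction of the
  isometry attaches a further interval.\<close>

lemma simple_ito_measurable_Fil:
  assumes sp: "simple_process M Fil n p \<xi>" and "0 \<le> t" "p n \<le> r \<or> t \<le> r"
  shows "simple_ito W n p \<xi> t \<in> borel_measurable (Fil r)"
proof -
  have "(\<lambda>\<omega>. \<xi> i \<omega> * (W (min t (p (Suc i))) \<omega> - W (min t (p i)) \<omega>)) \<in> borel_measurable (Fil r)"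
    if i: "i < n" for i
  \<comment> \<open>An interval that starts after t contributes a zero increment, so its coefficient
    need not be known at r.\<close>
  proof (cases "t \<le> p i")
    case True
    then have "min t (p (Suc i)) = min t (p i)"
      using simple_process_mono[OF sp, of i "Suc i"] i by auto
    then show ?thesis by simp
  next
    case False
    then have "p i \<le> r" using assms(3) simple_process_mono[OF sp, of i n] i by auto
    have "W (min t (p (Suc i))) \<in> borel_measurable (Fil r)" "W (min t (p i)) \<in> borel_measurable (Fil r)"
      using simple_process_mono[OF sp, of "Suc i" n] simple_process_mono[OF sp, of "i" n]
        simple_process_nonneg[OF sp, of "Suc i"] simple_process_nonneg[OF sp, of "i"] i assms(2,3)
      by (auto intro!: measurable_Fil_mono[OF W_adapted])
    moreover have "\<xi> i \<in> borel_measurable (Fil r)"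
      using simple_coeff(1)[OF sp i] \<open>p i \<le> r\<close> measurable_Fil_mono by blast
    ultimately show ?thesis by simp
  qed
  then show ?thesis unfolding simple_ito_def[abs_def] by (intro borel_measurable_sum) auto
qed

lemma simple_ito_measurable:
  assumes "simple_process M Fil n p \<xi>" and "0 \<le> t"
  shows "simple_ito W n p \<xi> t \<in> borel_measurable M"
  using simple_ito_measurable_Fil[OF assms, of t] measurable_Fil_M by blast

text \<open>Induction on the number of intervals: the last increment is independent of the past, so
  the cross term has mean zero and the square contributes the next term of the quadratic
  variation.\<close>

lemma simple_isometry:
  assumes sp: "simple_process M Fil n p \<xi>" and t: "0 \<le> t"
  shows "integrable M (\<lambda>\<omega>. (simple_ito W n p \<xi> t \<omega>)\<^sup>2)" "integrable M (simple_qv n p \<xi> t)"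
    "expectation (\<lambda>\<omega>. (simple_ito W n p \<xi> t \<omega>)\<^sup>2) = expectation (simple_qv n p \<xi> t)"
proof -
  have "integrable M (\<lambda>\<omega>. (simple_ito W n p \<xi> t \<omega>)\<^sup>2) \<and> integrable M (simple_qv n p \<xi> t) \<and>
    expectation (\<lambda>\<omega>. (simple_ito W n p \<xi> t \<omega>)\<^sup>2) = expectation (simple_qv n p \<xi> t)"
    using sp
  proof (induction n)
    case 0
    then show ?case by (simp add: simple_ito_def simple_qv_def[abs_def])
  next
    case (Suc n)
    have sp: "simple_process M Fil n p \<xi>" using Suc.prems simple_process_Suc by blast
    note IH = Suc.IH[OF sp]
    define S where "S = simple_ito W n p \<xi> t"
    define a where "a = min t (p n)"
    define b where "b = min t (p (Suc n))"
    have ab: "0 \<le> a" "a \<le> b" unfolding a_def b_def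
      using t simple_process_nonneg[OF Suc.prems, of n] simple_process_mono[OF Suc.prems, of n "Suc n"] by auto
    \<comment> \<open>If the last interval lies beyond t, then a = t may precede \<open>p n\<close>
      and \<open>\<xi> n\<close> need not be measurable for \<open>Fil a\<close>. Replacing it by 0
      is harmless, because the increment from a to b is then zero.\<close>
    define x where "x = (\<lambda>\<omega>. if a < b then \<xi> n \<omega> else 0)"
    obtain B where B: "\<forall>\<omega>\<in>space M. \<bar>\<xi> n \<omega>\<bar> \<le> B" using simple_coeff(3)[OF Suc.prems, of n] by auto
    have B0: "\<forall>\<omega>\<in>space M. \<bar>x \<omega>\<bar> \<le> \<bar>B\<bar>" using B unfolding x_def by (auto intro: order_trans[OF _ abs_ge_self])
    have xF: "x \<in> borel_measurable (Fil a)"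
    proof (cases "a < b")
      case True
      then have "a = p n" unfolding a_def b_def by (auto simp: min_def split: if_splits)
      then show ?thesis using simple_coeff(1)[OF Suc.prems, of n] True unfolding x_def by simp
    next
      case False then show ?thesis unfolding x_def by simp
    qed
    have SF: "S \<in> borel_measurable (Fil a)"
      unfolding S_def a_def using simple_ito_measurable_Fil[OF sp t, of "min t (p n)"]
      by (auto simp: min_def)
    have SM: "S \<in> borel_measurable M" and xM: "x \<in> borel_measurable M"
      using SF xF measurable_Fil_M by auto
    have iS2: "integrable M (\<lambda>\<omega>. (S \<omega>)\<^sup>2)" using IH unfolding S_def by simp
    have iS: "integrable M S"
      using SM iS2 square_integrable_imp_integrable by blast
    have ix: "integrable M (\<lambda>\<omega>. (x \<omega>)\<^sup>2)"
      by (rule integrable_const_bound[where B="B\<^sup>2"]) (use xM B0 abs_le_square_iff[of _ B] in auto)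
    have iSx: "integrable M (\<lambda>\<omega>. S \<omega> * x \<omega>)"
      using integrable_bounded_mult[OF xM B0 iS] by (simp add: mult.commute)
    have decomp: "simple_ito W (Suc n) p \<xi> t \<omega> = S \<omega> + x \<omega> * (W b \<omega> - W a \<omega>)" for \<omega>
      using ab unfolding S_def simple_ito_def x_def a_def[symmetric] b_def[symmetric]
      by (auto simp: a_def[symmetric] b_def[symmetric])
    have qd: "simple_qv (Suc n) p \<xi> t \<omega> = simple_qv n p \<xi> t \<omega> + (x \<omega>)\<^sup>2 * (b - a)" for \<omega>
      using ab unfolding simple_qv_def x_def by (auto simp: a_def[symmetric] b_def[symmetric])
    have sq: "(simple_ito W (Suc n) p \<xi> t \<omega>)\<^sup>2 =
       (S \<omega>)\<^sup>2 + 2 * (S \<omega> * x \<omega> * (W b \<omega> - W a \<omega>)) + (x \<omega>)\<^sup>2 * (W b \<omega> - W a \<omega>)\<^sup>2" for \<omega>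
      unfolding decomp by (simp add: power2_eq_square algebra_simps)
    have SxF: "(\<lambda>\<omega>. S \<omega> * x \<omega>) \<in> borel_measurable (Fil a)" and x2F: "(\<lambda>\<omega>. (x \<omega>)\<^sup>2) \<in> borel_measurable (Fil a)"
      using SF xF by auto
    note m1 = increment_mult[OF ab SxF iSx] and m2 = increment_mult[OF ab x2F ix]
    show ?case
      unfolding sq qd[abs_def] using m1 m2 iS2 IH ix
      by (simp add: S_def)
  qed
  then show "integrable M (\<lambda>\<omega>. (simple_ito W n p \<xi> t \<omega>)\<^sup>2)" "integrable M (simple_qv n p \<xi> t)"
    "expectation (\<lambda>\<omega>. (simple_ito W n p \<xi> t \<omega>)\<^sup>2) = expectation (simple_qv n p \<xi> t)"
    by auto
qed

text \<open>The martingale property in weak form: Y ranges over the integrable random variables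
  known at s, so no conditional expectation is involved.\<close>

lemma simple_martingale:
  assumes sp: "simple_process M Fil n p \<xi>" and st: "0 \<le> s" "s \<le> t"
    and Y: "Y \<in> borel_measurable (Fil s)" "integrable M Y"
  shows "integrable M (\<lambda>\<omega>. Y \<omega> * (simple_ito W n p \<xi> t \<omega> - simple_ito W n p \<xi> s \<omega>))"
    "expectation (\<lambda>\<omega>. Y \<omega> * (simple_ito W n p \<xi> t \<omega> - simple_ito W n p \<xi> s \<omega>)) = 0"
proof -
  define T where "T = (\<lambda>i \<omega>. Y \<omega> * (\<xi> i \<omega> * (W (min t (p (Suc i))) \<omega> - W (min t (p i)) \<omega>
      - (W (min s (p (Suc i))) \<omega> - W (min s (p i)) \<omega>))))"
  have T: "integrable M (T i) \<and> expectation (T i) = 0" if i: "i < n" for i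
  proof -
    \<comment> \<open>Clipping the i-th interval to [s, t] leaves a single increment after s; the
      product of Y and the coefficient is known at its left end.\<close>
    define a where "a = max s (min t (p i))"
    define b where "b = max s (min t (p (Suc i)))"
    have ab: "0 \<le> a" "a \<le> b" using st simple_process_mono[OF sp, of i "Suc i"] i
      unfolding a_def b_def by auto
    have TT: "T i \<omega> = Y \<omega> * (if a < b then \<xi> i \<omega> else 0) * (W b \<omega> - W a \<omega>)" for \<omega>
      using simple_process_mono[OF sp, of i "Suc i"] i st unfolding T_def a_def b_def
      by (auto simp: min_def max_def split: if_splits)
    obtain B where B: "\<forall>\<omega>\<in>space M. \<bar>\<xi> i \<omega>\<bar> \<le> B" using simple_coeff(3)[OF sp i] by auto
    have xF: "(\<lambda>\<omega>. if a < b then \<xi> i \<omega> else 0) \<in> borel_measurable (Fil a)"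
    proof (cases "a < b")
      case True
      then have "p i \<le> a" unfolding a_def b_def by (auto simp: min_def max_def split: if_splits)
      then show ?thesis using simple_coeff(1)[OF sp i] True measurable_Fil_mono by auto
    qed simp
    have "Y \<in> borel_measurable (Fil a)" using Y(1) by (rule measurable_Fil_mono) (simp add: a_def)
    then have m: "(\<lambda>\<omega>. Y \<omega> * (if a < b then \<xi> i \<omega> else 0)) \<in> borel_measurable (Fil a)" using xF by simp
    have "integrable M (\<lambda>\<omega>. (if a < b then \<xi> i \<omega> else 0) * Y \<omega>)"
      by (rule integrable_bounded_mult[where B="\<bar>B\<bar>"])
        (use measurable_Fil_M[OF xF] B Y(2) in \<open>auto intro: order_trans[OF _ abs_ge_self]\<close>)
    then have "integrable M (\<lambda>\<omega>. Y \<omega> * (if a < b then \<xi> i \<omega> else 0))" by (simp add: mult.commute)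
    from increment_mult(1,2)[OF ab m this] show ?thesis unfolding TT[abs_def] by simp
  qed
  have "(\<lambda>\<omega>. Y \<omega> * (simple_ito W n p \<xi> t \<omega> - simple_ito W n p \<xi> s \<omega>)) = (\<lambda>\<omega>. \<Sum>i<n. T i \<omega>)"
    unfolding simple_ito_def T_def
    by (simp add: sum_subtractf[symmetric] sum_distrib_left right_diff_distrib)
  then show "integrable M (\<lambda>\<omega>. Y \<omega> * (simple_ito W n p \<xi> t \<omega> - simple_ito W n p \<xi> s \<omega>))"
    "expectation (\<lambda>\<omega>. Y \<omega> * (simple_ito W n p \<xi> t \<omega> - simple_ito W n p \<xi> s \<omega>)) = 0"
    using T by auto
qed

end

section \<open>Truncation of simple processes by their quadratic variation\<close>

lemma simple_qv_Suc_mono: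
  assumes "simple_process M Fil n p \<xi>" "i \<le> j" "j \<le> n"
  shows "simple_qv i p \<xi> t \<omega> \<le> simple_qv j p \<xi> t \<omega>"
  unfolding simple_qv_def
proof (rule sum_mono2)
  fix k assume "k \<in> {..<j} - {..<i}"
  then have "p k \<le> p (Suc k)" using assms unfolding simple_process_def by auto
  then show "0 \<le> (\<xi> k \<omega>)\<^sup>2 * (min t (p (Suc k)) - min t (p k))" by (auto simp: min_def)
qed (use assms in auto)

context brownian_motion
begin

text \<open>Stopping the integrand just before its own quadratic variation exceeds \<open>N\<close> keeps it simple,
  since the quadratic variation over \<open>[0, p (i+1)]\<close> is already known at time \<open>p i\<close>.\<close>

lemma simple_truncation:
  assumes sp: "simple_process M Fil n p \<xi>" and N: "0 \<le> N"
  obtains \<eta> where "simple_process M Fil n p \<eta>"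
    "\<And>\<omega>. simple_qv n p \<eta> t \<omega> \<le> N" "\<And>\<omega>. simple_qv n p \<eta> t \<omega> \<le> simple_qv n p \<xi> t \<omega>"
    "\<And>\<omega>. simple_qv n p \<xi> t \<omega> \<le> N \<Longrightarrow> simple_ito W n p \<eta> t \<omega> = simple_ito W n p \<xi> t \<omega>"
    "\<And>\<omega> s. simple_qv n p \<xi> t \<omega> \<le> N \<Longrightarrow> simple_value n p \<eta> s \<omega> = simple_value n p \<xi> s \<omega>"
proof
  define \<eta> where "\<eta> = (\<lambda>i \<omega>. if simple_qv (Suc i) p \<xi> t \<omega> \<le> N then \<xi> i \<omega> else 0)"
  have qvm: "simple_qv (Suc i) p \<xi> t \<in> borel_measurable (Fil (p i))" if "i < n" for i
    unfolding simple_qv_def[abs_def]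
  proof (rule borel_measurable_sum)
    fix j assume "j \<in> {..<Suc i}"
    then have j: "j < n" "p j \<le> p i" using simple_process_mono[OF sp, of j i] that by auto
    have "\<xi> j \<in> borel_measurable (Fil (p i))"
      by (rule measurable_Fil_mono[OF simple_coeff(1)[OF sp j(1)] j(2)])
    then show "(\<lambda>\<omega>. (\<xi> j \<omega>)\<^sup>2 * (min t (p (Suc j)) - min t (p j))) \<in> borel_measurable (Fil (p i))"
      by simp
  qed
  show "simple_process M Fil n p \<eta>"
    unfolding simple_process_def
  proof (intro conjI allI impI)
    fix i assume i: "i < n"
    have "{\<omega> \<in> space (Fil (p i)). simple_qv (Suc i) p \<xi> t \<omega> \<le> N} \<in> sets (Fil (p i))"
      using qvm[OF i] by simp
    then show "\<eta> i \<in> borel_measurable (Fil (p i))"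
      unfolding \<eta>_def using simple_coeff(1)[OF sp i] by (intro measurable_If) auto
    obtain B where "\<forall>\<omega>\<in>space M. \<bar>\<xi> i \<omega>\<bar> \<le> B" using simple_coeff(3)[OF sp i] by auto
    then have "\<forall>\<omega>\<in>space M. \<bar>\<eta> i \<omega>\<bar> \<le> \<bar>B\<bar>" unfolding \<eta>_def by (auto intro: order_trans[OF _ abs_ge_self])
    then show "bounded (\<eta> i ` space M)" unfolding bounded_iff by auto
  qed (use sp in \<open>auto simp: simple_process_def\<close>)
  have "simple_qv m p \<eta> t \<omega> \<le> N" if "m \<le> n" for m \<omega>
    using that
  proof (induction m)
    case (Suc m)
    show ?case
    proof (cases "simple_qv (Suc m) p \<xi> t \<omega> \<le> N")
      case True
      \<comment> \<open>The quadratic variation grows with the index, so the retained coefficients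
        form an initial segment, on which the truncated and the original sums agree.\<close>
      have "simple_qv (Suc i) p \<xi> t \<omega> \<le> N" if "i < Suc m" for i
        using simple_qv_Suc_mono[OF sp, of "Suc i" "Suc m" t \<omega>] True that Suc.prems by auto
      then have "simple_qv (Suc m) p \<eta> t \<omega> = simple_qv (Suc m) p \<xi> t \<omega>"
        unfolding simple_qv_def \<eta>_def by (intro sum.cong refl) (auto simp: simple_qv_def)
      then show ?thesis using True by simp
    next
      case False
      then have "simple_qv (Suc m) p \<eta> t \<omega> = simple_qv m p \<eta> t \<omega>"
        by (simp add: simple_qv_def \<eta>_def)
      then show ?thesis using Suc by simp
    qed
  qed (use N in \<open>simp add: simple_qv_def\<close>)
  then show "simple_qv n p \<eta> t \<omega> \<le> N" for \<omega> by simp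
  show "simple_qv n p \<eta> t \<omega> \<le> simple_qv n p \<xi> t \<omega>" for \<omega>
    unfolding simple_qv_def
  proof (rule sum_mono, rule mult_right_mono)
    fix i assume "i \<in> {..<n}"
    then have "p i \<le> p (Suc i)" using sp unfolding simple_process_def by auto
    then show "0 \<le> min t (p (Suc i)) - min t (p i)" by auto
  qed (simp add: \<eta>_def)
  have eq: "\<eta> i \<omega> = \<xi> i \<omega>" if "simple_qv n p \<xi> t \<omega> \<le> N" "i < n" for i \<omega>
    using simple_qv_Suc_mono[OF sp, of "Suc i" n t \<omega>] that unfolding \<eta>_def by auto
  then show "simple_qv n p \<xi> t \<omega> \<le> N \<Longrightarrow> simple_ito W n p \<eta> t \<omega> = simple_ito W n p \<xi> t \<omega>" for \<omega>
    unfolding simple_ito_def by (intro sum.cong) auto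
  show "simple_qv n p \<xi> t \<omega> \<le> N \<Longrightarrow> simple_value n p \<eta> s \<omega> = simple_value n p \<xi> s \<omega>" for \<omega> s
    using eq unfolding simple_value_def by (intro sum.cong) auto
qed

end

section \<open>Common refinements and differences of simple processes\<close>

text \<open>The cells of the list that lie inside [a, b] tile it, because both end points belong to
  the list; so the increments of f telescope.\<close>

lemma sorted_telescope:
  fixes q :: "real list" and f :: "real \<Rightarrow> real"
  assumes "sorted_wrt (<) q" "a \<in> set q" "b \<in> set q" "a \<le> b"
  shows "(\<Sum>k<length q - 1. if a \<le> q ! k \<and> q ! Suc k \<le> b then f (q ! Suc k) - f (q ! k) else 0) = f b - f a"
proof -
  obtain i j where ij: "i < length q" "j < length q" "q ! i = a" "q ! j = b"
    using assms by (metis in_set_conv_nth)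
  have mono: "q ! k < q ! l \<longleftrightarrow> k < l" if "k < length q" "l < length q" for k l
    using sorted_wrt_nth_less[OF assms(1), of k l] sorted_wrt_nth_less[OF assms(1), of l k] that
    by (metis less_asym linorder_neqE_nat)
  then have mono': "q ! k \<le> q ! l \<longleftrightarrow> k \<le> l" if "k < length q" "l < length q" for k l
    using that by (metis linorder_not_less)
  have le: "i \<le> j" using mono'[of i j] ij assms by auto
  have "(\<Sum>k<length q - 1. if a \<le> q ! k \<and> q ! Suc k \<le> b then f (q ! Suc k) - f (q ! k) else 0)
     = (\<Sum>k<length q - 1. if k \<in> {i..<j} then f (q ! Suc k) - f (q ! k) else 0)"
    by (rule sum.cong) (use mono' ij in \<open>auto simp: Suc_le_eq\<close>)
  also have "\<dots> = (\<Sum>k\<in>{i..<j}. f (q ! Suc k) - f (q ! k))"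
    using ij by (subst sum.inter_restrict[symmetric]) (auto intro!: sum.cong)
  also have "\<dots> = f b - f a" using sum_Suc_diff'[OF le, of "\<lambda>k. f (q ! k)"] ij by simp
  finally show ?thesis .
qed

context brownian_motion
begin

text \<open>The identity holds for every f, so that one refinement preserves two things at once: the
  values of the process, with f a threshold function of time, and its integral, with f the Brownian
  path stopped at t.\<close>

lemma simple_refine:
  assumes sp: "simple_process M Fil n p \<xi>" and q: "sorted_wrt (<) q" "p ` {..n} \<subseteq> set q"
  obtains \<zeta> where "\<And>k. k < length q - 1 \<Longrightarrow> \<zeta> k \<in> borel_measurable (Fil (q ! k)) \<and> bounded (\<zeta> k ` space M)"
    "\<And>f \<omega>. (\<Sum>k<length q - 1. \<zeta> k \<omega> * (f (q ! Suc k) - f (q ! k)))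
       = (\<Sum>i<n. \<xi> i \<omega> * (f (p (Suc i)) - f (p i)))"
proof
  \<comment> \<open>At most one coarse interval contains a given fine cell; the sum picks its
    coefficient without naming the index, and is 0 on cells outside all of them.\<close>
  define \<zeta> where "\<zeta> = (\<lambda>k \<omega>. \<Sum>i<n. if p i \<le> q ! k \<and> q ! Suc k \<le> p (Suc i) then \<xi> i \<omega> else 0)"
  show "\<zeta> k \<in> borel_measurable (Fil (q ! k)) \<and> bounded (\<zeta> k ` space M)" if "k < length q - 1" for k
  proof
    show "\<zeta> k \<in> borel_measurable (Fil (q ! k))"
      unfolding \<zeta>_def
    proof (rule borel_measurable_sum)
      fix i assume "i \<in> {..<n}"
      then have i: "i < n" by simp
      show "(\<lambda>\<omega>. if p i \<le> q ! k \<and> q ! Suc k \<le> p (Suc i) then \<xi> i \<omega> else 0) \<in> borel_measurable (Fil (q ! k))"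
      proof (cases "p i \<le> q ! k \<and> q ! Suc k \<le> p (Suc i)")
        case True
        then have "\<xi> i \<in> borel_measurable (Fil (q ! k))"
          by (intro measurable_Fil_mono[OF simple_coeff(1)[OF sp i]]) simp
        then show ?thesis using True by simp
      qed (simp only: if_False borel_measurable_const)
    qed
    have "\<exists>B. \<forall>i<n. \<forall>\<omega>\<in>space M. \<bar>\<xi> i \<omega>\<bar> \<le> B i"
      using simple_coeff(3)[OF sp] by metis
    then obtain B where B: "\<And>i \<omega>. i < n \<Longrightarrow> \<omega> \<in> space M \<Longrightarrow> \<bar>\<xi> i \<omega>\<bar> \<le> B i" by auto
    have "\<bar>\<zeta> k \<omega>\<bar> \<le> (\<Sum>i<n. \<bar>B i\<bar>)" if "\<omega> \<in> space M" for \<omega>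
      unfolding \<zeta>_def
      by (rule order_trans[OF sum_abs], rule sum_mono) (use B that in \<open>auto intro: order_trans[OF _ abs_ge_self]\<close>)
    then show "bounded (\<zeta> k ` space M)" unfolding bounded_iff by auto
  qed
  fix f \<omega>
  have "(\<Sum>k<length q - 1. \<zeta> k \<omega> * (f (q ! Suc k) - f (q ! k)))
     = (\<Sum>k<length q - 1. \<Sum>i<n. \<xi> i \<omega> * (if p i \<le> q ! k \<and> q ! Suc k \<le> p (Suc i) then f (q ! Suc k) - f (q ! k) else 0))"
    unfolding \<zeta>_def sum_distrib_right by (intro sum.cong refl) auto
  also have "\<dots> = (\<Sum>i<n. \<xi> i \<omega> * (\<Sum>k<length q - 1. (if p i \<le> q ! k \<and> q ! Suc k \<le> p (Suc i) then f (q ! Suc k) - f (q ! k) else 0)))"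
    by (subst sum.swap) (simp add: sum_distrib_left)
  also have "\<dots> = (\<Sum>i<n. \<xi> i \<omega> * (f (p (Suc i)) - f (p i)))"
  proof (intro sum.cong refl)
    fix i assume i: "i \<in> {..<n}"
    have "p i \<le> p (Suc i)" using simple_process_mono[OF sp, of i "Suc i"] i by auto
    then show "\<xi> i \<omega> * (\<Sum>k<length q - 1. (if p i \<le> q ! k \<and> q ! Suc k \<le> p (Suc i) then f (q ! Suc k) - f (q ! k) else 0))
       = \<xi> i \<omega> * (f (p (Suc i)) - f (p i))"
      using q i by (subst sorted_telescope) (auto simp: image_subset_iff)
  qed
  finally show "(\<Sum>k<length q - 1. \<zeta> k \<omega> * (f (q ! Suc k) - f (q ! k)))
       = (\<Sum>i<n. \<xi> i \<omega> * (f (p (Suc i)) - f (p i)))" .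
qed

text \<open>The indicator is written as an increment of a threshold function, which is the shape
  required by \<open>simple_refine\<close>.\<close>

lemma simple_value_eq:
  assumes "simple_process M Fil n p \<xi>"
  shows "simple_value n p \<xi> s \<omega> = (\<Sum>i<n. \<xi> i \<omega> * (of_bool (s \<le> p (Suc i)) - of_bool (s \<le> p i)))"
  unfolding simple_value_def
proof (intro sum.cong refl)
  fix i assume "i \<in> {..<n}"
  then have "p i \<le> p (Suc i)" using assms unfolding simple_process_def by auto
  then show "\<xi> i \<omega> * indicat_real {p i<..p (Suc i)} s = \<xi> i \<omega> * (of_bool (s \<le> p (Suc i)) - of_bool (s \<le> p i))"
    by (auto simp: indicator_def)
qed

text \<open>Two simple processes have different partitions, so subtracting them requires the sorted
  union of their partition points. The difference is what carries estimates for one integrand over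
  to approximation errors.\<close>

lemma simple_diff:
  assumes sp: "simple_process M Fil n p \<xi>" and sp': "simple_process M Fil n' p' \<xi>'"
  obtains m q \<zeta> where "simple_process M Fil m q \<zeta>"
    "\<And>s \<omega>. simple_value m q \<zeta> s \<omega> = simple_value n p \<xi> s \<omega> - simple_value n' p' \<xi>' s \<omega>"
    "\<And>t \<omega>. simple_ito W m q \<zeta> t \<omega> = simple_ito W n p \<xi> t \<omega> - simple_ito W n' p' \<xi>' t \<omega>"
proof -
  define S where "S = p ` {..n} \<union> p' ` {..n'}"
  define q where "q = sorted_list_of_set S"
  have fin: "finite S" "S \<noteq> {}" unfolding S_def by auto
  have q: "sorted_wrt (<) q" "p ` {..n} \<subseteq> set q" "p' ` {..n'} \<subseteq> set q"
    unfolding q_def using fin by (auto simp: S_def)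
  obtain z where z: "\<And>k. k < length q - 1 \<Longrightarrow> z k \<in> borel_measurable (Fil (q ! k)) \<and> bounded (z k ` space M)"
    "\<And>f \<omega>. (\<Sum>k<length q - 1. z k \<omega> * (f (q ! Suc k) - f (q ! k))) = (\<Sum>i<n. \<xi> i \<omega> * (f (p (Suc i)) - f (p i)))"
    using simple_refine[OF sp q(1,2)] by blast
  obtain z' where z': "\<And>k. k < length q - 1 \<Longrightarrow> z' k \<in> borel_measurable (Fil (q ! k)) \<and> bounded (z' k ` space M)"
    "\<And>f \<omega>. (\<Sum>k<length q - 1. z' k \<omega> * (f (q ! Suc k) - f (q ! k))) = (\<Sum>i<n'. \<xi>' i \<omega> * (f (p' (Suc i)) - f (p' i)))"
    using simple_refine[OF sp' q(1,3)] by blast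
  define \<zeta> where "\<zeta> = (\<lambda>k \<omega>. z k \<omega> - z' k \<omega>)"
  have len: "0 < length q" using fin unfolding q_def by (simp add: card_gt_0_iff)
  have spz: "simple_process M Fil (length q - 1) ((!) q) \<zeta>"
    unfolding simple_process_def
  proof (intro conjI allI impI)
    have "q ! 0 \<in> S" using len fin nth_mem[of 0 q] unfolding q_def by auto
    then show "0 \<le> q ! 0" using simple_process_nonneg[OF sp] simple_process_nonneg[OF sp'] unfolding S_def by auto
  next
    fix i assume i: "i < length q - 1"
    show "q ! i \<le> q ! Suc i" using sorted_wrt_nth_less[OF q(1), of i "Suc i"] i by linarith
    show "\<zeta> i \<in> borel_measurable (Fil (q ! i))" using z(1)[OF i] z'(1)[OF i] unfolding \<zeta>_def
      by (intro borel_measurable_diff) auto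
    show "bounded (\<zeta> i ` space M)"
      using z(1)[OF i] z'(1)[OF i] bounded_minus_comp[of "z i" "space M" "z' i"] unfolding \<zeta>_def by auto
  qed
  have *: "(\<Sum>k<length q - 1. \<zeta> k \<omega> * (f (q ! Suc k) - f (q ! k)))
     = (\<Sum>i<n. \<xi> i \<omega> * (f (p (Suc i)) - f (p i))) - (\<Sum>i<n'. \<xi>' i \<omega> * (f (p' (Suc i)) - f (p' i)))" for f \<omega>
    unfolding z(2)[symmetric] z'(2)[symmetric] \<zeta>_def
    by (simp add: sum_subtractf[symmetric] left_diff_distrib)
  show ?thesis
  proof (rule that[OF spz])
    show "simple_value (length q - 1) ((!) q) \<zeta> s \<omega> = simple_value n p \<xi> s \<omega> - simple_value n' p' \<xi>' s \<omega>" for s \<omega>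
      unfolding simple_value_eq[OF sp] simple_value_eq[OF sp'] simple_value_eq[OF spz]
      using *[of \<omega> "\<lambda>x. of_bool (s \<le> x)"] by simp
    show "simple_ito W (length q - 1) ((!) q) \<zeta> t \<omega> = simple_ito W n p \<xi> t \<omega> - simple_ito W n' p' \<xi>' t \<omega>" for t \<omega>
      unfolding simple_ito_def using *[of \<omega> "\<lambda>x. W (min t x) \<omega>"] by simp
  qed
qed

end

section \<open>Square integrable Ito integrals\<close>

lemma sq_add_le: "(a + b)\<^sup>2 \<le> 2 * a\<^sup>2 + 2 * b\<^sup>2" for a b :: real
  using zero_le_power2[of "a - b"] by (simp add: power2_eq_square algebra_simps)

lemma sq_diff_le: "(a - b)\<^sup>2 \<le> 2 * a\<^sup>2 + 2 * b\<^sup>2" for a b :: real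
  using sq_add_le[of a "-b"] by simp

lemma integrable_sq_iff:
  fixes u :: "'a \<Rightarrow> real"
  assumes "u \<in> borel_measurable N"
  shows "integrable N (\<lambda>x. (u x)\<^sup>2) \<longleftrightarrow> (\<integral>\<^sup>+x. ennreal ((u x)\<^sup>2) \<partial>N) < \<infinity>"
  using assms by (simp add: integrable_iff_bounded)

lemma nn_integral_sq_eq:
  fixes u :: "'a \<Rightarrow> real"
  assumes "integrable N (\<lambda>x. (u x)\<^sup>2)"
  shows "(\<integral>\<^sup>+x. ennreal ((u x)\<^sup>2) \<partial>N) = ennreal (\<integral>x. (u x)\<^sup>2 \<partial>N)"
  using assms by (intro nn_integral_eq_integral) auto

lemma sq_integrable_diff:
  fixes u v :: "'a \<Rightarrow> real"
  assumes "u \<in> borel_measurable N" "v \<in> borel_measurable N"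
    and "integrable N (\<lambda>x. (u x)\<^sup>2)" "integrable N (\<lambda>x. (v x)\<^sup>2)"
  shows "integrable N (\<lambda>x. (u x - v x)\<^sup>2)"
  by (rule Bochner_Integration.integrable_bound[where f="\<lambda>x. 2 * (u x)\<^sup>2 + 2 * (v x)\<^sup>2"])
    (use assms sq_diff_le in auto)

lemma sq_integrable_mult:
  fixes u v :: "'a \<Rightarrow> real"
  assumes "u \<in> borel_measurable N" "v \<in> borel_measurable N"
    and "integrable N (\<lambda>x. (u x)\<^sup>2)" "integrable N (\<lambda>x. (v x)\<^sup>2)"
  shows "integrable N (\<lambda>x. u x * v x)"
proof (rule Bochner_Integration.integrable_bound[where f="\<lambda>x. (u x)\<^sup>2 + (v x)\<^sup>2"])
  have "\<bar>a * b\<bar> \<le> a\<^sup>2 + b\<^sup>2" for a b :: real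
    using sum_squares_bound[of a b] sum_squares_bound[of a "-b"] by (auto simp: abs_if)
  then show "AE x in N. norm (u x * v x) \<le> norm ((u x)\<^sup>2 + (v x)\<^sup>2)" by (intro AE_I2) simp
qed (use assms in auto)

text \<open>Continuity of the L2 norm, obtained from |x^2 - y^2| <= d y^2 + (1 + 1/d) (x - y)^2 with
  small d. The integrals are kept in \<open>ennreal\<close> since the u m are square integrable only
  from some index on.\<close>

lemma tendsto_nn_integral_sq:
  fixes u :: "nat \<Rightarrow> 'a \<Rightarrow> real"
  assumes um: "\<And>m. u m \<in> borel_measurable N" and vm: "v \<in> borel_measurable N"
    and d: "(\<lambda>m. \<integral>\<^sup>+x. ennreal ((u m x - v x)\<^sup>2) \<partial>N) \<longlonglongrightarrow> 0"
    and v: "(\<integral>\<^sup>+x. ennreal ((v x)\<^sup>2) \<partial>N) < \<infinity>"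
  shows "(\<lambda>m. \<integral>\<^sup>+x. ennreal ((u m x)\<^sup>2) \<partial>N) \<longlonglongrightarrow> (\<integral>\<^sup>+x. ennreal ((v x)\<^sup>2) \<partial>N)"
proof -
  have iv: "integrable N (\<lambda>x. (v x)\<^sup>2)" using v vm integrable_sq_iff by blast
  have ev: "eventually (\<lambda>m. (\<integral>\<^sup>+x. ennreal ((u m x - v x)\<^sup>2) \<partial>N) < \<infinity>) sequentially"
    using order_tendstoD(2)[OF d, of 1] by (auto elim!: eventually_mono intro: order.strict_trans)
  then have ev1: "eventually (\<lambda>m. integrable N (\<lambda>x. (u m x - v x)\<^sup>2)) sequentially"
    by (rule eventually_mono) (use um vm in \<open>simp add: integrable_sq_iff\<close>)
  have ev2: "eventually (\<lambda>m. integrable N (\<lambda>x. (u m x)\<^sup>2)) sequentially"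
    using ev1
  proof (rule eventually_mono)
    fix m assume "integrable N (\<lambda>x. (u m x - v x)\<^sup>2)"
    from sq_integrable_diff[OF _ _ this, of "\<lambda>x. - v x"]
    show "integrable N (\<lambda>x. (u m x)\<^sup>2)" using um vm iv by simp
  qed
  define a where "a = (\<integral>x. (v x)\<^sup>2 \<partial>N)"
  define b where "b = (\<lambda>m. \<integral>x. (u m x)\<^sup>2 \<partial>N)"
  define c where "c = (\<lambda>m. \<integral>x. (u m x - v x)\<^sup>2 \<partial>N)"
  have c0: "c \<longlonglongrightarrow> 0"
  proof (rule tendsto_ennrealD)
    show "(\<lambda>m. ennreal (c m)) \<longlonglongrightarrow> ennreal 0"
    proof (rule Lim_transform_eventually[of "\<lambda>m. \<integral>\<^sup>+x. ennreal ((u m x - v x)\<^sup>2) \<partial>N"])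
      show "eventually (\<lambda>m. (\<integral>\<^sup>+x. ennreal ((u m x - v x)\<^sup>2) \<partial>N) = ennreal (c m)) sequentially"
        using ev1 by (rule eventually_mono) (simp add: nn_integral_sq_eq c_def)
    qed (use d in simp)
  qed (auto simp: c_def)
  have a0: "0 \<le> a" unfolding a_def by simp
  have bound: "\<bar>b m - a\<bar> \<le> \<delta> * a + (1 + 1/\<delta>) * c m"
    if "0 < \<delta>" "integrable N (\<lambda>x. (u m x)\<^sup>2)" "integrable N (\<lambda>x. (u m x - v x)\<^sup>2)" for \<delta> m
  proof -
    have pt: "\<bar>x\<^sup>2 - y\<^sup>2\<bar> \<le> \<delta> * y\<^sup>2 + (1 + 1/\<delta>) * (x - y)\<^sup>2" for x y :: real
    proof -
      have e: "x\<^sup>2 - y\<^sup>2 = (x - y)\<^sup>2 + 2 * (y * (x - y))" by (simp add: power2_eq_square algebra_simps)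
      have "2 * \<bar>y * (x - y)\<bar> = 2 * (sqrt \<delta> * \<bar>y\<bar>) * (\<bar>x - y\<bar> / sqrt \<delta>)"
        using that by (simp add: abs_mult)
      also have "\<dots> \<le> (sqrt \<delta> * \<bar>y\<bar>)\<^sup>2 + (\<bar>x - y\<bar> / sqrt \<delta>)\<^sup>2" by (rule sum_squares_bound)
      also have "\<dots> = \<delta> * y\<^sup>2 + (1/\<delta>) * (x - y)\<^sup>2"
        using that by (simp add: power_mult_distrib power_divide)
      finally have "2 * \<bar>y * (x - y)\<bar> \<le> \<delta> * y\<^sup>2 + (1/\<delta>) * (x - y)\<^sup>2" .
      moreover have "(1 + 1/\<delta>) * (x - y)\<^sup>2 = (x - y)\<^sup>2 + (1/\<delta>) * (x - y)\<^sup>2" by (simp add: distrib_right)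
      ultimately show ?thesis unfolding e using zero_le_power2[of "x - y"] by linarith
    qed
    have "\<bar>b m - a\<bar> = \<bar>\<integral>x. (u m x)\<^sup>2 - (v x)\<^sup>2 \<partial>N\<bar>"
      unfolding a_def b_def using that iv by simp
    also have "\<dots> \<le> (\<integral>x. \<bar>(u m x)\<^sup>2 - (v x)\<^sup>2\<bar> \<partial>N)" by (rule integral_abs_bound)
    also have "\<dots> \<le> (\<integral>x. \<delta> * (v x)\<^sup>2 + (1 + 1/\<delta>) * (u m x - v x)\<^sup>2 \<partial>N)"
      using that iv pt by (intro integral_mono) auto
    also have "\<dots> = \<delta> * a + (1 + 1/\<delta>) * c m" unfolding a_def c_def using that iv by simp
    finally show ?thesis .
  qed
  have "b \<longlonglongrightarrow> a"
  proof (rule LIMSEQ_I)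
    fix r :: real assume r: "0 < r"
    \<comment> \<open>Half of the tolerance r goes to the fixed part \<open>\<delta> * a\<close>;
      the summand 1 avoids a division by zero when a = 0.\<close>
    define \<delta> where "\<delta> = r / (2 * (a + 1))"
    have \<delta>: "0 < \<delta>" "\<delta> * a < r / 2" unfolding \<delta>_def using r a0 by (auto simp: field_simps)
    define e where "e = (\<lambda>m. (1 + 1/\<delta>) * c m)"
    have "e \<longlonglongrightarrow> 0" unfolding e_def using tendsto_mult_left[OF c0, of "1 + 1/\<delta>"] by simp
    from order_tendstoD(2)[OF this, of "r/2"] r
    have "eventually (\<lambda>m. e m < r / 2) sequentially" by simp
    with ev1 ev2 have "eventually (\<lambda>m. norm (b m - a) < r) sequentially"
    proof eventually_elim
      case (elim m)
      then have "\<bar>b m - a\<bar> \<le> \<delta> * a + e m" using bound[OF \<delta>(1), of m] unfolding e_def by blast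
      then show ?case using \<delta>(2) elim(3) unfolding real_norm_def by linarith
    qed
    then show "\<exists>no. \<forall>n\<ge>no. norm (b n - a) < r" by (simp add: eventually_sequentially)
  qed
  then have "(\<lambda>m. ennreal (b m)) \<longlonglongrightarrow> ennreal a" by (rule tendsto_ennrealI)
  moreover have "eventually (\<lambda>m. ennreal (b m) = (\<integral>\<^sup>+x. ennreal ((u m x)\<^sup>2) \<partial>N)) sequentially"
    using ev2 by (rule eventually_mono) (simp add: nn_integral_sq_eq b_def)
  ultimately show ?thesis
    using tendsto_cong[of "\<lambda>m. ennreal (b m)"] iv by (simp add: nn_integral_sq_eq a_def)
qed

text \<open>Indices are chosen so that the k-th term exceeds 2^-k with probability below 2^-k; these
  probabilities are summable, and Borel-Cantelli applies.\<close>

lemma (in prob_space) to_zero_in_prob_AE_subseq: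
  assumes X: "\<And>m. X m \<in> borel_measurable M" and z: "to_zero_in_prob M X"
  obtains r :: "nat \<Rightarrow> nat" where "strict_mono r" "AE \<omega> in M. (\<lambda>m. X (r m) \<omega>) \<longlonglongrightarrow> 0"
proof -
  define A where "A = (\<lambda>k m. {\<omega> \<in> space M. ennreal ((1/2)^k) < X m \<omega>})"
  have "\<exists>m>N. measure M (A k m) < (1/2)^k" for k N
  proof -
    have "(\<lambda>m. measure M (A k m)) \<longlonglongrightarrow> 0"
      using z[unfolded to_zero_in_prob_def, rule_format, of "(1/2)^k"] unfolding A_def by simp
    from order_tendstoD(2)[OF this, of "(1/2)^k"]
    obtain m0 where "\<And>m. m \<ge> m0 \<Longrightarrow> measure M (A k m) < (1/2)^k"
      by (auto simp: eventually_sequentially)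
    then show ?thesis by (intro exI[of _ "max m0 (Suc N)"]) auto
  qed
  then have "\<forall>k. \<forall>N. \<exists>m. m > N \<and> measure M (A k m) < (1/2)^k" by blast
  then obtain f where f: "\<And>k N. f k N > N \<and> measure M (A k (f k N)) < (1/2)^k"
    unfolding choice_iff by blast
  \<comment> \<open>Each index is chosen beyond its predecessor, which makes r strictly
    increasing.\<close>
  define r where "r = rec_nat (f 0 0) (\<lambda>k m. f (Suc k) m)"
  have r: "r 0 = f 0 0" "\<And>k. r (Suc k) = f (Suc k) (r k)" by (auto simp: r_def)
  have mono: "strict_mono r" unfolding strict_mono_Suc_iff using r f by auto
  have mA: "measure M (A k (r k)) < (1/2)^k" for k
  proof (cases k)
    case 0 show ?thesis using f[of 0 0] unfolding 0 r(1) by blast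
  next
    case (Suc j) show ?thesis using f[of "r j" "Suc j"] unfolding Suc r(2) by blast
  qed
  have "AE \<omega> in M. eventually (\<lambda>k. \<omega> \<in> space M - A k (r k)) sequentially"
  proof (rule borel_cantelli_AE1)
    show "A k (r k) \<in> sets M" for k unfolding A_def using X by measurable
    then show "emeasure M (A k (r k)) < \<infinity>" for k by (simp add: less_top[symmetric])
    show "summable (\<lambda>k. measure M (A k (r k)))"
      by (rule summable_comparison_test[of _ "\<lambda>k. (1/2)^k"])
        (use mA in \<open>auto simp: less_imp_le intro!: exI[of _ 0]\<close>)
  qed
  then have "AE \<omega> in M. (\<lambda>m. X (r m) \<omega>) \<longlonglongrightarrow> 0"
  proof (rule AE_mp, intro AE_I2 impI)
    fix \<omega> assume ev: "eventually (\<lambda>k. \<omega> \<in> space M - A k (r k)) sequentially"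
    have "(\<lambda>k. ennreal ((1/2)^k)) \<longlonglongrightarrow> ennreal 0"
      by (intro tendsto_ennrealI LIMSEQ_power_zero) simp
    then have z: "(\<lambda>k. ennreal ((1/2)^k)) \<longlonglongrightarrow> 0" by simp
    have le: "eventually (\<lambda>k. X (r k) \<omega> \<le> ennreal ((1/2)^k)) sequentially"
      using ev
    proof (rule eventually_mono)
      fix k assume "\<omega> \<in> space M - A k (r k)"
      then have "\<omega> \<in> space M" and n: "\<omega> \<notin> A k (r k)" by auto
      have "\<not> ennreal ((1/2)^k) < X (r k) \<omega>"
      proof
        assume "ennreal ((1/2)^k) < X (r k) \<omega>"
        with \<open>\<omega> \<in> space M\<close> have "\<omega> \<in> A k (r k)" unfolding A_def by (intro CollectI conjI)
        with n show False by contradiction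
      qed
      then show "X (r k) \<omega> \<le> ennreal ((1/2)^k)" by (simp only: not_less)
    qed
    show "(\<lambda>m. X (r m) \<omega>) \<longlonglongrightarrow> 0"
      by (rule tendsto_sandwich[OF _ le tendsto_const z]) (intro always_eventually allI zero_le)
  qed
  then show ?thesis using mono that by blast
qed

section \<open>Pathwise square integrals of processes\<close>

abbreviation time_measure :: "real \<Rightarrow> real measure" where
  "time_measure t \<equiv> restrict_space lborel {0..t}"

text \<open>The quadratic variation of the stochastic integral of H. It is extended real because
  finiteness is known only almost surely.\<close>

definition qint :: "real \<Rightarrow> (real \<Rightarrow> 'a \<Rightarrow> real) \<Rightarrow> 'a \<Rightarrow> ennreal" where
  "qint t H \<omega> = (\<integral>\<^sup>+s\<in>{0..t}. ennreal ((H s \<omega>)\<^sup>2) \<partial>lborel)"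

lemma qint_eq: "qint t H \<omega> = (\<integral>\<^sup>+s. ennreal ((H s \<omega>)\<^sup>2) \<partial>time_measure t)"
  unfolding qint_def by (rule nn_integral_restrict_space[symmetric]) simp

lemma sigma_finite_time_measure: "sigma_finite_measure (time_measure t)"
proof (rule finite_measure.sigma_finite_measure)
  show "finite_measure (time_measure t)"
    by (rule finite_measureI) (simp add: emeasure_restrict_space emeasure_lborel_Icc_eq)
qed

lemma measurable_time_section:
  assumes "(\<lambda>(s, \<omega>). H s \<omega>) \<in> borel_measurable (time_measure t \<Otimes>\<^sub>M M)" "\<omega> \<in> space M"
  shows "(\<lambda>s. H s \<omega>) \<in> borel_measurable (time_measure t)"
  using measurable_compose[OF measurable_Pair2'[OF assms(2)] assms(1)] by (simp add: o_def)

lemma qint_measurable: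
  assumes H: "(\<lambda>(s, \<omega>). H s \<omega>) \<in> borel_measurable (time_measure t \<Otimes>\<^sub>M M)"
  shows "qint t H \<in> borel_measurable M"
proof -
  interpret T: sigma_finite_measure "time_measure t" by (rule sigma_finite_time_measure)
  have "(\<lambda>(\<omega>, s). ennreal ((H s \<omega>)\<^sup>2)) \<in> borel_measurable (M \<Otimes>\<^sub>M time_measure t)"
    using measurable_compose[OF measurable_pair_swap' H] by (simp add: case_prod_unfold)
  then show ?thesis unfolding qint_eq[abs_def] by (rule T.borel_measurable_nn_integral)
qed

text \<open>By Tonelli the expected quadratic variation is a squared L2 norm on the product of time
  and probability space, so that \<open>tendsto_nn_integral_sq\<close> applies to processes.\<close>

lemma nn_integral_qint:
  assumes H: "(\<lambda>(s, \<omega>). H s \<omega>) \<in> borel_measurable (time_measure t \<Otimes>\<^sub>M M)" and "sigma_finite_measure M"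
  shows "(\<integral>\<^sup>+\<omega>. qint t H \<omega> \<partial>M) = (\<integral>\<^sup>+x. ennreal ((case x of (s, \<omega>) \<Rightarrow> H s \<omega>)\<^sup>2) \<partial>(time_measure t \<Otimes>\<^sub>M M))"
proof -
  interpret pair_sigma_finite "time_measure t" M
    using assms(2) sigma_finite_time_measure by (simp add: pair_sigma_finite_def)
  have "(\<lambda>x. ennreal ((case x of (s, \<omega>) \<Rightarrow> H s \<omega>)\<^sup>2)) \<in> borel_measurable (time_measure t \<Otimes>\<^sub>M M)"
    using H by simp
  from nn_integral_snd[OF this] show ?thesis by (simp add: qint_eq)
qed

lemma qint_mono:
  assumes "s \<le> t" shows "qint s H \<omega> \<le> qint t H \<omega>"
  unfolding qint_def by (rule nn_integral_mono) (use assms in \<open>auto simp: indicator_def\<close>)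

lemma qint_diff_le:
  assumes H: "(\<lambda>s. H s \<omega>) \<in> borel_measurable (time_measure t)" and K: "(\<lambda>s. K s \<omega>) \<in> borel_measurable (time_measure t)"
  shows "qint t (\<lambda>s \<omega>. H s \<omega> - K s \<omega>) \<omega> \<le> 2 * qint t H \<omega> + 2 * qint t K \<omega>"
proof -
  have "qint t (\<lambda>s \<omega>. H s \<omega> - K s \<omega>) \<omega> \<le> (\<integral>\<^sup>+s. 2 * ennreal ((H s \<omega>)\<^sup>2) + 2 * ennreal ((K s \<omega>)\<^sup>2) \<partial>time_measure t)"
    unfolding qint_eq
  proof (rule nn_integral_mono)
    fix s
    have "ennreal ((H s \<omega> - K s \<omega>)\<^sup>2) \<le> ennreal (2 * (H s \<omega>)\<^sup>2 + 2 * (K s \<omega>)\<^sup>2)"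
      using sq_diff_le by (rule ennreal_leI)
    also have "\<dots> = 2 * ennreal ((H s \<omega>)\<^sup>2) + 2 * ennreal ((K s \<omega>)\<^sup>2)"
      by (simp add: ennreal_mult)
    finally show "ennreal ((H s \<omega> - K s \<omega>)\<^sup>2) \<le> 2 * ennreal ((H s \<omega>)\<^sup>2) + 2 * ennreal ((K s \<omega>)\<^sup>2)" .
  qed
  also have "\<dots> = 2 * qint t H \<omega> + 2 * qint t K \<omega>"
    unfolding qint_eq using H K by (simp add: nn_integral_add nn_integral_cmult)
  finally show ?thesis .
qed

context brownian_motion
begin

lemma simple_value_measurable:
  assumes "simple_process M Fil n p \<xi>"
  shows "(\<lambda>(s, \<omega>). simple_value n p \<xi> s \<omega>) \<in> borel_measurable (time_measure t \<Otimes>\<^sub>M M)"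
proof -
  have "(\<lambda>x. \<xi> i (snd x) * indicat_real {p i<..p (Suc i)} (fst x)) \<in> borel_measurable (time_measure t \<Otimes>\<^sub>M M)"
    if "i < n" for i
  proof (rule borel_measurable_times)
    show "(\<lambda>x. \<xi> i (snd x)) \<in> borel_measurable (time_measure t \<Otimes>\<^sub>M M)"
      using simple_coeff(2)[OF assms that] by simp
    have "(\<lambda>s. indicat_real {p i<..p (Suc i)} s) \<in> borel_measurable (time_measure t)"
      by (rule measurable_restrict_space1) simp
    then show "(\<lambda>x. indicat_real {p i<..p (Suc i)} (fst x)) \<in> borel_measurable (time_measure t \<Otimes>\<^sub>M M)"
      by (rule measurable_compose[OF measurable_fst])
  qed
  then show ?thesis unfolding simple_value_def case_prod_unfold by (intro borel_measurable_sum) auto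
qed

lemma qint_simple_value:
  assumes "simple_process M Fil n p \<xi>" "0 \<le> t"
  shows "qint t (simple_value n p \<xi>) \<omega> = ennreal (simple_qv n p \<xi> t \<omega>)"
  unfolding qint_def by (rule nn_integral_simple_value_sq[OF assms])

lemma simple_qv_nonneg:
  assumes "simple_process M Fil n p \<xi>" shows "0 \<le> simple_qv n p \<xi> t \<omega>"
  using simple_qv_Suc_mono[OF assms, of 0 n t \<omega>] by (simp add: simple_qv_def)

lemma nn_simple_isometry:
  assumes sp: "simple_process M Fil n p \<xi>" and t: "0 \<le> t"
  shows "(\<integral>\<^sup>+\<omega>. ennreal ((simple_ito W n p \<xi> t \<omega>)\<^sup>2) \<partial>M) = (\<integral>\<^sup>+\<omega>. qint t (simple_value n p \<xi>) \<omega> \<partial>M)"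
    "(\<integral>\<^sup>+\<omega>. qint t (simple_value n p \<xi>) \<omega> \<partial>M) < \<infinity>"
proof -
  note i = simple_isometry[OF sp t]
  have "(\<integral>\<^sup>+\<omega>. qint t (simple_value n p \<xi>) \<omega> \<partial>M) = ennreal (expectation (simple_qv n p \<xi> t))"
    unfolding qint_simple_value[OF sp t]
    using i simple_qv_nonneg[OF sp] by (intro nn_integral_eq_integral) auto
  then show "(\<integral>\<^sup>+\<omega>. ennreal ((simple_ito W n p \<xi> t \<omega>)\<^sup>2) \<partial>M) = (\<integral>\<^sup>+\<omega>. qint t (simple_value n p \<xi>) \<omega> \<partial>M)"
    "(\<integral>\<^sup>+\<omega>. qint t (simple_value n p \<xi>) \<omega> \<partial>M) < \<infinity>"
    using i by (auto simp: nn_integral_sq_eq)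
qed


text \<open>Passing to a subsequence turns the limits in probability in the definition of the integral into
  almost sure limits.\<close>

definition ito_lim :: "real \<Rightarrow> (real \<Rightarrow> 'a \<Rightarrow> real) \<Rightarrow> ('a \<Rightarrow> real) \<Rightarrow> bool" where
  "ito_lim t H Z \<longleftrightarrow>
     (\<lambda>(s, \<omega>). H s \<omega>) \<in> borel_measurable (time_measure t \<Otimes>\<^sub>M M) \<and> Z \<in> borel_measurable M \<and>
     (AE \<omega> in M. qint t H \<omega> < \<infinity>) \<and>
     (\<exists>n p \<xi>. (\<forall>m. simple_process M Fil (n m) (p m) (\<xi> m)) \<and>
        (AE \<omega> in M. (\<lambda>m. qint t (\<lambda>s \<omega>. simple_value (n m) (p m) (\<xi> m) s \<omega> - H s \<omega>) \<omega>) \<longlonglongrightarrow> 0) \<and>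
        (AE \<omega> in M. (\<lambda>m. simple_ito W (n m) (p m) (\<xi> m) t \<omega>) \<longlonglongrightarrow> Z \<omega>))"

lemma measurable_process_diff:
  assumes "(\<lambda>(s, \<omega>). H s \<omega>) \<in> borel_measurable (time_measure t \<Otimes>\<^sub>M M)"
    "(\<lambda>(s, \<omega>). K s \<omega>) \<in> borel_measurable (time_measure t \<Otimes>\<^sub>M M)"
  shows "(\<lambda>(s, \<omega>). H s \<omega> - K s \<omega> :: real) \<in> borel_measurable (time_measure t \<Otimes>\<^sub>M M)"
  using borel_measurable_diff[OF assms] by (simp add: case_prod_unfold)

text \<open>Two subsequences are taken in succession, the first for the integrands and the second
  for the integrals; the convergence already gained survives the second choice.\<close>

lemma has_ito_integral_imp_ito_lim:
  assumes "has_ito_integral M Fil W H t Z" and t: "0 \<le> t"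
  shows "ito_lim t H Z"
proof -
  have H: "(\<lambda>(s, \<omega>). H s \<omega>) \<in> borel_measurable (time_measure t \<Otimes>\<^sub>M M)" and Z: "Z \<in> borel_measurable M"
    and fin: "AE \<omega> in M. qint t H \<omega> < \<infinity>"
    using assms unfolding has_ito_integral_def qint_def by auto
  obtain n p \<xi> where sp: "\<And>m. simple_process M Fil (n m) (p m) (\<xi> m)"
    and X: "to_zero_in_prob M (\<lambda>m \<omega>. qint t (\<lambda>s \<omega>. simple_value (n m) (p m) (\<xi> m) s \<omega> - H s \<omega>) \<omega>)"
    and Y: "to_zero_in_prob M (\<lambda>m \<omega>. ennreal \<bar>simple_ito W (n m) (p m) (\<xi> m) t \<omega> - Z \<omega>\<bar>)"
    using assms unfolding has_ito_integral_def qint_def by auto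
  have Xm: "qint t (\<lambda>s \<omega>. simple_value (n m) (p m) (\<xi> m) s \<omega> - H s \<omega>) \<in> borel_measurable M" for m
    by (rule qint_measurable[OF measurable_process_diff[OF simple_value_measurable[OF sp] H]])
  obtain r where r: "strict_mono r"
    "AE \<omega> in M. (\<lambda>m. qint t (\<lambda>s \<omega>. simple_value (n (r m)) (p (r m)) (\<xi> (r m)) s \<omega> - H s \<omega>) \<omega>) \<longlonglongrightarrow> 0"
    using to_zero_in_prob_AE_subseq[OF Xm X] by blast
  have Y': "to_zero_in_prob M (\<lambda>m \<omega>. ennreal \<bar>simple_ito W (n (r m)) (p (r m)) (\<xi> (r m)) t \<omega> - Z \<omega>\<bar>)"
    using Y LIMSEQ_subseq_LIMSEQ[OF _ r(1)] unfolding to_zero_in_prob_def o_def by blast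
  have Ym: "(\<lambda>\<omega>. ennreal \<bar>simple_ito W (n (r m)) (p (r m)) (\<xi> (r m)) t \<omega> - Z \<omega>\<bar>) \<in> borel_measurable M" for m
    using simple_ito_measurable[OF sp t] Z by measurable
  obtain q where q: "strict_mono q"
    "AE \<omega> in M. (\<lambda>m. ennreal \<bar>simple_ito W (n (r (q m))) (p (r (q m))) (\<xi> (r (q m))) t \<omega> - Z \<omega>\<bar>) \<longlonglongrightarrow> 0"
    using to_zero_in_prob_AE_subseq[OF Ym Y'] by blast
  have 1: "AE \<omega> in M. (\<lambda>m. qint t (\<lambda>s \<omega>. simple_value (n (r (q m))) (p (r (q m))) (\<xi> (r (q m))) s \<omega> - H s \<omega>) \<omega>) \<longlonglongrightarrow> 0"
    using r(2) by (rule AE_mp, intro AE_I2 impI) (drule LIMSEQ_subseq_LIMSEQ[OF _ q(1)], simp add: o_def)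
  have 2: "AE \<omega> in M. (\<lambda>m. simple_ito W (n (r (q m))) (p (r (q m))) (\<xi> (r (q m))) t \<omega>) \<longlonglongrightarrow> Z \<omega>"
    using q(2)
  proof (rule AE_mp, intro AE_I2 impI)
    fix \<omega>
    assume a: "(\<lambda>m. ennreal \<bar>simple_ito W (n (r (q m))) (p (r (q m))) (\<xi> (r (q m))) t \<omega> - Z \<omega>\<bar>) \<longlonglongrightarrow> 0"
    have "(\<lambda>m. \<bar>simple_ito W (n (r (q m))) (p (r (q m))) (\<xi> (r (q m))) t \<omega> - Z \<omega>\<bar>) \<longlonglongrightarrow> 0"
      by (rule tendsto_ennrealD) (use a in auto)
    then have "(\<lambda>m. simple_ito W (n (r (q m))) (p (r (q m))) (\<xi> (r (q m))) t \<omega> - Z \<omega>) \<longlonglongrightarrow> 0"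
      by (rule tendsto_rabs_zero_cancel)
    then show "(\<lambda>m. simple_ito W (n (r (q m))) (p (r (q m))) (\<xi> (r (q m))) t \<omega>) \<longlonglongrightarrow> Z \<omega>"
      by (rule LIM_zero_cancel)
  qed
  show ?thesis unfolding ito_lim_def
    using H Z fin sp 1 2
    by (intro conjI exI[of _ "n \<circ> r \<circ> q"] exI[of _ "p \<circ> r \<circ> q"] exI[of _ "\<xi> \<circ> r \<circ> q"]) (auto simp: o_def)
qed

section \<open>Second moments, isometry and orthogonality for limits of simple integrals\<close>

lemma qint_tendsto:
  assumes H: "(\<lambda>(s, \<omega>). H s \<omega>) \<in> borel_measurable (time_measure t \<Otimes>\<^sub>M M)"
    and V: "\<And>m. (\<lambda>(s, \<omega>). V m s \<omega>) \<in> borel_measurable (time_measure t \<Otimes>\<^sub>M M)"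
    and "\<omega> \<in> space M" "qint t H \<omega> < \<infinity>" "(\<lambda>m. qint t (\<lambda>s \<omega>. V m s \<omega> - H s \<omega>) \<omega>) \<longlonglongrightarrow> 0"
  shows "(\<lambda>m. qint t (V m) \<omega>) \<longlonglongrightarrow> qint t H \<omega>"
  using assms(4,5) unfolding qint_eq
  by (intro tendsto_nn_integral_sq measurable_time_section[OF H] measurable_time_section[OF V] assms(3)) auto

text \<open>A second moment bound that presupposes no integrability. The truncated simple integrals
  have second moment at most E min(N, quadratic variation); where \<open>qint t H\<close> is below N
  they eventually coincide with the original ones, hence converge to Z. Fatou on the left and
  dominated convergence on the right give the limit.\<close>

lemma ito_lim_truncated:
  assumes lim: "ito_lim t H Z" and t: "0 \<le> t" and N: "0 < N"
  shows "(\<integral>\<^sup>+\<omega>. indicator {\<omega>. qint t H \<omega> < ennreal N} \<omega> * ennreal ((Z \<omega>)\<^sup>2) \<partial>M)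
     \<le> (\<integral>\<^sup>+\<omega>. min (ennreal N) (qint t H \<omega>) \<partial>M)"
proof -
  have H: "(\<lambda>(s, \<omega>). H s \<omega>) \<in> borel_measurable (time_measure t \<Otimes>\<^sub>M M)" and Z: "Z \<in> borel_measurable M"
    and fin: "AE \<omega> in M. qint t H \<omega> < \<infinity>"
    using lim unfolding ito_lim_def by auto
  obtain n p \<xi> where sp: "\<And>m. simple_process M Fil (n m) (p m) (\<xi> m)"
    and 1: "AE \<omega> in M. (\<lambda>m. qint t (\<lambda>s \<omega>. simple_value (n m) (p m) (\<xi> m) s \<omega> - H s \<omega>) \<omega>) \<longlonglongrightarrow> 0"
    and 2: "AE \<omega> in M. (\<lambda>m. simple_ito W (n m) (p m) (\<xi> m) t \<omega>) \<longlonglongrightarrow> Z \<omega>"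
    using lim unfolding ito_lim_def by blast
  have "\<exists>\<eta>. simple_process M Fil (n m) (p m) \<eta> \<and>
    (\<forall>\<omega>. simple_qv (n m) (p m) \<eta> t \<omega> \<le> N \<and> simple_qv (n m) (p m) \<eta> t \<omega> \<le> simple_qv (n m) (p m) (\<xi> m) t \<omega> \<and>
      (simple_qv (n m) (p m) (\<xi> m) t \<omega> \<le> N \<longrightarrow> simple_ito W (n m) (p m) \<eta> t \<omega> = simple_ito W (n m) (p m) (\<xi> m) t \<omega>))" for m
    using simple_truncation[OF sp[of m] less_imp_le[OF N], of t] by metis
  then obtain \<eta> where spe: "\<And>m. simple_process M Fil (n m) (p m) (\<eta> m)"
    and e1: "\<And>m \<omega>. simple_qv (n m) (p m) (\<eta> m) t \<omega> \<le> N"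
    and e2: "\<And>m \<omega>. simple_qv (n m) (p m) (\<eta> m) t \<omega> \<le> simple_qv (n m) (p m) (\<xi> m) t \<omega>"
    and e3: "\<And>m \<omega>. simple_qv (n m) (p m) (\<xi> m) t \<omega> \<le> N \<Longrightarrow> simple_ito W (n m) (p m) (\<eta> m) t \<omega> = simple_ito W (n m) (p m) (\<xi> m) t \<omega>"
    by metis
  define V where "V = (\<lambda>m. simple_value (n m) (p m) (\<xi> m))"
  have Vm: "(\<lambda>(s, \<omega>). V m s \<omega>) \<in> borel_measurable (time_measure t \<Otimes>\<^sub>M M)" for m
    unfolding V_def by (rule simple_value_measurable[OF sp])
  define J where "J = (\<lambda>m. simple_ito W (n m) (p m) (\<eta> m) t)"
  have Jm[measurable]: "J m \<in> borel_measurable M" for m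
    unfolding J_def by (rule simple_ito_measurable[OF spe t])
  have qm: "qint t H \<in> borel_measurable M" "\<And>m. qint t (V m) \<in> borel_measurable M"
    by (rule qint_measurable[OF H]) (rule qint_measurable[OF Vm])
  have qV: "qint t (V m) \<omega> = ennreal (simple_qv (n m) (p m) (\<xi> m) t \<omega>)" for m \<omega>
    unfolding V_def by (rule qint_simple_value[OF sp t])
  have J2: "(\<integral>\<^sup>+\<omega>. ennreal ((J m \<omega>)\<^sup>2) \<partial>M) \<le> (\<integral>\<^sup>+\<omega>. min (ennreal N) (qint t (V m) \<omega>) \<partial>M)" for m
    unfolding J_def nn_simple_isometry(1)[OF spe t] qV qint_simple_value[OF spe t]
    by (intro nn_integral_mono) (auto intro!: ennreal_leI e1 e2)
  have qlim: "AE \<omega> in M. (\<lambda>m. qint t (V m) \<omega>) \<longlonglongrightarrow> qint t H \<omega>"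
    using 1 fin AE_space
  proof eventually_elim
    case (elim \<omega>)
    show ?case
      by (rule qint_tendsto[where V=V, OF H Vm elim(3,2)]) (use elim(1) in \<open>simp add: V_def\<close>)
  qed
  have lim2: "(\<lambda>m. \<integral>\<^sup>+\<omega>. min (ennreal N) (qint t (V m) \<omega>) \<partial>M) \<longlonglongrightarrow> (\<integral>\<^sup>+\<omega>. min (ennreal N) (qint t H \<omega>) \<partial>M)"
  proof (rule nn_integral_dominated_convergence[where w="\<lambda>_. ennreal N"])
    show "AE \<omega> in M. (\<lambda>m. min (ennreal N) (qint t (V m) \<omega>)) \<longlonglongrightarrow> min (ennreal N) (qint t H \<omega>)"
      using qlim by (rule AE_mp, intro AE_I2 impI) (intro tendsto_min tendsto_const)
  qed (use qm in \<open>auto simp: emeasure_space_1\<close>)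
  have "(\<integral>\<^sup>+\<omega>. indicator {\<omega>. qint t H \<omega> < ennreal N} \<omega> * ennreal ((Z \<omega>)\<^sup>2) \<partial>M)
    \<le> (\<integral>\<^sup>+\<omega>. liminf (\<lambda>m. ennreal ((J m \<omega>)\<^sup>2)) \<partial>M)"
  proof (rule nn_integral_mono_AE)
    show "AE \<omega> in M. indicator {\<omega>. qint t H \<omega> < ennreal N} \<omega> * ennreal ((Z \<omega>)\<^sup>2) \<le> liminf (\<lambda>m. ennreal ((J m \<omega>)\<^sup>2))"
      using 2 qlim
    proof eventually_elim
      case (elim \<omega>)
      show ?case
      proof (cases "qint t H \<omega> < ennreal N")
        case True
        \<comment> \<open>The strict inequality is essential here: it is inherited by the
          approximants from some index on, so that truncation leaves them unchanged.\<close>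
        have "eventually (\<lambda>m. qint t (V m) \<omega> < ennreal N) sequentially"
          using order_tendstoD(2)[OF elim(2) True] .
        then have "eventually (\<lambda>m. J m \<omega> = simple_ito W (n m) (p m) (\<xi> m) t \<omega>) sequentially"
        proof (rule eventually_mono)
          fix m assume "qint t (V m) \<omega> < ennreal N"
          then have "simple_qv (n m) (p m) (\<xi> m) t \<omega> \<le> N"
            unfolding qV using N by (simp add: ennreal_less_iff simple_qv_nonneg[OF sp])
          then show "J m \<omega> = simple_ito W (n m) (p m) (\<xi> m) t \<omega>" unfolding J_def by (rule e3)
        qed
        then have "(\<lambda>m. J m \<omega>) \<longlonglongrightarrow> Z \<omega>" using elim(1) by (rule tendsto_cong[THEN iffD2])
        then have "(\<lambda>m. ennreal ((J m \<omega>)\<^sup>2)) \<longlonglongrightarrow> ennreal ((Z \<omega>)\<^sup>2)" by (intro tendsto_ennrealI tendsto_power)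
        then have "liminf (\<lambda>m. ennreal ((J m \<omega>)\<^sup>2)) = ennreal ((Z \<omega>)\<^sup>2)"
          by (intro lim_imp_Liminf) auto
        then show ?thesis by (simp add: indicator_def)
      qed (simp add: indicator_def)
    qed
  qed
  also have "\<dots> \<le> liminf (\<lambda>m. \<integral>\<^sup>+\<omega>. ennreal ((J m \<omega>)\<^sup>2) \<partial>M)"
    by (rule nn_integral_liminf) simp
  also have "\<dots> \<le> liminf (\<lambda>m. \<integral>\<^sup>+\<omega>. min (ennreal N) (qint t (V m) \<omega>) \<partial>M)"
    by (rule Liminf_mono) (use J2 in simp)
  also have "\<dots> = (\<integral>\<^sup>+\<omega>. min (ennreal N) (qint t H \<omega>) \<partial>M)"
    using lim2 by (intro lim_imp_Liminf) auto
  finally show ?thesis .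
qed

text \<open>Fatou as the truncation level tends to infinity: almost surely the quadratic variation
  is finite, so the indicator is eventually 1. The right side may be infinite.\<close>

lemma ito_lim_le:
  assumes lim: "ito_lim t H Z" and t: "0 \<le> t"
  shows "(\<integral>\<^sup>+\<omega>. ennreal ((Z \<omega>)\<^sup>2) \<partial>M) \<le> (\<integral>\<^sup>+\<omega>. qint t H \<omega> \<partial>M)"
proof -
  have H: "(\<lambda>(s, \<omega>). H s \<omega>) \<in> borel_measurable (time_measure t \<Otimes>\<^sub>M M)" and Z: "Z \<in> borel_measurable M"
    and fin: "AE \<omega> in M. qint t H \<omega> < \<infinity>"
    using lim unfolding ito_lim_def by auto
  have qm: "qint t H \<in> borel_measurable M" by (rule qint_measurable[OF H])
  define f where "f = (\<lambda>m \<omega>. indicator {\<omega>. qint t H \<omega> < ennreal (real (Suc m))} \<omega> * ennreal ((Z \<omega>)\<^sup>2))"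
  have fm: "f m \<in> borel_measurable M" for m
    unfolding f_def using qm Z by measurable
  have "(\<integral>\<^sup>+\<omega>. ennreal ((Z \<omega>)\<^sup>2) \<partial>M) \<le> (\<integral>\<^sup>+\<omega>. liminf (\<lambda>m. f m \<omega>) \<partial>M)"
  proof (rule nn_integral_mono_AE)
    show "AE \<omega> in M. ennreal ((Z \<omega>)\<^sup>2) \<le> liminf (\<lambda>m. f m \<omega>)"
      using fin
    proof eventually_elim
      case (elim \<omega>)
      then obtain r where r: "qint t H \<omega> = ennreal r" "0 \<le> r" by (cases "qint t H \<omega>") auto
      obtain k :: nat where k: "r < real k" using reals_Archimedean2 by blast
      have "eventually (\<lambda>m. f m \<omega> = ennreal ((Z \<omega>)\<^sup>2)) sequentially"
        using eventually_ge_at_top[of k]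
      proof eventually_elim
        case (elim m)
        then have "r < real (Suc m)" using k by linarith
        then have "qint t H \<omega> < ennreal (real (Suc m))" unfolding r(1) using r(2) by (simp only: ennreal_less_iff)
        then show ?case unfolding f_def by (simp add: indicator_def)
      qed
      then have "(\<lambda>m. f m \<omega>) \<longlonglongrightarrow> ennreal ((Z \<omega>)\<^sup>2)" by (rule tendsto_eventually)
      then show ?case by (subst lim_imp_Liminf) auto
    qed
  qed
  also have "\<dots> \<le> liminf (\<lambda>m. \<integral>\<^sup>+\<omega>. f m \<omega> \<partial>M)"
    by (rule nn_integral_liminf) (rule fm)
  also have "\<dots> \<le> liminf (\<lambda>m::nat. \<integral>\<^sup>+\<omega>. qint t H \<omega> \<partial>M)"
  proof (rule Liminf_mono, rule always_eventually, rule allI)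
    fix m :: nat
    have "(\<integral>\<^sup>+\<omega>. f m \<omega> \<partial>M) \<le> (\<integral>\<^sup>+\<omega>. min (ennreal (real (Suc m))) (qint t H \<omega>) \<partial>M)"
      unfolding f_def by (rule ito_lim_truncated[OF lim t]) simp
    also have "\<dots> \<le> (\<integral>\<^sup>+\<omega>. qint t H \<omega> \<partial>M)" by (rule nn_integral_mono) simp
    finally show "(\<integral>\<^sup>+\<omega>. f m \<omega> \<partial>M) \<le> (\<integral>\<^sup>+\<omega>. qint t H \<omega> \<partial>M)" .
  qed
  finally show ?thesis by (simp add: Liminf_const)
qed

text \<open>This form allows \<open>ito_lim_le\<close> to be applied to the error of a simple
  approximation.\<close>

lemma ito_lim_diff_simple:
  assumes lim: "ito_lim t H Z" and t: "0 \<le> t" and sp': "simple_process M Fil k q \<zeta>"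
  shows "ito_lim t (\<lambda>s \<omega>. H s \<omega> - simple_value k q \<zeta> s \<omega>) (\<lambda>\<omega>. Z \<omega> - simple_ito W k q \<zeta> t \<omega>)"
proof -
  have H: "(\<lambda>(s, \<omega>). H s \<omega>) \<in> borel_measurable (time_measure t \<Otimes>\<^sub>M M)" and Z: "Z \<in> borel_measurable M"
    and fin: "AE \<omega> in M. qint t H \<omega> < \<infinity>"
    using lim unfolding ito_lim_def by auto
  obtain n p \<xi> where sp: "\<And>m. simple_process M Fil (n m) (p m) (\<xi> m)"
    and 1: "AE \<omega> in M. (\<lambda>m. qint t (\<lambda>s \<omega>. simple_value (n m) (p m) (\<xi> m) s \<omega> - H s \<omega>) \<omega>) \<longlonglongrightarrow> 0"
    and 2: "AE \<omega> in M. (\<lambda>m. simple_ito W (n m) (p m) (\<xi> m) t \<omega>) \<longlonglongrightarrow> Z \<omega>"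
    using lim unfolding ito_lim_def by blast
  have "\<exists>n' p' \<xi>'. simple_process M Fil n' p' \<xi>' \<and>
    (\<forall>s \<omega>. simple_value n' p' \<xi>' s \<omega> = simple_value (n m) (p m) (\<xi> m) s \<omega> - simple_value k q \<zeta> s \<omega>) \<and>
    (\<forall>t \<omega>. simple_ito W n' p' \<xi>' t \<omega> = simple_ito W (n m) (p m) (\<xi> m) t \<omega> - simple_ito W k q \<zeta> t \<omega>)" for m
    using simple_diff[OF sp[of m] sp'] by metis
  then obtain n' p' \<xi>' where sp2: "\<And>m. simple_process M Fil (n' m) (p' m) (\<xi>' m)"
    and v: "\<And>m s \<omega>. simple_value (n' m) (p' m) (\<xi>' m) s \<omega> = simple_value (n m) (p m) (\<xi> m) s \<omega> - simple_value k q \<zeta> s \<omega>"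
    and i: "\<And>m t \<omega>. simple_ito W (n' m) (p' m) (\<xi>' m) t \<omega> = simple_ito W (n m) (p m) (\<xi> m) t \<omega> - simple_ito W k q \<zeta> t \<omega>"
    by metis
  note K = simple_value_measurable[OF sp', of t]
  show ?thesis unfolding ito_lim_def
  proof (intro conjI exI[of _ n'] exI[of _ p'] exI[of _ \<xi>'] allI sp2)
    show "(\<lambda>(s, \<omega>). H s \<omega> - simple_value k q \<zeta> s \<omega>) \<in> borel_measurable (time_measure t \<Otimes>\<^sub>M M)"
      by (rule measurable_process_diff[OF H K])
    show "(\<lambda>\<omega>. Z \<omega> - simple_ito W k q \<zeta> t \<omega>) \<in> borel_measurable M"
      using Z simple_ito_measurable[OF sp' t] by simp
    show "AE \<omega> in M. qint t (\<lambda>s \<omega>. H s \<omega> - simple_value k q \<zeta> s \<omega>) \<omega> < \<infinity>"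
      using fin AE_space
    proof eventually_elim
      case (elim \<omega>)
      have "qint t (\<lambda>s \<omega>. H s \<omega> - simple_value k q \<zeta> s \<omega>) \<omega> \<le> 2 * qint t H \<omega> + 2 * qint t (simple_value k q \<zeta>) \<omega>"
        by (rule qint_diff_le[where t=t and H=H and \<omega>=\<omega> and K="simple_value k q \<zeta>", OF measurable_time_section[OF H elim(2)] measurable_time_section[OF K elim(2)]])
      also have "\<dots> < \<infinity>" using elim unfolding qint_simple_value[OF sp' t]
        by (simp add: ennreal_mult_less_top)
      finally show ?case .
    qed
    show "AE \<omega> in M. (\<lambda>m. qint t (\<lambda>s \<omega>. simple_value (n' m) (p' m) (\<xi>' m) s \<omega> - (H s \<omega> - simple_value k q \<zeta> s \<omega>)) \<omega>) \<longlonglongrightarrow> 0"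
      using 1 unfolding v by simp
    show "AE \<omega> in M. (\<lambda>m. simple_ito W (n' m) (p' m) (\<xi>' m) t \<omega>) \<longlonglongrightarrow> Z \<omega> - simple_ito W k q \<zeta> t \<omega>"
      using 2 unfolding i by (rule AE_mp, intro AE_I2 impI) (intro tendsto_diff tendsto_const)
  qed
qed


lemma qint_commute: "qint t (\<lambda>s \<omega>. H s \<omega> - K s \<omega>) \<omega> = qint t (\<lambda>s \<omega>. K s \<omega> - H s \<omega>) \<omega>"
  unfolding qint_def by (simp add: power2_commute)

text \<open>Almost sure convergence of the approximants does not imply mean square convergence.
  After truncation at level N their quadratic variation is at most N, so dominated convergence works
  where \<open>qint t H\<close> is below N; the rest is small for large N since
  \<open>qint t H\<close> has finite expectation.\<close>

lemma ito_lim_L2_approx: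
  assumes lim: "ito_lim t H Z" and t: "0 \<le> t" and fH: "(\<integral>\<^sup>+\<omega>. qint t H \<omega> \<partial>M) < \<infinity>" and \<epsilon>: "0 < \<epsilon>"
  obtains n p \<xi> where "simple_process M Fil n p \<xi>"
    "(\<integral>\<^sup>+\<omega>. qint t (\<lambda>s \<omega>. H s \<omega> - simple_value n p \<xi> s \<omega>) \<omega> \<partial>M) < ennreal \<epsilon>"
proof -
  have H: "(\<lambda>(s, \<omega>). H s \<omega>) \<in> borel_measurable (time_measure t \<Otimes>\<^sub>M M)"
    and fin: "AE \<omega> in M. qint t H \<omega> < \<infinity>"
    using lim unfolding ito_lim_def by auto
  obtain n p \<xi> where sp: "\<And>m. simple_process M Fil (n m) (p m) (\<xi> m)"
    and 1: "AE \<omega> in M. (\<lambda>m. qint t (\<lambda>s \<omega>. simple_value (n m) (p m) (\<xi> m) s \<omega> - H s \<omega>) \<omega>) \<longlonglongrightarrow> 0"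
    using lim unfolding ito_lim_def by blast
  have qm: "qint t H \<in> borel_measurable M" by (rule qint_measurable[OF H])
  \<comment> \<open>The error of a truncated approximant is at most 2 N + 2 \<open>qint t H\<close>,
    hence at most 4 \<open>qint t H\<close> on the event that N is reached; this is the origin of
    the factor 4.\<close>
  define g where "g = (\<lambda>N \<omega>. indicator {\<omega>. ennreal (real N) \<le> qint t H \<omega>} \<omega> * (4 * qint t H \<omega>))"
  have g0: "(\<lambda>N. \<integral>\<^sup>+\<omega>. g N \<omega> \<partial>M) \<longlonglongrightarrow> (\<integral>\<^sup>+\<omega>. 0 \<partial>M)"
  proof (rule nn_integral_dominated_convergence[where w="\<lambda>\<omega>. 4 * qint t H \<omega>"])
    show "g N \<in> borel_measurable M" for N unfolding g_def using qm by measurable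
    show "(\<integral>\<^sup>+\<omega>. 4 * qint t H \<omega> \<partial>M) < \<infinity>"
      using fH qm by (simp add: nn_integral_cmult ennreal_mult_less_top)
    show "AE \<omega> in M. (\<lambda>N. g N \<omega>) \<longlonglongrightarrow> 0"
      using fin
    proof eventually_elim
      case (elim \<omega>)
      then obtain r where r: "qint t H \<omega> = ennreal r" "0 \<le> r" by (cases "qint t H \<omega>") auto
      obtain k :: nat where k: "r < real k" using reals_Archimedean2 by blast
      have "eventually (\<lambda>N. g N \<omega> = 0) sequentially"
        using eventually_ge_at_top[of k]
      proof eventually_elim
        case (elim m)
        then have "r < real m" using k by linarith
        then have "qint t H \<omega> < ennreal (real m)" unfolding r(1) using r(2) by (simp only: ennreal_less_iff)
        then show ?case unfolding g_def by (simp add: indicator_def not_le)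
      qed
      then show ?case by (rule tendsto_eventually)
    qed
    show "AE \<omega> in M. g N \<omega> \<le> 4 * qint t H \<omega>" for N unfolding g_def by (auto simp: indicator_def)
  qed (use qm in auto)
  then have "eventually (\<lambda>N. (\<integral>\<^sup>+\<omega>. g N \<omega> \<partial>M) < ennreal (\<epsilon>/2)) sequentially"
    using \<epsilon> by (intro order_tendstoD(2)) (auto simp: ennreal_zero_less_divide)
  then obtain N :: nat where N: "(\<integral>\<^sup>+\<omega>. g N \<omega> \<partial>M) < ennreal (\<epsilon>/2)"
    by (auto simp: eventually_sequentially)
  have "\<exists>\<eta>. simple_process M Fil (n m) (p m) \<eta> \<and>
    (\<forall>\<omega>. simple_qv (n m) (p m) \<eta> t \<omega> \<le> real N \<and>
      (simple_qv (n m) (p m) (\<xi> m) t \<omega> \<le> real N \<longrightarrow> (\<forall>s. simple_value (n m) (p m) \<eta> s \<omega> = simple_value (n m) (p m) (\<xi> m) s \<omega>)))" for m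
    using simple_truncation[OF sp[of m] of_nat_0_le_iff[of N], of t] by metis
  then obtain \<eta> where spe: "\<And>m. simple_process M Fil (n m) (p m) (\<eta> m)"
    and e1: "\<And>m \<omega>. simple_qv (n m) (p m) (\<eta> m) t \<omega> \<le> real N"
    and e3: "\<And>m \<omega> s. simple_qv (n m) (p m) (\<xi> m) t \<omega> \<le> real N \<Longrightarrow> simple_value (n m) (p m) (\<eta> m) s \<omega> = simple_value (n m) (p m) (\<xi> m) s \<omega>"
    by metis
  define V where "V = (\<lambda>m. simple_value (n m) (p m) (\<xi> m))"
  define Y where "Y = (\<lambda>m. simple_value (n m) (p m) (\<eta> m))"
  have Vm: "(\<lambda>(s, \<omega>). V m s \<omega>) \<in> borel_measurable (time_measure t \<Otimes>\<^sub>M M)" for m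
    unfolding V_def by (rule simple_value_measurable[OF sp])
  have Ym: "(\<lambda>(s, \<omega>). Y m s \<omega>) \<in> borel_measurable (time_measure t \<Otimes>\<^sub>M M)" for m
    unfolding Y_def by (rule simple_value_measurable[OF spe])
  have qV: "qint t (V m) \<omega> = ennreal (simple_qv (n m) (p m) (\<xi> m) t \<omega>)" for m \<omega>
    unfolding V_def by (rule qint_simple_value[OF sp t])
  have qY: "qint t (Y m) \<omega> = ennreal (simple_qv (n m) (p m) (\<eta> m) t \<omega>)" for m \<omega>
    unfolding Y_def by (rule qint_simple_value[OF spe t])
  define d where "d = (\<lambda>m. qint t (\<lambda>s \<omega>. Y m s \<omega> - H s \<omega>))"
  have dm: "d m \<in> borel_measurable M" for m
    unfolding d_def by (rule qint_measurable[OF measurable_process_diff[OF Ym H]])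
  have dle: "d m \<omega> \<le> 2 * ennreal (real N) + 2 * qint t H \<omega>" if "\<omega> \<in> space M" for m \<omega>
  proof -
    have "d m \<omega> \<le> 2 * qint t (Y m) \<omega> + 2 * qint t H \<omega>"
      unfolding d_def
      by (rule qint_diff_le[where t=t and H="Y m" and K=H and \<omega>=\<omega>, OF measurable_time_section[OF Ym that] measurable_time_section[OF H that]])
    also have "\<dots> \<le> 2 * ennreal (real N) + 2 * qint t H \<omega>"
      unfolding qY by (intro add_mono mult_left_mono ennreal_leI e1) auto
    finally show ?thesis .
  qed
  define u where "u = (\<lambda>m \<omega>. indicator {\<omega>. qint t H \<omega> < ennreal (real N)} \<omega> * d m \<omega>)"
  have um: "u m \<in> borel_measurable M" for m unfolding u_def using qm dm by measurable
  have u0: "(\<lambda>m. \<integral>\<^sup>+\<omega>. u m \<omega> \<partial>M) \<longlonglongrightarrow> (\<integral>\<^sup>+\<omega>. 0 \<partial>M)"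
  proof (rule nn_integral_dominated_convergence[where w="\<lambda>\<omega>. 2 * ennreal (real N) + 2 * qint t H \<omega>"])
    show "(\<integral>\<^sup>+\<omega>. 2 * ennreal (real N) + 2 * qint t H \<omega> \<partial>M) < \<infinity>"
      using fH qm by (simp add: nn_integral_add nn_integral_cmult ennreal_mult_less_top emeasure_space_1)
    show "AE \<omega> in M. u m \<omega> \<le> 2 * ennreal (real N) + 2 * qint t H \<omega>" for m
      using dle unfolding u_def by (intro AE_I2) (auto simp: indicator_def)
    show "AE \<omega> in M. (\<lambda>m. u m \<omega>) \<longlonglongrightarrow> 0"
      using 1 fin AE_space
    proof eventually_elim
      case (elim \<omega>)
      show ?case
      proof (cases "qint t H \<omega> < ennreal (real N)")
        case True
        have lim1: "(\<lambda>m. qint t (V m) \<omega>) \<longlonglongrightarrow> qint t H \<omega>"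
          by (rule qint_tendsto[where V=V, OF H Vm elim(3,2)]) (use elim(1) in \<open>simp add: V_def\<close>)
        have "eventually (\<lambda>m. u m \<omega> = qint t (\<lambda>s \<omega>. V m s \<omega> - H s \<omega>) \<omega>) sequentially"
          using order_tendstoD(2)[OF lim1 True]
        proof eventually_elim
          case (elim m)
          then have "simple_qv (n m) (p m) (\<xi> m) t \<omega> < real N"
            unfolding qV by (simp only: ennreal_less_iff simple_qv_nonneg[OF sp])
          then have "Y m s \<omega> = V m s \<omega>" for s unfolding Y_def V_def by (intro e3) simp
          then show ?case using True unfolding u_def d_def by (simp add: indicator_def qint_def)
        qed
        then show ?thesis using elim(1) unfolding V_def by (rule tendsto_cong[THEN iffD2])
      qed (simp add: u_def indicator_def)
    qed
  qed (use qm um in auto)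
  then have "eventually (\<lambda>m. (\<integral>\<^sup>+\<omega>. u m \<omega> \<partial>M) < ennreal (\<epsilon>/2)) sequentially"
    using \<epsilon> by (intro order_tendstoD(2)) (auto simp: ennreal_zero_less_divide)
  then obtain m where m: "(\<integral>\<^sup>+\<omega>. u m \<omega> \<partial>M) < ennreal (\<epsilon>/2)"
    by (auto simp: eventually_sequentially)
  have gm: "g N \<in> borel_measurable M" unfolding g_def using qm by measurable
  have "(\<integral>\<^sup>+\<omega>. d m \<omega> \<partial>M) \<le> (\<integral>\<^sup>+\<omega>. u m \<omega> + g N \<omega> \<partial>M)"
  proof (rule nn_integral_mono)
    fix \<omega> assume w: "\<omega> \<in> space M"
    show "d m \<omega> \<le> u m \<omega> + g N \<omega>"
    proof (cases "qint t H \<omega> < ennreal (real N)")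
      case False
      have "d m \<omega> \<le> 2 * qint t H \<omega> + 2 * qint t H \<omega>"
        using False by (intro order_trans[OF dle[OF w, of m]] add_mono mult_left_mono) (auto simp: not_less)
      also have "\<dots> = 4 * qint t H \<omega>" by (simp add: distrib_right[symmetric])
      finally show ?thesis using False unfolding u_def g_def by (simp add: indicator_def not_less)
    qed (simp add: u_def indicator_def)
  qed
  also have "\<dots> = (\<integral>\<^sup>+\<omega>. u m \<omega> \<partial>M) + (\<integral>\<^sup>+\<omega>. g N \<omega> \<partial>M)"
    using um gm by (rule nn_integral_add)
  also have "\<dots> < ennreal (\<epsilon>/2) + ennreal (\<epsilon>/2)" using m N by (rule add_strict_mono)
  also have "\<dots> = ennreal \<epsilon>" using \<epsilon> by (simp add: ennreal_plus[symmetric] del: ennreal_plus)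
  finally have "(\<integral>\<^sup>+\<omega>. qint t (\<lambda>s \<omega>. H s \<omega> - Y m s \<omega>) \<omega> \<partial>M) < ennreal \<epsilon>"
    unfolding d_def by (subst qint_commute)
  then show ?thesis using that[OF spe[of m]] unfolding Y_def by blast
qed

lemma ito_lim_seq:
  assumes lim: "ito_lim t H Z" and t: "0 \<le> t" and fH: "(\<integral>\<^sup>+\<omega>. qint t H \<omega> \<partial>M) < \<infinity>"
  obtains n p \<xi> where "\<And>m. simple_process M Fil (n m) (p m) (\<xi> m)"
    "(\<lambda>m. \<integral>\<^sup>+\<omega>. qint t (\<lambda>s \<omega>. H s \<omega> - simple_value (n m) (p m) (\<xi> m) s \<omega>) \<omega> \<partial>M) \<longlonglongrightarrow> 0"
proof -
  have "\<exists>n p \<xi>. simple_process M Fil n p \<xi> \<and>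
    (\<integral>\<^sup>+\<omega>. qint t (\<lambda>s \<omega>. H s \<omega> - simple_value n p \<xi> s \<omega>) \<omega> \<partial>M) < ennreal (1 / real (Suc m))" for m
    using ito_lim_L2_approx[OF lim t fH, of "1 / real (Suc m)"] by (metis of_nat_0_less_iff zero_less_Suc zero_less_divide_1_iff)
  then obtain n p \<xi> where sp: "\<And>m. simple_process M Fil (n m) (p m) (\<xi> m)"
    and e: "\<And>m. (\<integral>\<^sup>+\<omega>. qint t (\<lambda>s \<omega>. H s \<omega> - simple_value (n m) (p m) (\<xi> m) s \<omega>) \<omega> \<partial>M) < ennreal (1 / real (Suc m))"
    by metis
  have "(\<lambda>m. ennreal (1 / real (Suc m))) \<longlonglongrightarrow> ennreal 0"
    by (intro tendsto_ennrealI LIMSEQ_Suc lim_1_over_n)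
  then have z: "(\<lambda>m. ennreal (1 / real (Suc m))) \<longlonglongrightarrow> 0" by (simp only: ennreal_0)
  have "(\<lambda>m. \<integral>\<^sup>+\<omega>. qint t (\<lambda>s \<omega>. H s \<omega> - simple_value (n m) (p m) (\<xi> m) s \<omega>) \<omega> \<partial>M) \<longlonglongrightarrow> 0"
    by (rule tendsto_sandwich[OF _ _ tendsto_const z]) (intro always_eventually allI zero_le less_imp_le[OF e])+
  then show ?thesis using that sp by blast
qed

text \<open>The definition supplies unrelated approximations at different times. A sequence chosen
  for the final time t serves every earlier s as well, because the quadratic variation of the error
  increases with time.\<close>

lemma ito_lim_J_tendsto:
  assumes lim: "ito_lim s H Z" and s: "0 \<le> s" "s \<le> t" and sp: "\<And>m. simple_process M Fil (n m) (p m) (\<xi> m)"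
    and z: "(\<lambda>m. \<integral>\<^sup>+\<omega>. qint t (\<lambda>s \<omega>. H s \<omega> - simple_value (n m) (p m) (\<xi> m) s \<omega>) \<omega> \<partial>M) \<longlonglongrightarrow> 0"
  shows "(\<lambda>m. \<integral>\<^sup>+\<omega>. ennreal ((simple_ito W (n m) (p m) (\<xi> m) s \<omega> - Z \<omega>)\<^sup>2) \<partial>M) \<longlonglongrightarrow> 0"
proof (rule tendsto_sandwich[OF _ _ tendsto_const z])
  show "eventually (\<lambda>m. (\<integral>\<^sup>+\<omega>. ennreal ((simple_ito W (n m) (p m) (\<xi> m) s \<omega> - Z \<omega>)\<^sup>2) \<partial>M) \<le>
     (\<integral>\<^sup>+\<omega>. qint t (\<lambda>s \<omega>. H s \<omega> - simple_value (n m) (p m) (\<xi> m) s \<omega>) \<omega> \<partial>M)) sequentially"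
  proof (intro always_eventually allI)
    fix m
    have "(\<integral>\<^sup>+\<omega>. ennreal ((simple_ito W (n m) (p m) (\<xi> m) s \<omega> - Z \<omega>)\<^sup>2) \<partial>M)
      = (\<integral>\<^sup>+\<omega>. ennreal ((Z \<omega> - simple_ito W (n m) (p m) (\<xi> m) s \<omega>)\<^sup>2) \<partial>M)"
      by (simp only: power2_commute)
    also have "\<dots> \<le> (\<integral>\<^sup>+\<omega>. qint s (\<lambda>s \<omega>. H s \<omega> - simple_value (n m) (p m) (\<xi> m) s \<omega>) \<omega> \<partial>M)"
      by (rule ito_lim_le[OF ito_lim_diff_simple[OF lim s(1) sp] s(1)])
    also have "\<dots> \<le> (\<integral>\<^sup>+\<omega>. qint t (\<lambda>s \<omega>. H s \<omega> - simple_value (n m) (p m) (\<xi> m) s \<omega>) \<omega> \<partial>M)"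
      by (intro nn_integral_mono qint_mono s(2))
    finally show "(\<integral>\<^sup>+\<omega>. ennreal ((simple_ito W (n m) (p m) (\<xi> m) s \<omega> - Z \<omega>)\<^sup>2) \<partial>M) \<le>
     (\<integral>\<^sup>+\<omega>. qint t (\<lambda>s \<omega>. H s \<omega> - simple_value (n m) (p m) (\<xi> m) s \<omega>) \<omega> \<partial>M)" .
  qed
qed (intro always_eventually allI zero_le)

text \<open>The isometry of simple processes passes to the limit on both sides, on the left in L2 of
  the probability space and on the right in L2 of the product with time.\<close>

theorem ito_isometry:
  assumes lim: "ito_lim t H Z" and t: "0 \<le> t" and fH: "(\<integral>\<^sup>+\<omega>. qint t H \<omega> \<partial>M) < \<infinity>"
  shows "(\<integral>\<^sup>+\<omega>. ennreal ((Z \<omega>)\<^sup>2) \<partial>M) = (\<integral>\<^sup>+\<omega>. qint t H \<omega> \<partial>M)"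
proof -
  have H: "(\<lambda>(s, \<omega>). H s \<omega>) \<in> borel_measurable (time_measure t \<Otimes>\<^sub>M M)" and Z: "Z \<in> borel_measurable M"
    using lim unfolding ito_lim_def by auto
  obtain n p \<xi> where sp: "\<And>m. simple_process M Fil (n m) (p m) (\<xi> m)"
    and z: "(\<lambda>m. \<integral>\<^sup>+\<omega>. qint t (\<lambda>s \<omega>. H s \<omega> - simple_value (n m) (p m) (\<xi> m) s \<omega>) \<omega> \<partial>M) \<longlonglongrightarrow> 0"
    using ito_lim_seq[OF assms] by blast
  have fZ: "(\<integral>\<^sup>+\<omega>. ennreal ((Z \<omega>)\<^sup>2) \<partial>M) < \<infinity>"
    using ito_lim_le[OF lim t] fH by (rule le_less_trans)
  have l1: "(\<lambda>m. \<integral>\<^sup>+\<omega>. ennreal ((simple_ito W (n m) (p m) (\<xi> m) t \<omega>)\<^sup>2) \<partial>M) \<longlonglongrightarrow> (\<integral>\<^sup>+\<omega>. ennreal ((Z \<omega>)\<^sup>2) \<partial>M)"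
    by (rule tendsto_nn_integral_sq[OF simple_ito_measurable[OF sp t] Z ito_lim_J_tendsto[OF lim t order_refl sp z] fZ])
  note Vm = simple_value_measurable[OF sp, where t=t]
  have sf: "sigma_finite_measure M" by unfold_locales
  let ?P = "time_measure t \<Otimes>\<^sub>M M"
  let ?V = "\<lambda>m x. case x of (s, \<omega>) \<Rightarrow> simple_value (n m) (p m) (\<xi> m) s \<omega>"
  have z': "(\<lambda>m. \<integral>\<^sup>+x. ennreal ((?V m x - (case x of (s, \<omega>) \<Rightarrow> H s \<omega>))\<^sup>2) \<partial>?P) \<longlonglongrightarrow> 0"
    using z unfolding nn_integral_qint[OF measurable_process_diff[OF H Vm] sf]
    by (simp add: case_prod_unfold power2_commute)
  have l2: "(\<lambda>m. \<integral>\<^sup>+x. ennreal ((?V m x)\<^sup>2) \<partial>?P) \<longlonglongrightarrow> (\<integral>\<^sup>+x. ennreal ((case x of (s, \<omega>) \<Rightarrow> H s \<omega>)\<^sup>2) \<partial>?P)"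
    by (rule tendsto_nn_integral_sq[OF Vm H z']) (use fH in \<open>simp only: nn_integral_qint[OF H sf]\<close>)
  show ?thesis
    using LIMSEQ_unique[OF l1] l2 unfolding nn_integral_qint[OF H sf] nn_simple_isometry(1)[OF sp t]
      nn_integral_qint[OF Vm sf] by blast
qed

text \<open>Increments of simple integrals are exactly orthogonal to Y, and the same simple
  processes approximate the integral at s and at t; the remaining error is removed by a weighted
  Cauchy-Schwarz inequality.\<close>

theorem ito_orthogonal:
  assumes lim: "ito_lim t H Z" and lim': "ito_lim s H Z'" and s: "0 \<le> s" "s \<le> t"
    and fH: "(\<integral>\<^sup>+\<omega>. qint t H \<omega> \<partial>M) < \<infinity>"
    and Y: "Y \<in> borel_measurable (Fil s)" and Y2: "integrable M (\<lambda>\<omega>. (Y \<omega>)\<^sup>2)"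
  shows "expectation (\<lambda>\<omega>. Y \<omega> * (Z \<omega> - Z' \<omega>)) = 0"
proof -
  have t: "0 \<le> t" using s by simp
  have Z: "Z \<in> borel_measurable M" "Z' \<in> borel_measurable M"
    using lim lim' unfolding ito_lim_def by auto
  have YM: "Y \<in> borel_measurable M" using Y by (rule measurable_Fil_M)
  have iY: "integrable M Y" using YM Y2 square_integrable_imp_integrable by blast
  have fH': "(\<integral>\<^sup>+\<omega>. qint s H \<omega> \<partial>M) < \<infinity>"
    using nn_integral_mono[of M "qint s H" "qint t H"] qint_mono[OF s(2)] fH by (metis le_less_trans)
  have iZ: "integrable M (\<lambda>\<omega>. (Z \<omega>)\<^sup>2)" "integrable M (\<lambda>\<omega>. (Z' \<omega>)\<^sup>2)"
    using ito_lim_le[OF lim t] ito_lim_le[OF lim' s(1)] fH fH' Z by (auto simp: integrable_sq_iff intro: le_less_trans)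
  obtain n p \<xi> where sp: "\<And>m. simple_process M Fil (n m) (p m) (\<xi> m)"
    and z: "(\<lambda>m. \<integral>\<^sup>+\<omega>. qint t (\<lambda>s \<omega>. H s \<omega> - simple_value (n m) (p m) (\<xi> m) s \<omega>) \<omega> \<partial>M) \<longlonglongrightarrow> 0"
    using ito_lim_seq[OF lim t fH] by blast
  define D where "D = (\<lambda>m \<omega>. (simple_ito W (n m) (p m) (\<xi> m) t \<omega> - Z \<omega>) - (simple_ito W (n m) (p m) (\<xi> m) s \<omega> - Z' \<omega>))"
  define a where "a = (\<lambda>m. \<integral>\<^sup>+\<omega>. ennreal ((simple_ito W (n m) (p m) (\<xi> m) t \<omega> - Z \<omega>)\<^sup>2) \<partial>M)"
  define b where "b = (\<lambda>m. \<integral>\<^sup>+\<omega>. ennreal ((simple_ito W (n m) (p m) (\<xi> m) s \<omega> - Z' \<omega>)\<^sup>2) \<partial>M)"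
  have ab: "a \<longlonglongrightarrow> 0" "b \<longlonglongrightarrow> 0" unfolding a_def b_def
    by (rule ito_lim_J_tendsto[OF lim t order_refl sp z]) (rule ito_lim_J_tendsto[OF lim' s sp z])
  note Jm = simple_ito_measurable[OF sp t] simple_ito_measurable[OF sp s(1)]
  have iA: "integrable M (\<lambda>\<omega>. (simple_ito W (n m) (p m) (\<xi> m) t \<omega> - Z \<omega>)\<^sup>2)"
    "integrable M (\<lambda>\<omega>. (simple_ito W (n m) (p m) (\<xi> m) s \<omega> - Z' \<omega>)\<^sup>2)" for m
    using sq_integrable_diff[OF Jm(1) Z(1) simple_isometry(1)[OF sp t] iZ(1)]
      sq_integrable_diff[OF Jm(2) Z(2) simple_isometry(1)[OF sp s(1)] iZ(2)] by auto
  have Dm: "D m \<in> borel_measurable M" for m unfolding D_def using Jm Z by measurable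
  have iD: "integrable M (\<lambda>\<omega>. (D m \<omega>)\<^sup>2)" for m
    unfolding D_def by (rule sq_integrable_diff[OF _ _ iA]) (use Jm Z in measurable)
  define c where "c = expectation (\<lambda>\<omega>. Y \<omega> * (Z \<omega> - Z' \<omega>))"
  define y where "y = expectation (\<lambda>\<omega>. (Y \<omega>)\<^sup>2)"
  have iYZ: "integrable M (\<lambda>\<omega>. Y \<omega> * (Z \<omega> - Z' \<omega>))"
    by (rule sq_integrable_mult[OF YM _ Y2 sq_integrable_diff[OF Z iZ]]) (use Z in simp)
  have iYD: "integrable M (\<lambda>\<omega>. Y \<omega> * D m \<omega>)" for m
    by (rule sq_integrable_mult[OF YM Dm Y2 iD])
  \<comment> \<open>Since the simple increment contributes nothing, the constant c is, up to sign,
    the pairing of Y with the approximation error, for every m.\<close>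
  have cD: "c = - expectation (\<lambda>\<omega>. Y \<omega> * D m \<omega>)" for m
  proof -
    note mg = simple_martingale[OF sp s Y iY, of m]
    have "expectation (\<lambda>\<omega>. Y \<omega> * D m \<omega>) =
      expectation (\<lambda>\<omega>. Y \<omega> * (simple_ito W (n m) (p m) (\<xi> m) t \<omega> - simple_ito W (n m) (p m) (\<xi> m) s \<omega>) - Y \<omega> * (Z \<omega> - Z' \<omega>))"
      unfolding D_def by (intro Bochner_Integration.integral_cong refl) (simp add: algebra_simps)
    also have "\<dots> = - c" unfolding c_def using mg iYZ by simp
    finally show ?thesis by simp
  qed
  define e where "e = (\<lambda>m. expectation (\<lambda>\<omega>. (D m \<omega>)\<^sup>2))"
  have e0: "e \<longlonglongrightarrow> 0"
  proof (rule tendsto_ennrealD)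
    have le: "ennreal (e m) \<le> 2 * a m + 2 * b m" for m
    proof -
      have "e m \<le> expectation (\<lambda>\<omega>. 2 * (simple_ito W (n m) (p m) (\<xi> m) t \<omega> - Z \<omega>)\<^sup>2 + 2 * (simple_ito W (n m) (p m) (\<xi> m) s \<omega> - Z' \<omega>)\<^sup>2)"
        unfolding e_def using iD[of m] iA[of m] sq_diff_le unfolding D_def by (intro integral_mono) auto
      also have "\<dots> = 2 * expectation (\<lambda>\<omega>. (simple_ito W (n m) (p m) (\<xi> m) t \<omega> - Z \<omega>)\<^sup>2) + 2 * expectation (\<lambda>\<omega>. (simple_ito W (n m) (p m) (\<xi> m) s \<omega> - Z' \<omega>)\<^sup>2)"
        using iA[of m] by simp
      finally show ?thesis unfolding a_def b_def nn_integral_sq_eq[OF iA(1)] nn_integral_sq_eq[OF iA(2)]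
        by (subst (asm) ennreal_le_iff[symmetric]) (simp_all add: ennreal_mult)
    qed
    have "(\<lambda>m. 2 * a m + 2 * b m) \<longlonglongrightarrow> 2 * 0 + 2 * 0"
      by (intro tendsto_add ennreal_tendsto_cmult ab) auto
    then have z: "(\<lambda>m. 2 * a m + 2 * b m) \<longlonglongrightarrow> 0" by simp
    have "(\<lambda>m. ennreal (e m)) \<longlonglongrightarrow> 0"
      by (rule tendsto_sandwich[OF _ _ tendsto_const z]) (intro always_eventually allI zero_le le)+
    then show "(\<lambda>m. ennreal (e m)) \<longlonglongrightarrow> ennreal 0" by simp
  qed (auto simp: e_def)
  \<comment> \<open>Two limits follow: m tends to infinity with \<open>\<delta>\<close> fixed, which
    removes the error term, and only then \<open>\<delta>\<close> tends to 0.\<close>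
  have bound: "2 * \<bar>c\<bar> \<le> \<delta> * y + e m / \<delta>" if "0 < \<delta>" for \<delta> m
  proof -
    have "2 * \<bar>c\<bar> = 2 * \<bar>expectation (\<lambda>\<omega>. Y \<omega> * D m \<omega>)\<bar>" using cD[of m] by simp
    also have "\<dots> \<le> 2 * expectation (\<lambda>\<omega>. \<bar>Y \<omega> * D m \<omega>\<bar>)"
      using integral_abs_bound[of M "\<lambda>\<omega>. Y \<omega> * D m \<omega>"] by simp
    also have "\<dots> = expectation (\<lambda>\<omega>. 2 * \<bar>Y \<omega> * D m \<omega>\<bar>)" by simp
    also have "\<dots> \<le> expectation (\<lambda>\<omega>. \<delta> * (Y \<omega>)\<^sup>2 + (1/\<delta>) * (D m \<omega>)\<^sup>2)"
    proof (rule integral_mono)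
      show "2 * \<bar>Y \<omega> * D m \<omega>\<bar> \<le> \<delta> * (Y \<omega>)\<^sup>2 + (1/\<delta>) * (D m \<omega>)\<^sup>2" for \<omega>
      proof -
        have "2 * \<bar>Y \<omega> * D m \<omega>\<bar> = 2 * (sqrt \<delta> * \<bar>Y \<omega>\<bar>) * (\<bar>D m \<omega>\<bar> / sqrt \<delta>)"
          using that by (simp add: abs_mult)
        also have "\<dots> \<le> (sqrt \<delta> * \<bar>Y \<omega>\<bar>)\<^sup>2 + (\<bar>D m \<omega>\<bar> / sqrt \<delta>)\<^sup>2" by (rule sum_squares_bound)
        also have "\<dots> = \<delta> * (Y \<omega>)\<^sup>2 + (1/\<delta>) * (D m \<omega>)\<^sup>2"
          using that by (simp add: power_mult_distrib power_divide)
        finally show ?thesis .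
      qed
    qed (use iYD Y2 iD in auto)
    also have "\<dots> = \<delta> * y + e m / \<delta>" unfolding y_def e_def using Y2 iD by simp
    finally show ?thesis .
  qed
  have "2 * \<bar>c\<bar> \<le> \<delta> * y" if "0 < \<delta>" for \<delta>
  proof (rule LIMSEQ_le_const)
    have "(\<lambda>m. \<delta> * y + e m / \<delta>) \<longlonglongrightarrow> \<delta> * y + 0 / \<delta>" using that by (intro tendsto_intros e0) auto
    then show "(\<lambda>m. \<delta> * y + e m / \<delta>) \<longlonglongrightarrow> \<delta> * y" by simp
    show "\<exists>N. \<forall>m\<ge>N. 2 * \<bar>c\<bar> \<le> \<delta> * y + e m / \<delta>" using bound[OF that] by blast
  qed
  then have "2 * \<bar>c\<bar> \<le> \<epsilon>" if "0 < \<epsilon>" for \<epsilon>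
  proof -
    have y0: "0 \<le> y" unfolding y_def by simp
    have "2 * \<bar>c\<bar> \<le> \<epsilon> / (y + 1) * y" using \<open>0 < \<epsilon>\<close> y0 by (intro \<open>\<And>\<delta>. 0 < \<delta> \<Longrightarrow> 2 * \<bar>c\<bar> \<le> \<delta> * y\<close>) auto
    also have "\<dots> \<le> \<epsilon>" using y0 \<open>0 < \<epsilon>\<close> by (simp add: field_simps)
    finally show ?thesis .
  qed
  then have "2 * \<bar>c\<bar> \<le> 0" using field_le_epsilon[of "2 * \<bar>c\<bar>" 0] by simp
  then show ?thesis unfolding c_def by simp
qed

end

section \<open>Energy identity for linear stochastic differential equations\<close>

lemma integrable_time_measure:
  fixes f :: "real \<Rightarrow> real"
  shows "integrable (time_measure t) f \<longleftrightarrow> set_integrable lborel {0..t} f"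
  unfolding set_integrable_def by (rule integrable_restrict_space) simp

lemma integral_time_measure:
  fixes f :: "real \<Rightarrow> real"
  shows "(\<integral>s. f s \<partial>time_measure t) = (LINT s:{0..t}|lborel. f s)"
  unfolding set_lebesgue_integral_def by (rule integral_restrict_space) simp

lemma continuous_time_integrable:
  fixes f :: "real \<Rightarrow> real"
  assumes "continuous_on {0..} f"
  shows "integrable (time_measure t) f"
  unfolding integrable_time_measure
  by (rule borel_integrable_atLeastAtMost') (rule continuous_on_subset[OF assms], auto)

lemma time_integral_eq:
  fixes f :: "real \<Rightarrow> real"
  assumes "continuous_on {0..} f"
  shows "(LINT u:{0..s}|lborel. f u) = integral {0..s} f"
  using continuous_time_integrable[OF assms, of s] unfolding integrable_time_measure
  by (rule set_borel_integral_eq_integral)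

lemma time_integral_deriv:
  fixes f :: "real \<Rightarrow> real"
  assumes f: "continuous_on {0..} f" and s: "0 \<le> s" "s \<le> t"
  shows "((\<lambda>s. LINT u:{0..s}|lborel. f u) has_real_derivative f s) (at s within {0..t})"
proof -
  have "((\<lambda>s. integral {0..s} f) has_real_derivative f s) (at s within {0..t})"
    by (rule integral_has_real_derivative) (use s continuous_on_subset[OF f] in auto)
  then show ?thesis unfolding time_integral_eq[OF f] .
qed

lemma time_integral_continuous:
  fixes f :: "real \<Rightarrow> real"
  assumes f: "continuous_on {0..} f"
  shows "continuous_on {0..} (\<lambda>s. LINT u:{0..s}|lborel. f u)"
proof -
  let ?V = "\<lambda>s. LINT u:{0..s}|lborel. f u"
  have "continuous (at s within {0..}) ?V" if "s \<in> {0..}" for s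
  proof -
    \<comment> \<open>The derivative is available on bounded intervals; [0, s+1] is a neighbourhood
      of s in the half line.\<close>
    have "continuous (at s within {0..s+1}) ?V"
      by (rule DERIV_continuous[OF time_integral_deriv[OF f]]) (use that in auto)
    moreover have "at s within {0..s+1} = at s within {0..}"
      by (rule at_within_nhd[of _ "{..<s+1}"]) auto
    ultimately show ?thesis by simp
  qed
  then show ?thesis by (simp add: continuous_on_eq_continuous_within)
qed

text \<open>Cauchy-Schwarz against the constant 1, obtained by expanding the nonnegative integral of
  the squared deviation from the time average v / s.\<close>

lemma time_integral_sq_le:
  fixes f :: "real \<Rightarrow> real"
  assumes f: "continuous_on {0..} f" and s: "0 \<le> s"
  shows "(LINT u:{0..s}|lborel. f u)\<^sup>2 \<le> s * (LINT u:{0..s}|lborel. (f u)\<^sup>2)"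
proof (cases "s = 0")
  case True
  have "(LINT u:{0..0}|lborel. f u) = 0" unfolding time_integral_eq[OF f] by simp
  then show ?thesis using True by simp
next
  case False
  then have s: "0 < s" using s by simp
  define v where "v = (LINT u:{0..s}|lborel. f u)"
  define q where "q = (LINT u:{0..s}|lborel. (f u)\<^sup>2)"
  have f2: "continuous_on {0..} (\<lambda>u. (f u)\<^sup>2)" by (intro continuous_intros f)
  note i = continuous_time_integrable[OF f, of s] continuous_time_integrable[OF f2, of s]
  have m: "measure (time_measure s) {0..s} = s"
    using s by (simp add: measure_restrict_space)
  have fm: "finite_measure (time_measure s)"
    by (rule finite_measureI) (simp add: emeasure_restrict_space emeasure_lborel_Icc_eq)
  have ic: "integrable (time_measure s) (\<lambda>u. c)" for c :: real
    using finite_measure.integrable_const[OF fm] .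
  have "0 \<le> (\<integral>u. (f u - v / s)\<^sup>2 \<partial>time_measure s)" by simp
  also have "\<dots> = (\<integral>u. (f u)\<^sup>2 - (2 * (v/s)) * f u + (v/s)\<^sup>2 \<partial>time_measure s)"
    by (intro Bochner_Integration.integral_cong refl) (simp add: power2_eq_square algebra_simps)
  also have "\<dots> = q - (2 * (v/s)) * v + (v/s)\<^sup>2 * s"
    using i ic unfolding v_def q_def integral_time_measure[symmetric] by (simp add: m)
  also have "\<dots> = q - v\<^sup>2 / s" using s by (simp add: power2_eq_square field_simps)
  finally have "v\<^sup>2 \<le> s * q" using s by (simp add: field_simps)
  then show ?thesis unfolding v_def q_def .
qed

text \<open>Sampling the time on the grid of mesh 1/(n+1) from below gives processes with countably
  many times, which are jointly measurable; path continuity makes them converge pointwise.\<close>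

lemma continuous_process_measurable:
  fixes f :: "real \<Rightarrow> 'a \<Rightarrow> real"
  assumes c: "\<And>\<omega>. \<omega> \<in> space M \<Longrightarrow> continuous_on {0..} (\<lambda>s. f s \<omega>)"
    and m: "\<And>s. 0 \<le> s \<Longrightarrow> f s \<in> borel_measurable M"
  shows "(\<lambda>(s, \<omega>). f s \<omega>) \<in> borel_measurable (time_measure t \<Otimes>\<^sub>M M)"
proof -
  let ?P = "time_measure t \<Otimes>\<^sub>M M"
  \<comment> \<open>The grid index is rounded down, and times are nonnegative on the space at hand,
    so every sampled time stays in the half line where measurability and continuity are
    known.\<close>
  define g where "g = (\<lambda>(n::nat) (x::real \<times> 'a). nat \<lfloor>real (Suc n) * fst x\<rfloor>)"
  have gm: "g n \<in> measurable ?P (count_space UNIV)" for n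
  proof -
    have "(\<lambda>s::real. nat \<lfloor>real (Suc n) * s\<rfloor>) \<in> measurable lborel (count_space UNIV)" by measurable
    then have "(\<lambda>s::real. nat \<lfloor>real (Suc n) * s\<rfloor>) \<in> measurable (time_measure t) (count_space UNIV)"
      by (rule measurable_restrict_space1)
    then show ?thesis unfolding g_def by (rule measurable_compose[OF measurable_fst])
  qed
  have m1: "(\<lambda>x. f (real i / real (Suc n)) (snd x)) \<in> borel_measurable ?P" for i n
    by (rule measurable_compose[OF measurable_snd m]) simp
  have fm: "(\<lambda>x. f (real (g n x) / real (Suc n)) (snd x)) \<in> borel_measurable ?P" for n
    by (rule measurable_compose_countable[OF m1 gm])
  have "(\<lambda>x. f (fst x) (snd x)) \<in> borel_measurable ?P"
  proof (rule borel_measurable_LIMSEQ_real[OF _ fm])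
    fix x assume "x \<in> space ?P"
    then have x: "0 \<le> fst x" "snd x \<in> space M" by (auto simp: space_pair_measure)
    have g0: "real (g n x) = of_int \<lfloor>real (Suc n) * fst x\<rfloor>" for n
      unfolding g_def using x(1) by simp
    have lim: "(\<lambda>n. real (g n x) / real (Suc n)) \<longlonglongrightarrow> fst x"
    proof (rule tendsto_sandwich)
      show "eventually (\<lambda>n. fst x - 1 / real (Suc n) \<le> real (g n x) / real (Suc n)) sequentially"
      proof (intro always_eventually allI)
        fix n
        have "real (Suc n) * fst x - 1 \<le> real (g n x)" unfolding g0 by linarith
        then have "(real (Suc n) * fst x - 1) / real (Suc n) \<le> real (g n x) / real (Suc n)"
          by (rule divide_right_mono) simp
        then show "fst x - 1 / real (Suc n) \<le> real (g n x) / real (Suc n)" by (simp add: diff_divide_distrib)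
      qed
      show "eventually (\<lambda>n. real (g n x) / real (Suc n) \<le> fst x) sequentially"
      proof (intro always_eventually allI)
        fix n
        have "real (g n x) \<le> real (Suc n) * fst x" unfolding g0 by linarith
        then show "real (g n x) / real (Suc n) \<le> fst x" by (simp add: divide_le_eq mult.commute)
      qed
      have "(\<lambda>n. fst x - 1 / real (Suc n)) \<longlonglongrightarrow> fst x - 0"
        by (intro tendsto_diff tendsto_const LIMSEQ_Suc lim_1_over_n)
      then show "(\<lambda>n. fst x - 1 / real (Suc n)) \<longlonglongrightarrow> fst x" by simp
    qed (rule tendsto_const)
    have "continuous (at (fst x) within {0..}) (\<lambda>s. f s (snd x))"
      using c[OF x(2)] x(1) by (simp add: continuous_on_eq_continuous_within)
    then show "(\<lambda>n. f (real (g n x) / real (Suc n)) (snd x)) \<longlonglongrightarrow> f (fst x) (snd x)"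
      by (rule continuous_within_tendsto_compose'[OF _ _ lim]) auto
  qed
  then show ?thesis by (simp add: case_prod_unfold)
qed

lemma time_integral_measurable:
  fixes f :: "real \<Rightarrow> 'a \<Rightarrow> real"
  assumes c: "\<And>\<omega>. \<omega> \<in> space M \<Longrightarrow> continuous_on {0..} (\<lambda>s. f s \<omega>)"
    and m: "\<And>s. 0 \<le> s \<Longrightarrow> f s \<in> borel_measurable M"
  shows "(\<lambda>\<omega>. LINT u:{0..s}|lborel. f u \<omega>) \<in> borel_measurable M"
proof -
  interpret T: sigma_finite_measure "time_measure s" by (rule sigma_finite_time_measure)
  have "(\<lambda>(\<omega>, s). f s \<omega>) \<in> borel_measurable (M \<Otimes>\<^sub>M time_measure s)"
    using measurable_compose[OF measurable_pair_swap' continuous_process_measurable[OF c m]]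
    by (simp add: case_prod_unfold)
  then show ?thesis unfolding integral_time_measure[symmetric] by (rule T.borel_measurable_lebesgue_integral)
qed

context brownian_motion
begin

text \<open>The square of \<open>a = a 0 - V + Z\<close>, with \<open>V\<close> absolutely continuous and \<open>Z\<close> the stochastic
  integral, is expanded without Ito's formula: \<open>(a 0 - V)\<^sup>2\<close> by the fundamental theorem of calculus,
  \<open>Z\<^sup>2\<close> by the isometry, and the cross term \<open>E (V t Z t) = \<integral> E (d s Z t) ds = \<integral> E (d s Z s) ds\<close> by
  orthogonality of the increments.\<close>

theorem energy_component:
  fixes a d H :: "real \<Rightarrow> 'a \<Rightarrow> real"
  defines "V \<equiv> \<lambda>s \<omega>. LINT u:{0..s}|lborel. d u \<omega>"
  defines "Z \<equiv> \<lambda>s \<omega>. a s \<omega> - a 0 \<omega> + V s \<omega>"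
  assumes t: "0 \<le> t"
    and ac: "\<And>\<omega>. \<omega> \<in> space M \<Longrightarrow> continuous_on {0..} (\<lambda>s. a s \<omega>)"
    and dc: "\<And>\<omega>. \<omega> \<in> space M \<Longrightarrow> continuous_on {0..} (\<lambda>s. d s \<omega>)"
    and aF: "\<And>s. 0 \<le> s \<Longrightarrow> a s \<in> borel_measurable (Fil s)"
    and dF: "\<And>s. 0 \<le> s \<Longrightarrow> d s \<in> borel_measurable (Fil s)"
    and ito: "\<And>s. 0 \<le> s \<Longrightarrow> ito_lim s H (Z s)"
    and a0: "integrable M (\<lambda>\<omega>. (a 0 \<omega>)\<^sup>2)"
    and a2: "(\<integral>\<^sup>+\<omega>. qint t a \<omega> \<partial>M) < \<infinity>" and d2: "(\<integral>\<^sup>+\<omega>. qint t d \<omega> \<partial>M) < \<infinity>"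
    and H2: "(\<integral>\<^sup>+\<omega>. qint t H \<omega> \<partial>M) < \<infinity>"
  shows "integrable M (\<lambda>\<omega>. (a t \<omega>)\<^sup>2)"
    "integrable (time_measure t) (\<lambda>s. expectation (\<lambda>\<omega>. a s \<omega> * d s \<omega>))"
    "AE s in time_measure t. integrable M (\<lambda>\<omega>. a s \<omega> * d s \<omega>)"
    "expectation (\<lambda>\<omega>. (a t \<omega>)\<^sup>2) = expectation (\<lambda>\<omega>. (a 0 \<omega>)\<^sup>2) + enn2real (\<integral>\<^sup>+\<omega>. qint t H \<omega> \<partial>M)
      - 2 * (LINT s:{0..t}|lborel. expectation (\<lambda>\<omega>. a s \<omega> * d s \<omega>))"
proof -
  let ?T = "time_measure t"
  let ?P = "?T \<Otimes>\<^sub>M M"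
  have sfM: "sigma_finite_measure M" by unfold_locales
  interpret P: pair_sigma_finite ?T M
    using sfM sigma_finite_time_measure by (simp add: pair_sigma_finite_def)
  have finT: "finite_measure ?T"
    by (rule finite_measureI) (simp add: emeasure_restrict_space emeasure_lborel_Icc_eq)
  have aM: "a s \<in> borel_measurable M" and dM: "d s \<in> borel_measurable M" if "0 \<le> s" for s
    using aF[OF that] dF[OF that] measurable_Fil_M by auto
  have Vc: "continuous_on {0..} (\<lambda>s. V s \<omega>)" if "\<omega> \<in> space M" for \<omega>
    unfolding V_def by (rule time_integral_continuous[OF dc[OF that]])
  have VM: "V s \<in> borel_measurable M" for s
    unfolding V_def by (rule time_integral_measurable[OF dc dM])
  have ZM: "Z s \<in> borel_measurable M" if "0 \<le> s" for s using ito[OF that] unfolding ito_lim_def by blast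
  have aP: "(\<lambda>(s, \<omega>). a s \<omega>) \<in> borel_measurable ?P" by (rule continuous_process_measurable[OF ac aM])
  have dP: "(\<lambda>(s, \<omega>). d s \<omega>) \<in> borel_measurable ?P" by (rule continuous_process_measurable[OF dc dM])
  have VP: "(\<lambda>(s, \<omega>). V s \<omega>) \<in> borel_measurable ?P" by (rule continuous_process_measurable[OF Vc VM])
  \<comment> \<open>A square integrable random variable, viewed as a process constant in time, is
    square integrable on the product because the time interval has finite length.\<close>
  have const2: "integrable ?P (\<lambda>x. (f (snd x))\<^sup>2)" if f: "f \<in> borel_measurable M" "integrable M (\<lambda>\<omega>. (f \<omega>)\<^sup>2)" for f :: "'a \<Rightarrow> real"
  proof -
    have fm: "(\<lambda>x. f (snd x)) \<in> borel_measurable ?P" using f(1) by simp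
    have "(\<integral>\<^sup>+x. ennreal ((f (snd x))\<^sup>2) \<partial>?P) = (\<integral>\<^sup>+\<omega>. \<integral>\<^sup>+s. ennreal ((f \<omega>)\<^sup>2) \<partial>?T \<partial>M)"
      using P.nn_integral_snd[of "\<lambda>x. ennreal ((f (snd x))\<^sup>2)"] fm by simp
    also have "\<dots> = (\<integral>\<^sup>+\<omega>. ennreal ((f \<omega>)\<^sup>2) \<partial>M) * emeasure ?T (space ?T)"
      using f(1) by (simp add: nn_integral_multc)
    also have "\<dots> < \<infinity>" using f finite_measure.finite_emeasure_space[OF finT]
      by (simp add: ennreal_mult_eq_top_iff nn_integral_sq_eq less_top[symmetric])
    finally show ?thesis using fm by (simp add: integrable_sq_iff)
  qed
  have P2: "integrable ?P (\<lambda>x. (K (fst x) (snd x))\<^sup>2)"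
    if "(\<lambda>(s, \<omega>). K s \<omega>) \<in> borel_measurable ?P" "(\<integral>\<^sup>+\<omega>. qint t K \<omega> \<partial>M) < \<infinity>" for K
    using that(2) unfolding nn_integral_qint[OF that(1) sfM]
    using integrable_sq_iff[OF that(1)] by (simp add: case_prod_unfold)
  have ia2: "integrable ?P (\<lambda>x. (a (fst x) (snd x))\<^sup>2)" by (rule P2[OF aP a2])
  have id2: "integrable ?P (\<lambda>x. (d (fst x) (snd x))\<^sup>2)" by (rule P2[OF dP d2])
  define Q where "Q = (\<lambda>\<omega>. LINT u:{0..t}|lborel. (d u \<omega>)\<^sup>2)"
  have d2c: "continuous_on {0..} (\<lambda>s. (d s \<omega>)\<^sup>2)" if "\<omega> \<in> space M" for \<omega>
    using dc[OF that] by (intro continuous_intros)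
  have QM: "Q \<in> borel_measurable M" unfolding Q_def
    by (rule time_integral_measurable[OF d2c]) (use dM in auto)
  have Qq: "qint t d \<omega> = ennreal (Q \<omega>)" if "\<omega> \<in> space M" for \<omega>
    unfolding qint_eq Q_def integral_time_measure[symmetric]
    by (rule nn_integral_eq_integral[OF continuous_time_integrable[OF d2c[OF that]]]) simp
  have Q0: "0 \<le> Q \<omega>" for \<omega> unfolding Q_def integral_time_measure[symmetric] by simp
  have iQ: "integrable M Q"
  proof (rule integrableI_nonneg)
    have "(\<integral>\<^sup>+\<omega>. ennreal (Q \<omega>) \<partial>M) = (\<integral>\<^sup>+\<omega>. qint t d \<omega> \<partial>M)" by (rule nn_integral_cong) (simp add: Qq)
    then show "(\<integral>\<^sup>+\<omega>. ennreal (Q \<omega>) \<partial>M) < \<infinity>" using d2 by simp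
  qed (use QM Q0 in auto)
  \<comment> \<open>The bound t * Q is the same for all times up to t, which makes V square
    integrable at each such time and on the product.\<close>
  have VQ: "(V s \<omega>)\<^sup>2 \<le> t * Q \<omega>" if "0 \<le> s" "s \<le> t" "\<omega> \<in> space M" for s \<omega>
  proof -
    have "(V s \<omega>)\<^sup>2 \<le> s * (LINT u:{0..s}|lborel. (d u \<omega>)\<^sup>2)"
      unfolding V_def by (rule time_integral_sq_le[OF dc[OF that(3)] that(1)])
    also have "(LINT u:{0..s}|lborel. (d u \<omega>)\<^sup>2) \<le> Q \<omega>"
      unfolding Q_def time_integral_eq[OF d2c[OF that(3)]]
      using that d2c[OF that(3)] by (intro integral_subset_le integrable_continuous_real)
       (auto elim: continuous_on_subset)
    finally show ?thesis using that Q0[of \<omega>] by (meson mult_mono order_trans mult_left_mono mult_right_mono)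
  qed
  have iV2: "integrable M (\<lambda>\<omega>. (V s \<omega>)\<^sup>2)" if "0 \<le> s" "s \<le> t" for s
    by (rule Bochner_Integration.integrable_bound[where f="\<lambda>\<omega>. t * Q \<omega>"])
      (use iQ VM VQ[OF that] in \<open>auto intro!: AE_I2 order_trans[OF _ abs_ge_self]\<close>)
  have iV2P: "integrable ?P (\<lambda>x. (V (fst x) (snd x))\<^sup>2)"
  proof (rule Bochner_Integration.integrable_bound[where f="\<lambda>x. t * Q (snd x)"])
    have "integrable ?P (\<lambda>x. (sqrt (Q (snd x)))\<^sup>2)"
      by (rule const2) (use QM iQ Q0 in \<open>auto simp: real_sqrt_pow2\<close>)
    then show "integrable ?P (\<lambda>x. t * Q (snd x))" using Q0 by (simp add: real_sqrt_pow2)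
    show "(\<lambda>x. (V (fst x) (snd x))\<^sup>2) \<in> borel_measurable ?P" using VP by (simp add: case_prod_unfold)
    show "AE x in ?P. norm ((V (fst x) (snd x))\<^sup>2) \<le> norm (t * Q (snd x))"
      using VQ by (intro AE_I2) (auto simp: space_pair_measure intro: order_trans[OF _ abs_ge_self])
  qed
  have fZ: "(\<integral>\<^sup>+\<omega>. ennreal ((Z t \<omega>)\<^sup>2) \<partial>M) = (\<integral>\<^sup>+\<omega>. qint t H \<omega> \<partial>M)"
    by (rule ito_isometry[OF ito[OF t] t H2])
  have iZ: "integrable M (\<lambda>\<omega>. (Z t \<omega>)\<^sup>2)" using H2 unfolding fZ[symmetric] using ZM[OF t] by (simp add: integrable_sq_iff)
  have eZ: "expectation (\<lambda>\<omega>. (Z t \<omega>)\<^sup>2) = enn2real (\<integral>\<^sup>+\<omega>. qint t H \<omega> \<partial>M)"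
    unfolding fZ[symmetric] nn_integral_sq_eq[OF iZ] by simp
  define B where "B = (\<lambda>s \<omega>. a 0 \<omega> - V s \<omega>)"
  have BM: "B s \<in> borel_measurable M" for s unfolding B_def using aM[of 0] VM by simp
  have iB: "integrable M (\<lambda>\<omega>. (B t \<omega>)\<^sup>2)"
    unfolding B_def by (rule sq_integrable_diff[OF aM VM a0 iV2[OF t]]) auto
  have aB: "a s \<omega> = B s \<omega> + Z s \<omega>" for s \<omega> unfolding B_def Z_def by simp
  have iBZ: "integrable M (\<lambda>\<omega>. B t \<omega> * Z t \<omega>)" by (rule sq_integrable_mult[OF BM ZM[OF t] iB iZ])
  have sqa: "(a t \<omega>)\<^sup>2 = (B t \<omega>)\<^sup>2 + 2 * (B t \<omega> * Z t \<omega>) + (Z t \<omega>)\<^sup>2" for \<omega>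
    unfolding aB by (simp add: power2_eq_square algebra_simps)
  show "integrable M (\<lambda>\<omega>. (a t \<omega>)\<^sup>2)" unfolding sqa using iB iBZ iZ by simp
  have e1: "expectation (\<lambda>\<omega>. (a t \<omega>)\<^sup>2) = expectation (\<lambda>\<omega>. (B t \<omega>)\<^sup>2) + 2 * expectation (\<lambda>\<omega>. B t \<omega> * Z t \<omega>) + enn2real (\<integral>\<^sup>+\<omega>. qint t H \<omega> \<partial>M)"
    unfolding sqa eZ[symmetric] using iB iBZ iZ by simp

  have dP': "(\<lambda>x. d (fst x) (snd x)) \<in> borel_measurable ?P" and aP': "(\<lambda>x. a (fst x) (snd x)) \<in> borel_measurable ?P"
    and VP': "(\<lambda>x. V (fst x) (snd x)) \<in> borel_measurable ?P"
    using dP aP VP by (simp_all add: case_prod_unfold)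
  have a0P: "(\<lambda>x. a 0 (snd x)) \<in> borel_measurable ?P" using aM[of 0] by simp
  have ZtP: "(\<lambda>x. Z t (snd x)) \<in> borel_measurable ?P" using ZM[OF t] by simp
  have BP: "(\<lambda>x. B (fst x) (snd x)) \<in> borel_measurable ?P" unfolding B_def using a0P VP' by simp
  have iB2P: "integrable ?P (\<lambda>x. (B (fst x) (snd x))\<^sup>2)"
    unfolding B_def by (rule sq_integrable_diff[OF a0P VP' const2[OF aM a0] iV2P]) simp
  \<comment> \<open>The stochastic integral is given at each time separately, up to null sets. Joint
    measurability and square integrability are therefore read off from Z = a - B.\<close>
  have ZP: "(\<lambda>x. Z (fst x) (snd x)) \<in> borel_measurable ?P"
    and iZ2P: "integrable ?P (\<lambda>x. (Z (fst x) (snd x))\<^sup>2)"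
    using sq_integrable_diff[OF aP' BP ia2 iB2P] borel_measurable_diff[OF aP' BP] by (simp_all add: aB)
  have idB: "integrable ?P (\<lambda>x. d (fst x) (snd x) * B (fst x) (snd x))"
    by (rule sq_integrable_mult[OF dP' BP id2 iB2P])
  have idZ: "integrable ?P (\<lambda>x. d (fst x) (snd x) * Z (fst x) (snd x))"
    by (rule sq_integrable_mult[OF dP' ZP id2 iZ2P])
  have idZt: "integrable ?P (\<lambda>x. d (fst x) (snd x) * Z t (snd x))"
    by (rule sq_integrable_mult[OF dP' ZtP id2 const2[OF ZM[OF t] iZ]])
  have iad: "integrable ?P (\<lambda>x. a (fst x) (snd x) * d (fst x) (snd x))"
    by (rule sq_integrable_mult[OF aP' dP' ia2 id2])
  have ftc: "(B t \<omega>)\<^sup>2 = (a 0 \<omega>)\<^sup>2 - 2 * (\<integral>s. d s \<omega> * B s \<omega> \<partial>?T)" if w: "\<omega> \<in> space M" for \<omega>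
  proof -
    have Bc: "continuous_on {0..} (\<lambda>s. B s \<omega>)" unfolding B_def by (intro continuous_intros Vc[OF w])
    have V0: "V 0 \<omega> = 0" unfolding V_def time_integral_eq[OF dc[OF w]] by simp
    have "(LINT s:{0..t}|lborel. - 2 * (d s \<omega> * B s \<omega>)) = (B t \<omega>)\<^sup>2 - (B 0 \<omega>)\<^sup>2"
      unfolding set_lebesgue_integral_def
    proof (rule integral_FTC_atLeastAtMost[OF t])
      show "((\<lambda>s. (B s \<omega>)\<^sup>2) has_vector_derivative - 2 * (d s \<omega> * B s \<omega>)) (at s within {0..t})" if "0 \<le> s" "s \<le> t" for s
        unfolding has_real_derivative_iff_has_vector_derivative[symmetric] B_def V_def
        by (auto intro!: derivative_eq_intros time_integral_deriv[OF dc[OF w] that])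
      show "continuous_on {0..t} (\<lambda>s. - 2 * (d s \<omega> * B s \<omega>))"
        by (rule continuous_on_subset[of "{0..}"]) (auto intro!: continuous_intros dc[OF w] Bc)
    qed
    moreover have "(LINT s:{0..t}|lborel. - 2 * (d s \<omega> * B s \<omega>)) = - 2 * (LINT s:{0..t}|lborel. d s \<omega> * B s \<omega>)"
      by (rule set_integral_mult_right)
    moreover have "B 0 \<omega> = a 0 \<omega>" unfolding B_def V0 by simp
    ultimately show ?thesis unfolding integral_time_measure by simp
  qed
  have sndI: "integrable M (\<lambda>\<omega>. \<integral>s. f s \<omega> \<partial>?T)" "expectation (\<lambda>\<omega>. \<integral>s. f s \<omega> \<partial>?T) = (\<integral>x. f (fst x) (snd x) \<partial>?P)"
    if "integrable ?P (\<lambda>x. f (fst x) (snd x))" for f :: "real \<Rightarrow> 'a \<Rightarrow> real"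
    using P.integrable_snd[of f] P.integral_snd[of f] that by (auto simp: case_prod_unfold)
  have fstI: "(\<integral>s. expectation (f s) \<partial>?T) = (\<integral>x. f (fst x) (snd x) \<partial>?P)" "integrable ?T (\<lambda>s. expectation (f s))"
    "AE s in ?T. integrable M (f s)"
    if "integrable ?P (\<lambda>x. f (fst x) (snd x))" for f :: "real \<Rightarrow> 'a \<Rightarrow> real"
    using P.integral_fst'[OF that] P.integrable_fst'[OF that] P.AE_integrable_fst'[OF that] by auto
  have eB: "expectation (\<lambda>\<omega>. (B t \<omega>)\<^sup>2) = expectation (\<lambda>\<omega>. (a 0 \<omega>)\<^sup>2) - 2 * (\<integral>x. d (fst x) (snd x) * B (fst x) (snd x) \<partial>?P)"
  proof -
    have "expectation (\<lambda>\<omega>. (B t \<omega>)\<^sup>2) = expectation (\<lambda>\<omega>. (a 0 \<omega>)\<^sup>2 - 2 * (\<integral>s. d s \<omega> * B s \<omega> \<partial>?T))"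
      by (rule Bochner_Integration.integral_cong[OF refl ftc])
    also have "\<dots> = expectation (\<lambda>\<omega>. (a 0 \<omega>)\<^sup>2) - 2 * expectation (\<lambda>\<omega>. \<integral>s. d s \<omega> * B s \<omega> \<partial>?T)"
      using a0 sndI(1)[of "\<lambda>s \<omega>. d s \<omega> * B s \<omega>", OF idB] by simp
    finally show ?thesis using sndI(2)[of "\<lambda>s \<omega>. d s \<omega> * B s \<omega>", OF idB] by simp
  qed
  have "expectation (\<lambda>\<omega>. V t \<omega> * Z t \<omega>) = expectation (\<lambda>\<omega>. \<integral>s. d s \<omega> * Z t \<omega> \<partial>?T)"
    unfolding V_def integral_time_measure[symmetric]
    by (rule Bochner_Integration.integral_cong) (auto simp: integral_time_measure[symmetric])
  also have "\<dots> = (\<integral>s. expectation (\<lambda>\<omega>. d s \<omega> * Z t \<omega>) \<partial>?T)"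
    using sndI(2)[of "\<lambda>s \<omega>. d s \<omega> * Z t \<omega>", OF idZt] fstI(1)[of "\<lambda>s \<omega>. d s \<omega> * Z t \<omega>", OF idZt] by simp
  also have "\<dots> = (\<integral>s. expectation (\<lambda>\<omega>. d s \<omega> * Z s \<omega>) \<partial>?T)"
  proof (rule Bochner_Integration.integral_cong_AE)
    \<comment> \<open>For almost every s the value d s is square integrable, hence admissible as the
      earlier random variable in \<open>ito_orthogonal\<close>; this replaces Z t by Z s.\<close>
    show "AE s in ?T. expectation (\<lambda>\<omega>. d s \<omega> * Z t \<omega>) = expectation (\<lambda>\<omega>. d s \<omega> * Z s \<omega>)"
      using fstI(3)[of "\<lambda>s \<omega>. (d s \<omega>)\<^sup>2", OF id2] fstI(3)[of "\<lambda>s \<omega>. d s \<omega> * Z t \<omega>", OF idZt]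
        fstI(3)[of "\<lambda>s \<omega>. d s \<omega> * Z s \<omega>", OF idZ] AE_space
    proof eventually_elim
      case (elim s)
      then have s: "0 \<le> s" "s \<le> t" by (auto)
      have "expectation (\<lambda>\<omega>. d s \<omega> * (Z t \<omega> - Z s \<omega>)) = 0"
        by (rule ito_orthogonal[OF ito[OF t] ito[OF s(1)] s H2 dF[OF s(1)] elim(1)])
      then show ?case using elim by (simp add: right_diff_distrib)
    qed
  qed (use fstI(2)[of "\<lambda>s \<omega>. d s \<omega> * Z t \<omega>", OF idZt] fstI(2)[of "\<lambda>s \<omega>. d s \<omega> * Z s \<omega>", OF idZ] in auto)
  also have "\<dots> = (\<integral>x. d (fst x) (snd x) * Z (fst x) (snd x) \<partial>?P)"
    by (rule fstI(1)[of "\<lambda>s \<omega>. d s \<omega> * Z s \<omega>", OF idZ])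
  finally have eVZ: "expectation (\<lambda>\<omega>. V t \<omega> * Z t \<omega>) = (\<integral>x. d (fst x) (snd x) * Z (fst x) (snd x) \<partial>?P)" .
  have Z0: "Z 0 \<omega> = 0" if "\<omega> \<in> space M" for \<omega>
    unfolding Z_def V_def time_integral_eq[OF dc[OF that]] by simp
  \<comment> \<open>Orthogonality between the times 0 and t removes the initial value, because Z
    vanishes at time 0.\<close>
  have "expectation (\<lambda>\<omega>. a 0 \<omega> * (Z t \<omega> - Z 0 \<omega>)) = 0"
    by (rule ito_orthogonal[OF ito[OF t] ito _ t H2 aF a0]) auto
  moreover have "expectation (\<lambda>\<omega>. a 0 \<omega> * (Z t \<omega> - Z 0 \<omega>)) = expectation (\<lambda>\<omega>. a 0 \<omega> * Z t \<omega>)"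
    by (rule Bochner_Integration.integral_cong) (simp_all add: Z0)
  ultimately have ea0: "expectation (\<lambda>\<omega>. a 0 \<omega> * Z t \<omega>) = 0" by simp
  have "expectation (\<lambda>\<omega>. B t \<omega> * Z t \<omega>) = expectation (\<lambda>\<omega>. a 0 \<omega> * Z t \<omega> - V t \<omega> * Z t \<omega>)"
    unfolding B_def by (simp add: left_diff_distrib)
  also have "\<dots> = - (\<integral>x. d (fst x) (snd x) * Z (fst x) (snd x) \<partial>?P)"
    using sq_integrable_mult[OF aM ZM[OF t] a0 iZ] sq_integrable_mult[OF VM ZM[OF t] iV2[OF t] iZ] ea0 eVZ by simp
  finally have eBZ: "expectation (\<lambda>\<omega>. B t \<omega> * Z t \<omega>) = - (\<integral>x. d (fst x) (snd x) * Z (fst x) (snd x) \<partial>?P)" .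
  have "(\<integral>x. a (fst x) (snd x) * d (fst x) (snd x) \<partial>?P) =
    (\<integral>x. d (fst x) (snd x) * B (fst x) (snd x) + d (fst x) (snd x) * Z (fst x) (snd x) \<partial>?P)"
    by (simp add: aB algebra_simps)
  also have "\<dots> = (\<integral>x. d (fst x) (snd x) * B (fst x) (snd x) \<partial>?P) + (\<integral>x. d (fst x) (snd x) * Z (fst x) (snd x) \<partial>?P)"
    using idB idZ by simp
  finally have ead: "(\<integral>x. a (fst x) (snd x) * d (fst x) (snd x) \<partial>?P) =
    (\<integral>x. d (fst x) (snd x) * B (fst x) (snd x) \<partial>?P) + (\<integral>x. d (fst x) (snd x) * Z (fst x) (snd x) \<partial>?P)" .
  show "integrable (time_measure t) (\<lambda>s. expectation (\<lambda>\<omega>. a s \<omega> * d s \<omega>))"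
    "AE s in time_measure t. integrable M (\<lambda>\<omega>. a s \<omega> * d s \<omega>)"
    using fstI(2,3)[of "\<lambda>s \<omega>. a s \<omega> * d s \<omega>", OF iad] by auto
  show "expectation (\<lambda>\<omega>. (a t \<omega>)\<^sup>2) = expectation (\<lambda>\<omega>. (a 0 \<omega>)\<^sup>2) + enn2real (\<integral>\<^sup>+\<omega>. qint t H \<omega> \<partial>M)
      - 2 * (LINT s:{0..t}|lborel. expectation (\<lambda>\<omega>. a s \<omega> * d s \<omega>))"
    unfolding integral_time_measure[symmetric] fstI(1)[of "\<lambda>s \<omega>. a s \<omega> * d s \<omega>", OF iad] ead e1 eB eBZ by simp
qed

end

text \<open>A Gronwall inequality that needs no regularity of \<open>G\<close>: the supremum \<open>S\<close> of
  \<open>exp (- 2 K1 s) G s\<close> satisfies \<open>S \<le> K0 T + S / 2\<close>.\<close>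

lemma gronwall_bounded:
  fixes G :: "real \<Rightarrow> real"
  assumes T: "0 \<le> T" and K0: "0 \<le> K0" and K1: "0 < K1"
    and G0: "\<And>s. 0 \<le> s \<Longrightarrow> s \<le> T \<Longrightarrow> 0 \<le> G s" and GN: "\<And>s. 0 \<le> s \<Longrightarrow> s \<le> T \<Longrightarrow> G s \<le> N"
    and step: "\<And>t. 0 \<le> t \<Longrightarrow> t \<le> T \<Longrightarrow> ennreal (G t) \<le> (\<integral>\<^sup>+s\<in>{0..t}. ennreal (K0 + K1 * G s) \<partial>lborel)"
  shows "G T \<le> 2 * K0 * T * exp (2 * K1 * T)"
proof -
  define h where "h = (\<lambda>s. exp (- (2 * K1 * s)) * G s)"
  define S where "S = (SUP s\<in>{0..T}. h s)"
  have "h s \<le> N" if "s \<in> {0..T}" for s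
  proof -
    have "h s \<le> 1 * G s" unfolding h_def using that K1 G0 by (intro mult_right_mono) auto
    then show ?thesis using GN that by force
  qed
  \<comment> \<open>The bound N makes the supremum S finite, so that S / 2 can be subtracted in the
    end; it does not enter the resulting constant.\<close>
  then have bdd: "bdd_above (h ` {0..T})" by (intro bdd_aboveI2)
  have hS: "h s \<le> S" if "s \<in> {0..T}" for s unfolding S_def by (rule cSUP_upper[OF that bdd])
  have S0: "0 \<le> S" using hS[of 0] G0[of 0] T unfolding h_def by auto
  have GS: "G s \<le> S * exp (2 * K1 * s)" if "s \<in> {0..T}" for s
  proof -
    have "G s = h s * exp (2 * K1 * s)" unfolding h_def by (simp add: exp_minus)
    then show ?thesis using hS[OF that] by simp
  qed
  have "h t \<le> K0 * T + S / 2" if t: "t \<in> {0..T}" for t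
  proof -
    \<comment> \<open>F is a primitive of f. Integrating K1 times the weight exp(2 K1 s) yields one
      half of the weight, and this factor 1/2 is what closes the estimate.\<close>
    define F where "F = (\<lambda>s. K0 * s + S / 2 * exp (2 * K1 * s))"
    define f where "f = (\<lambda>s. K0 + K1 * (S * exp (2 * K1 * s)))"
    have f0: "0 \<le> f s" for s unfolding f_def using K0 K1 S0 by simp
    have "ennreal (G t) \<le> (\<integral>\<^sup>+s\<in>{0..t}. ennreal (K0 + K1 * G s) \<partial>lborel)" using step t by auto
    also have "\<dots> \<le> (\<integral>\<^sup>+s\<in>{0..t}. ennreal (f s) \<partial>lborel)"
      by (rule nn_integral_mono) (use GS t K1 in \<open>auto simp: indicator_def f_def intro!: ennreal_leI\<close>)
    also have "\<dots> = ennreal (F t - F 0)"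
    proof (rule nn_integral_FTC_Icc)
      show "(F has_real_derivative f s) (at s)" for s
        unfolding F_def f_def by (auto intro!: derivative_eq_intros)
      show "f \<in> borel_measurable borel" unfolding f_def by measurable
    qed (use f0 t in auto)
    finally have "G t \<le> F t - F 0"
    proof (subst (asm) ennreal_le_iff)
      show "0 \<le> F t - F 0" proof -
        have "S / 2 * 1 \<le> S / 2 * exp (2 * K1 * t)" using S0 K1 t by (intro mult_left_mono) auto
        moreover have "0 \<le> K0 * t" using K0 t by simp
        ultimately show ?thesis unfolding F_def by simp
      qed
    qed
    also have "\<dots> \<le> K0 * T + S / 2 * exp (2 * K1 * t)"
      unfolding F_def using mult_left_mono[of t T K0] K0 S0 t by simp
    finally have Gt: "G t \<le> K0 * T + S / 2 * exp (2 * K1 * t)" .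
    have "h t \<le> exp (- (2 * K1 * t)) * (K0 * T + S / 2 * exp (2 * K1 * t))"
      unfolding h_def by (rule mult_left_mono[OF Gt]) simp
    also have "\<dots> = exp (- (2 * K1 * t)) * (K0 * T) + S / 2" by (simp add: distrib_left exp_minus)
    also have "\<dots> \<le> 1 * (K0 * T) + S / 2"
      using K0 K1 T t by (intro add_right_mono mult_right_mono) auto
    finally show ?thesis by simp
  qed
  then have "S \<le> K0 * T + S / 2" unfolding S_def using T by (intro cSUP_least) auto
  then have "S \<le> 2 * K0 * T" by simp
  have "G T \<le> S * exp (2 * K1 * T)" using GS T by simp
  also have "\<dots> \<le> 2 * K0 * T * exp (2 * K1 * T)" using \<open>S \<le> 2 * K0 * T\<close> by simp
  finally show ?thesis .
qed

section \<open>Moment bounds for linear systems\<close>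

lemma sq_add3_le: "(a + b + c)\<^sup>2 \<le> 3 * a\<^sup>2 + 3 * b\<^sup>2 + 3 * c\<^sup>2" for a b c :: real
  using zero_le_power2[of "a - b"] zero_le_power2[of "b - c"] zero_le_power2[of "a - c"]
  by (simp add: power2_eq_square algebra_simps)

text \<open>No moment of a is assumed; \<open>growth\<close> is the hypothesis that produces all of
  them. Each equation is required time by time, with its own exceptional null set.\<close>

locale linear_sde = brownian_motion M Fil W
  for M :: "'a measure" and Fil :: "real \<Rightarrow> 'a measure" and W +
  fixes J :: "'i set" and a H :: "'i \<Rightarrow> real \<Rightarrow> 'a \<Rightarrow> real" and A :: "'i \<Rightarrow> 'i \<Rightarrow> real" and c :: "'i \<Rightarrow> real"
    and C :: real
  assumes fin: "finite J"
    and a_cont: "\<And>j \<omega>. j \<in> J \<Longrightarrow> \<omega> \<in> space M \<Longrightarrow> continuous_on {0..} (\<lambda>s. a j s \<omega>)"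
    and a_adapted: "\<And>j s. j \<in> J \<Longrightarrow> 0 \<le> s \<Longrightarrow> a j s \<in> borel_measurable (Fil s)"
    and a_init: "\<And>j. j \<in> J \<Longrightarrow> AE \<omega> in M. a j 0 \<omega> = c j"
    and sde: "\<And>j t. j \<in> J \<Longrightarrow> 0 \<le> t \<Longrightarrow> has_ito_integral M Fil W (H j) t
      (\<lambda>\<omega>. a j t \<omega> - a j 0 \<omega> + (LINT s:{0..t}|lborel. \<Sum>l\<in>J. A j l * a l s \<omega>))"
    and C: "0 \<le> C"
    and growth: "\<And>s \<omega>. 0 \<le> s \<Longrightarrow> \<omega> \<in> space M \<Longrightarrow> (\<Sum>j\<in>J. (H j s \<omega>)\<^sup>2) \<le> C * (1 + (\<Sum>j\<in>J. (a j s \<omega>)\<^sup>2))"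
begin

definition d :: "'i \<Rightarrow> real \<Rightarrow> 'a \<Rightarrow> real" where "d j s \<omega> = (\<Sum>l\<in>J. A j l * a l s \<omega>)"
definition V :: "'i \<Rightarrow> real \<Rightarrow> 'a \<Rightarrow> real" where "V j s \<omega> = (LINT u:{0..s}|lborel. d j u \<omega>)"
definition Z :: "'i \<Rightarrow> real \<Rightarrow> 'a \<Rightarrow> real" where "Z j s \<omega> = a j s \<omega> - a j 0 \<omega> + V j s \<omega>"
text \<open>The density r dominates (a j)^2 and, up to the constants C and B, the squares of noise
  and drift. Its integral R is a common measure of size for all of them and is used as the level of
  truncation.\<close>

definition r :: "real \<Rightarrow> 'a \<Rightarrow> real" where "r s \<omega> = 1 + (\<Sum>j\<in>J. (a j s \<omega>)\<^sup>2)"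
definition R :: "real \<Rightarrow> 'a \<Rightarrow> real" where "R s \<omega> = (LINT u:{0..s}|lborel. r u \<omega>)"
text \<open>The squared Frobenius norm of A, which bounds every drift component by
  Cauchy-Schwarz.\<close>

definition B :: real where "B = (\<Sum>j\<in>J. \<Sum>l\<in>J. (A j l)\<^sup>2)"

lemma B_nonneg: "0 \<le> B" unfolding B_def by (intro sum_nonneg) auto

lemma d_cont: "j \<in> J \<Longrightarrow> \<omega> \<in> space M \<Longrightarrow> continuous_on {0..} (\<lambda>s. d j s \<omega>)"
  unfolding d_def by (intro continuous_intros a_cont)

lemma d_adapted: "j \<in> J \<Longrightarrow> 0 \<le> s \<Longrightarrow> d j s \<in> borel_measurable (Fil s)"
  unfolding d_def[abs_def] by (intro borel_measurable_sum borel_measurable_times borel_measurable_const a_adapted)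

lemma r_cont: "\<omega> \<in> space M \<Longrightarrow> continuous_on {0..} (\<lambda>s. r s \<omega>)"
  unfolding r_def by (intro continuous_intros a_cont)

lemma a_meas: "j \<in> J \<Longrightarrow> 0 \<le> s \<Longrightarrow> a j s \<in> borel_measurable M"
  using a_adapted measurable_Fil_M by blast

lemma r_meas: "0 \<le> s \<Longrightarrow> r s \<in> borel_measurable M"
  unfolding r_def[abs_def]
  by (intro borel_measurable_add borel_measurable_sum borel_measurable_power borel_measurable_const a_meas)

lemma r_ge_1: "1 \<le> r s \<omega>" unfolding r_def by (simp add: sum_nonneg)

lemma R_cont: "\<omega> \<in> space M \<Longrightarrow> continuous_on {0..} (\<lambda>s. R s \<omega>)"
  unfolding R_def by (intro time_integral_continuous r_cont)

lemma R_meas: "R s \<in> borel_measurable M"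
  unfolding R_def[abs_def] by (intro time_integral_measurable r_cont r_meas)

lemma R_nn: "\<omega> \<in> space M \<Longrightarrow> ennreal (R s \<omega>) = (\<integral>\<^sup>+u. ennreal (r u \<omega>) \<partial>time_measure s)"
  unfolding R_def integral_time_measure[symmetric] using r_ge_1
  by (intro nn_integral_eq_integral[symmetric] continuous_time_integrable r_cont) (auto intro!: AE_I2 intro: order_trans[of 0 1])

lemma R_nonneg: "0 \<le> R s \<omega>"
  unfolding R_def integral_time_measure[symmetric] using r_ge_1
  by (intro Bochner_Integration.integral_nonneg) (auto intro: order_trans[of 0 1])

lemma R_mono:
  assumes "\<omega> \<in> space M" "0 \<le> s" "s \<le> t" shows "R s \<omega> \<le> R t \<omega>"
proof -
  have c: "continuous_on {0..t} (\<lambda>s. r s \<omega>)" using r_cont[OF assms(1)] continuous_on_subset by fastforce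
  show ?thesis unfolding R_def time_integral_eq[OF r_cont[OF assms(1)]]
    by (rule integral_subset_le)
     (use assms c r_ge_1 in \<open>auto intro!: integrable_continuous_real intro: continuous_on_subset order_trans[of 0 1]\<close>)
qed

lemma qint_le_R:
  assumes w: "\<omega> \<in> space M" and K: "0 \<le> K" and le: "\<And>u. 0 \<le> u \<Longrightarrow> (X u \<omega>)\<^sup>2 \<le> K * r u \<omega>"
  shows "qint s X \<omega> \<le> ennreal (K * R s \<omega>)"
proof -
  have "qint s X \<omega> \<le> (\<integral>\<^sup>+u. ennreal K * ennreal (r u \<omega>) \<partial>time_measure s)"
    unfolding qint_eq using le K r_ge_1
    by (intro nn_integral_mono) (auto simp: ennreal_mult[symmetric] order_trans[of 0 1] intro!: ennreal_leI)
  also have "\<dots> = ennreal K * (\<integral>\<^sup>+u. ennreal (r u \<omega>) \<partial>time_measure s)"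
    using continuous_time_integrable[OF r_cont[OF w], of s] by (intro nn_integral_cmult) auto
  also have "\<dots> = ennreal (K * R s \<omega>)" unfolding R_nn[OF w, symmetric] using K R_nonneg by (simp add: ennreal_mult)
  finally show ?thesis .
qed

lemma a_sq_le: "j \<in> J \<Longrightarrow> (a j u \<omega>)\<^sup>2 \<le> r u \<omega>"
  unfolding r_def using member_le_sum[of j J "\<lambda>j. (a j u \<omega>)\<^sup>2"] fin by simp

lemma d_sq_le:
  assumes "j \<in> J" shows "(d j u \<omega>)\<^sup>2 \<le> B * r u \<omega>"
proof -
  have "(d j u \<omega>)\<^sup>2 \<le> (\<Sum>l\<in>J. (A j l)\<^sup>2) * (\<Sum>l\<in>J. (a l u \<omega>)\<^sup>2)"
    unfolding d_def by (rule Cauchy_Schwarz_ineq_sum)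
  also have "\<dots> \<le> B * r u \<omega>"
    unfolding B_def r_def
  proof (rule mult_mono)
    show "(\<Sum>l\<in>J. (A j l)\<^sup>2) \<le> (\<Sum>j\<in>J. \<Sum>l\<in>J. (A j l)\<^sup>2)"
      by (rule member_le_sum[OF assms _ fin]) (simp add: sum_nonneg)
  qed (auto intro!: sum_nonneg)
  finally show ?thesis .
qed

lemma H_sq_le:
  assumes "j \<in> J" "0 \<le> u" "\<omega> \<in> space M" shows "(H j u \<omega>)\<^sup>2 \<le> C * r u \<omega>"
  using growth[OF assms(2,3)] member_le_sum[of j J "\<lambda>j. (H j u \<omega>)\<^sup>2"] fin assms(1) unfolding r_def by auto

lemma ito_Z: "j \<in> J \<Longrightarrow> 0 \<le> t \<Longrightarrow> ito_lim t (H j) (Z j t)"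
  using has_ito_integral_imp_ito_lim[OF sde] unfolding Z_def[abs_def] V_def d_def by blast

lemma V_sq_le:
  assumes j: "j \<in> J" and w: "\<omega> \<in> space M" and s: "0 \<le> s"
  shows "(V j s \<omega>)\<^sup>2 \<le> s * (B * R s \<omega>)"
proof -
  have "(V j s \<omega>)\<^sup>2 \<le> s * (LINT u:{0..s}|lborel. (d j u \<omega>)\<^sup>2)"
    unfolding V_def by (rule time_integral_sq_le[OF d_cont[OF j w] s])
  also have "(LINT u:{0..s}|lborel. (d j u \<omega>)\<^sup>2) \<le> (LINT u:{0..s}|lborel. B * r u \<omega>)"
    unfolding integral_time_measure[symmetric]
    by (intro integral_mono continuous_time_integrable continuous_intros d_cont[OF j w] r_cont[OF w] d_sq_le[OF j])
  also have "\<dots> = B * R s \<omega>" unfolding R_def by simp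
  finally show ?thesis using s by (simp add: mult_left_mono)
qed

text \<open>Truncation at the level \<open>N\<close> of \<open>R = \<integral> (1 + \<Sum> (a j)\<^sup>2)\<close> makes all expectations finite, and the
  resulting Gronwall bound does not depend on \<open>N\<close>; this replaces localisation by stopping times.\<close>

lemma min_R_le:
  assumes w: "\<omega> \<in> space M" and t: "0 \<le> t" and N: "0 \<le> N"
  shows "ennreal (min N (R t \<omega>)) \<le> (\<integral>\<^sup>+s. indicator {s. R s \<omega> \<le> N} s * ennreal (r s \<omega>) \<partial>time_measure t)"
proof -
  have R0: "R 0 \<omega> = 0" unfolding R_def time_integral_eq[OF r_cont[OF w]] by simp
  \<comment> \<open>u is a time at which the increasing path of R reaches min N (R t); it acts as a
    stopping time for the single path and exists by the intermediate value theorem.\<close>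
  obtain u where u: "0 \<le> u" "u \<le> t" "R u \<omega> = min N (R t \<omega>)"
    using IVT'[of "\<lambda>s. R s \<omega>" 0 "min N (R t \<omega>)" t] R0 R_nonneg[of t \<omega>] N t
      continuous_on_subset[OF R_cont[OF w], of "{0..t}"] by auto
  have "ennreal (min N (R t \<omega>)) = (\<integral>\<^sup>+s\<in>{0..u}. ennreal (r s \<omega>) \<partial>lborel)"
    unfolding u(3)[symmetric] R_nn[OF w] by (rule nn_integral_restrict_space) simp
  also have "\<dots> \<le> (\<integral>\<^sup>+s\<in>{0..t}. indicator {s. R s \<omega> \<le> N} s * ennreal (r s \<omega>) \<partial>lborel)"
  proof (rule nn_integral_mono)
    fix s
    show "ennreal (r s \<omega>) * indicator {0..u} s \<le> indicator {s. R s \<omega> \<le> N} s * ennreal (r s \<omega>) * indicator {0..t} s"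
    proof (cases "s \<in> {0..u}")
      case True
      then have "R s \<omega> \<le> R u \<omega>" using R_mono[OF w] by auto
      then have "R s \<omega> \<le> N" using u(3) by simp
      then show ?thesis using True u by (simp add: indicator_def)
    qed simp
  qed
  also have "\<dots> = (\<integral>\<^sup>+s. indicator {s. R s \<omega> \<le> N} s * ennreal (r s \<omega>) \<partial>time_measure t)"
    by (rule nn_integral_restrict_space[symmetric]) simp
  finally show ?thesis .
qed

text \<open>The exceptional null set stems from the initial value alone, so the decomposition holds
  for all times simultaneously.\<close>

lemma a_decomp:
  assumes j: "j \<in> J"
  shows "AE \<omega> in M. \<forall>s. a j s \<omega> = c j + (- V j s \<omega>) + Z j s \<omega>"
  using a_init[OF j] by eventually_elim (simp add: Z_def)

text \<open>Where R is at most N, the quadratic variation of Z is at most C N, hence strictly below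
  the level C N + 1 of \<open>ito_lim_truncated\<close>. The truncated quadratic variation is at
  most 1 + C min N R in either case.\<close>

lemma truncated_Z:
  assumes j: "j \<in> J" and s: "0 \<le> s" and N: "0 \<le> N"
  shows "(\<integral>\<^sup>+\<omega>. indicator {\<omega>. R s \<omega> \<le> N} \<omega> * ennreal ((Z j s \<omega>)\<^sup>2) \<partial>M)
    \<le> ennreal (1 + C * expectation (\<lambda>\<omega>. min N (R s \<omega>)))"
proof -
  have pos: "0 < C * N + 1" using C N by (simp add: add_nonneg_pos)
  have iR: "integrable M (\<lambda>\<omega>. min N (R s \<omega>))"
    by (rule integrable_const_bound[where B=N]) (use R_meas R_nonneg N in auto)
  have qR: "qint s (H j) \<omega> \<le> ennreal (C * R s \<omega>)" if "\<omega> \<in> space M" for \<omega>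
    by (rule qint_le_R[where X="H j" and \<omega>=\<omega>, OF that C H_sq_le[OF j _ that]])
  have "(\<integral>\<^sup>+\<omega>. indicator {\<omega>. R s \<omega> \<le> N} \<omega> * ennreal ((Z j s \<omega>)\<^sup>2) \<partial>M) \<le>
     (\<integral>\<^sup>+\<omega>. indicator {\<omega>. qint s (H j) \<omega> < ennreal (C * N + 1)} \<omega> * ennreal ((Z j s \<omega>)\<^sup>2) \<partial>M)"
  proof (rule nn_integral_mono, rule mult_right_mono)
    fix \<omega> assume w: "\<omega> \<in> space M"
    have "qint s (H j) \<omega> < ennreal (C * N + 1)" if "R s \<omega> \<le> N"
    proof -
      have "C * R s \<omega> < C * N + 1" using mult_left_mono[OF that C] by simp
      then have "ennreal (C * R s \<omega>) < ennreal (C * N + 1)" using pos by (simp add: ennreal_lessI)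
      then show ?thesis using qR[OF w] by (rule le_less_trans[rotated])
    qed
    then show "indicator {\<omega>. R s \<omega> \<le> N} \<omega> \<le> (indicator {\<omega>. qint s (H j) \<omega> < ennreal (C * N + 1)} \<omega> :: ennreal)"
      by (auto simp: indicator_def)
  qed simp
  also have "\<dots> \<le> (\<integral>\<^sup>+\<omega>. min (ennreal (C * N + 1)) (qint s (H j) \<omega>) \<partial>M)"
    by (rule ito_lim_truncated[OF ito_Z[OF j s] s pos])
  also have "\<dots> \<le> (\<integral>\<^sup>+\<omega>. ennreal (1 + C * min N (R s \<omega>)) \<partial>M)"
  proof (rule nn_integral_mono)
    fix \<omega> assume w: "\<omega> \<in> space M"
    show "min (ennreal (C * N + 1)) (qint s (H j) \<omega>) \<le> ennreal (1 + C * min N (R s \<omega>))"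
    proof (cases "R s \<omega> \<le> N")
      case True
      have "qint s (H j) \<omega> \<le> ennreal (1 + C * min N (R s \<omega>))"
        by (rule order_trans[OF qR[OF w] ennreal_leI]) (simp add: True min_absorb2)
      then show ?thesis by (rule min.coboundedI2)
    next
      case False
      then show ?thesis by (intro min.coboundedI1 ennreal_leI) (simp add: min_def)
    qed
  qed
  also have "\<dots> = ennreal (expectation (\<lambda>\<omega>. 1 + C * min N (R s \<omega>)))"
    using iR C N R_nonneg by (intro nn_integral_eq_integral) auto
  also have "expectation (\<lambda>\<omega>. 1 + C * min N (R s \<omega>)) = 1 + C * expectation (\<lambda>\<omega>. min N (R s \<omega>))"
    using iR by (simp add: prob_space)
  finally show ?thesis .
qed

text \<open>The factors 3 come from splitting a component as initial value, drift and noise; the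
  last term of \<open>K0\<close> collects the 1 of \<open>truncated_Z\<close> for each component.
  \<open>K1\<close> depends on the horizon T through the drift, and its summand 1 makes it positive
  even for an empty index set.\<close>

definition K0 :: real where "K0 = 1 + (\<Sum>j\<in>J. 3 * (c j)\<^sup>2) + 3 * real (card J)"
definition K1 :: "real \<Rightarrow> real" where "K1 T = 3 * real (card J) * (T * B) + 3 * real (card J) * C + 1"

text \<open>On the event R <= N the drift part is bounded path by path through
  \<open>V_sq_le\<close>, the noise part in mean through \<open>truncated_Z\<close>, and R equals
  min N R.\<close>

lemma truncated_r:
  assumes s: "0 \<le> s" "s \<le> T" and N: "0 \<le> N"
  shows "(\<integral>\<^sup>+\<omega>. indicator {\<omega>. R s \<omega> \<le> N} \<omega> * ennreal (r s \<omega>) \<partial>M)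
    \<le> ennreal (K0 + K1 T * expectation (\<lambda>\<omega>. min N (R s \<omega>)))"
proof -
  let ?g = "expectation (\<lambda>\<omega>. min N (R s \<omega>))"
  let ?I = "\<lambda>\<omega>. indicator {\<omega>. R s \<omega> \<le> N} \<omega> :: ennreal"
  have iR: "integrable M (\<lambda>\<omega>. min N (R s \<omega>))"
    by (rule integrable_const_bound[where B=N]) (use R_meas R_nonneg N in auto)
  have g0: "0 \<le> ?g" using N R_nonneg by (intro Bochner_Integration.integral_nonneg) auto
  have dec: "AE \<omega> in M. \<forall>j\<in>J. \<forall>s. a j s \<omega> = c j + (- V j s \<omega>) + Z j s \<omega>"
    using fin a_decomp by (intro AE_finite_allI) auto
  define k where "k = 1 + (\<Sum>j\<in>J. 3 * (c j)\<^sup>2)"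
  define k' where "k' = 3 * real (card J) * (T * B)"
  have kk: "0 \<le> k" "0 \<le> k'" unfolding k_def k'_def using B_nonneg s by (auto intro!: add_nonneg_nonneg sum_nonneg)
  have Zm: "Z j s \<in> borel_measurable M" if "j \<in> J" for j using ito_Z[OF that s(1)] unfolding ito_lim_def by blast
  have Im: "?I \<in> borel_measurable M" using R_meas by measurable
  have "(\<integral>\<^sup>+\<omega>. ?I \<omega> * ennreal (r s \<omega>) \<partial>M) \<le>
     (\<integral>\<^sup>+\<omega>. ennreal (k + k' * min N (R s \<omega>)) + (\<Sum>j\<in>J. 3 * (?I \<omega> * ennreal ((Z j s \<omega>)\<^sup>2))) \<partial>M)"
  proof (rule nn_integral_mono_AE)
    show "AE \<omega> in M. ?I \<omega> * ennreal (r s \<omega>) \<le> ennreal (k + k' * min N (R s \<omega>)) + (\<Sum>j\<in>J. 3 * (?I \<omega> * ennreal ((Z j s \<omega>)\<^sup>2)))"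
      using dec AE_space
    proof eventually_elim
      case (elim \<omega>)
      show ?case
      proof (cases "R s \<omega> \<le> N")
        case True
        have "r s \<omega> \<le> 1 + (\<Sum>j\<in>J. 3 * (c j)\<^sup>2 + 3 * (T * (B * R s \<omega>)) + 3 * (Z j s \<omega>)\<^sup>2)"
          unfolding r_def
        proof (intro add_left_mono sum_mono)
          fix j assume j: "j \<in> J"
          have "(a j s \<omega>)\<^sup>2 \<le> 3 * (c j)\<^sup>2 + 3 * (V j s \<omega>)\<^sup>2 + 3 * (Z j s \<omega>)\<^sup>2"
            using elim(1) j sq_add3_le[of "c j" "- V j s \<omega>" "Z j s \<omega>"] by simp
          moreover have "(V j s \<omega>)\<^sup>2 \<le> T * (B * R s \<omega>)"
            using V_sq_le[OF j elim(2) s(1)] mult_right_mono[OF s(2), of "B * R s \<omega>"] B_nonneg R_nonneg[of s \<omega>] by simp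
          ultimately show "(a j s \<omega>)\<^sup>2 \<le> 3 * (c j)\<^sup>2 + 3 * (T * (B * R s \<omega>)) + 3 * (Z j s \<omega>)\<^sup>2" by linarith
        qed
        also have "\<dots> = (k + k' * R s \<omega>) + (\<Sum>j\<in>J. 3 * (Z j s \<omega>)\<^sup>2)"
          unfolding k_def k'_def by (simp add: sum.distrib algebra_simps)
        finally have "ennreal (r s \<omega>) \<le> ennreal (k + k' * R s \<omega> + (\<Sum>j\<in>J. 3 * (Z j s \<omega>)\<^sup>2))" by (rule ennreal_leI)
        also have "\<dots> = ennreal (k + k' * R s \<omega>) + (\<Sum>j\<in>J. 3 * ennreal ((Z j s \<omega>)\<^sup>2))"
          using kk R_nonneg[of s \<omega>] by (simp add: sum_nonneg ennreal_mult flip: sum_ennreal)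
        finally show ?thesis using True by (simp add: indicator_def min_absorb2)
      qed (simp add: indicator_def)
    qed
  qed
  also have "\<dots> = (\<integral>\<^sup>+\<omega>. ennreal (k + k' * min N (R s \<omega>)) \<partial>M) + (\<Sum>j\<in>J. 3 * (\<integral>\<^sup>+\<omega>. ?I \<omega> * ennreal ((Z j s \<omega>)\<^sup>2) \<partial>M))"
    using Zm Im R_meas[of s] by (subst nn_integral_add) (auto simp: nn_integral_sum nn_integral_cmult)
  also have "\<dots> \<le> ennreal (k + k' * ?g) + (\<Sum>j\<in>J. 3 * ennreal (1 + C * ?g))"
  proof (intro add_mono sum_mono mult_left_mono truncated_Z s(1) N)
    have "(\<integral>\<^sup>+\<omega>. ennreal (k + k' * min N (R s \<omega>)) \<partial>M) = ennreal (expectation (\<lambda>\<omega>. k + k' * min N (R s \<omega>)))"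
      using iR kk N R_nonneg by (intro nn_integral_eq_integral) auto
    also have "\<dots> = ennreal (k + k' * ?g)" using iR by (simp add: prob_space)
    finally show "(\<integral>\<^sup>+\<omega>. ennreal (k + k' * min N (R s \<omega>)) \<partial>M) \<le> ennreal (k + k' * ?g)" by simp
  qed auto
  also have "\<dots> = ennreal (k + k' * ?g + real (card J) * (3 * (1 + C * ?g)))"
    using kk g0 C by (simp add: ennreal_mult ennreal_of_nat_eq_real_of_nat)
  also have "\<dots> \<le> ennreal (K0 + K1 T * ?g)"
    using g0 unfolding K0_def K1_def k_def k'_def by (intro ennreal_leI) (simp add: algebra_simps)
  finally show ?thesis .
qed

text \<open>\<open>min_R_le\<close>, Fubini and \<open>truncated_r\<close> give the integral
  inequality for the mean of min N R. This mean is bounded by N, as Gronwall requires, while the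
  conclusion is uniform in N; Fatou then removes the truncation.\<close>

lemma expectation_R_finite:
  assumes T: "0 \<le> T"
  shows "(\<integral>\<^sup>+\<omega>. ennreal (R T \<omega>) \<partial>M) < \<infinity>"
proof -
  let ?g = "\<lambda>N s. expectation (\<lambda>\<omega>. min N (R s \<omega>))"
  have iR: "integrable M (\<lambda>\<omega>. min N (R s \<omega>))" if "0 \<le> N" for N s
    by (rule integrable_const_bound[where B=N]) (use R_meas R_nonneg that in auto)
  have nnR: "(\<integral>\<^sup>+\<omega>. ennreal (min N (R s \<omega>)) \<partial>M) = ennreal (?g N s)" if "0 \<le> N" for N s
    using iR[OF that] R_nonneg that by (intro nn_integral_eq_integral) auto
  have K: "0 \<le> K0" "0 < K1 T" unfolding K0_def K1_def using C B_nonneg T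
    by (auto intro!: add_nonneg_nonneg add_nonneg_pos sum_nonneg)
  have sfM: "sigma_finite_measure M" by unfold_locales
  have bound: "?g N T \<le> 2 * K0 * T * exp (2 * K1 T * T)" if N: "0 \<le> N" for N
  proof (rule gronwall_bounded[OF T K, where N=N])
    show "0 \<le> ?g N s" for s using N R_nonneg by (intro Bochner_Integration.integral_nonneg) auto
    show "?g N s \<le> N" for s
      using iR[OF N, of s] integral_mono[of M "\<lambda>\<omega>. min N (R s \<omega>)" "\<lambda>_. N"] by (simp add: prob_space)
    fix t assume t: "0 \<le> t" "t \<le> T"
    interpret P: pair_sigma_finite "time_measure t" M
      using sfM sigma_finite_time_measure by (simp add: pair_sigma_finite_def)
    let ?P = "time_measure t \<Otimes>\<^sub>M M"
    have RP: "(\<lambda>(s, \<omega>). R s \<omega>) \<in> borel_measurable ?P" by (rule continuous_process_measurable[OF R_cont R_meas])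
    have rP: "(\<lambda>(s, \<omega>). r s \<omega>) \<in> borel_measurable ?P" by (rule continuous_process_measurable[OF r_cont r_meas])
    have m: "(\<lambda>x. indicator {x. R (fst x) (snd x) \<le> N} x * ennreal (r (fst x) (snd x))) \<in> borel_measurable ?P"
      using RP rP unfolding case_prod_unfold by measurable
    have "ennreal (?g N t) = (\<integral>\<^sup>+\<omega>. ennreal (min N (R t \<omega>)) \<partial>M)" by (rule nnR[OF N, symmetric])
    also have "\<dots> \<le> (\<integral>\<^sup>+\<omega>. (\<integral>\<^sup>+s. indicator {s. R s \<omega> \<le> N} s * ennreal (r s \<omega>) \<partial>time_measure t) \<partial>M)"
      by (rule nn_integral_mono[OF min_R_le[OF _ t(1) N]])
    also have "\<dots> = (\<integral>\<^sup>+s. (\<integral>\<^sup>+\<omega>. indicator {\<omega>. R s \<omega> \<le> N} \<omega> * ennreal (r s \<omega>) \<partial>M) \<partial>time_measure t)"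
      using P.Fubini'[of "\<lambda>s \<omega>. indicator {x. R (fst x) (snd x) \<le> N} (s, \<omega>) * ennreal (r s \<omega>)"] m
      by (simp add: case_prod_unfold indicator_def)
    also have "\<dots> \<le> (\<integral>\<^sup>+s. ennreal (K0 + K1 T * ?g N s) \<partial>time_measure t)"
      by (rule nn_integral_mono) (use t N in \<open>auto intro!: truncated_r\<close>)
    also have "\<dots> = (\<integral>\<^sup>+s\<in>{0..t}. ennreal (K0 + K1 T * ?g N s) \<partial>lborel)"
      by (rule nn_integral_restrict_space) simp
    finally show "ennreal (?g N t) \<le> (\<integral>\<^sup>+s\<in>{0..t}. ennreal (K0 + K1 T * ?g N s) \<partial>lborel)" .
  qed
  have "(\<integral>\<^sup>+\<omega>. ennreal (R T \<omega>) \<partial>M) \<le> (\<integral>\<^sup>+\<omega>. liminf (\<lambda>n::nat. ennreal (min (real n) (R T \<omega>))) \<partial>M)"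
  proof (rule nn_integral_mono)
    fix \<omega>
    obtain k :: nat where k: "R T \<omega> < real k" using reals_Archimedean2 by blast
    have "eventually (\<lambda>n. ennreal (min (real n) (R T \<omega>)) = ennreal (R T \<omega>)) sequentially"
      using eventually_ge_at_top[of k] by eventually_elim (use k in \<open>auto simp: min_def\<close>)
    then have "(\<lambda>n. ennreal (min (real n) (R T \<omega>))) \<longlonglongrightarrow> ennreal (R T \<omega>)" by (rule tendsto_eventually)
    then show "ennreal (R T \<omega>) \<le> liminf (\<lambda>n::nat. ennreal (min (real n) (R T \<omega>)))"
      by (subst lim_imp_Liminf) auto
  qed
  also have "\<dots> \<le> liminf (\<lambda>n::nat. \<integral>\<^sup>+\<omega>. ennreal (min (real n) (R T \<omega>)) \<partial>M)"
    by (rule nn_integral_liminf) (use R_meas in measurable)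
  also have "\<dots> \<le> liminf (\<lambda>n::nat. ennreal (2 * K0 * T * exp (2 * K1 T * T)))"
    by (rule Liminf_mono) (simp only: nnR[OF of_nat_0_le_iff], intro always_eventually allI ennreal_leI bound, simp)
  also have "\<dots> < \<infinity>" by (simp add: Liminf_const)
  finally show ?thesis .
qed

lemma qint_finite:
  assumes t: "0 \<le> t" and K: "0 \<le> K" and le: "\<And>u \<omega>. 0 \<le> u \<Longrightarrow> \<omega> \<in> space M \<Longrightarrow> (X u \<omega>)\<^sup>2 \<le> K * r u \<omega>"
  shows "(\<integral>\<^sup>+\<omega>. qint t X \<omega> \<partial>M) < \<infinity>"
proof -
  have "(\<integral>\<^sup>+\<omega>. qint t X \<omega> \<partial>M) \<le> (\<integral>\<^sup>+\<omega>. ennreal K * ennreal (R t \<omega>) \<partial>M)"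
  proof (rule nn_integral_mono)
    fix \<omega> assume w: "\<omega> \<in> space M"
    have "qint t X \<omega> \<le> ennreal (K * R t \<omega>)" by (rule qint_le_R[where X=X and \<omega>=\<omega>, OF w K le[OF _ w]])
    then show "qint t X \<omega> \<le> ennreal K * ennreal (R t \<omega>)" using K R_nonneg by (simp add: ennreal_mult)
  qed
  also have "\<dots> = ennreal K * (\<integral>\<^sup>+\<omega>. ennreal (R t \<omega>) \<partial>M)"
    using R_meas by (intro nn_integral_cmult) simp
  also have "\<dots> < \<infinity>" using expectation_R_finite[OF t] by (simp add: ennreal_mult_less_top)
  finally show ?thesis .
qed

section \<open>Summation of the component identities\<close>

lemma a0_sq: "j \<in> J \<Longrightarrow> integrable M (\<lambda>\<omega>. (a j 0 \<omega>)\<^sup>2)" "j \<in> J \<Longrightarrow> expectation (\<lambda>\<omega>. (a j 0 \<omega>)\<^sup>2) = (c j)\<^sup>2"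
proof -
  assume j: "j \<in> J"
  have ae: "AE \<omega> in M. (c j)\<^sup>2 = (a j 0 \<omega>)\<^sup>2" using a_init[OF j] by eventually_elim simp
  have m: "(\<lambda>\<omega>. (a j 0 \<omega>)\<^sup>2) \<in> borel_measurable M" using a_meas[OF j, of 0] by simp
  show "integrable M (\<lambda>\<omega>. (a j 0 \<omega>)\<^sup>2)"
    by (rule integrable_cong_AE_imp[OF _ m ae]) simp
  show "expectation (\<lambda>\<omega>. (a j 0 \<omega>)\<^sup>2) = (c j)\<^sup>2"
    using integral_cong_AE[OF m _ AE_symmetric[OF ae]] by (simp add: prob_space)
qed

lemma component:
  assumes j: "j \<in> J" and t: "0 \<le> t"
  shows "integrable M (\<lambda>\<omega>. (a j t \<omega>)\<^sup>2)"
    "integrable (time_measure t) (\<lambda>s. expectation (\<lambda>\<omega>. a j s \<omega> * d j s \<omega>))"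
    "AE s in time_measure t. integrable M (\<lambda>\<omega>. a j s \<omega> * d j s \<omega>)"
    "expectation (\<lambda>\<omega>. (a j t \<omega>)\<^sup>2) = (c j)\<^sup>2 + enn2real (\<integral>\<^sup>+\<omega>. qint t (H j) \<omega> \<partial>M)
      - 2 * (LINT s:{0..t}|lborel. expectation (\<lambda>\<omega>. a j s \<omega> * d j s \<omega>))"
proof -
  have aq: "(\<integral>\<^sup>+\<omega>. qint t (a j) \<omega> \<partial>M) < \<infinity>" by (rule qint_finite[OF t, of 1]) (use a_sq_le[OF j] in auto)
  have dq: "(\<integral>\<^sup>+\<omega>. qint t (d j) \<omega> \<partial>M) < \<infinity>" by (rule qint_finite[OF t B_nonneg]) (use d_sq_le[OF j] in auto)
  have Hq: "(\<integral>\<^sup>+\<omega>. qint t (H j) \<omega> \<partial>M) < \<infinity>" by (rule qint_finite[OF t C H_sq_le[OF j]])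
  have it: "ito_lim s (H j) (\<lambda>\<omega>. a j s \<omega> - a j 0 \<omega> + (LINT u:{0..s}|lborel. d j u \<omega>))" if "0 \<le> s" for s
    using ito_Z[OF j that] unfolding Z_def[abs_def] V_def .
  note e = energy_component[OF t a_cont[OF j] d_cont[OF j] a_adapted[OF j] d_adapted[OF j] it a0_sq(1)[OF j] aq dq Hq]
  show "integrable M (\<lambda>\<omega>. (a j t \<omega>)\<^sup>2)"
    "integrable (time_measure t) (\<lambda>s. expectation (\<lambda>\<omega>. a j s \<omega> * d j s \<omega>))"
    "AE s in time_measure t. integrable M (\<lambda>\<omega>. a j s \<omega> * d j s \<omega>)"
    using e(1-3) by auto
  show "expectation (\<lambda>\<omega>. (a j t \<omega>)\<^sup>2) = (c j)\<^sup>2 + enn2real (\<integral>\<^sup>+\<omega>. qint t (H j) \<omega> \<partial>M)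
      - 2 * (LINT s:{0..t}|lborel. expectation (\<lambda>\<omega>. a j s \<omega> * d j s \<omega>))"
    using e(4) a0_sq(2)[OF j] by simp
qed

text \<open>Integrability holds at every time and not only at almost every time: the growth bound
  compares the noise with r s, whose expectation is finite by \<open>component\<close>.\<close>

lemma H_component:
  assumes j: "j \<in> J" and t: "0 \<le> t"
  shows "\<And>s. 0 \<le> s \<Longrightarrow> integrable M (\<lambda>\<omega>. (H j s \<omega>)\<^sup>2)"
    "integrable (time_measure t) (\<lambda>s. expectation (\<lambda>\<omega>. (H j s \<omega>)\<^sup>2))"
    "enn2real (\<integral>\<^sup>+\<omega>. qint t (H j) \<omega> \<partial>M) = (LINT s:{0..t}|lborel. expectation (\<lambda>\<omega>. (H j s \<omega>)\<^sup>2))"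
proof -
  show "integrable M (\<lambda>\<omega>. (H j s \<omega>)\<^sup>2)" if s: "0 \<le> s" for s
  proof (rule Bochner_Integration.integrable_bound[where f="\<lambda>\<omega>. C * r s \<omega>"])
    show "integrable M (\<lambda>\<omega>. C * r s \<omega>)" unfolding r_def using component(1)[OF _ s] by auto
    have "H j s \<in> borel_measurable (Fil s)" using sde[OF j s] s unfolding has_ito_integral_def by auto
    then show "(\<lambda>\<omega>. (H j s \<omega>)\<^sup>2) \<in> borel_measurable M" by (intro borel_measurable_power measurable_Fil_M)
    show "AE \<omega> in M. norm ((H j s \<omega>)\<^sup>2) \<le> norm (C * r s \<omega>)"
      using H_sq_le[OF j s] by (intro AE_I2) (auto intro: order_trans[OF _ abs_ge_self])
  qed
  let ?P = "time_measure t \<Otimes>\<^sub>M M"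
  have sfM: "sigma_finite_measure M" by unfold_locales
  interpret P: pair_sigma_finite "time_measure t" M
    using sfM sigma_finite_time_measure by (simp add: pair_sigma_finite_def)
  have Hm: "(\<lambda>(s, \<omega>). H j s \<omega>) \<in> borel_measurable ?P" using ito_Z[OF j t] unfolding ito_lim_def by blast
  have Hq: "(\<integral>\<^sup>+\<omega>. qint t (H j) \<omega> \<partial>M) < \<infinity>" by (rule qint_finite[OF t C H_sq_le[OF j]])
  have iP: "integrable ?P (\<lambda>x. (case x of (s, \<omega>) \<Rightarrow> H j s \<omega>)\<^sup>2)"
    using Hq unfolding nn_integral_qint[OF Hm sfM] using integrable_sq_iff[OF Hm] by simp
  show "integrable (time_measure t) (\<lambda>s. expectation (\<lambda>\<omega>. (H j s \<omega>)\<^sup>2))"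
    using P.integrable_fst'[OF iP] by simp
  show "enn2real (\<integral>\<^sup>+\<omega>. qint t (H j) \<omega> \<partial>M) = (LINT s:{0..t}|lborel. expectation (\<lambda>\<omega>. (H j s \<omega>)\<^sup>2))"
    unfolding nn_integral_qint[OF Hm sfM] nn_integral_sq_eq[OF iP]
    using P.integral_fst'[OF iP] by (simp add: integral_time_measure)
qed

text \<open>The drift enters the sum of the component identities only through the quadratic form of
  A; its sign gives the inequality, its vanishing the equality.\<close>

theorem energy:
  assumes t: "0 \<le> t"
  shows "integrable M (\<lambda>\<omega>. \<Sum>j\<in>J. (a j t \<omega>)\<^sup>2)"
    "\<And>s. 0 \<le> s \<Longrightarrow> integrable M (\<lambda>\<omega>. \<Sum>j\<in>J. (H j s \<omega>)\<^sup>2)"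
    "set_integrable lborel {0..t} (\<lambda>s. expectation (\<lambda>\<omega>. \<Sum>j\<in>J. (H j s \<omega>)\<^sup>2))"
    "(\<And>s \<omega>. 0 \<le> s \<Longrightarrow> \<omega> \<in> space M \<Longrightarrow> 0 \<le> (\<Sum>j\<in>J. a j s \<omega> * (\<Sum>l\<in>J. A j l * a l s \<omega>))) \<Longrightarrow>
      expectation (\<lambda>\<omega>. \<Sum>j\<in>J. (a j t \<omega>)\<^sup>2)
        \<le> (\<Sum>j\<in>J. (c j)\<^sup>2) + (LINT s:{0..t}|lborel. expectation (\<lambda>\<omega>. \<Sum>j\<in>J. (H j s \<omega>)\<^sup>2))"
    "(\<And>s \<omega>. 0 \<le> s \<Longrightarrow> \<omega> \<in> space M \<Longrightarrow> (\<Sum>j\<in>J. a j s \<omega> * (\<Sum>l\<in>J. A j l * a l s \<omega>)) = 0) \<Longrightarrow>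
      expectation (\<lambda>\<omega>. \<Sum>j\<in>J. (a j t \<omega>)\<^sup>2)
        = (\<Sum>j\<in>J. (c j)\<^sup>2) + (LINT s:{0..t}|lborel. expectation (\<lambda>\<omega>. \<Sum>j\<in>J. (H j s \<omega>)\<^sup>2))"
proof -
  show "integrable M (\<lambda>\<omega>. \<Sum>j\<in>J. (a j t \<omega>)\<^sup>2)" using component(1)[OF _ t] by simp
  show iH: "integrable M (\<lambda>\<omega>. \<Sum>j\<in>J. (H j s \<omega>)\<^sup>2)" if "0 \<le> s" for s using H_component(1)[OF _ t that] by simp
  have eH: "expectation (\<lambda>\<omega>. \<Sum>j\<in>J. (H j s \<omega>)\<^sup>2) = (\<Sum>j\<in>J. expectation (\<lambda>\<omega>. (H j s \<omega>)\<^sup>2))" if "s \<in> {0..t}" for s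
    using H_component(1)[OF _ t, of _ s] that by (intro Bochner_Integration.integral_sum) auto
  have i1: "integrable (time_measure t) (\<lambda>s. \<Sum>j\<in>J. expectation (\<lambda>\<omega>. (H j s \<omega>)\<^sup>2))"
    using H_component(2)[OF _ t] by simp
  then have i2: "integrable (time_measure t) (\<lambda>s. expectation (\<lambda>\<omega>. \<Sum>j\<in>J. (H j s \<omega>)\<^sup>2))"
    using Bochner_Integration.integrable_cong[of "time_measure t" "time_measure t" "\<lambda>s. expectation (\<lambda>\<omega>. \<Sum>j\<in>J. (H j s \<omega>)\<^sup>2)"] eH
    by simp
  then show "set_integrable lborel {0..t} (\<lambda>s. expectation (\<lambda>\<omega>. \<Sum>j\<in>J. (H j s \<omega>)\<^sup>2))"
    unfolding integrable_time_measure .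
  have iEH: "(LINT s:{0..t}|lborel. expectation (\<lambda>\<omega>. \<Sum>j\<in>J. (H j s \<omega>)\<^sup>2)) = (\<Sum>j\<in>J. enn2real (\<integral>\<^sup>+\<omega>. qint t (H j) \<omega> \<partial>M))"
  proof -
    have "(LINT s:{0..t}|lborel. expectation (\<lambda>\<omega>. \<Sum>j\<in>J. (H j s \<omega>)\<^sup>2))
      = (\<integral>s. (\<Sum>j\<in>J. expectation (\<lambda>\<omega>. (H j s \<omega>)\<^sup>2)) \<partial>time_measure t)"
      unfolding integral_time_measure[symmetric] by (rule Bochner_Integration.integral_cong) (use eH in auto)
    also have "\<dots> = (\<Sum>j\<in>J. \<integral>s. expectation (\<lambda>\<omega>. (H j s \<omega>)\<^sup>2) \<partial>time_measure t)"
      using H_component(2)[OF _ t] by (intro Bochner_Integration.integral_sum)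
    also have "\<dots> = (\<Sum>j\<in>J. enn2real (\<integral>\<^sup>+\<omega>. qint t (H j) \<omega> \<partial>M))"
      using H_component(3)[OF _ t] by (intro sum.cong refl) (simp add: integral_time_measure)
    finally show ?thesis .
  qed
  have main: "expectation (\<lambda>\<omega>. \<Sum>j\<in>J. (a j t \<omega>)\<^sup>2)
     = (\<Sum>j\<in>J. (c j)\<^sup>2) + (LINT s:{0..t}|lborel. expectation (\<lambda>\<omega>. \<Sum>j\<in>J. (H j s \<omega>)\<^sup>2))
      - 2 * (\<integral>s. (\<Sum>j\<in>J. expectation (\<lambda>\<omega>. a j s \<omega> * d j s \<omega>)) \<partial>time_measure t)"
  proof -
    have "expectation (\<lambda>\<omega>. \<Sum>j\<in>J. (a j t \<omega>)\<^sup>2) = (\<Sum>j\<in>J. expectation (\<lambda>\<omega>. (a j t \<omega>)\<^sup>2))"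
      using component(1)[OF _ t] by (intro Bochner_Integration.integral_sum)
    also have "\<dots> = (\<Sum>j\<in>J. (c j)\<^sup>2) + (\<Sum>j\<in>J. enn2real (\<integral>\<^sup>+\<omega>. qint t (H j) \<omega> \<partial>M))
       - 2 * (\<Sum>j\<in>J. \<integral>s. expectation (\<lambda>\<omega>. a j s \<omega> * d j s \<omega>) \<partial>time_measure t)"
      using component(4)[OF _ t] by (simp add: sum.distrib sum_subtractf sum_distrib_left integral_time_measure)
    also have "(\<Sum>j\<in>J. \<integral>s. expectation (\<lambda>\<omega>. a j s \<omega> * d j s \<omega>) \<partial>time_measure t) =
      (\<integral>s. (\<Sum>j\<in>J. expectation (\<lambda>\<omega>. a j s \<omega> * d j s \<omega>)) \<partial>time_measure t)"
      using component(2)[OF _ t] by (intro Bochner_Integration.integral_sum[symmetric])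
    finally show ?thesis unfolding iEH .
  qed
  \<comment> \<open>Sum and expectation are exchanged at almost every time, so that the pointwise
    hypothesis on the quadratic form can be used under the expectation.\<close>
  have AEs: "AE s in time_measure t. 0 \<le> s \<and> (\<Sum>j\<in>J. expectation (\<lambda>\<omega>. a j s \<omega> * d j s \<omega>)) = expectation (\<lambda>\<omega>. \<Sum>j\<in>J. a j s \<omega> * d j s \<omega>)"
  proof -
    have "AE s in time_measure t. \<forall>j\<in>J. integrable M (\<lambda>\<omega>. a j s \<omega> * d j s \<omega>)"
      using component(3)[OF _ t] fin by (intro AE_finite_allI) auto
    then show ?thesis using AE_space
    proof eventually_elim
      case (elim s)
      then show ?case by (subst Bochner_Integration.integral_sum) auto
    qed
  qed
  show "expectation (\<lambda>\<omega>. \<Sum>j\<in>J. (a j t \<omega>)\<^sup>2)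
        \<le> (\<Sum>j\<in>J. (c j)\<^sup>2) + (LINT s:{0..t}|lborel. expectation (\<lambda>\<omega>. \<Sum>j\<in>J. (H j s \<omega>)\<^sup>2))"
    if pos: "\<And>s \<omega>. 0 \<le> s \<Longrightarrow> \<omega> \<in> space M \<Longrightarrow> 0 \<le> (\<Sum>j\<in>J. a j s \<omega> * (\<Sum>l\<in>J. A j l * a l s \<omega>))"
  proof -
    have "0 \<le> (\<integral>s. (\<Sum>j\<in>J. expectation (\<lambda>\<omega>. a j s \<omega> * d j s \<omega>)) \<partial>time_measure t)"
    proof (rule integral_nonneg_AE)
      show "AE s in time_measure t. 0 \<le> (\<Sum>j\<in>J. expectation (\<lambda>\<omega>. a j s \<omega> * d j s \<omega>))"
        using AEs by eventually_elim (use pos in \<open>auto simp: d_def intro!: Bochner_Integration.integral_nonneg\<close>)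
    qed
    then show ?thesis using main by simp
  qed
  show "expectation (\<lambda>\<omega>. \<Sum>j\<in>J. (a j t \<omega>)\<^sup>2)
        = (\<Sum>j\<in>J. (c j)\<^sup>2) + (LINT s:{0..t}|lborel. expectation (\<lambda>\<omega>. \<Sum>j\<in>J. (H j s \<omega>)\<^sup>2))"
    if z: "\<And>s \<omega>. 0 \<le> s \<Longrightarrow> \<omega> \<in> space M \<Longrightarrow> (\<Sum>j\<in>J. a j s \<omega> * (\<Sum>l\<in>J. A j l * a l s \<omega>)) = 0"
  proof -
    have ez: "expectation (\<lambda>\<omega>. \<Sum>j\<in>J. a j s \<omega> * d j s \<omega>) = 0" if "0 \<le> s" for s
      using z[OF that] Bochner_Integration.integral_cong[of M M "\<lambda>\<omega>. \<Sum>j\<in>J. a j s \<omega> * d j s \<omega>" "\<lambda>_. 0"]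
      by (simp add: d_def)
    have "AE s in time_measure t. (\<Sum>j\<in>J. expectation (\<lambda>\<omega>. a j s \<omega> * d j s \<omega>)) = 0"
      using AEs by eventually_elim (use ez in auto)
    then have "(\<integral>s. (\<Sum>j\<in>J. expectation (\<lambda>\<omega>. a j s \<omega> * d j s \<omega>)) \<partial>time_measure t) = 0"
      by (rule integral_eq_zero_AE)
    then show ?thesis using main by simp
  qed
qed

end

section \<open>Divergence theorem on triangles\<close>

lemma Basis_vec2: "(Basis :: (real^2) set) = {axis 1 1, axis 2 1}"
  unfolding Basis_vec_def by (auto simp: UNIV_2)

lemma axis2_neq: "(axis 1 1 :: real^2) \<noteq> axis 2 1"
  by (simp add: axis_eq_axis)

lemma inner_axis2: "x \<bullet> axis i (1::real) = x $ i"
  by (simp add: inner_axis)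

lemma measurable_vector2: "(\<lambda>(x, y). vector [x, y] :: real^2) \<in> measurable (lborel \<Otimes>\<^sub>M lborel) borel"
proof -
  have "continuous_on UNIV (\<lambda>z::real \<times> real. (vector [fst z, snd z] :: real^2))"
    by (subst continuous_on_componentwise)
      (auto simp: Basis_vec2 inner_axis2 intro!: continuous_intros)
  then have "(\<lambda>z::real \<times> real. (vector [fst z, snd z] :: real^2)) \<in> borel_measurable borel"
    by (rule borel_measurable_continuous_onI)
  then show ?thesis by (simp add: case_prod_unfold lborel_prod)
qed

text \<open>Lebesgue measure is determined by the volumes of boxes, and a box corresponds to a
  product of intervals. This gives access to Fubini on \<open>real^2\<close>.\<close>

lemma lborel_vec2: "(lborel :: (real^2) measure) = distr (lborel \<Otimes>\<^sub>M lborel) borel (\<lambda>(x, y). vector [x, y])"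
proof (rule lborel_eqI)
  fix l u :: "real^2" assume le: "\<And>b. b \<in> Basis \<Longrightarrow> l \<bullet> b \<le> u \<bullet> b"
  have le': "l $ 1 \<le> u $ 1" "l $ 2 \<le> u $ 2"
    using le[of "axis 1 1"] le[of "axis 2 1"] by (auto simp: Basis_vec2 inner_axis2)
  have "(\<lambda>(x, y). vector [x, y] :: real^2) -` box l u \<inter> space (lborel \<Otimes>\<^sub>M lborel)
     = {l $ 1<..<u $ 1} \<times> {l $ 2<..<u $ 2}"
    by (auto simp: box_def Basis_vec2 inner_axis2 space_pair_measure)
  then have "emeasure (distr (lborel \<Otimes>\<^sub>M lborel) borel (\<lambda>(x, y). vector [x, y])) (box l u)
     = emeasure (lborel \<Otimes>\<^sub>M lborel) ({l $ 1<..<u $ 1} \<times> {l $ 2<..<u $ 2})"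
    using emeasure_distr[OF measurable_vector2, of "box l u"] by simp
  also have "\<dots> = ennreal ((u $ 1 - l $ 1) * (u $ 2 - l $ 2))"
    using le' by (subst lborel.emeasure_pair_measure_Times) (auto simp: ennreal_mult)
  also have "(u $ 1 - l $ 1) * (u $ 2 - l $ 2) = prod ((\<bullet>) (u - l)) Basis"
    unfolding Basis_vec2 by (simp add: axis2_neq inner_axis2)
  finally show "emeasure (distr (lborel \<Otimes>\<^sub>M lborel) borel (\<lambda>(x, y). vector [x, y])) (box l u) = (\<Prod>b\<in>Basis. (u - l) \<bullet> b)"
    by simp
qed simp

lemma integral_vec2:
  fixes f :: "real^2 \<Rightarrow> real"
  assumes "integrable lborel f"
  shows "(\<integral>x. f x \<partial>lborel) = (\<integral>t. (\<integral>s. f (vector [s, t]) \<partial>lborel) \<partial>lborel)"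
proof -
  have fm: "f \<in> borel_measurable borel" using assms by auto
  have i: "integrable (lborel \<Otimes>\<^sub>M lborel) (\<lambda>(x, y). f (vector [x, y]))"
    using assms integrable_distr[OF measurable_vector2, of f] unfolding lborel_vec2[symmetric]
    by (simp add: case_prod_unfold)
  have "(\<integral>x. f x \<partial>lborel) = (\<integral>x. f x \<partial>distr (lborel \<Otimes>\<^sub>M lborel) borel (\<lambda>(x, y). vector [x, y]))"
    by (simp flip: lborel_vec2)
  also have "\<dots> = (\<integral>(x, y). f (vector [x, y]) \<partial>(lborel \<Otimes>\<^sub>M lborel))"
    using integral_distr[OF measurable_vector2 fm] by (simp add: case_prod_unfold)
  also have "\<dots> = (\<integral>t. (\<integral>s. f (vector [s, t]) \<partial>lborel) \<partial>lborel)"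
    using lborel_pair.integral_snd[OF i] by simp
  finally show ?thesis .
qed

text \<open>The functions are embedded in \<open>real^1\<close> to meet the vector valued form of
  \<open>integral_change_of_variables_linear\<close>. Integrability of both functions lets the gauge
  integrals there be read as Lebesgue integrals.\<close>

lemma integral_linear_change2:
  fixes f :: "real^2 \<Rightarrow> real" and L :: "real^2 \<Rightarrow> real^2"
  assumes L: "linear L" and det: "det (matrix L) \<noteq> 0"
    and f: "integrable lborel f" and fL: "integrable lborel (\<lambda>x. f (L x))"
  shows "(\<integral>x. f x \<partial>lborel) = \<bar>det (matrix L)\<bar> * (\<integral>x. f (L x) \<partial>lborel)"
proof -
  let ?v = "vec :: real \<Rightarrow> real^1"
  have blv: "bounded_linear ?v"
    by (rule linear_conv_bounded_linear[THEN iffD1]) (auto simp: linear_iff vec_eq_iff)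
  have surj: "range L = UNIV" using L det by (metis det_nz_iff_inj linear_injective_imp_surjective)
  have hi: "((\<lambda>x. ?v (h x)) has_integral ?v (\<integral>x. h x \<partial>lborel)) UNIV" if "integrable lborel h" for h :: "real^2 \<Rightarrow> real"
    using has_integral_linear[OF has_integral_integral_lborel[OF that] blv] by (simp add: o_def)
  have "integrable lborel (\<lambda>x. ?v (f x))" by (rule integrable_bounded_linear[OF blv f])
  then have ai: "(\<lambda>x. ?v (f x)) absolutely_integrable_on UNIV"
    using integrable_completion[of "\<lambda>x. ?v (f x)" lborel] by (simp add: set_integrable_def)
  have "?v (\<integral>x. f x \<partial>lborel) = integral UNIV (\<lambda>x. ?v (f x))"
    using hi[OF f] by (simp add: integral_unique)
  also have "\<dots> = \<bar>det (matrix L)\<bar> *\<^sub>R integral UNIV ((\<lambda>x. ?v (f x)) \<circ> L)"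
    using integral_change_of_variables_linear[OF L, where f="\<lambda>x. ?v (f x)" and S=UNIV] ai surj by simp
  also have "integral UNIV ((\<lambda>x. ?v (f x)) \<circ> L) = ?v (\<integral>x. f (L x) \<partial>lborel)"
    using hi[OF fL] by (simp add: integral_unique o_def)
  finally have "(?v (\<integral>x. f x \<partial>lborel)) $ 1 = (\<bar>det (matrix L)\<bar> *\<^sub>R ?v (\<integral>x. f (L x) \<partial>lborel)) $ 1" by simp
  then show ?thesis by simp
qed

section \<open>Integrals over triangles\<close>

text \<open>The determinant of two plane vectors. For two sides of a triangle it is twice the signed
  area, and its sign is the orientation.\<close>

definition wedge :: "real^2 \<Rightarrow> real^2 \<Rightarrow> real" where
  "wedge p q = p $ 1 * q $ 2 - p $ 2 * q $ 1"

definition "std_simplex2 = {z :: real^2. 0 \<le> z $ 1 \<and> 0 \<le> z $ 2 \<and> z $ 1 + z $ 2 \<le> 1}"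

text \<open>Cramer's rule in the plane.\<close>

lemma wedge_coords:
  assumes "wedge p q \<noteq> 0"
  shows "w = (wedge w q / wedge p q) *\<^sub>R p + (wedge p w / wedge p q) *\<^sub>R q"
proof -
  have "wedge p q *\<^sub>R w = wedge w q *\<^sub>R p + wedge p w *\<^sub>R q"
    by (simp add: vec_eq_iff forall_2 wedge_def algebra_simps)
  then have "(1 / wedge p q) *\<^sub>R (wedge p q *\<^sub>R w) = (1 / wedge p q) *\<^sub>R (wedge w q *\<^sub>R p + wedge p w *\<^sub>R q)" by simp
  then show ?thesis using assms by (simp add: scaleR_add_right)
qed

text \<open>Barycentric coordinates. They are unique because pairing with either side by
  \<open>wedge\<close> recovers the other coefficient.\<close>

lemma in_triangle_iff:
  assumes w: "wedge (b - a) (c - a) \<noteq> 0"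
  shows "a + z $ 1 *\<^sub>R (b - a) + z $ 2 *\<^sub>R (c - a) \<in> convex hull {a, b, c} \<longleftrightarrow> z \<in> std_simplex2"
proof
  assume "z \<in> std_simplex2"
  then have "0 \<le> 1 - z $ 1 - z $ 2" "0 \<le> z $ 1" "0 \<le> z $ 2" unfolding std_simplex2_def by auto
  then show "a + z $ 1 *\<^sub>R (b - a) + z $ 2 *\<^sub>R (c - a) \<in> convex hull {a, b, c}"
    unfolding convex_hull_3
    by (intro CollectI exI[of _ "1 - z $ 1 - z $ 2"] exI[of _ "z $ 1"] exI[of _ "z $ 2"])
     (auto simp: algebra_simps)
next
  assume "a + z $ 1 *\<^sub>R (b - a) + z $ 2 *\<^sub>R (c - a) \<in> convex hull {a, b, c}"
  then obtain u v t where uvt: "0 \<le> u" "0 \<le> v" "0 \<le> t" "u + v + t = 1"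
    "a + z $ 1 *\<^sub>R (b - a) + z $ 2 *\<^sub>R (c - a) = u *\<^sub>R a + v *\<^sub>R b + t *\<^sub>R c"
    unfolding convex_hull_3 by auto
  have u: "u = 1 - v - t" using uvt by simp
  have eq: "z $ 1 *\<^sub>R (b - a) + z $ 2 *\<^sub>R (c - a) = v *\<^sub>R (b - a) + t *\<^sub>R (c - a)"
    using uvt(5) unfolding u by (simp add: algebra_simps)
  have wl: "wedge (x *\<^sub>R p + y *\<^sub>R q) q = x * wedge p q" "wedge p (x *\<^sub>R p + y *\<^sub>R q) = y * wedge p q" for x y and p q :: "real^2"
    by (simp_all add: wedge_def algebra_simps)
  have "z $ 1 = v" "z $ 2 = t"
    using arg_cong[OF eq, of "\<lambda>x. wedge x (c - a)"] arg_cong[OF eq, of "\<lambda>x. wedge (b - a) x"] w unfolding wl by auto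
  then show "z \<in> std_simplex2" using uvt unfolding std_simplex2_def by auto
qed

text \<open>The triangle is the affine image of the reference triangle, with Jacobian twice the
  area; Fubini there integrates first in the direction b - a, over a range of length 1 - t.\<close>

lemma triangle_integral:
  fixes f :: "real^2 \<Rightarrow> real"
  assumes f: "continuous_on UNIV f" and w: "wedge (b - a) (c - a) \<noteq> 0"
  shows "(LINT x:convex hull {a, b, c}|lborel. f x)
    = \<bar>wedge (b - a) (c - a)\<bar> * (LINT t:{0..1}|lborel. LINT s:{0..1-t}|lborel. f (a + s *\<^sub>R (b - a) + t *\<^sub>R (c - a)))"
proof -
  let ?K = "convex hull {a, b, c}"
  define p where "p = b - a"
  define q where "q = c - a"
  define L where "L = (\<lambda>z::real^2. z $ 1 *\<^sub>R p + z $ 2 *\<^sub>R q)"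
  have L: "linear L" unfolding L_def by (auto simp: linear_iff algebra_simps)
  have detL: "det (matrix L) = wedge p q"
    unfolding det_2 matrix_def L_def wedge_def by (simp add: axis_def)
  have Lc: "continuous_on UNIV L" unfolding L_def by (intro continuous_intros)
  have K: "compact ?K" by (simp add: compact_convex_hull finite_imp_compact)
  have fK: "integrable lborel (\<lambda>x. indicator ?K x *\<^sub>R f x)"
    by (rule borel_integrable_compact[OF K continuous_on_subset[OF f]]) simp
  \<comment> \<open>Shifting the vertex a to the origin leaves a linear map to deal with.\<close>
  define h where "h = (\<lambda>x. indicator ?K (a + x) *\<^sub>R f (a + x))"
  have h: "integrable lborel h" "(\<integral>x. h x \<partial>lborel) = (LINT x:?K|lborel. f x)"
  proof -
    have m: "(+) a \<in> measurable lborel borel" by simp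
    have fm: "(\<lambda>x. indicator ?K x *\<^sub>R f x) \<in> borel_measurable borel" using fK by auto
    show "integrable lborel h"
      using integrable_distr[OF m, of "\<lambda>x. indicator ?K x *\<^sub>R f x"] fK unfolding lborel_distr_plus h_def by simp
    show "(\<integral>x. h x \<partial>lborel) = (LINT x:?K|lborel. f x)"
      using integral_distr[OF m fm] unfolding lborel_distr_plus h_def set_lebesgue_integral_def by simp
  qed
  have S: "compact std_simplex2"
  proof -
    have "std_simplex2 \<subseteq> cbox 0 (vector [1, 1])"
      unfolding std_simplex2_def by (auto simp: mem_box Basis_vec2 inner_axis2)
    then have "bounded std_simplex2" by (rule bounded_subset[OF bounded_cbox])
    moreover have "closed std_simplex2" unfolding std_simplex2_def
      by (intro closed_Collect_conj closed_Collect_le continuous_intros)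
    ultimately show ?thesis by (simp add: compact_eq_bounded_closed)
  qed
  have hL: "h (L z) = indicator std_simplex2 z *\<^sub>R f (a + L z)" for z
    using in_triangle_iff[OF w, of z] unfolding h_def L_def p_def q_def by (simp add: indicator_def add.assoc)
  have fL: "continuous_on UNIV (\<lambda>z. f (a + L z))"
    by (rule continuous_on_compose2[OF f]) (auto intro!: continuous_intros Lc)
  have ihL: "integrable lborel (\<lambda>z. h (L z))"
    unfolding hL by (rule borel_integrable_compact[OF S continuous_on_subset[OF fL]]) simp
  have "(LINT x:?K|lborel. f x) = \<bar>wedge p q\<bar> * (\<integral>z. h (L z) \<partial>lborel)"
    unfolding h(2)[symmetric] detL[symmetric]
    by (rule integral_linear_change2[OF L _ h(1) ihL]) (use w in \<open>simp add: detL p_def q_def\<close>)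
  also have "(\<integral>z. h (L z) \<partial>lborel) = (\<integral>t. (\<integral>s. h (L (vector [s, t])) \<partial>lborel) \<partial>lborel)"
    by (rule integral_vec2[OF ihL])
  also have "\<dots> = (LINT t:{0..1}|lborel. LINT s:{0..1-t}|lborel. f (a + s *\<^sub>R p + t *\<^sub>R q))"
    unfolding set_lebesgue_integral_def
  proof (rule Bochner_Integration.integral_cong[OF refl])
    fix t
    show "(\<integral>s. h (L (vector [s, t])) \<partial>lborel) = indicator {0..1} t *\<^sub>R (\<integral>s. indicator {0..1-t} s *\<^sub>R f (a + s *\<^sub>R p + t *\<^sub>R q) \<partial>lborel)"
    proof (cases "t \<in> {0..1}")
      case True
      then show ?thesis unfolding hL
        by (auto simp: std_simplex2_def L_def indicator_def add.assoc intro!: Bochner_Integration.integral_cong)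
    next
      case False
      then have "h (L (vector [s, t])) = 0" for s unfolding hL by (auto simp: std_simplex2_def indicator_def)
      then show ?thesis using False by simp
    qed
  qed
  finally show ?thesis unfolding p_def q_def .
qed

text \<open>The derivative is taken in the direction of the inner integration variable, so the
  fundamental theorem of calculus applies on each inner line; the end values lie on the side from b
  to c and on the side from a to c.\<close>

lemma triangle_integral_derivative:
  fixes F :: "real^2 \<Rightarrow> real"
  assumes F: "\<And>x. (F has_derivative F' x) (at x)" and c: "continuous_on UNIV (\<lambda>x. F' x (b - a))"
    and w: "wedge (b - a) (c - a) \<noteq> 0"
  shows "(LINT x:convex hull {a, b, c}|lborel. F' x (b - a))
    = \<bar>wedge (b - a) (c - a)\<bar> * ((LINT t:{0..1}|lborel. F (linepath b c t)) - (LINT t:{0..1}|lborel. F (linepath a c t)))"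
proof -
  let ?\<Phi> = "\<lambda>s t. a + s *\<^sub>R (b - a) + t *\<^sub>R (c - a)"
  have Fc: "continuous_on UNIV F"
    using F has_derivative_continuous by (fastforce simp: continuous_on_eq_continuous_within)
  have inner: "(LINT s:{0..1-t}|lborel. F' (?\<Phi> s t) (b - a)) = F (linepath b c t) - F (linepath a c t)"
    if t: "t \<in> {0..1}" for t
  proof -
    have "(LINT s:{0..1-t}|lborel. F' (?\<Phi> s t) (b - a)) = F (?\<Phi> (1 - t) t) - F (?\<Phi> 0 t)"
      unfolding set_lebesgue_integral_def
    proof (rule integral_FTC_atLeastAtMost)
      show "((\<lambda>s. F (?\<Phi> s t)) has_vector_derivative F' (?\<Phi> s t) (b - a)) (at s within {0..1-t})" for s
      proof -
        have "((\<lambda>s. ?\<Phi> s t) has_derivative (\<lambda>h. h *\<^sub>R (b - a))) (at s within {0..1-t})"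
          by (auto intro!: derivative_eq_intros)
        from has_derivative_compose[OF this F]
        have "((\<lambda>s. F (?\<Phi> s t)) has_derivative (\<lambda>h. F' (?\<Phi> s t) (h *\<^sub>R (b - a)))) (at s within {0..1-t})" .
        moreover have "F' (?\<Phi> s t) (h *\<^sub>R (b - a)) = h *\<^sub>R F' (?\<Phi> s t) (b - a)" for h
          using has_derivative_linear[OF F] by (rule linear_scale)
        ultimately show ?thesis unfolding has_vector_derivative_def by simp
      qed
      show "continuous_on {0..1-t} (\<lambda>s. F' (?\<Phi> s t) (b - a))"
        by (rule continuous_on_compose2[OF c]) (auto intro!: continuous_intros)
    qed (use t in auto)
    moreover have "?\<Phi> (1 - t) t = linepath b c t" "?\<Phi> 0 t = linepath a c t"
      by (simp_all add: linepath_def algebra_simps)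
    ultimately show ?thesis by simp
  qed
  have ci: "set_integrable lborel {0..1} (\<lambda>t. F (linepath x y t))" for x y
    by (rule borel_integrable_atLeastAtMost', rule continuous_on_compose2[OF Fc])
      (auto intro!: continuous_on_linepath)
  have "(LINT t:{0..1}|lborel. LINT s:{0..1-t}|lborel. F' (?\<Phi> s t) (b - a))
     = (LINT t:{0..1}|lborel. F (linepath b c t) - F (linepath a c t))"
    by (rule set_lebesgue_integral_cong) (use inner in auto)
  also have "\<dots> = (LINT t:{0..1}|lborel. F (linepath b c t)) - (LINT t:{0..1}|lborel. F (linepath a c t))"
    by (rule set_integral_diff(2)[OF ci ci])
  finally show ?thesis unfolding triangle_integral[OF c w] by simp
qed

section \<open>Edges, facets and outer normals of triangles\<close>

lemma linepath_integral_reverse: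
  "(LINT s:{0..1}|lborel. f (linepath b a s)) = (LINT s:{0..1}|lborel. (f (linepath a b s)::real))"
proof -
  have "(\<integral>s. indicat_real {0..1} s *\<^sub>R f (linepath b a s) \<partial>lborel)
    = \<bar>-1\<bar> *\<^sub>R (\<integral>s. indicat_real {0..1} (1 + -1 * s) *\<^sub>R f (linepath b a (1 + -1 * s)) \<partial>lborel)"
    by (rule lborel_integral_real_affine) simp
  also have "\<dots> = (\<integral>s. indicat_real {0..1} s *\<^sub>R f (linepath a b s) \<partial>lborel)"
    by (simp add: linepath_def indicator_def conj_commute add.commute cong: conj_cong)
  finally show ?thesis unfolding set_lebesgue_integral_def .
qed

text \<open>A segment determines its end points up to order, so the choice in
  \<open>edge_integral\<close> may reverse the parametrisation; the substitution of 1 - s for s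
  shows that the value is the same.\<close>

lemma edge_integral_segment:
  "edge_integral (closed_segment a b) f = dist a b * (LINT s:{0..1}|lborel. f (linepath a b s))"
proof -
  define P where "P = (\<lambda>(x, y). closed_segment a b = closed_segment x y)"
  have "P (SOME z. P z)" by (rule someI[of P "(a, b)"]) (simp add: P_def)
  then obtain x y where xy: "(SOME z. P z) = (x, y)" "{a, b} = {x, y}"
    unfolding P_def by (cases "SOME z. P z") (auto simp: P_def)
  then have "(x = a \<and> y = b) \<or> (x = b \<and> y = a)" by (auto simp: doubleton_eq_iff)
  moreover have "edge_integral (closed_segment a b) f = dist x y * (LINT s:{0..1}|lborel. f (linepath x y s))"
    unfolding edge_integral_def using xy(1) by (simp add: P_def)
  ultimately show ?thesis using linepath_integral_reverse[of f a b] by (auto simp: dist_commute)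
qed

text \<open>If the determinant vanished, c - a would be a multiple of b - a, and c would lie on the
  line through a and b, against affine independence.\<close>

lemma simplex2_vertices:
  fixes K :: "(real^2) set"
  assumes "2 simplex K"
  obtains a b c where "K = convex hull {a, b, c}" "wedge (b - a) (c - a) \<noteq> 0" "\<not> affine_dependent {a, b, c}"
    "a \<noteq> b" "b \<noteq> c" "a \<noteq> c"
proof -
  obtain C where C: "\<not> affine_dependent C" "int (card C) = 2 + 1" "K = convex hull C"
    using assms unfolding simplex_def by auto
  then have "card C = 3" by simp
  then obtain a b c where abc: "C = {a, b, c}" "a \<noteq> b" "b \<noteq> c" "a \<noteq> c"
    by (auto simp: card_3_iff)
  have "wedge (b - a) (c - a) \<noteq> 0"
  proof
    assume z: "wedge (b - a) (c - a) = 0"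
    define p where "p = b - a"
    define q where "q = c - a"
    have "p \<noteq> 0" using abc unfolding p_def by simp
    then have "p $ 1 \<noteq> 0 \<or> p $ 2 \<noteq> 0" by (auto simp: vec_eq_iff forall_2)
    then obtain l where l: "q = l *\<^sub>R p"
    proof
      assume 1: "p $ 1 \<noteq> 0"
      have "q = (q $ 1 / p $ 1) *\<^sub>R p"
        using 1 z unfolding p_def[symmetric] q_def[symmetric] wedge_def by (auto simp: vec_eq_iff forall_2 field_simps)
      then show thesis by (rule that)
    next
      assume 2: "p $ 2 \<noteq> 0"
      have "q = (q $ 2 / p $ 2) *\<^sub>R p"
        using 2 z unfolding p_def[symmetric] q_def[symmetric] wedge_def by (auto simp: vec_eq_iff forall_2 field_simps)
      then show thesis by (rule that)
    qed
    have "c = (1 - l) *\<^sub>R a + l *\<^sub>R b" using l unfolding p_def q_def by (simp add: algebra_simps)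
    then have "c \<in> affine hull {a, b}" unfolding affine_hull_2 by (intro CollectI exI[of _ "1 - l"] exI[of _ l]) simp
    moreover have "C - {c} = {a, b}" using abc by auto
    ultimately show False using C(1) abc(1) unfolding affine_dependent_def by auto
  qed
  then show ?thesis using that C abc by blast
qed

lemma triangle_facets:
  fixes a b c :: "real^2"
  assumes "\<not> affine_dependent {a, b, c}" "a \<noteq> b" "b \<noteq> c" "a \<noteq> c"
  shows "{e. e facet_of convex hull {a, b, c}} = {closed_segment a b, closed_segment b c, closed_segment c a}"
proof -
  have d: "{a, b, c} - {a} = {b, c}" "{a, b, c} - {b} = {c, a}" "{a, b, c} - {c} = {a, b}" using assms by auto
  have g: "(\<exists>u\<in>{a, b, c}. P u) \<longleftrightarrow> P a \<or> P b \<or> P c" for P by auto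
  have "e facet_of convex hull {a, b, c} \<longleftrightarrow> e \<noteq> {} \<and> (\<exists>u\<in>{a, b, c}. e = convex hull ({a, b, c} - {u}))" for e
    unfolding facet_of_convex_hull_affine_independent[OF assms(1)] by blast
  then have *: "e facet_of convex hull {a, b, c} \<longleftrightarrow> e \<noteq> {} \<and> (e = closed_segment b c \<or> e = closed_segment c a \<or> e = closed_segment a b)" for e
    unfolding g d segment_convex_hull .
  have ne: "closed_segment x y \<noteq> {}" for x y :: "real^2" by auto
  show ?thesis
  proof (intro set_eqI iffI)
    fix e assume "e \<in> {e. e facet_of convex hull {a, b, c}}"
    then have "e = closed_segment b c \<or> e = closed_segment c a \<or> e = closed_segment a b"
      unfolding mem_Collect_eq * by (rule conjunct2)
    then show "e \<in> {closed_segment a b, closed_segment b c, closed_segment c a}"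
      unfolding insert_iff empty_iff by argo
  next
    fix e assume "e \<in> {closed_segment a b, closed_segment b c, closed_segment c a}"
    then have "e = closed_segment b c \<or> e = closed_segment c a \<or> e = closed_segment a b"
      unfolding insert_iff empty_iff by argo
    then show "e \<in> {e. e facet_of convex hull {a, b, c}}"
      unfolding mem_Collect_eq * using ne by metis
  qed
qed

text \<open>The counterclockwise quarter turn, by which the determinant becomes an inner
  product.\<close>

definition rot :: "real^2 \<Rightarrow> real^2" where "rot p = vector [- p $ 2, p $ 1]"

lemma inner_rot: "q \<bullet> rot p = wedge p q"
  by (simp add: rot_def inner_vec_def wedge_def UNIV_2)

lemma norm_rot: "norm (rot p) = norm p"
  by (simp add: norm_eq_sqrt_inner rot_def inner_vec_def UNIV_2 add.commute)

lemma wedge_self: "wedge p p = 0" by (simp add: wedge_def)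

text \<open>The quarter turn of b - a is perpendicular to the edge, and its product with c - a is
  the determinant, so the sign makes the vector point away from c. Conversely, testing the defining
  inequality at both end points forces any candidate to be perpendicular to the edge; its length and
  the vertex c then fix the multiple.\<close>

lemma outer_normal_triangle:
  assumes w: "wedge (b - a) (c - a) \<noteq> 0"
  shows "outer_normal (convex hull {a, b, c}) (closed_segment a b) = (- sgn (wedge (b - a) (c - a)) / dist a b) *\<^sub>R rot (b - a)"
proof -
  define p where "p = b - a"
  define q where "q = c - a"
  define \<omega> where "\<omega> = wedge p q"
  have \<omega>: "\<omega> \<noteq> 0" using w unfolding \<omega>_def p_def q_def .
  then have p0: "p \<noteq> 0" unfolding \<omega>_def wedge_def by auto
  have d: "dist a b = norm p" unfolding p_def by (simp add: dist_norm norm_minus_commute)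
  define n where "n = (- sgn \<omega> / norm p) *\<^sub>R rot p"
  have np: "n \<bullet> p = 0" unfolding n_def by (simp add: inner_commute[of _ p] inner_rot wedge_self)
  have nq: "n \<bullet> q = - \<bar>\<omega>\<bar> / norm p"
    unfolding n_def by (simp add: inner_commute[of _ q] inner_rot \<omega>_def[symmetric] abs_sgn)
  show ?thesis unfolding p_def[symmetric] q_def[symmetric] \<omega>_def[symmetric] d n_def[symmetric] outer_normal_def
  proof (rule the_equality)
    show "norm n = 1 \<and> (\<forall>x\<in>closed_segment a b. \<forall>y\<in>convex hull {a, b, c}. n \<bullet> (y - x) \<le> 0)"
    proof (intro conjI ballI)
      show "norm n = 1" unfolding n_def using p0 \<omega> by (simp add: norm_rot sgn_real_def)
      fix x y assume x: "x \<in> closed_segment a b" and y: "y \<in> convex hull {a, b, c}"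
      obtain u where u: "x = (1 - u) *\<^sub>R a + u *\<^sub>R b" using x by (auto simp: in_segment)
      obtain u1 v1 t where y': "0 \<le> u1" "0 \<le> v1" "0 \<le> t" "u1 + v1 + t = 1" "y = u1 *\<^sub>R a + v1 *\<^sub>R b + t *\<^sub>R c"
        using y unfolding convex_hull_3 by auto
      have u1: "u1 = 1 - v1 - t" using y'(4) by simp
      have "y - x = (v1 - u) *\<^sub>R p + t *\<^sub>R q" unfolding y'(5) u u1 p_def q_def by (simp add: algebra_simps)
      then have "n \<bullet> (y - x) = t * (- \<bar>\<omega>\<bar> / norm p)" by (simp add: inner_add_right np nq)
      also have "\<dots> \<le> 0" using y'(3) by (simp add: mult_nonneg_nonneg)
      finally show "n \<bullet> (y - x) \<le> 0" .
    qed
    fix m :: "real^2" assume m: "norm m = 1 \<and> (\<forall>x\<in>closed_segment a b. \<forall>y\<in>convex hull {a, b, c}. m \<bullet> (y - x) \<le> 0)"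
    have verts: "a \<in> convex hull {a, b, c}" "b \<in> convex hull {a, b, c}" "c \<in> convex hull {a, b, c}"
      by (auto intro: hull_inc)
    have "m \<bullet> (b - a) \<le> 0" "m \<bullet> (a - b) \<le> 0" and mq: "m \<bullet> q \<le> 0"
      using m verts unfolding q_def by auto
    then have mp: "m \<bullet> p = 0" unfolding p_def by (simp add: inner_diff_right)
    define \<mu> where "\<mu> = (m \<bullet> rot p) / (norm p)\<^sup>2"
    have pp: "(norm p)\<^sup>2 = p $ 1 * p $ 1 + p $ 2 * p $ 2"
      by (simp add: power2_norm_eq_inner inner_vec_def UNIV_2)
    have pp0: "(norm p)\<^sup>2 \<noteq> 0" using p0 by simp
    have mp': "m $ 1 * p $ 1 + m $ 2 * p $ 2 = 0" using mp by (simp add: inner_vec_def UNIV_2)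
    have "(norm p)\<^sup>2 *\<^sub>R m = (m \<bullet> rot p) *\<^sub>R rot p"
    proof -
      have "(p $ 1 * p $ 1 + p $ 2 * p $ 2) * m $ 1 = (m $ 2 * p $ 1 - m $ 1 * p $ 2) * (- p $ 2)" using mp' by algebra
      moreover have "(p $ 1 * p $ 1 + p $ 2 * p $ 2) * m $ 2 = (m $ 2 * p $ 1 - m $ 1 * p $ 2) * p $ 1" using mp' by algebra
      ultimately show ?thesis unfolding pp
        by (simp add: vec_eq_iff forall_2 rot_def inner_vec_def UNIV_2 algebra_simps)
    qed
    then have "(1 / (norm p)\<^sup>2) *\<^sub>R ((norm p)\<^sup>2 *\<^sub>R m) = (1 / (norm p)\<^sup>2) *\<^sub>R ((m \<bullet> rot p) *\<^sub>R rot p)" by simp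
    then have m_eq: "m = \<mu> *\<^sub>R rot p" using pp0 unfolding \<mu>_def by simp
    have "\<mu> * \<omega> \<le> 0" using mq unfolding m_eq by (simp add: inner_commute[of _ q] inner_rot \<omega>_def)
    moreover have "\<bar>\<mu>\<bar> * norm p = 1" using m unfolding m_eq by (simp add: norm_rot)
    ultimately have "\<mu> = - sgn \<omega> / norm p" using \<omega> p0
      by (auto simp: sgn_real_def field_simps mult_le_0_iff abs_if split: if_splits)
    then show "m = n" unfolding n_def m_eq by simp
  qed
qed

lemma edge_integral_cmult: "edge_integral e (\<lambda>x. c * f x) = c * edge_integral e f"
  unfolding edge_integral_def by (simp add: case_prod_unfold Let_def)

text \<open>The length of the edge cancels the normalisation of the normal, so the flux is linear in
  the edge vector.\<close>

lemma edge_flux: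
  assumes "wedge (b - a) (c - a) \<noteq> 0"
  shows "edge_integral (closed_segment a b) (\<lambda>x. F x * (v \<bullet> outer_normal (convex hull {a, b, c}) (closed_segment a b)))
    = - sgn (wedge (b - a) (c - a)) * wedge (b - a) v * (LINT s:{0..1}|lborel. F (linepath a b s))"
proof -
  have "a \<noteq> b" using assms by (auto simp: wedge_def)
  then show ?thesis
    unfolding mult.commute[of "F _"] edge_integral_cmult edge_integral_segment outer_normal_triangle[OF assms]
    by (simp add: inner_rot)
qed

section \<open>Gauss formula on one triangle\<close>

lemma continuous_set_integrable:
  fixes f :: "real^2 \<Rightarrow> real"
  assumes "continuous_on UNIV f" "compact K" shows "set_integrable lborel K f"
  unfolding set_integrable_def
  by (rule borel_integrable_compact[OF assms(2) continuous_on_subset[OF assms(1)]]) simp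

text \<open>Both sides are combinations of the averages of F over the three edges. On the left v is
  resolved along the two sides p and q and \<open>triangle_integral_derivative\<close> is used for
  each; on the right the third edge vector is q - p.\<close>

lemma triangle_gauss:
  fixes F :: "real^2 \<Rightarrow> real"
  assumes K: "2 simplex K"
    and F: "\<And>x. (F has_derivative F' x) (at x)" and c: "\<And>v. continuous_on UNIV (\<lambda>x. F' x v)"
  shows "(LINT x:K|lborel. F' x v) = boundary_integral K (\<lambda>e x. F x * (v \<bullet> outer_normal K e))"
proof -
  obtain a b c' where abc: "K = convex hull {a, b, c'}" "wedge (b - a) (c' - a) \<noteq> 0" "\<not> affine_dependent {a, b, c'}"
    "a \<noteq> b" "b \<noteq> c'" "a \<noteq> c'"
    using simplex2_vertices[OF K] by blast
  define p where "p = b - a"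
  define q where "q = c' - a"
  define \<omega> where "\<omega> = wedge p q"
  have \<omega>: "\<omega> \<noteq> 0" using abc unfolding \<omega>_def p_def q_def by simp
  have cK: "compact K" unfolding abc(1) by (simp add: compact_convex_hull finite_imp_compact)
  let ?I = "\<lambda>x y. LINT s:{0..1}|lborel. F (linepath x y s)"
  \<comment> \<open>The determinant is invariant under cyclic relabelling of the vertices and
    changes sign under an exchange, so all edges share one orientation factor.\<close>
  have wr: "wedge (c' - b) (a - b) = \<omega>" "wedge (a - c') (b - c') = \<omega>" "wedge (b - a) (c' - a) = \<omega>" "wedge (c' - a) (b - a) = - \<omega>"
    unfolding \<omega>_def p_def q_def wedge_def by (simp_all add: algebra_simps)
  have hull: "convex hull {b, c', a} = K" "convex hull {c', a, b} = K" "convex hull {a, c', b} = K"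
    unfolding abc(1) by (simp_all add: insert_commute)
  have dist3: "closed_segment a b \<noteq> closed_segment b c'" "closed_segment a b \<noteq> closed_segment c' a" "closed_segment b c' \<noteq> closed_segment c' a"
    using abc by (auto simp: doubleton_eq_iff)
  have "boundary_integral K (\<lambda>e x. F x * (v \<bullet> outer_normal K e))
    = (\<Sum>e\<in>{closed_segment a b, closed_segment b c', closed_segment c' a}. edge_integral e (\<lambda>x. F x * (v \<bullet> outer_normal K e)))"
    unfolding boundary_integral_def triangle_facets[OF abc(3-6), folded abc(1)] ..
  also have "\<dots> = edge_integral (closed_segment a b) (\<lambda>x. F x * (v \<bullet> outer_normal K (closed_segment a b)))
     + edge_integral (closed_segment b c') (\<lambda>x. F x * (v \<bullet> outer_normal K (closed_segment b c')))
     + edge_integral (closed_segment c' a) (\<lambda>x. F x * (v \<bullet> outer_normal K (closed_segment c' a)))"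
    using dist3 by (simp add: add.assoc)
  also have "\<dots> = - sgn \<omega> * (wedge (b - a) v * ?I a b + wedge (c' - b) v * ?I b c' + wedge (a - c') v * ?I c' a)"
    using edge_flux[of b a c' F v] edge_flux[of c' b a F v] edge_flux[of a c' b F v] \<omega>
    unfolding wr hull abc(1)[symmetric] by (simp add: algebra_simps)
  also have "\<dots> = sgn \<omega> * (wedge v q * (?I b c' - ?I a c') + wedge p v * (?I c' b - ?I a b))"
    unfolding linepath_integral_reverse[of F b c'] linepath_integral_reverse[of F a c']
    by (simp add: p_def q_def wedge_def algebra_simps)
  finally have rhs: "boundary_integral K (\<lambda>e x. F x * (v \<bullet> outer_normal K e))
     = sgn \<omega> * (wedge v q * (?I b c' - ?I a c') + wedge p v * (?I c' b - ?I a b))" .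
  have v: "v = (wedge v q / \<omega>) *\<^sub>R p + (wedge p v / \<omega>) *\<^sub>R q"
    unfolding \<omega>_def by (rule wedge_coords) (use \<omega> in \<open>simp add: \<omega>_def\<close>)
  have F'v: "F' x v = (wedge v q / \<omega>) * F' x p + (wedge p v / \<omega>) * F' x q" for x
  proof -
    have "F' x v = F' x ((wedge v q / \<omega>) *\<^sub>R p + (wedge p v / \<omega>) *\<^sub>R q)" using v by simp
    also have "\<dots> = (wedge v q / \<omega>) * F' x p + (wedge p v / \<omega>) * F' x q"
      using has_derivative_linear[OF F[of x]] by (simp add: linear_add linear_scale)
    finally show ?thesis .
  qed
  note si = continuous_set_integrable[OF c cK]
  have "(LINT x:K|lborel. F' x v) = (wedge v q / \<omega>) * (LINT x:K|lborel. F' x p) + (wedge p v / \<omega>) * (LINT x:K|lborel. F' x q)"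
    unfolding F'v using si by (subst set_integral_add) auto
  also have "(LINT x:K|lborel. F' x p) = \<bar>\<omega>\<bar> * (?I b c' - ?I a c')"
    using triangle_integral_derivative[OF F c abc(2)] unfolding abc(1)[symmetric] wr p_def .
  also have "(LINT x:K|lborel. F' x q) = \<bar>\<omega>\<bar> * (?I c' b - ?I a b)"
    using triangle_integral_derivative[OF F c, of c' a b] \<omega> unfolding wr hull q_def by simp
  finally have lhs: "(LINT x:K|lborel. F' x v) = wedge v q / \<omega> * (\<bar>\<omega>\<bar> * (?I b c' - ?I a c')) + wedge p v / \<omega> * (\<bar>\<omega>\<bar> * (?I c' b - ?I a b))" .
  have "y / \<omega> * (\<bar>\<omega>\<bar> * D) = sgn \<omega> * (y * D)" for y D
    using \<omega> by (cases "\<omega> > 0") (auto simp: sgn_real_def)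
  then show ?thesis unfolding lhs rhs by (simp add: distrib_left)
qed

text \<open>Continuity of the derivative is demanded direction by direction, the form in which
  \<open>gradient\<close> and \<open>divergence\<close> evaluate it.\<close>

definition C1_field :: "(real^2 \<Rightarrow> 'b::real_normed_vector) \<Rightarrow> bool" where
  "C1_field f \<longleftrightarrow> (\<exists>f'. \<forall>x. (f has_derivative f' x) (at x) \<and> (\<forall>v. continuous_on UNIV (\<lambda>x. f' x v)))"

lemma C1_fieldE:
  assumes "C1_field f"
  shows "(f has_derivative frechet_derivative f (at x)) (at x)"
    "continuous_on UNIV (\<lambda>x. frechet_derivative f (at x) v)" "continuous_on UNIV f"
proof -
  obtain f' where f': "\<And>x. (f has_derivative f' x) (at x)" "\<And>v. continuous_on UNIV (\<lambda>x. f' x v)"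
    using assms unfolding C1_field_def by blast
  have "frechet_derivative f (at x) = f' x" for x using frechet_derivative_at[OF f'(1)] by simp
  then show "(f has_derivative frechet_derivative f (at x)) (at x)"
    "continuous_on UNIV (\<lambda>x. frechet_derivative f (at x) v)" using f' by simp_all
  show "continuous_on UNIV f"
    using f'(1) has_derivative_continuous by (fastforce simp: continuous_on_eq_continuous_within)
qed

lemma edge_integral_sum:
  assumes "finite I" "\<And>i. i \<in> I \<Longrightarrow> continuous_on UNIV (f i)"
  shows "edge_integral e (\<lambda>x. \<Sum>i\<in>I. f i x) = (\<Sum>i\<in>I. edge_integral e (f i))"
proof -
  have "set_integrable lborel {0..1} (\<lambda>s. f i (linepath a b s))" if "i \<in> I" for i a b
    by (rule borel_integrable_atLeastAtMost', rule continuous_on_compose2[OF assms(2)[OF that]])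
      (auto intro!: continuous_on_linepath)
  then have "(LINT s:{0..1}|lborel. \<Sum>i\<in>I. f i (linepath a b s)) = (\<Sum>i\<in>I. LINT s:{0..1}|lborel. f i (linepath a b s))" for a b
    unfolding set_lebesgue_integral_def set_integrable_def by (simp add: sum_distrib_left)
  then show ?thesis unfolding edge_integral_def by (simp add: case_prod_unfold Let_def sum_distrib_left)
qed

lemma edge_integral_nonneg: "(\<And>x. 0 \<le> f x) \<Longrightarrow> 0 \<le> edge_integral e f"
  unfolding edge_integral_def set_lebesgue_integral_def
  by (auto simp: case_prod_unfold Let_def intro!: mult_nonneg_nonneg Bochner_Integration.integral_nonneg)

text \<open>The left side is the integral of the divergence of E U, by the product rule.
  \<open>triangle_gauss\<close> is applied to each component of E U in its own coordinate
  direction.\<close>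

lemma triangle_gauss_product:
  fixes E :: "real^2 \<Rightarrow> real" and U :: "real^2 \<Rightarrow> real^2"
  assumes K: "2 simplex K" and E: "C1_field E" and U: "C1_field U"
  shows "(LINT x:K|lborel. U x \<bullet> gradient E x) + (LINT x:K|lborel. E x * divergence U x)
    = boundary_integral K (\<lambda>e x. E x * (U x \<bullet> outer_normal K e))"
proof -
  let ?E' = "\<lambda>x. frechet_derivative E (at x)" and ?U' = "\<lambda>x. frechet_derivative U (at x)"
  note E' = C1_fieldE[OF E] and U' = C1_fieldE[OF U]
  define F' where "F' = (\<lambda>b x h. E x * (?U' x h \<bullet> b) + ?E' x h * (U x \<bullet> b))"
  have der: "((\<lambda>x. E x * (U x \<bullet> b)) has_derivative F' b x) (at x)" for b x
    unfolding F'_def by (auto intro!: derivative_eq_intros E'(1) U'(1))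
  have con: "continuous_on UNIV (\<lambda>x. F' b x v)" for b v
    unfolding F'_def by (intro continuous_intros E' U')
  have cK: "compact K" using simplex2_vertices[OF K] by (metis compact_convex_hull finite.emptyI finite.insertI finite_imp_compact)
  have s1: "(\<Sum>b\<in>Basis. F' b x b) = U x \<bullet> gradient E x + E x * divergence U x" for x
    unfolding F'_def gradient_def divergence_def
    by (simp add: sum.distrib inner_sum_right sum_distrib_left add.commute)
  have cU: "continuous_on UNIV (\<lambda>x. U x \<bullet> gradient E x)" "continuous_on UNIV (\<lambda>x. E x * divergence U x)"
    unfolding gradient_def divergence_def by (intro continuous_intros E' U')+
  have "(LINT x:K|lborel. U x \<bullet> gradient E x) + (LINT x:K|lborel. E x * divergence U x)
     = (LINT x:K|lborel. \<Sum>b\<in>Basis. F' b x b)"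
    unfolding s1 by (rule set_integral_add(2)[symmetric]) (rule continuous_set_integrable[OF _ cK], rule cU)+
  also have "\<dots> = (\<Sum>b\<in>Basis. LINT x:K|lborel. F' b x b)"
    using continuous_set_integrable[OF con cK]
    unfolding set_lebesgue_integral_def set_integrable_def scaleR_sum_right
    by (intro Bochner_Integration.integral_sum)
  also have "\<dots> = (\<Sum>b\<in>Basis. boundary_integral K (\<lambda>e x. E x * (U x \<bullet> b) * (b \<bullet> outer_normal K e)))"
    by (intro sum.cong refl triangle_gauss[OF K der con])
  also have "\<dots> = boundary_integral K (\<lambda>e x. \<Sum>b\<in>Basis. E x * (U x \<bullet> b) * (b \<bullet> outer_normal K e))"
    unfolding boundary_integral_def
    by (subst sum.swap, intro sum.cong refl edge_integral_sum[symmetric]) (auto intro!: continuous_intros E' U')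
  also have "(\<lambda>e x. \<Sum>b\<in>Basis. E x * (U x \<bullet> b) * (b \<bullet> outer_normal K e)) = (\<lambda>e x. E x * (U x \<bullet> outer_normal K e))"
    by (intro ext) (simp add: euclidean_inner[of "U _"] sum_distrib_left inner_commute mult.assoc)
  finally show ?thesis .
qed

section \<open>Edge pairing and energy dissipation\<close>

lemma edge_integral_add:
  assumes "continuous_on UNIV f" "continuous_on UNIV g"
  shows "edge_integral e (\<lambda>x. f x + g x) = edge_integral e f + edge_integral e g"
  using edge_integral_sum[of "{True, False}" "\<lambda>b. if b then f else g" e] assms by simp

lemma edge_integral_translate:
  assumes "e = closed_segment a b"
  shows "edge_integral (translate v e) f = edge_integral e (\<lambda>x. f (v + x))"
proof -
  have "linepath (v + a) (v + b) s = v + linepath a b s" for s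
    by (simp add: linepath_def algebra_simps)
  then show ?thesis
    unfolding assms closed_segment_translation[symmetric] edge_integral_segment by simp
qed

text \<open>Relabelling puts the given edge first, the position in which
  \<open>outer_normal_triangle\<close> computes the normal.\<close>

lemma triangle_facet:
  fixes K e :: "(real^2) set"
  assumes K: "2 simplex K" and e: "e facet_of K"
  obtains a b c where "K = convex hull {a, b, c}" "e = closed_segment a b" "wedge (b - a) (c - a) \<noteq> 0"
    "\<not> affine_dependent {a, b, c}" "a \<noteq> b" "b \<noteq> c" "a \<noteq> c"
proof -
  obtain a b c where abc: "K = convex hull {a, b, c}" "wedge (b - a) (c - a) \<noteq> 0" "\<not> affine_dependent {a, b, c}"
    "a \<noteq> b" "b \<noteq> c" "a \<noteq> c"
    using simplex2_vertices[OF K] by blast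
  have wr: "wedge (c - b) (a - b) = wedge (b - a) (c - a)" "wedge (a - c) (b - c) = wedge (b - a) (c - a)"
    unfolding wedge_def by (simp_all add: algebra_simps)
  have perm: "{b, c, a} = {a, b, c}" "{c, a, b} = {a, b, c}" by auto
  have "e \<in> {closed_segment a b, closed_segment b c, closed_segment c a}"
    using e unfolding triangle_facets[OF abc(3-6), folded abc(1), symmetric] by simp
  then consider "e = closed_segment a b" | "e = closed_segment b c" | "e = closed_segment c a" by auto
  then show ?thesis
  proof cases
    case 1 show ?thesis by (rule that[OF abc(1) 1 abc(2-6)])
  next
    case 2 show ?thesis by (rule that[of b c a]) (use abc 2 in \<open>simp_all only: perm wr not_sym, simp_all\<close>)
  next
    case 3 show ?thesis by (rule that[of c a b]) (use abc 3 in \<open>simp_all only: perm wr not_sym, simp_all\<close>)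
  qed
qed

lemma finite_triangle_facets:
  fixes K :: "(real^2) set"
  assumes "2 simplex K" shows "finite {e. e facet_of K}"
proof -
  obtain a b c where abc: "K = convex hull {a, b, c}" "\<not> affine_dependent {a, b, c}" "a \<noteq> b" "b \<noteq> c" "a \<noteq> c"
    using simplex2_vertices[OF assms] by metis
  show ?thesis unfolding abc(1) triangle_facets[OF abc(2-5)] by simp
qed

lemma simplex_translate:
  assumes "2 simplex K" shows "2 simplex (translate v K)"
proof -
  obtain C where C: "\<not> affine_dependent C" "int (card C) = 2 + 1" "K = convex hull C"
    using assms unfolding simplex_def by auto
  have "\<not> affine_dependent ((+) v ` C)" using C(1) by (simp add: affine_dependent_translation_eq[symmetric])
  moreover have "int (card ((+) v ` C)) = 2 + 1" using C(2) by (simp add: card_image)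
  moreover have "translate v K = convex hull ((+) v ` C)" unfolding C(3) by (simp add: convex_hull_translation)
  ultimately show ?thesis unfolding simplex_def by blast
qed

lemma translate_translate: "translate v (translate w S) = translate (v + w) S"
  by (auto simp: image_image add.assoc)

lemma translate_cancel: "translate v (translate (- v) S) = S" "translate (- v) (translate v S) = S"
  unfolding translate_translate by simp_all

lemma facet_of_translate: "translate v e facet_of translate v K \<longleftrightarrow> e facet_of K"
  unfolding facet_of_def by (simp add: aff_dim_translation_eq)

lemma outer_normal_translate: "outer_normal (translate v K) (translate v e) = outer_normal K e"
  unfolding outer_normal_def by simp

lemma triangle_interior_point:
  fixes a b c :: "real^2"
  assumes "\<not> affine_dependent {a, b, c}" "a \<noteq> b" "b \<noteq> c" "a \<noteq> c" "0 < s" "0 < t" "s + t < 1"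
  shows "a + s *\<^sub>R (b - a) + t *\<^sub>R (c - a) \<in> rel_interior (convex hull {a, b, c})"
proof -
  define u where "u = (\<lambda>x. if x = a then 1 - s - t else if x = b then s else t)"
  have "sum u {a, b, c} = 1" "(\<Sum>x\<in>{a, b, c}. u x *\<^sub>R x) = a + s *\<^sub>R (b - a) + t *\<^sub>R (c - a)"
    using assms by (auto simp: u_def algebra_simps)
  moreover have "\<forall>x\<in>{a, b, c}. 0 < u x" using assms unfolding u_def by auto
  ultimately show ?thesis unfolding rel_interior_convex_hull_explicit[OF assms(1)] by blast
qed

text \<open>Points close to the midpoint of the common edge, on the side of both apexes, are
  interior to both triangles.\<close>

lemma same_side_overlap:
  fixes a b c c' :: "real^2"
  assumes i: "\<not> affine_dependent {a, b, c}" "a \<noteq> b" "b \<noteq> c" "a \<noteq> c"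
    and i': "\<not> affine_dependent {a, b, c'}" "b \<noteq> c'" "a \<noteq> c'"
    and w: "0 < wedge (b - a) (c - a) * wedge (b - a) (c' - a)"
  shows "rel_interior (convex hull {a, b, c}) \<inter> rel_interior (convex hull {a, b, c'}) \<noteq> {}"
proof -
  define p where "p = b - a"
  define l where "l = wedge (c - a) (c' - a) / wedge p (c' - a)"
  \<comment> \<open>l and m are the coordinates of c - a along the edge and along c' - a; m > 0
    expresses that both apexes lie on the same side.\<close>
  define m where "m = wedge p (c - a) / wedge p (c' - a)"
  have w': "wedge p (c' - a) \<noteq> 0" using w unfolding p_def by auto
  have q: "c - a = l *\<^sub>R p + m *\<^sub>R (c' - a)" unfolding l_def m_def by (rule wedge_coords[OF w'])
  have m0: "0 < m" unfolding m_def using w unfolding p_def[symmetric] by (auto simp: zero_less_mult_iff intro: divide_neg_neg)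
  \<comment> \<open>With d = 1/(4 k) the change from one coordinate system to the other moves the
    coordinate along the edge by at most 1/4 from 1/2, which keeps it positive and the coordinate
    sum below 1.\<close>
  define k where "k = 1 + \<bar>l\<bar> + m"
  define d where "d = 1 / (4 * k)"
  have k: "0 < k" "1 \<le> k" "\<bar>l\<bar> + m \<le> k" unfolding k_def using m0 by auto
  have d: "0 < d" "d \<le> 1/4" "d * (\<bar>l\<bar> + m) \<le> 1/4" "d * (1 + \<bar>l\<bar>) \<le> 1/4"
    using k m0 unfolding d_def k_def by (auto simp: field_simps)
  define z where "z = a + ((1 - d)/2) *\<^sub>R (b - a) + d *\<^sub>R (c - a)"
  have "0 < (1 - d)/2" "(1 - d)/2 + d < 1" using d(1,2) by (simp_all add: field_simps)
  then have "z \<in> rel_interior (convex hull {a, b, c})"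
    unfolding z_def by (intro triangle_interior_point[OF i] d(1))
  moreover have "z = a + ((1 - d)/2 + d * l) *\<^sub>R (b - a) + (d * m) *\<^sub>R (c' - a)"
    unfolding z_def q p_def by (simp add: algebra_simps)
  moreover have "a + ((1 - d)/2 + d * l) *\<^sub>R (b - a) + (d * m) *\<^sub>R (c' - a) \<in> rel_interior (convex hull {a, b, c'})"
  proof (rule triangle_interior_point[OF i'(1) i(2) i'(2,3)])
    have dl: "\<bar>d * l\<bar> = d * \<bar>l\<bar>" using d by (simp add: abs_mult)
    have "- (d * \<bar>l\<bar>) \<le> d * l" "d * l \<le> d * \<bar>l\<bar>" using dl by linarith+
    moreover have "d * \<bar>l\<bar> + d * m \<le> 1/4" "d + d * \<bar>l\<bar> \<le> 1/4" using d(3,4) by (simp_all add: distrib_left)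
    moreover have "(1 - d)/2 = 1/2 - d/2" by (simp add: field_simps)
    moreover have "0 \<le> d * m" "0 \<le> d * \<bar>l\<bar>" using d(1) m0 by simp_all
    ultimately show "0 < (1 - d)/2 + d * l" "(1 - d)/2 + d * l + d * m < 1"
      using d(1,2) by argo+
  qed (use d m0 in simp)
  ultimately show ?thesis by auto
qed

lemma aff_dim_triangle:
  assumes "2 simplex K" shows "aff_dim K = 2" "K \<noteq> {}" "convex K"
proof -
  obtain C where C: "\<not> affine_dependent C" "int (card C) = 2 + 1" "K = convex hull C"
    using assms unfolding simplex_def by auto
  show "aff_dim K = 2" unfolding C(3) aff_dim_convex_hull using aff_dim_affine_independent[OF C(1)] C(2) by simp
  then show "K \<noteq> {}" by auto
  show "convex K" unfolding C(3) by simp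
qed

section \<open>Neighbours across periodic edges\<close>

context periodic_mesh
begin

lemma lattice_uminus: "v \<in> \<Lambda> \<Longrightarrow> - v \<in> \<Lambda>"
proof -
  assume v: "v \<in> \<Lambda>"
  obtain p q where \<Lambda>: "\<Lambda> = {of_int m *\<^sub>R p + of_int n *\<^sub>R q | m n. True}"
    using lattice unfolding period_lattice_def by blast
  obtain m n where "v = of_int m *\<^sub>R p + of_int n *\<^sub>R q" using v unfolding \<Lambda> by blast
  then have "- v = of_int (- m) *\<^sub>R p + of_int (- n) *\<^sub>R q" by simp
  then show ?thesis unfolding \<Lambda> by blast
qed

lemma neighbour_props:
  assumes "K \<in> Th" "e facet_of K" "neighbour \<Lambda> Th K e = (K', v)"
  shows "K' \<in> Th" "v \<in> \<Lambda>" "(K', v) \<noteq> (K, 0)" "e facet_of translate v K'"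
  using theI'[OF two_neighbours[OF assms(1,2)]] assms(3) unfolding neighbour_def by auto

lemma neighbour_eqI:
  assumes "K \<in> Th" "e facet_of K" "K' \<in> Th" "v \<in> \<Lambda>" "(K', v) \<noteq> (K, 0)" "e facet_of translate v K'"
  shows "neighbour \<Lambda> Th K e = (K', v)"
  unfolding neighbour_def
  by (rule the1_equality[OF two_neighbours[OF assms(1,2)]]) (use assms in auto)

text \<open>Shifting the configuration by - v moves the neighbour to its own place and K to the
  other side of the edge; uniqueness of the neighbour identifies K there.\<close>

lemma neighbour_sym:
  assumes K: "K \<in> Th" and e: "e facet_of K" and nb: "neighbour \<Lambda> Th K e = (K', v)"
  shows "translate (- v) e facet_of K'" "neighbour \<Lambda> Th K' (translate (- v) e) = (K, - v)"
proof -
  note p = neighbour_props[OF K e nb]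
  have "translate (- v) e facet_of translate (- v) (translate v K')"
    using p(4) unfolding facet_of_translate .
  then show f: "translate (- v) e facet_of K'" unfolding translate_cancel .
  show "neighbour \<Lambda> Th K' (translate (- v) e) = (K, - v)"
  proof (rule neighbour_eqI[OF p(1) f K lattice_uminus[OF p(2)]])
    show "(K, - v) \<noteq> (K', 0)" using p(3) by auto
    show "translate (- v) e facet_of translate (- v) K" using e unfolding facet_of_translate .
  qed
qed

text \<open>If the two cells lay on the same side of \<open>e\<close>, their interiors would meet, and then conformity
  would force them to coincide.\<close>

lemma minus_normal_eq:
  assumes K: "K \<in> Th" and e: "e facet_of K"
  shows "minus_normal \<Lambda> Th K e = - outer_normal K e"
proof -
  obtain K' v where nb: "neighbour \<Lambda> Th K e = (K', v)" by fastforce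
  note p = neighbour_props[OF K e nb]
  define L where "L = translate v K'"
  have sK: "2 simplex K" and sK': "2 simplex K'" using cells_triangle K p(1) by auto
  have sL: "2 simplex L" unfolding L_def by (rule simplex_translate[OF sK'])
  have eL: "e facet_of L" using p(4) unfolding L_def .
  obtain a b c where abc: "K = convex hull {a, b, c}" "e = closed_segment a b" "wedge (b - a) (c - a) \<noteq> 0"
    "\<not> affine_dependent {a, b, c}" "a \<noteq> b" "b \<noteq> c" "a \<noteq> c"
    using triangle_facet[OF sK e] by blast
  obtain a' b' c' where abc': "L = convex hull {a', b', c'}" "e = closed_segment a' b'" "wedge (b' - a') (c' - a') \<noteq> 0"
    "\<not> affine_dependent {a', b', c'}" "a' \<noteq> b'" "b' \<noteq> c'" "a' \<noteq> c'"
    using triangle_facet[OF sL eL] by blast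
  have ab: "{a, b} = {a', b'}" using abc(2) abc'(2) by simp
  then have abL: "{a', b', c'} = {a, b, c'}" by auto
  have L: "L = convex hull {a, b, c'}" "\<not> affine_dependent {a, b, c'}"
    using abc'(1,4) unfolding abL by auto
  have cc: "b \<noteq> c'" "a \<noteq> c'" using ab abc' by (auto simp: doubleton_eq_iff)
  have w': "wedge (b - a) (c' - a) \<noteq> 0"
  proof -
    have "(a' = a \<and> b' = b) \<or> (a' = b \<and> b' = a)" using ab by (auto simp: doubleton_eq_iff)
    moreover have "wedge (a - b) (c' - b) = - wedge (b - a) (c' - a)" by (simp add: wedge_def algebra_simps)
    ultimately show ?thesis using abc'(3) by auto
  qed
  have "\<not> 0 < wedge (b - a) (c - a) * wedge (b - a) (c' - a)"
  proof
    assume "0 < wedge (b - a) (c - a) * wedge (b - a) (c' - a)"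
    from same_side_overlap[OF abc(4-7) L(2) cc this]
    have ov: "rel_interior K \<inter> rel_interior L \<noteq> {}" unfolding abc(1) L(1) .
    have f: "(K \<inter> L) face_of K" "(K \<inter> L) face_of L" using conforming[OF K p(1,2)] unfolding L_def by auto
    have "rel_interior K \<subseteq> K" "rel_interior L \<subseteq> L" by (rule rel_interior_subset)+
    then have "K \<inter> L = K" "K \<inter> L = L"
      using face_of_disjoint_rel_interior[OF f(1)] face_of_disjoint_rel_interior[OF f(2)] ov by blast+
    then have KL: "K = L" by blast
    show False
    \<comment> \<open>With v = 0 the neighbour would be K itself, which its definition excludes;
      with v nonzero the interior of K would lie in D and in a translate of D.\<close>
    proof (cases "v = 0")
      case True then show False using KL p(3) unfolding L_def by simp
    next
      case False
      have "interior K \<subseteq> interior D" using K D_eq by (intro interior_mono) auto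
      moreover have "interior K \<subseteq> interior (translate v D)"
        unfolding KL L_def using p(1) D_eq by (intro interior_mono image_mono) auto
      ultimately have "interior K = {}" using D_disjoint[OF p(2) False] by blast
      moreover have "interior K = rel_interior K" using aff_dim_triangle(1)[OF sK] by (intro interior_rel_interior[symmetric]) simp
      ultimately show False using aff_dim_triangle(2,3)[OF sK] by (simp add: rel_interior_eq_empty)
    qed
  qed
  then have "wedge (b - a) (c - a) * wedge (b - a) (c' - a) < 0" using abc(3) w' by (simp add: not_less order_less_le)
  then have "sgn (wedge (b - a) (c' - a)) = - sgn (wedge (b - a) (c - a))"
    by (auto simp: mult_less_0_iff)
  then have "outer_normal L e = - outer_normal K e"
    unfolding abc(2) L(1) abc(1) outer_normal_triangle[OF w'] outer_normal_triangle[OF abc(3)] by simp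
  then show ?thesis unfolding minus_normal_def nb L_def by simp
qed

text \<open>Pairs of a cell and one of its edges: every face of the mesh occurs twice, once from
  each side.\<close>

definition edges :: "((real^2) set \<times> (real^2) set) set" where
  "edges = Sigma Th (\<lambda>K. {e. e facet_of K})"

text \<open>Passage to the other side of a face. The edge is shifted back by the period because the
  neighbouring cell is stored at its untranslated position.\<close>

definition flip :: "(real^2) set \<times> (real^2) set \<Rightarrow> (real^2) set \<times> (real^2) set" where
  "flip = (\<lambda>(K, e). case neighbour \<Lambda> Th K e of (K', v) \<Rightarrow> (K', translate (- v) e))"

lemma flip_involution: "z \<in> edges \<Longrightarrow> flip z \<in> edges" "z \<in> edges \<Longrightarrow> flip (flip z) = z"
proof -
  assume z: "z \<in> edges"
  obtain K e where Ke: "z = (K, e)" by fastforce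
  obtain K' v where nb: "neighbour \<Lambda> Th K e = (K', v)" by fastforce
  have K: "K \<in> Th" "e facet_of K" using z unfolding Ke edges_def by auto
  note s = neighbour_sym[OF K nb] and p = neighbour_props[OF K nb]
  have f: "flip z = (K', translate (- v) e)" unfolding flip_def Ke using nb by simp
  show "flip z \<in> edges" unfolding f edges_def using p s by auto
  show "flip (flip z) = z" unfolding f unfolding flip_def Ke prod.case s(2) minus_minus translate_cancel ..
qed

text \<open>\<open>flip\<close> is an involution of \<open>edges\<close>, so it permutes the
  summands.\<close>

lemma sum_edges_flip: "(\<Sum>z\<in>edges. g (flip z)) = (\<Sum>z\<in>edges. g z)"
  by (rule sum.reindex_bij_witness[of _ flip flip]) (auto simp: flip_involution)

end

section \<open>Numerical fluxes and the energy lost at an edge\<close>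

locale dg_flux = periodic_mesh \<Lambda> D Th for \<Lambda> D :: "(real^2) set" and Th +
  fixes r :: "real^2" and \<alpha> \<beta>\<^sub>1 \<beta>\<^sub>2 :: real
begin

text \<open>Integrand of the edge \<open>e\<close> of \<open>K\<close> in the energy balance: the boundary term of the divergence
  theorem minus the two numerical fluxes.\<close>

definition edge_balance ::
  "real piecewise \<Rightarrow> (real^2) piecewise \<Rightarrow> (real^2) set \<Rightarrow> (real^2) set \<Rightarrow> real^2 \<Rightarrow> real" where
  "edge_balance E U K e x = E K x * (U K x \<bullet> outer_normal K e)
     - flux1 \<Lambda> Th r \<alpha> \<beta>\<^sub>1 K e U E x \<bullet> (E K x *\<^sub>R outer_normal K e)
     - flux2 \<Lambda> Th r \<alpha> \<beta>\<^sub>2 K e E U x * (U K x \<bullet> outer_normal K e)"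

definition edge_loss ::
  "real piecewise \<Rightarrow> (real^2) piecewise \<Rightarrow> (real^2) set \<Rightarrow> (real^2) set \<Rightarrow> real^2 \<Rightarrow> real" where
  "edge_loss E U K e x = \<beta>\<^sub>1 * (norm (jump_normal \<Lambda> Th K e E x))\<^sup>2 + \<beta>\<^sub>2 * (jump_dot \<Lambda> Th K e U x)\<^sup>2"

text \<open>The fluxes take the same value from both sides while the normal changes sign. The jump
  of E (U . n) equals average times jump in both orders, which the averages in the fluxes cancel;
  the \<open>\<alpha>\<close> terms are equal products of the two jumps with opposite signs. Only
  the squared jumps remain.\<close>

lemma edge_balance_flip:
  assumes K: "K \<in> Th" and e: "e facet_of K" and nb: "neighbour \<Lambda> Th K e = (K', v)"
  shows "edge_balance E U K e x + edge_balance E U K' (translate (- v) e) (- v + x) = edge_loss E U K e x"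
proof -
  define n where "n = outer_normal K e"
  define e' where "e' = translate (- v) e"
  have nb': "neighbour \<Lambda> Th K' e' = (K, - v)" unfolding e'_def by (rule neighbour_sym(2)[OF K e nb])
  have mn: "minus_normal \<Lambda> Th K e = - n" unfolding n_def by (rule minus_normal_eq[OF K e])
  have on': "outer_normal K' e' = - n"
  proof -
    have "outer_normal K' e' = outer_normal (translate v K') (translate v e')" by (rule outer_normal_translate[symmetric])
    also have "translate v e' = e" unfolding e'_def by (rule translate_cancel)
    also have "outer_normal (translate v K') e = - n" using mn unfolding minus_normal_def nb by simp
    finally show ?thesis .
  qed
  have mn': "minus_normal \<Lambda> Th K' e' = n"
    unfolding minus_normal_def nb' prod.case n_def unfolding e'_def outer_normal_translate ..
  have tr: "minus_trace \<Lambda> Th K e E x = E K' (x - v)" "minus_trace \<Lambda> Th K' e' E (x - v) = E K x"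
    "minus_trace \<Lambda> Th K e U x = U K' (x - v)" "minus_trace \<Lambda> Th K' e' U (x - v) = U K x"
    unfolding minus_trace_def nb nb' by simp_all
  \<comment> \<open>The final identity is polynomial and valid for every value of \<open>nn\<close>,
    so the length of the normal stays symbolic.\<close>
  define nn where "nn = n \<bullet> n"
  define Ep where "Ep = E K x"
  define Em where "Em = E K' (x - v)"
  define Up where "Up = U K x"
  define Um where "Um = U K' (x - v)"
  define s where "s = \<alpha> * sgn (r \<bullet> n)"
  \<comment> \<open>The normal and the sign of its product with r both change across the face, so
    the \<open>\<alpha>\<close> vector is the same from both sides.\<close>
  have al: "alpha_vec \<alpha> r K e = s *\<^sub>R n" "alpha_vec \<alpha> r K' e' = s *\<^sub>R n"
    unfolding alpha_vec_def on' n_def[symmetric] s_def by (simp_all add: sgn_minus)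
  have jn: "jump_normal \<Lambda> Th K e E x = (Ep - Em) *\<^sub>R n" "jump_normal \<Lambda> Th K' e' E (x - v) = (Ep - Em) *\<^sub>R n"
    unfolding jump_normal_def tr mn mn' on' n_def[symmetric] Ep_def Em_def by (simp_all add: algebra_simps)
  have jd: "jump_dot \<Lambda> Th K e U x = Up \<bullet> n - Um \<bullet> n" "jump_dot \<Lambda> Th K' e' U (x - v) = Up \<bullet> n - Um \<bullet> n"
    unfolding jump_dot_def tr mn mn' on' n_def[symmetric] Up_def Um_def by simp_all
  have av: "avg \<Lambda> Th K e E x = (Ep + Em) / 2" "avg \<Lambda> Th K' e' E (x - v) = (Ep + Em) / 2"
    "avg \<Lambda> Th K e U x = (1/2) *\<^sub>R (Up + Um)" "avg \<Lambda> Th K' e' U (x - v) = (1/2) *\<^sub>R (Up + Um)"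
    unfolding avg_def tr Ep_def Em_def Up_def Um_def by (simp_all add: add.commute)
  define f1 where "f1 = flux1 \<Lambda> Th r \<alpha> \<beta>\<^sub>1 K e U E x"
  define f2 where "f2 = flux2 \<Lambda> Th r \<alpha> \<beta>\<^sub>2 K e E U x"
  have f1': "flux1 \<Lambda> Th r \<alpha> \<beta>\<^sub>1 K' e' U E (x - v) = f1" unfolding f1_def flux1_def av jd jn al ..
  have f2': "flux2 \<Lambda> Th r \<alpha> \<beta>\<^sub>2 K' e' E U (x - v) = f2" unfolding f2_def flux2_def av jd jn al ..
  define u where "u = Up \<bullet> n"
  define m where "m = Um \<bullet> n"
  have f1n: "f1 \<bullet> n = (u + m) / 2 - (u - m) * (s * nn) - \<beta>\<^sub>1 * (Ep - Em) * nn"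
    unfolding f1_def flux1_def av jd jn al u_def m_def nn_def
    by (simp add: inner_diff_left inner_add_left algebra_simps)
  have f2e: "f2 = (Ep + Em) / 2 + (Ep - Em) * (s * nn) - \<beta>\<^sub>2 * (u - m)"
    unfolding f2_def flux2_def av jd jn al u_def m_def nn_def by (simp add: algebra_simps)
  have b1: "edge_balance E U K e x = Ep * u - Ep * (f1 \<bullet> n) - f2 * u"
    unfolding edge_balance_def n_def[symmetric] f1_def[symmetric] f2_def[symmetric] Ep_def[symmetric] Up_def[symmetric] u_def by simp
  have b2: "edge_balance E U K' e' (x - v) = - (Em * m) + Em * (f1 \<bullet> n) + f2 * m"
    unfolding edge_balance_def on' f1' f2' Em_def[symmetric] Um_def[symmetric] m_def by simp
  have "edge_loss E U K e x = \<beta>\<^sub>1 * ((Ep - Em)\<^sup>2 * nn) + \<beta>\<^sub>2 * (u - m)\<^sup>2"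
    unfolding edge_loss_def jn jd u_def m_def nn_def by (simp add: power_mult_distrib power2_norm_eq_inner[symmetric])
  moreover have "edge_balance E U K e x + edge_balance E U K' e' (x - v) = \<beta>\<^sub>1 * ((Ep - Em)\<^sup>2 * nn) + \<beta>\<^sub>2 * (u - m)\<^sup>2"
    unfolding b1 b2 f1n f2e by (simp add: power2_eq_square field_simps)
  ultimately show ?thesis unfolding e'_def by (simp add: add.commute)
qed

text \<open>The deterministic part of the scheme as it stands on the left of the equation; the
  tested solution therefore moves with rate minus this quantity.\<close>

definition drift1 :: "real piecewise \<Rightarrow> (real^2) piecewise \<Rightarrow> (real^2) set \<Rightarrow> (real^2 \<Rightarrow> real) \<Rightarrow> real" where
  "drift1 E U K \<phi> = (LINT x:K|lborel. U K x \<bullet> gradient \<phi> x)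
     - boundary_integral K (\<lambda>e x. flux1 \<Lambda> Th r \<alpha> \<beta>\<^sub>1 K e U E x \<bullet> (\<phi> x *\<^sub>R outer_normal K e))"

definition drift2 :: "real piecewise \<Rightarrow> (real^2) piecewise \<Rightarrow> (real^2) set \<Rightarrow> (real^2 \<Rightarrow> real^2) \<Rightarrow> real" where
  "drift2 E U K \<psi> = (LINT x:K|lborel. E K x * divergence \<psi> x)
     - boundary_integral K (\<lambda>e x. flux2 \<Lambda> Th r \<alpha> \<beta>\<^sub>2 K e E U x * (\<psi> x \<bullet> outer_normal K e))"

lemma continuous_minus_trace:
  assumes "K \<in> Th" "e facet_of K" "\<And>K. K \<in> Th \<Longrightarrow> continuous_on UNIV (w K)"
  shows "continuous_on UNIV (minus_trace \<Lambda> Th K e w)"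
proof -
  obtain K' v where nb: "neighbour \<Lambda> Th K e = (K', v)" by fastforce
  have "continuous_on UNIV (w K')" using assms neighbour_props[OF assms(1,2) nb] by auto
  then have "continuous_on UNIV (\<lambda>x. w K' (x - v))"
    by (rule continuous_on_compose2) (auto intro!: continuous_intros)
  then show ?thesis unfolding minus_trace_def[abs_def] nb by simp
qed

lemma continuous_fluxes:
  assumes "K \<in> Th" "e facet_of K" "\<And>K. K \<in> Th \<Longrightarrow> continuous_on UNIV (E K)" "\<And>K. K \<in> Th \<Longrightarrow> continuous_on UNIV (U K)"
  shows "continuous_on UNIV (flux1 \<Lambda> Th r \<alpha> \<beta>\<^sub>1 K e U E)" "continuous_on UNIV (flux2 \<Lambda> Th r \<alpha> \<beta>\<^sub>2 K e E U)"
  unfolding flux1_def[abs_def] flux2_def[abs_def] avg_def jump_dot_def jump_normal_def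
  using assms by (auto intro!: continuous_intros continuous_minus_trace)

text \<open>Inserting the solution as test function reduces each cell to its edge balances by the
  divergence theorem. Averaging the sum over all pairs with its flipped copy combines the two sides
  of each face; the factor 1/2 remains because every face is visited twice.\<close>

lemma energy_dissipation:
  assumes E: "\<And>K. K \<in> Th \<Longrightarrow> C1_field (E K)" and U: "\<And>K. K \<in> Th \<Longrightarrow> C1_field (U K)"
  shows "(\<Sum>K\<in>Th. drift1 E U K (E K) + drift2 E U K (U K)) = (1/2) * (\<Sum>(K, e)\<in>edges. edge_integral e (edge_loss E U K e))"
proof -
  note Ec = C1_fieldE(3)[OF E] and Uc = C1_fieldE(3)[OF U]
  have bc: "continuous_on UNIV (edge_balance E U K e)" if "K \<in> Th" "e facet_of K" for K e
    unfolding edge_balance_def[abs_def] using that by (intro continuous_intros continuous_fluxes Ec Uc)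
  have cell: "drift1 E U K (E K) + drift2 E U K (U K) = (\<Sum>e | e facet_of K. edge_integral e (edge_balance E U K e))" if K: "K \<in> Th" for K
  proof -
    have "drift1 E U K (E K) + drift2 E U K (U K) = boundary_integral K (\<lambda>e x. E K x * (U K x \<bullet> outer_normal K e))
       - boundary_integral K (\<lambda>e x. flux1 \<Lambda> Th r \<alpha> \<beta>\<^sub>1 K e U E x \<bullet> (E K x *\<^sub>R outer_normal K e))
       - boundary_integral K (\<lambda>e x. flux2 \<Lambda> Th r \<alpha> \<beta>\<^sub>2 K e E U x * (U K x \<bullet> outer_normal K e))"
      unfolding drift1_def drift2_def triangle_gauss_product[OF cells_triangle[OF K] E[OF K] U[OF K], symmetric] by simp
    also have "\<dots> = (\<Sum>e | e facet_of K. edge_integral e (edge_balance E U K e))"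
      unfolding boundary_integral_def sum_subtractf[symmetric]
    proof (intro sum.cong refl)
      fix e assume "e \<in> {e. e facet_of K}"
      then have e: "e facet_of K" by simp
      let ?a = "\<lambda>x. E K x * (U K x \<bullet> outer_normal K e)"
      let ?b = "\<lambda>x. flux1 \<Lambda> Th r \<alpha> \<beta>\<^sub>1 K e U E x \<bullet> (E K x *\<^sub>R outer_normal K e)"
      let ?c = "\<lambda>x. flux2 \<Lambda> Th r \<alpha> \<beta>\<^sub>2 K e E U x * (U K x \<bullet> outer_normal K e)"
      have "continuous_on UNIV ?a" by (intro continuous_intros Ec[OF K] Uc[OF K])
      moreover have "continuous_on UNIV ?b" by (intro continuous_intros continuous_fluxes[OF K e Ec Uc] Ec[OF K])
      moreover have "continuous_on UNIV ?c" by (intro continuous_intros continuous_fluxes[OF K e Ec Uc] Uc[OF K])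
      ultimately have ac: "continuous_on UNIV ?a" "continuous_on UNIV ?b" "continuous_on UNIV ?c" .
      have "edge_integral e ?a = edge_integral e (\<lambda>x. edge_balance E U K e x + (?b x + ?c x))"
        unfolding edge_balance_def by (simp add: algebra_simps)
      also have "\<dots> = edge_integral e (edge_balance E U K e) + (edge_integral e ?b + edge_integral e ?c)"
        using ac bc[OF K e] by (simp add: edge_integral_add continuous_on_add)
      finally show "edge_integral e ?a - edge_integral e ?b - edge_integral e ?c = edge_integral e (edge_balance E U K e)" by simp
    qed
    finally show ?thesis .
  qed
  define g where "g = (\<lambda>(K, e). edge_integral e (edge_balance E U K e))"
  have total: "(\<Sum>K\<in>Th. drift1 E U K (E K) + drift2 E U K (U K)) = (\<Sum>z\<in>edges. g z)"
    unfolding edges_def g_def using finite_cells finite_triangle_facets cells_triangle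
    by (subst sum.Sigma[symmetric]) (auto simp: cell)
  have pair: "g z + g (flip z) = (case z of (K, e) \<Rightarrow> edge_integral e (edge_loss E U K e))" if z: "z \<in> edges" for z
  proof -
    obtain K e where Ke: "z = (K, e)" by fastforce
    obtain K' v where nb: "neighbour \<Lambda> Th K e = (K', v)" by fastforce
    have K: "K \<in> Th" "e facet_of K" using z unfolding Ke edges_def by auto
    note p = neighbour_props[OF K nb]
    obtain a b where ab: "e = closed_segment a b" using triangle_facet[OF cells_triangle[OF K(1)] K(2)] by metis
    have c': "continuous_on UNIV (\<lambda>x. edge_balance E U K' (translate (- v) e) (- v + x))"
      by (rule continuous_on_compose2[OF bc[OF p(1) neighbour_sym(1)[OF K nb]]]) (auto intro!: continuous_intros)
    have "g (flip z) = edge_integral e (\<lambda>x. edge_balance E U K' (translate (- v) e) (- v + x))"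
      unfolding g_def flip_def Ke prod.case nb edge_integral_translate[OF ab] ..
    then have "g z + g (flip z) = edge_integral e (\<lambda>x. edge_balance E U K e x + edge_balance E U K' (translate (- v) e) (- v + x))"
      unfolding edge_integral_add[OF bc[OF K] c'] by (simp add: g_def Ke)
    then show ?thesis unfolding edge_balance_flip[OF K nb] Ke by simp
  qed
  have "(\<Sum>z\<in>edges. g z) = (1/2) * ((\<Sum>z\<in>edges. g z) + (\<Sum>z\<in>edges. g (flip z)))"
    unfolding sum_edges_flip by simp
  also have "\<dots> = (1/2) * (\<Sum>z\<in>edges. g z + g (flip z))" by (simp add: sum.distrib)
  also have "(\<Sum>z\<in>edges. g z + g (flip z)) = (\<Sum>(K, e)\<in>edges. edge_integral e (edge_loss E U K e))"
    by (rule sum.cong[OF refl pair])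
  finally show ?thesis unfolding total .
qed

end

section \<open>Polynomial spaces on the cells\<close>

definition ip :: "(real^2) set \<Rightarrow> (real^2 \<Rightarrow> 'b::euclidean_space) \<Rightarrow> (real^2 \<Rightarrow> 'b) \<Rightarrow> real" where
  "ip K f g = (LINT x:K|lborel. f x \<bullet> g x)"

lemma ip_integrable:
  assumes "compact K" "continuous_on K f" "continuous_on K g"
  shows "set_integrable lborel K (\<lambda>x. f x \<bullet> g x)"
  unfolding set_integrable_def
  by (rule borel_integrable_compact[OF assms(1)]) (intro continuous_intros assms(2,3))

lemma ip_commute: "ip K f g = ip K g f"
  unfolding ip_def by (simp add: inner_commute)

lemma ip_sum_left:
  assumes "compact K" "finite I" "\<And>i. i \<in> I \<Longrightarrow> continuous_on K (f i)" "continuous_on K g"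
  shows "ip K (\<lambda>x. \<Sum>i\<in>I. c i *\<^sub>R f i x) g = (\<Sum>i\<in>I. c i * ip K (f i) g)"
proof -
  have "ip K (\<lambda>x. \<Sum>i\<in>I. c i *\<^sub>R f i x) g = (LINT x:K|lborel. \<Sum>i\<in>I. c i * (f i x \<bullet> g x))"
    unfolding ip_def by (simp add: inner_sum_left)
  also have "\<dots> = (\<Sum>i\<in>I. LINT x:K|lborel. c i * (f i x \<bullet> g x))"
    using ip_integrable[OF assms(1) assms(3) assms(4)]
    unfolding set_lebesgue_integral_def set_integrable_def scaleR_sum_right
    by (intro Bochner_Integration.integral_sum) (simp add: mult.left_commute)
  finally show ?thesis unfolding ip_def by simp
qed

lemma ip_add_left:
  assumes "compact K" "continuous_on K f" "continuous_on K g" "continuous_on K h"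
  shows "ip K (\<lambda>x. f x + g x) h = ip K f h + ip K g h"
  unfolding ip_def inner_add_left by (rule set_integral_add(2)) (intro ip_integrable assms)+

lemma ip_diff_left:
  assumes "compact K" "continuous_on K f" "continuous_on K g" "continuous_on K h"
  shows "ip K (\<lambda>x. f x - g x) h = ip K f h - ip K g h"
  unfolding ip_def inner_diff_left by (rule set_integral_diff(2)) (intro ip_integrable assms)+

lemma ip_diff_right:
  assumes "compact K" "continuous_on K f" "continuous_on K g" "continuous_on K h"
  shows "ip K h (\<lambda>x. f x - g x) = ip K h f - ip K h g"
  unfolding ip_def inner_diff_right by (rule set_integral_diff(2)) (intro ip_integrable assms)+

lemma ip_scale_left: "ip K (\<lambda>x. c *\<^sub>R f x) g = c * ip K f g"
  unfolding ip_def by simp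

lemma ip_scale_right: "ip K f (\<lambda>x. c *\<^sub>R g x) = c * ip K f g"
  unfolding ip_def by simp

lemma ip_nonneg: "0 \<le> ip K f f"
  unfolding ip_def set_lebesgue_integral_def by (intro Bochner_Integration.integral_nonneg) simp

text \<open>The generators may be linearly dependent; the inductions below discard those that add
  nothing.\<close>

definition fspan :: "'i set \<Rightarrow> ('i \<Rightarrow> 'x \<Rightarrow> 'b::real_vector) \<Rightarrow> ('x \<Rightarrow> 'b) set" where
  "fspan I m = {f. \<exists>c. f = (\<lambda>x. \<Sum>i\<in>I. c i *\<^sub>R m i x)}"

lemma fspanI: "f = (\<lambda>x. \<Sum>i\<in>I. c i *\<^sub>R m i x) \<Longrightarrow> f \<in> fspan I m"
  unfolding fspan_def by (rule CollectI, rule exI[of _ c])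

lemma fspanE:
  assumes "f \<in> fspan I m" obtains c where "f = (\<lambda>x. \<Sum>i\<in>I. c i *\<^sub>R m i x)"
  using assms unfolding fspan_def by blast

lemma fspan_add: "f \<in> fspan I m \<Longrightarrow> g \<in> fspan I m \<Longrightarrow> (\<lambda>x. f x + g x) \<in> fspan I m"
proof -
  assume "f \<in> fspan I m" "g \<in> fspan I m"
  then obtain c d where "f = (\<lambda>x. \<Sum>i\<in>I. c i *\<^sub>R m i x)" "g = (\<lambda>x. \<Sum>i\<in>I. d i *\<^sub>R m i x)"
    unfolding fspan_def by blast
  then have "(\<lambda>x. f x + g x) = (\<lambda>x. \<Sum>i\<in>I. (c i + d i) *\<^sub>R m i x)"
    by (simp add: scaleR_add_left sum.distrib)
  then show ?thesis by (rule fspanI)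
qed

lemma fspan_scale: "f \<in> fspan I m \<Longrightarrow> (\<lambda>x. a *\<^sub>R f x) \<in> fspan I m"
proof -
  assume "f \<in> fspan I m"
  then obtain c where "f = (\<lambda>x. \<Sum>i\<in>I. c i *\<^sub>R m i x)" unfolding fspan_def by blast
  then have "(\<lambda>x. a *\<^sub>R f x) = (\<lambda>x. \<Sum>i\<in>I. (a * c i) *\<^sub>R m i x)" by (simp add: scaleR_sum_right)
  then show ?thesis by (rule fspanI)
qed

lemma fspan_zero: "(\<lambda>x. 0) \<in> fspan I m"
  unfolding fspan_def by (intro CollectI exI[of _ "\<lambda>i. 0"]) simp

lemma fspan_sum:
  assumes "finite S" "\<And>j. j \<in> S \<Longrightarrow> f j \<in> fspan I m"
  shows "(\<lambda>x. \<Sum>j\<in>S. c j *\<^sub>R f j x) \<in> fspan I m"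
  using assms by (induction S) (simp_all add: fspan_zero fspan_add fspan_scale)

lemma fspan_diff: "f \<in> fspan I m \<Longrightarrow> g \<in> fspan I m \<Longrightarrow> (\<lambda>x. f x - g x) \<in> fspan I m"
  using fspan_add[OF _ fspan_scale[of g I m "-1"], of f] by simp

lemma fspan_insert:
  assumes "finite I" "a \<notin> I"
  shows "f \<in> fspan (insert a I) m \<longleftrightarrow> (\<exists>c g. g \<in> fspan I m \<and> f = (\<lambda>x. c *\<^sub>R m a x + g x))"
proof
  assume "f \<in> fspan (insert a I) m"
  then obtain c where "f = (\<lambda>x. \<Sum>i\<in>insert a I. c i *\<^sub>R m i x)" unfolding fspan_def by blast
  then have "f = (\<lambda>x. c a *\<^sub>R m a x + (\<Sum>i\<in>I. c i *\<^sub>R m i x))" using assms by simp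
  then show "\<exists>c g. g \<in> fspan I m \<and> f = (\<lambda>x. c *\<^sub>R m a x + g x)" unfolding fspan_def by blast
next
  assume "\<exists>c g. g \<in> fspan I m \<and> f = (\<lambda>x. c *\<^sub>R m a x + g x)"
  then obtain c d where f: "f = (\<lambda>x. c *\<^sub>R m a x + (\<Sum>i\<in>I. d i *\<^sub>R m i x))" unfolding fspan_def by blast
  have "f = (\<lambda>x. \<Sum>i\<in>insert a I. (if i = a then c else d i) *\<^sub>R m i x)"
  proof
    fix x
    have "(\<Sum>i\<in>I. d i *\<^sub>R m i x) = (\<Sum>i\<in>I. (if i = a then c else d i) *\<^sub>R m i x)"
      using assms(2) by (intro sum.cong) auto
    then show "f x = (\<Sum>i\<in>insert a I. (if i = a then c else d i) *\<^sub>R m i x)" unfolding f using assms by simp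
  qed
  then show "f \<in> fspan (insert a I) m" by (rule fspanI)
qed

lemma fspan_insert_mono:
  assumes "finite I" "a \<notin> I"
  shows "f \<in> fspan I m \<Longrightarrow> f \<in> fspan (insert a I) m" "m a \<in> fspan (insert a I) m"
proof -
  show "f \<in> fspan (insert a I) m" if "f \<in> fspan I m"
    unfolding fspan_insert[OF assms] using that by (intro exI[of _ 0] exI[of _ f]) simp
  show "m a \<in> fspan (insert a I) m"
    unfolding fspan_insert[OF assms] by (intro exI[of _ 1] exI[of _ "\<lambda>x. 0"]) (simp add: fspan_zero)
qed

text \<open>A finitely generated space of functions is determined by finitely many scalar point
  evaluations. Induction on the generators: if the old interpolation misses the new generator, one
  further evaluation at a point of nonzero residual repairs it.\<close>

lemma fspan_interpolation:
  fixes m :: "'i \<Rightarrow> 'x \<Rightarrow> 'b::euclidean_space"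
  assumes "finite I"
  shows "\<exists>n y b l. (\<forall>j<n::nat. l j \<in> fspan I m) \<and> (\<forall>f\<in>fspan I m. \<forall>x. f x = (\<Sum>j<n. (f (y j) \<bullet> b j) *\<^sub>R l j x))"
  using assms
proof (induction I)
  case empty
  have "fspan {} m = {\<lambda>x. 0}" unfolding fspan_def by auto
  then show ?case by (intro exI[of _ 0]) auto
next
  case (insert a I)
  then obtain n y b l where l: "\<And>j. j < n \<Longrightarrow> l j \<in> fspan I m"
    and rep: "\<And>f x. f \<in> fspan I m \<Longrightarrow> f x = (\<Sum>j<n::nat. (f (y j) \<bullet> b j) *\<^sub>R l j x)"
    by blast
  note ins = fspan_insert[OF insert.hyps] and mono = fspan_insert_mono[OF insert.hyps]
  \<comment> \<open>g is the part of the new generator that the old evaluations cannot represent;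
    every function of the enlarged span has a multiple of g as residual.\<close>
  define g where "g = (\<lambda>x. m a x - (\<Sum>j<n. (m a (y j) \<bullet> b j) *\<^sub>R l j x))"
  have res: "f x - (\<Sum>j<n. (f (y j) \<bullet> b j) *\<^sub>R l j x) = c *\<^sub>R g x"
    if "h \<in> fspan I m" "f = (\<lambda>x. c *\<^sub>R m a x + h x)" for f h c x
    unfolding that(2) g_def using rep[OF that(1), of x]
    by (simp add: inner_add_left scaleR_add_left sum.distrib scaleR_diff_right scaleR_sum_right)
  have gs: "g \<in> fspan (insert a I) m"
    unfolding g_def using l mono by (intro fspan_diff fspan_sum) auto
  show ?case
  proof (cases "\<forall>x. g x = 0")
    case True
    have "f x = (\<Sum>j<n. (f (y j) \<bullet> b j) *\<^sub>R l j x)" if f: "f \<in> fspan (insert a I) m" for f x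
    proof -
      obtain c h where "h \<in> fspan I m" "f = (\<lambda>x. c *\<^sub>R m a x + h x)" using f ins by blast
      from res[OF this, of x] show ?thesis using True by simp
    qed
    then show ?thesis using l mono(1) by blast
  next
    case False
    then obtain q where q: "g q \<noteq> 0" by blast
    define N where "N = g q \<bullet> g q"
    have N: "N \<noteq> 0" using q unfolding N_def by simp
    define y' where "y' = y(n := q)"
    define b' where "b' = b(n := (1 / N) *\<^sub>R g q)"
    \<comment> \<open>The multiple of g is read off from the residual at q. Expressing that residual
      through evaluations introduces the old values at q, which the corrected \<open>l'\<close>
      subtract.\<close>
    define l' where "l' = (\<lambda>j x. if j = n then g x else l j x - (l j q \<bullet> ((1 / N) *\<^sub>R g q)) *\<^sub>R g x)"
    have "l' j \<in> fspan (insert a I) m" if "j < Suc n" for j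
    proof (cases "j = n")
      case True then show ?thesis using gs unfolding l'_def by simp
    next
      case False
      then have "(\<lambda>x. l j x - (l j q \<bullet> ((1 / N) *\<^sub>R g q)) *\<^sub>R g x) \<in> fspan (insert a I) m"
        using l that mono gs by (intro fspan_diff fspan_scale) (auto simp: less_Suc_eq)
      then show ?thesis using False unfolding l'_def by simp
    qed
    moreover have "f x = (\<Sum>j<Suc n. (f (y' j) \<bullet> b' j) *\<^sub>R l' j x)" if f: "f \<in> fspan (insert a I) m" for f x
    proof -
      obtain c h where ch: "h \<in> fspan I m" "f = (\<lambda>x. c *\<^sub>R m a x + h x)" using f ins by blast
      note r = res[OF ch]
      define w where "w = (1 / N) *\<^sub>R g q"
      have "f q \<bullet> w - (\<Sum>j<n. (f (y j) \<bullet> b j) * (l j q \<bullet> w)) = c * (g q \<bullet> w)"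
        using arg_cong[OF r[of q], of "\<lambda>z. z \<bullet> w"] by (simp add: inner_diff_left inner_sum_left)
      then have c: "c = f q \<bullet> w - (\<Sum>j<n. (f (y j) \<bullet> b j) * (l j q \<bullet> w))"
        using N unfolding w_def N_def by simp
      have "(\<Sum>j<Suc n. (f (y' j) \<bullet> b' j) *\<^sub>R l' j x)
        = (\<Sum>j<n. (f (y j) \<bullet> b j) *\<^sub>R (l j x - (l j q \<bullet> w) *\<^sub>R g x)) + (f q \<bullet> w) *\<^sub>R g x"
        unfolding y'_def b'_def l'_def w_def by simp
      also have "\<dots> = (\<Sum>j<n. (f (y j) \<bullet> b j) *\<^sub>R l j x) + c *\<^sub>R g x"
        unfolding c by (simp add: scaleR_diff_right sum_subtractf scaleR_sum_left scaleR_diff_left)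
      also have "\<dots> = f x" using r[of x] by (simp add: algebra_simps)
      finally show ?thesis by simp
    qed
    ultimately show ?thesis by blast
  qed
qed

text \<open>Gram-Schmidt. The inner product sees the functions only on K while equality is meant on
  the whole plane, so definiteness is a hypothesis; it guarantees that a nonzero residual can be
  normalised.\<close>

lemma fspan_orthonormal_basis:
  fixes m :: "'i \<Rightarrow> real^2 \<Rightarrow> 'b::euclidean_space"
  assumes "finite I" and K: "compact K"
    and "\<And>i. i \<in> I \<Longrightarrow> continuous_on K (m i)"
    and "\<And>f. f \<in> fspan I m \<Longrightarrow> ip K f f = 0 \<Longrightarrow> f = (\<lambda>x. 0)"
  shows "\<exists>n e. (\<forall>j<n::nat. e j \<in> fspan I m) \<and> (\<forall>i<n. \<forall>j<n. ip K (e i) (e j) = of_bool (i = j))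
    \<and> (\<forall>f\<in>fspan I m. \<forall>x. f x = (\<Sum>j<n. ip K f (e j) *\<^sub>R e j x))"
  using assms(1,3,4)
proof (induction I)
  case empty
  have "fspan {} m = {\<lambda>x. 0}" unfolding fspan_def by auto
  then show ?case by (intro exI[of _ 0]) auto
next
  case (insert a I)
  note ins = fspan_insert[OF insert.hyps] and mono = fspan_insert_mono[OF insert.hyps]
  have "\<exists>n e. (\<forall>j<n::nat. e j \<in> fspan I m) \<and> (\<forall>i<n. \<forall>j<n. ip K (e i) (e j) = of_bool (i = j))
    \<and> (\<forall>f\<in>fspan I m. \<forall>x. f x = (\<Sum>j<n. ip K f (e j) *\<^sub>R e j x))"
    by (rule insert.IH) (use insert.prems mono in auto)
  then obtain n e where e: "\<And>j. j < n \<Longrightarrow> e j \<in> fspan I m"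
    and on: "\<And>i j. i < n \<Longrightarrow> j < n \<Longrightarrow> ip K (e i) (e j) = of_bool (i = j)"
    and rep: "\<And>f x. f \<in> fspan I m \<Longrightarrow> f x = (\<Sum>j<n::nat. ip K f (e j) *\<^sub>R e j x)"
    by blast
  have cont: "continuous_on K f" if "f \<in> fspan (insert a I) m" for f
    using that insert.prems(1) unfolding fspan_def by (auto intro!: continuous_intros)
  note cont' = cont[OF mono(1)]
  have ce: "continuous_on K (e j)" if "j < n" for j using cont'[OF e[OF that]] .
  have ca: "continuous_on K (m a)" using cont[OF mono(2)] .
  define g where "g = (\<lambda>x. m a x - (\<Sum>j<n. ip K (m a) (e j) *\<^sub>R e j x))"
  have gs: "g \<in> fspan (insert a I) m"
    unfolding g_def using e mono by (intro fspan_diff fspan_sum) auto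
  note cg = cont[OF gs]
  have cs: "continuous_on K (\<lambda>x. \<Sum>j<n. d j *\<^sub>R e j x)" for d by (intro continuous_intros ce) simp
  have sum_e: "ip K (\<lambda>x. \<Sum>j<n. d j *\<^sub>R e j x) (e i) = d i" if "i < n" for i d
  proof -
    have "ip K (\<lambda>x. \<Sum>j<n. d j *\<^sub>R e j x) (e i) = (\<Sum>j<n. d j * ip K (e j) (e i))"
      by (rule ip_sum_left[OF K]) (use ce that in auto)
    also have "\<dots> = (\<Sum>j<n. d j * of_bool (j = i))" using on that by (intro sum.cong) auto
    also have "\<dots> = d i" using that by (simp add: of_bool_def if_distrib sum.delta cong: if_cong)
    finally show ?thesis .
  qed
  have ge: "ip K g (e i) = 0" if "i < n" for i
    unfolding g_def ip_diff_left[OF K ca cs ce[OF that]] sum_e[OF that] by simp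
  have dec: "\<exists>c h. h \<in> fspan I m \<and> (\<forall>x. f x = c *\<^sub>R g x + h x)" if f: "f \<in> fspan (insert a I) m" for f
  proof -
    obtain c h where ch: "h \<in> fspan I m" "f = (\<lambda>x. c *\<^sub>R m a x + h x)" using f ins by blast
    have "(\<lambda>x. c *\<^sub>R (\<Sum>j<n. ip K (m a) (e j) *\<^sub>R e j x) + h x) \<in> fspan I m"
      using e ch(1) by (intro fspan_add fspan_scale fspan_sum) auto
    moreover have "f x = c *\<^sub>R g x + (c *\<^sub>R (\<Sum>j<n. ip K (m a) (e j) *\<^sub>R e j x) + h x)" for x
      unfolding ch(2) g_def by (simp add: scaleR_diff_right)
    ultimately show ?thesis by blast
  qed
  have ip_dec: "ip K f u = c * ip K g u + ip K h u"
    if "h \<in> fspan I m" "\<forall>x. f x = c *\<^sub>R g x + h x" "continuous_on K u" for f h c u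
  proof -
    have "f = (\<lambda>x. c *\<^sub>R g x + h x)" using that(2) by auto
    then show ?thesis
      using ip_add_left[OF K continuous_on_scaleR[OF continuous_on_const cg] cont'[OF that(1)] that(3), of c] ip_scale_left[of K c g u]
      by simp
  qed
  show ?case
  proof (cases "\<forall>x. g x = 0")
    case True
    then have "f \<in> fspan I m" if f: "f \<in> fspan (insert a I) m" for f
    proof -
      obtain c h where ch: "h \<in> fspan I m" "\<forall>x. f x = c *\<^sub>R g x + h x" using dec[OF f] by blast
      then have "f = h" using True by auto
      then show ?thesis using ch(1) by simp
    qed
    then show ?thesis using e on rep mono(1) by (intro exI[of _ n] exI[of _ e]) blast
  next
    case False
    then have "ip K g g \<noteq> 0" using insert.prems(2)[OF gs] by auto
    then have N: "0 < ip K g g" using ip_nonneg[of K g] by simp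
    define N where "N = sqrt (ip K g g)"
    have N0: "0 < N" and NN: "N * N = ip K g g" unfolding N_def using N by auto
    define e' where "e' = (\<lambda>j. if j = n then (\<lambda>x. (1 / N) *\<^sub>R g x) else e j)"
    have e'n: "e' n = (\<lambda>x. (1 / N) *\<^sub>R g x)" and e'j: "\<And>j. j < n \<Longrightarrow> e' j = e j" unfolding e'_def by auto
    have m: "e' j \<in> fspan (insert a I) m" if "j < Suc n" for j
      using that e mono(1) fspan_scale[OF gs] unfolding e'_def by (auto simp: less_Suc_eq)
    have cen: "continuous_on K (e' n)" using cont[OF m[of n]] by simp
    have nn: "ip K (e' n) (e' n) = 1"
      unfolding e'n ip_scale_left ip_scale_right using N0 NN[symmetric] by simp
    have nj: "ip K (e' n) (e j) = 0" if "j < n" for j unfolding e'n ip_scale_left ge[OF that] by simp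
    have on': "ip K (e' i) (e' j) = of_bool (i = j)" if "i < Suc n" "j < Suc n" for i j
      using that on nn nj ip_commute[of K "e i" "e' n"] by (cases "i = n"; cases "j = n") (auto simp: e'j)
    have "f x = (\<Sum>j<Suc n. ip K f (e' j) *\<^sub>R e' j x)" if f: "f \<in> fspan (insert a I) m" for f x
    proof -
      obtain c h where ch: "h \<in> fspan I m" "\<forall>x. f x = c *\<^sub>R g x + h x" using dec[OF f] by blast
      have 1: "ip K f (e j) = ip K h (e j)" if "j < n" for j
        using ip_dec[OF ch ce[OF that]] ge[OF that] by simp
      have h: "h = (\<lambda>x. \<Sum>j<n. ip K h (e j) *\<^sub>R e j x)" using rep[OF ch(1)] by auto
      have hn: "ip K h (e' n) = 0"
      proof -
        have "ip K h (e' n) = ip K (\<lambda>x. \<Sum>j<n. ip K h (e j) *\<^sub>R e j x) (e' n)" using h by simp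
        also have "\<dots> = (\<Sum>j<n. ip K h (e j) * ip K (e j) (e' n))"
          by (rule ip_sum_left[OF K]) (use ce cen in auto)
        also have "\<dots> = 0" using nj ip_commute[of K _ "e' n"] by (intro sum.neutral) auto
        finally show ?thesis .
      qed
      have gn: "ip K g (e' n) = N"
        unfolding e'n ip_scale_right using N0 NN[symmetric] by simp
      have 2: "ip K f (e' n) = c * N" using ip_dec[OF ch cen] hn gn by simp
      have "(\<Sum>j<Suc n. ip K f (e' j) *\<^sub>R e' j x) = (\<Sum>j<n. ip K h (e j) *\<^sub>R e j x) + (c * N) *\<^sub>R ((1 / N) *\<^sub>R g x)"
        using 1 2 by (simp add: e'j) (simp add: e'n)
      also have "\<dots> = h x + c *\<^sub>R g x" using rep[OF ch(1), of x] N0 by simp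
      finally show ?thesis using ch(2) by simp
    qed
    then show ?thesis using m on' by blast
  qed
qed

section \<open>Polynomials of bounded degree\<close>

text \<open>Vector coefficients are resolved into scalar ones, one generator for each monomial and
  coordinate vector, so that the results on spans apply to scalar and vector polynomials
  alike.\<close>

lemma poly_space_fspan:
  "(poly_space k :: (real^2 \<Rightarrow> 'b::euclidean_space) set)
    = fspan ({(i, j). i + j \<le> k} \<times> Basis) (\<lambda>((i, j), b) x. ((x $ 1) ^ i * (x $ 2) ^ j) *\<^sub>R b)"
proof -
  let ?I = "{(i, j). i + j \<le> k}"
  have "(\<lambda>x::real^2. \<Sum>(i, j)\<in>?I. ((x $ 1) ^ i * (x $ 2) ^ j) *\<^sub>R c i j) =
      (\<lambda>x. \<Sum>z\<in>?I \<times> Basis. (c (fst (fst z)) (snd (fst z)) \<bullet> snd z) *\<^sub>R (((x $ 1) ^ fst (fst z) * (x $ 2) ^ snd (fst z)) *\<^sub>R snd z))"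
    for c :: "nat \<Rightarrow> nat \<Rightarrow> 'b"
  proof (rule ext)
    fix x :: "real^2"
    have "(\<Sum>(i, j)\<in>?I. ((x $ 1) ^ i * (x $ 2) ^ j) *\<^sub>R c i j)
       = (\<Sum>z\<in>?I. \<Sum>b\<in>Basis. (c (fst z) (snd z) \<bullet> b) *\<^sub>R (((x $ 1) ^ fst z * (x $ 2) ^ snd z) *\<^sub>R b))"
      unfolding case_prod_unfold
    proof (rule sum.cong[OF refl])
      fix z :: "nat \<times> nat"
      have "((x $ 1) ^ fst z * (x $ 2) ^ snd z) *\<^sub>R c (fst z) (snd z)
        = ((x $ 1) ^ fst z * (x $ 2) ^ snd z) *\<^sub>R (\<Sum>b\<in>Basis. (c (fst z) (snd z) \<bullet> b) *\<^sub>R b)"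
        by (simp add: euclidean_representation)
      also have "\<dots> = (\<Sum>b\<in>Basis. (c (fst z) (snd z) \<bullet> b) *\<^sub>R (((x $ 1) ^ fst z * (x $ 2) ^ snd z) *\<^sub>R b))"
        unfolding scaleR_sum_right by (simp add: mult.commute)
      finally show "((x $ 1) ^ fst z * (x $ 2) ^ snd z) *\<^sub>R c (fst z) (snd z)
        = (\<Sum>b\<in>Basis. (c (fst z) (snd z) \<bullet> b) *\<^sub>R (((x $ 1) ^ fst z * (x $ 2) ^ snd z) *\<^sub>R b))" .
    qed
    then show "(\<Sum>(i, j)\<in>?I. ((x $ 1) ^ i * (x $ 2) ^ j) *\<^sub>R c i j) =
      (\<Sum>z\<in>?I \<times> Basis. (c (fst (fst z)) (snd (fst z)) \<bullet> snd z) *\<^sub>R (((x $ 1) ^ fst (fst z) * (x $ 2) ^ snd (fst z)) *\<^sub>R snd z))"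
      by (simp add: sum.cartesian_product case_prod_unfold)
  qed
  note 1 = this
  show ?thesis
  proof (intro set_eqI iffI)
    fix w :: "real^2 \<Rightarrow> 'b" assume "w \<in> poly_space k"
    then obtain c :: "nat \<Rightarrow> nat \<Rightarrow> 'b" where "w = (\<lambda>x. \<Sum>(i, j)\<in>?I. ((x $ 1) ^ i * (x $ 2) ^ j) *\<^sub>R c i j)"
      unfolding poly_space_def by blast
    then have w: "w = (\<lambda>x. \<Sum>z\<in>?I \<times> Basis. (c (fst (fst z)) (snd (fst z)) \<bullet> snd z) *\<^sub>R (((x $ 1) ^ fst (fst z) * (x $ 2) ^ snd (fst z)) *\<^sub>R snd z))"
      unfolding 1 .
    show "w \<in> fspan (?I \<times> Basis) (\<lambda>((i, j), b) x. ((x $ 1) ^ i * (x $ 2) ^ j) *\<^sub>R b)"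
      by (rule fspanI[where c="\<lambda>z. c (fst (fst z)) (snd (fst z)) \<bullet> snd z"]) (simp only: w case_prod_unfold)
  next
    fix w :: "real^2 \<Rightarrow> 'b" assume "w \<in> fspan (?I \<times> Basis) (\<lambda>((i, j), b) x. ((x $ 1) ^ i * (x $ 2) ^ j) *\<^sub>R b)"
    then obtain d where d: "w = (\<lambda>x. \<Sum>z\<in>?I \<times> Basis. d z *\<^sub>R (\<lambda>((i, j), b) x. ((x $ 1) ^ i * (x $ 2) ^ j) *\<^sub>R b) z x)"
      by (rule fspanE)
    have w: "w = (\<lambda>x. \<Sum>z\<in>?I \<times> Basis. d z *\<^sub>R (((x $ 1) ^ fst (fst z) * (x $ 2) ^ snd (fst z)) *\<^sub>R snd z))"
      unfolding d by (intro ext sum.cong refl) (simp add: case_prod_unfold)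
    define c where "c = (\<lambda>i j. \<Sum>b\<in>Basis. d ((i, j), b) *\<^sub>R b)"
    have cd: "c i j \<bullet> b = d ((i, j), b)" if "b \<in> Basis" for i j b
      unfolding c_def by (rule inner_sum_left_Basis[OF that])
    have cz: "c (fst (fst z)) (snd (fst z)) \<bullet> snd z = d z" if "z \<in> ?I \<times> Basis" for z
    proof -
      have "snd z \<in> Basis" using that by (rule SigmaE) (simp only: snd_conv)
      from cd[OF this, of "fst (fst z)" "snd (fst z)"] show ?thesis by (simp only: prod.collapse)
    qed
    have "w = (\<lambda>x. \<Sum>z\<in>?I \<times> Basis. (c (fst (fst z)) (snd (fst z)) \<bullet> snd z) *\<^sub>R (((x $ 1) ^ fst (fst z) * (x $ 2) ^ snd (fst z)) *\<^sub>R snd z))"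
      unfolding w by (intro ext sum.cong refl) (simp only: cz)
    then have "w = (\<lambda>x. \<Sum>(i, j)\<in>?I. ((x $ 1) ^ i * (x $ 2) ^ j) *\<^sub>R c i j)" unfolding 1 .
    then show "w \<in> poly_space k" unfolding poly_space_def by blast
  qed
qed

lemma finite_poly_index: "finite {(i, j). i + j \<le> (k::nat)}"
  by (rule finite_subset[of _ "{..k} \<times> {..k}"]) auto

lemma C1_field_sum:
  assumes "finite S" "\<And>j. j \<in> S \<Longrightarrow> C1_field (f j)"
  shows "C1_field (\<lambda>x. \<Sum>j\<in>S. c j *\<^sub>R f j x)"
  unfolding C1_field_def
  by (rule exI[of _ "\<lambda>x h. \<Sum>j\<in>S. c j *\<^sub>R frechet_derivative (f j) (at x) h"])
    (auto intro!: derivative_eq_intros C1_fieldE[OF assms(2)] continuous_intros)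

lemma C1_field_poly: "f \<in> poly_space k \<Longrightarrow> C1_field (f :: real^2 \<Rightarrow> 'b::euclidean_space)"
proof -
  assume "f \<in> poly_space k"
  then obtain d where d: "f = (\<lambda>x. \<Sum>z\<in>{(i, j). i + j \<le> k} \<times> Basis. d z *\<^sub>R (\<lambda>((i, j), b) x. ((x $ 1) ^ i * (x $ 2) ^ j) *\<^sub>R b) z x)"
    unfolding poly_space_fspan by (rule fspanE)
  have f: "f = (\<lambda>x. \<Sum>z\<in>{(i, j). i + j \<le> k} \<times> Basis. d z *\<^sub>R (((x $ 1) ^ fst (fst z) * (x $ 2) ^ snd (fst z)) *\<^sub>R snd z))"
    unfolding d by (intro ext sum.cong refl) (simp add: case_prod_unfold)
  have "C1_field (\<lambda>x::real^2. ((x $ 1) ^ i * (x $ 2) ^ j) *\<^sub>R b)" for i j and b :: 'b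
    unfolding C1_field_def
  proof (intro exI[of _ "\<lambda>x h. ((x $ 1) ^ i * (of_nat j * h $ 2 * (x $ 2) ^ (j - 1)) + of_nat i * h $ 1 * (x $ 1) ^ (i - 1) * (x $ 2) ^ j) *\<^sub>R b"] allI conjI)
    show "((\<lambda>x::real^2. ((x $ 1) ^ i * (x $ 2) ^ j) *\<^sub>R b) has_derivative
      (\<lambda>h. ((x $ 1) ^ i * (of_nat j * h $ 2 * (x $ 2) ^ (j - 1)) + of_nat i * h $ 1 * (x $ 1) ^ (i - 1) * (x $ 2) ^ j) *\<^sub>R b)) (at x)" for x
      by (auto intro!: derivative_eq_intros bounded_linear.has_derivative[OF bounded_linear_vec_nth] simp: algebra_simps)
  qed (intro continuous_intros)
  then show ?thesis unfolding f using finite_poly_index by (intro C1_field_sum) auto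
qed

text \<open>On the line through a point of S and x, each component is a polynomial in one variable
  with infinitely many zeros near the point of S; hence it also vanishes at x.\<close>

lemma poly_space_eq_0:
  fixes f :: "real^2 \<Rightarrow> 'b::euclidean_space"
  assumes f: "f \<in> poly_space k" and S: "open S" "S \<noteq> {}" and z: "\<And>x. x \<in> S \<Longrightarrow> f x = 0"
  shows "f = (\<lambda>x. 0)"
proof
  fix x
  obtain z0 where z0: "z0 \<in> S" using S by blast
  obtain c :: "nat \<Rightarrow> nat \<Rightarrow> 'b" where c: "f = (\<lambda>x. \<Sum>(i, j)\<in>{(i, j). i + j \<le> k}. ((x $ 1) ^ i * (x $ 2) ^ j) *\<^sub>R c i j)"
    using f unfolding poly_space_def by blast
  define d where "d = x - z0"
  have "f x \<bullet> b = 0" for b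
  proof -
    define P where "P = (\<Sum>(i, j)\<in>{(i, j). i + j \<le> k}. smult (c i j \<bullet> b) ([:z0 $ 1, d $ 1:] ^ i * [:z0 $ 2, d $ 2:] ^ j))"
    have P: "poly P t = f (z0 + t *\<^sub>R d) \<bullet> b" for t
      unfolding P_def c by (simp add: poly_sum inner_sum_left case_prod_unfold mult.commute mult.left_commute)
    have "open ((\<lambda>t::real. z0 + t *\<^sub>R d) -` S)"
      by (rule open_vimage[OF S(1)]) (intro continuous_intros)
    moreover have "0 \<in> (\<lambda>t::real. z0 + t *\<^sub>R d) -` S" using z0 by simp
    ultimately obtain \<epsilon> where \<epsilon>: "0 < \<epsilon>" "ball 0 \<epsilon> \<subseteq> (\<lambda>t::real. z0 + t *\<^sub>R d) -` S"
      by (rule openE)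
    have "infinite {0<..<\<epsilon>}" using \<epsilon>(1) by simp
    moreover have "{0<..<\<epsilon>} \<subseteq> ball 0 \<epsilon>" by (auto simp: dist_real_def)
    ultimately have "infinite ((\<lambda>t::real. z0 + t *\<^sub>R d) -` S)"
      using \<epsilon>(2) by (meson finite_subset order_trans)
    moreover have "(\<lambda>t::real. z0 + t *\<^sub>R d) -` S \<subseteq> {t. poly P t = 0}" using z unfolding P by auto
    ultimately have "P = 0" using poly_roots_finite finite_subset by blast
    then show ?thesis using P[of 1] unfolding d_def by simp
  qed
  then have "f x \<bullet> f x = 0" .
  then show "f x = 0" by simp
qed

lemma triangle_topology:
  assumes "2 simplex (K :: (real^2) set)"
  shows "compact K" "interior K \<noteq> {}"
proof -
  show "compact K" using simplex2_vertices[OF assms] by (metis compact_convex_hull finite.emptyI finite.insertI finite_imp_compact)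
  have "interior K = rel_interior K" using aff_dim_triangle(1)[OF assms] by (intro interior_rel_interior[symmetric]) simp
  then show "interior K \<noteq> {}" using aff_dim_triangle(2,3)[OF assms] by (simp add: rel_interior_eq_empty)
qed

text \<open>A zero norm makes f vanish almost everywhere on K. The set of interior points with
  nonzero value is open and null, hence empty, and vanishing on an open set extends to the
  plane.\<close>

lemma ip_poly_eq_0:
  assumes K: "2 simplex K" and f: "f \<in> poly_space k" and z: "ip K f f = 0"
  shows "f = (\<lambda>x. 0)"
proof -
  note t = triangle_topology[OF K]
  have fc: "continuous_on UNIV f" by (rule C1_fieldE(3)[OF C1_field_poly[OF f]])
  have g: "continuous_on UNIV (\<lambda>x. f x \<bullet> f x)" by (intro continuous_intros fc)
  have si: "integrable lborel (\<lambda>x. indicator K x *\<^sub>R (f x \<bullet> f x))"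
    using continuous_set_integrable[OF g t(1)] unfolding set_integrable_def .
  have "(\<integral>x. indicator K x *\<^sub>R (f x \<bullet> f x) \<partial>lborel) = 0" using z unfolding ip_def set_lebesgue_integral_def .
  then have "AE x in lborel. indicator K x *\<^sub>R (f x \<bullet> f x) = 0"
    using integral_nonneg_eq_0_iff_AE[OF si] by simp
  then have ae: "AE x in lborel. x \<in> interior K \<longrightarrow> f x = 0"
    by eventually_elim (use interior_subset in \<open>auto simp: indicator_def split: if_splits\<close>)
  define S where "S = interior K \<inter> {x. f x \<noteq> 0}"
  have oS: "open S" unfolding S_def
    by (intro open_Int open_interior open_Collect_neq fc continuous_intros)
  have "AE x in lborel. x \<notin> S" using ae by eventually_elim (auto simp: S_def)
  then have "emeasure lborel S = 0"
    using AE_iff_measurable[of S lborel "\<lambda>x. x \<notin> S"] oS by auto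
  then have "negligible S" using oS by (simp add: negligible_iff_emeasure0)
  then have "S = {}" using oS open_not_negligible by blast
  then show ?thesis unfolding S_def
    by (intro poly_space_eq_0[OF f open_interior t(2)]) auto
qed

section \<open>Linearity of the scheme in solution and test function\<close>

lemma frechet_derivative_sum:
  assumes "finite S" "\<And>j. j \<in> S \<Longrightarrow> C1_field (f j)"
  shows "frechet_derivative (\<lambda>x. \<Sum>j\<in>S. c j *\<^sub>R f j x) (at x) h = (\<Sum>j\<in>S. c j *\<^sub>R frechet_derivative (f j) (at x) h)"
proof -
  have "((\<lambda>x. \<Sum>j\<in>S. c j *\<^sub>R f j x) has_derivative (\<lambda>h. \<Sum>j\<in>S. c j *\<^sub>R frechet_derivative (f j) (at x) h)) (at x)"
    by (auto intro!: derivative_eq_intros C1_fieldE[OF assms(2)])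
  then show ?thesis by (subst frechet_derivative_at[symmetric]) (assumption, rule refl)
qed

lemma gradient_sum:
  assumes "finite S" "\<And>j. j \<in> S \<Longrightarrow> C1_field (f j)"
  shows "gradient (\<lambda>x. \<Sum>j\<in>S. c j *\<^sub>R f j x) x = (\<Sum>j\<in>S. c j *\<^sub>R gradient (f j) x)"
proof -
  have "gradient (\<lambda>x. \<Sum>j\<in>S. c j *\<^sub>R f j x) x = (\<Sum>b\<in>Basis. \<Sum>j\<in>S. c j *\<^sub>R (frechet_derivative (f j) (at x) b *\<^sub>R b))"
    unfolding gradient_def by (simp only: frechet_derivative_sum[OF assms] scaleR_sum_left) simp
  also have "\<dots> = (\<Sum>j\<in>S. c j *\<^sub>R gradient (f j) x)"
    unfolding gradient_def scaleR_sum_right by (rule sum.swap)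
  finally show ?thesis .
qed

lemma divergence_sum:
  assumes "finite S" "\<And>j. j \<in> S \<Longrightarrow> C1_field (f j)"
  shows "divergence (\<lambda>x. \<Sum>j\<in>S. c j *\<^sub>R f j x) x = (\<Sum>j\<in>S. c j * divergence (f j) x)"
proof -
  have "divergence (\<lambda>x. \<Sum>j\<in>S. c j *\<^sub>R f j x) x = (\<Sum>b\<in>Basis. \<Sum>j\<in>S. c j * (frechet_derivative (f j) (at x) b \<bullet> b))"
    unfolding divergence_def by (simp only: frechet_derivative_sum[OF assms] inner_sum_left inner_scaleR_left)
  also have "\<dots> = (\<Sum>j\<in>S. c j * divergence (f j) x)"
    unfolding divergence_def sum_distrib_left by (rule sum.swap)
  finally show ?thesis .
qed

lemma continuous_gradient: "C1_field \<phi> \<Longrightarrow> continuous_on UNIV (\<lambda>x. gradient \<phi> x)"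
  unfolding gradient_def by (intro continuous_intros C1_fieldE)

lemma continuous_divergence: "C1_field \<psi> \<Longrightarrow> continuous_on UNIV (\<lambda>x. divergence \<psi> x)"
  unfolding divergence_def by (intro continuous_intros C1_fieldE)

lemma set_integral_linear_sum:
  fixes g :: "'i \<Rightarrow> real^2 \<Rightarrow> real"
  assumes "compact K" "finite S" "\<And>j. j \<in> S \<Longrightarrow> continuous_on UNIV (g j)"
  shows "(LINT x:K|lborel. \<Sum>j\<in>S. c j * g j x) = (\<Sum>j\<in>S. c j * (LINT x:K|lborel. g j x))"
proof -
  have "set_integrable lborel K (g j)" if "j \<in> S" for j
    by (rule continuous_set_integrable[OF assms(3)[OF that] assms(1)])
  then have "(LINT x:K|lborel. \<Sum>j\<in>S. c j * g j x) = (\<Sum>j\<in>S. LINT x:K|lborel. c j * g j x)"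
    unfolding set_lebesgue_integral_def set_integrable_def scaleR_sum_right
    by (intro Bochner_Integration.integral_sum) (simp add: mult.left_commute)
  then show ?thesis by simp
qed

lemma boundary_integral_linear_sum:
  assumes "finite S" "\<And>j e. j \<in> S \<Longrightarrow> e facet_of K \<Longrightarrow> continuous_on UNIV (g j e)"
  shows "boundary_integral K (\<lambda>e x. \<Sum>j\<in>S. c j * g j e x) = (\<Sum>j\<in>S. c j * boundary_integral K (g j))"
proof -
  have "boundary_integral K (\<lambda>e x. \<Sum>j\<in>S. c j * g j e x) = (\<Sum>e | e facet_of K. \<Sum>j\<in>S. c j * edge_integral e (g j e))"
    unfolding boundary_integral_def
  proof (intro sum.cong refl)
    fix e assume "e \<in> {e. e facet_of K}"
    then have "edge_integral e (\<lambda>x. \<Sum>j\<in>S. c j * g j e x) = (\<Sum>j\<in>S. edge_integral e (\<lambda>x. c j * g j e x))"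
      using assms by (intro edge_integral_sum) (auto intro!: continuous_intros)
    then show "edge_integral e (\<lambda>x. \<Sum>j\<in>S. c j * g j e x) = (\<Sum>j\<in>S. c j * edge_integral e (g j e))"
      by (simp add: edge_integral_cmult)
  qed
  also have "\<dots> = (\<Sum>j\<in>S. c j * boundary_integral K (g j))"
    unfolding boundary_integral_def by (subst sum.swap) (simp add: sum_distrib_left)
  finally show ?thesis .
qed

lemma boundary_integral_cong:
  "(\<And>e x. e facet_of K \<Longrightarrow> f e x = g e x) \<Longrightarrow> boundary_integral K f = boundary_integral K g"
proof -
  assume a: "\<And>e x. e facet_of K \<Longrightarrow> f e x = g e x"
  then have "f e = g e" if "e facet_of K" for e using that by auto
  then show ?thesis unfolding boundary_integral_def by (intro sum.cong) auto
qed

context dg_flux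
begin

lemma minus_trace_sum:
  assumes "K \<in> Th" "e facet_of K" "\<And>K x. K \<in> Th \<Longrightarrow> w K x = (\<Sum>l\<in>S. a l *\<^sub>R b l K x)"
  shows "minus_trace \<Lambda> Th K e w x = (\<Sum>l\<in>S. a l *\<^sub>R minus_trace \<Lambda> Th K e (b l) x)"
proof -
  obtain K' v where nb: "neighbour \<Lambda> Th K e = (K', v)" by fastforce
  show ?thesis unfolding minus_trace_def nb using assms(3) neighbour_props(1)[OF assms(1,2) nb] by simp
qed

lemma flux_sum:
  assumes K: "K \<in> Th" and e: "e facet_of K"
    and E: "\<And>K x. K \<in> Th \<Longrightarrow> E K x = (\<Sum>l\<in>S. a l *\<^sub>R eb l K x)"
    and U: "\<And>K x. K \<in> Th \<Longrightarrow> U K x = (\<Sum>l\<in>S. a l *\<^sub>R ub l K x)"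
  shows "flux1 \<Lambda> Th r \<alpha> \<beta>\<^sub>1 K e U E x = (\<Sum>l\<in>S. a l *\<^sub>R flux1 \<Lambda> Th r \<alpha> \<beta>\<^sub>1 K e (ub l) (eb l) x)"
    "flux2 \<Lambda> Th r \<alpha> \<beta>\<^sub>2 K e E U x = (\<Sum>l\<in>S. a l * flux2 \<Lambda> Th r \<alpha> \<beta>\<^sub>2 K e (eb l) (ub l) x)"
proof -
  have t: "minus_trace \<Lambda> Th K e E x = (\<Sum>l\<in>S. a l *\<^sub>R minus_trace \<Lambda> Th K e (eb l) x)"
    "minus_trace \<Lambda> Th K e U x = (\<Sum>l\<in>S. a l *\<^sub>R minus_trace \<Lambda> Th K e (ub l) x)"
    by (rule minus_trace_sum[OF K e E], assumption) (rule minus_trace_sum[OF K e U], assumption)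
  have av: "avg \<Lambda> Th K e U x = (\<Sum>l\<in>S. a l *\<^sub>R avg \<Lambda> Th K e (ub l) x)"
    "avg \<Lambda> Th K e E x = (\<Sum>l\<in>S. a l *\<^sub>R avg \<Lambda> Th K e (eb l) x)"
    unfolding avg_def t E[OF K] U[OF K]
    by (simp_all add: scaleR_sum_right sum.distrib[symmetric] scaleR_add_right sum_distrib_left sum_divide_distrib distrib_left add_divide_distrib)
  have jd: "jump_dot \<Lambda> Th K e U x = (\<Sum>l\<in>S. a l * jump_dot \<Lambda> Th K e (ub l) x)"
    unfolding jump_dot_def t U[OF K] by (simp add: inner_sum_left sum.distrib distrib_left)
  have jn: "jump_normal \<Lambda> Th K e E x = (\<Sum>l\<in>S. a l *\<^sub>R jump_normal \<Lambda> Th K e (eb l) x)"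
    unfolding jump_normal_def t E[OF K] by (simp add: scaleR_sum_left sum.distrib scaleR_add_right)
  show "flux1 \<Lambda> Th r \<alpha> \<beta>\<^sub>1 K e U E x = (\<Sum>l\<in>S. a l *\<^sub>R flux1 \<Lambda> Th r \<alpha> \<beta>\<^sub>1 K e (ub l) (eb l) x)"
    unfolding flux1_def av jd jn
    by (simp add: scaleR_diff_right sum_subtractf scaleR_sum_left scaleR_sum_right mult.commute)
  show "flux2 \<Lambda> Th r \<alpha> \<beta>\<^sub>2 K e E U x = (\<Sum>l\<in>S. a l * flux2 \<Lambda> Th r \<alpha> \<beta>\<^sub>2 K e (eb l) (ub l) x)"
    unfolding flux2_def av jd jn
    by (simp add: right_diff_distrib distrib_left sum_subtractf sum.distrib inner_sum_right sum_distrib_left mult.left_commute)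
qed

text \<open>Linearity in the pair of unknowns, expanded jointly with one family of coefficients;
  this is what turns the scheme into a matrix.\<close>

lemma drift_linear:
  assumes K: "K \<in> Th" and S: "finite S" and \<phi>: "C1_field \<phi>" and \<psi>: "C1_field \<psi>"
    and eb: "\<And>l K. l \<in> S \<Longrightarrow> K \<in> Th \<Longrightarrow> continuous_on UNIV (eb l K)"
    and ub: "\<And>l K. l \<in> S \<Longrightarrow> K \<in> Th \<Longrightarrow> continuous_on UNIV (ub l K)"
    and E: "\<And>K x. K \<in> Th \<Longrightarrow> E K x = (\<Sum>l\<in>S. a l *\<^sub>R eb l K x)"
    and U: "\<And>K x. K \<in> Th \<Longrightarrow> U K x = (\<Sum>l\<in>S. a l *\<^sub>R ub l K x)"
  shows "drift1 E U K \<phi> = (\<Sum>l\<in>S. drift1 (eb l) (ub l) K \<phi> * a l)"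
    "drift2 E U K \<psi> = (\<Sum>l\<in>S. drift2 (eb l) (ub l) K \<psi> * a l)"
proof -
  note cK = triangle_topology(1)[OF cells_triangle[OF K]]
  note fs = flux_sum[where E=E and U=U, OF K _ E U]
  have "(LINT x:K|lborel. U K x \<bullet> gradient \<phi> x) = (LINT x:K|lborel. \<Sum>l\<in>S. a l * (ub l K x \<bullet> gradient \<phi> x))"
    unfolding U[OF K] by (simp add: inner_sum_left)
  also have "\<dots> = (\<Sum>l\<in>S. a l * (LINT x:K|lborel. ub l K x \<bullet> gradient \<phi> x))"
    by (rule set_integral_linear_sum[OF cK S]) (intro continuous_intros ub K continuous_gradient \<phi>)
  finally have 1: "(LINT x:K|lborel. U K x \<bullet> gradient \<phi> x) = (\<Sum>l\<in>S. a l * (LINT x:K|lborel. ub l K x \<bullet> gradient \<phi> x))" .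
  have "boundary_integral K (\<lambda>e x. flux1 \<Lambda> Th r \<alpha> \<beta>\<^sub>1 K e U E x \<bullet> (\<phi> x *\<^sub>R outer_normal K e))
    = boundary_integral K (\<lambda>e x. \<Sum>l\<in>S. a l * (flux1 \<Lambda> Th r \<alpha> \<beta>\<^sub>1 K e (ub l) (eb l) x \<bullet> (\<phi> x *\<^sub>R outer_normal K e)))"
    by (rule boundary_integral_cong) (simp add: fs(1) inner_sum_left sum_distrib_left mult.left_commute)
  also have "\<dots> = (\<Sum>l\<in>S. a l * boundary_integral K (\<lambda>e x. flux1 \<Lambda> Th r \<alpha> \<beta>\<^sub>1 K e (ub l) (eb l) x \<bullet> (\<phi> x *\<^sub>R outer_normal K e)))"
    by (rule boundary_integral_linear_sum[OF S]) (intro continuous_intros continuous_fluxes K eb ub C1_fieldE(3)[OF \<phi>])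
  finally have 2: "boundary_integral K (\<lambda>e x. flux1 \<Lambda> Th r \<alpha> \<beta>\<^sub>1 K e U E x \<bullet> (\<phi> x *\<^sub>R outer_normal K e))
    = (\<Sum>l\<in>S. a l * boundary_integral K (\<lambda>e x. flux1 \<Lambda> Th r \<alpha> \<beta>\<^sub>1 K e (ub l) (eb l) x \<bullet> (\<phi> x *\<^sub>R outer_normal K e)))" .
  show "drift1 E U K \<phi> = (\<Sum>l\<in>S. drift1 (eb l) (ub l) K \<phi> * a l)"
    unfolding drift1_def 1 2 sum_subtractf[symmetric] left_diff_distrib
    by (simp only: mult.commute[of "a _"])
  have "(LINT x:K|lborel. E K x * divergence \<psi> x) = (LINT x:K|lborel. \<Sum>l\<in>S. a l * (eb l K x * divergence \<psi> x))"
    unfolding E[OF K] by (simp add: sum_distrib_right mult.assoc)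
  also have "\<dots> = (\<Sum>l\<in>S. a l * (LINT x:K|lborel. eb l K x * divergence \<psi> x))"
    by (rule set_integral_linear_sum[OF cK S]) (intro continuous_intros eb K continuous_divergence \<psi>)
  finally have 3: "(LINT x:K|lborel. E K x * divergence \<psi> x) = (\<Sum>l\<in>S. a l * (LINT x:K|lborel. eb l K x * divergence \<psi> x))" .
  have "boundary_integral K (\<lambda>e x. flux2 \<Lambda> Th r \<alpha> \<beta>\<^sub>2 K e E U x * (\<psi> x \<bullet> outer_normal K e))
    = boundary_integral K (\<lambda>e x. \<Sum>l\<in>S. a l * (flux2 \<Lambda> Th r \<alpha> \<beta>\<^sub>2 K e (eb l) (ub l) x * (\<psi> x \<bullet> outer_normal K e)))"
    by (rule boundary_integral_cong) (simp add: fs(2) sum_distrib_right mult.assoc)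
  also have "\<dots> = (\<Sum>l\<in>S. a l * boundary_integral K (\<lambda>e x. flux2 \<Lambda> Th r \<alpha> \<beta>\<^sub>2 K e (eb l) (ub l) x * (\<psi> x \<bullet> outer_normal K e)))"
    by (rule boundary_integral_linear_sum[OF S]) (intro continuous_intros continuous_fluxes K eb ub C1_fieldE(3)[OF \<psi>])
  finally have 4: "boundary_integral K (\<lambda>e x. flux2 \<Lambda> Th r \<alpha> \<beta>\<^sub>2 K e E U x * (\<psi> x \<bullet> outer_normal K e))
    = (\<Sum>l\<in>S. a l * boundary_integral K (\<lambda>e x. flux2 \<Lambda> Th r \<alpha> \<beta>\<^sub>2 K e (eb l) (ub l) x * (\<psi> x \<bullet> outer_normal K e)))" .
  show "drift2 E U K \<psi> = (\<Sum>l\<in>S. drift2 (eb l) (ub l) K \<psi> * a l)"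
    unfolding drift2_def 3 4 sum_subtractf[symmetric] left_diff_distrib
    by (simp only: mult.commute[of "a _"])
qed

text \<open>Linearity in the test function, needed to assemble the quadratic form from the equations
  tested with single basis functions.\<close>

lemma drift1_test_sum:
  assumes K: "K \<in> Th" and S: "finite S" and \<phi>: "\<And>j. j \<in> S \<Longrightarrow> C1_field (\<phi> j)"
    and E: "\<And>K. K \<in> Th \<Longrightarrow> continuous_on UNIV (E K)" and U: "\<And>K. K \<in> Th \<Longrightarrow> continuous_on UNIV (U K)"
  shows "drift1 E U K (\<lambda>x. \<Sum>j\<in>S. c j *\<^sub>R \<phi> j x) = (\<Sum>j\<in>S. c j * drift1 E U K (\<phi> j))"
proof -
  note cK = triangle_topology(1)[OF cells_triangle[OF K]]
  have 1: "(LINT x:K|lborel. U K x \<bullet> gradient (\<lambda>x. \<Sum>j\<in>S. c j *\<^sub>R \<phi> j x) x) = (\<Sum>j\<in>S. c j * (LINT x:K|lborel. U K x \<bullet> gradient (\<phi> j) x))"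
    by (simp only: gradient_sum[OF S \<phi>] inner_sum_right inner_scaleR_right)
      (rule set_integral_linear_sum[OF cK S], intro continuous_intros U K continuous_gradient \<phi>)
  have "boundary_integral K (\<lambda>e x. flux1 \<Lambda> Th r \<alpha> \<beta>\<^sub>1 K e U E x \<bullet> ((\<Sum>j\<in>S. c j *\<^sub>R \<phi> j x) *\<^sub>R outer_normal K e))
    = boundary_integral K (\<lambda>e x. \<Sum>j\<in>S. c j * (flux1 \<Lambda> Th r \<alpha> \<beta>\<^sub>1 K e U E x \<bullet> (\<phi> j x *\<^sub>R outer_normal K e)))"
    by (simp add: sum_distrib_right mult.assoc)
  also have "\<dots> = (\<Sum>j\<in>S. c j * boundary_integral K (\<lambda>e x. flux1 \<Lambda> Th r \<alpha> \<beta>\<^sub>1 K e U E x \<bullet> (\<phi> j x *\<^sub>R outer_normal K e)))"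
    by (rule boundary_integral_linear_sum[OF S]) (intro continuous_intros continuous_fluxes K E U C1_fieldE(3)[OF \<phi>])
  finally show ?thesis unfolding drift1_def 1 by (simp add: sum_subtractf right_diff_distrib)
qed

lemma drift2_test_sum:
  assumes K: "K \<in> Th" and S: "finite S" and \<psi>: "\<And>j. j \<in> S \<Longrightarrow> C1_field (\<psi> j)"
    and E: "\<And>K. K \<in> Th \<Longrightarrow> continuous_on UNIV (E K)" and U: "\<And>K. K \<in> Th \<Longrightarrow> continuous_on UNIV (U K)"
  shows "drift2 E U K (\<lambda>x. \<Sum>j\<in>S. c j *\<^sub>R \<psi> j x) = (\<Sum>j\<in>S. c j * drift2 E U K (\<psi> j))"
proof -
  note cK = triangle_topology(1)[OF cells_triangle[OF K]]
  have "(LINT x:K|lborel. E K x * divergence (\<lambda>x. \<Sum>j\<in>S. c j *\<^sub>R \<psi> j x) x) = (LINT x:K|lborel. \<Sum>j\<in>S. c j * (E K x * divergence (\<psi> j) x))"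
    by (simp only: divergence_sum[OF S \<psi>] sum_distrib_left mult.left_commute)
  also have "\<dots> = (\<Sum>j\<in>S. c j * (LINT x:K|lborel. E K x * divergence (\<psi> j) x))"
    by (rule set_integral_linear_sum[OF cK S]) (intro continuous_intros E K continuous_divergence \<psi>)
  finally have 1: "(LINT x:K|lborel. E K x * divergence (\<lambda>x. \<Sum>j\<in>S. c j *\<^sub>R \<psi> j x) x) = (\<Sum>j\<in>S. c j * (LINT x:K|lborel. E K x * divergence (\<psi> j) x))" .
  have "boundary_integral K (\<lambda>e x. flux2 \<Lambda> Th r \<alpha> \<beta>\<^sub>2 K e E U x * ((\<Sum>j\<in>S. c j *\<^sub>R \<psi> j x) \<bullet> outer_normal K e))
    = boundary_integral K (\<lambda>e x. \<Sum>j\<in>S. c j * (flux2 \<Lambda> Th r \<alpha> \<beta>\<^sub>2 K e E U x * (\<psi> j x \<bullet> outer_normal K e)))"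
    by (simp add: inner_sum_left sum_distrib_left mult.left_commute)
  also have "\<dots> = (\<Sum>j\<in>S. c j * boundary_integral K (\<lambda>e x. flux2 \<Lambda> Th r \<alpha> \<beta>\<^sub>2 K e E U x * (\<psi> j x \<bullet> outer_normal K e)))"
    by (rule boundary_integral_linear_sum[OF S]) (intro continuous_intros continuous_fluxes K E U C1_fieldE(3)[OF \<psi>])
  finally show ?thesis unfolding drift2_def 1 by (simp add: sum_subtractf right_diff_distrib)
qed

end

section \<open>Orthonormal bases on cells and the L2 projection\<close>

definition cell_onb :: "nat \<Rightarrow> (real^2) set \<Rightarrow> nat \<Rightarrow> (nat \<Rightarrow> real^2 \<Rightarrow> 'b::euclidean_space) \<Rightarrow> bool" where
  "cell_onb k K n e \<longleftrightarrow> (\<forall>j<n. e j \<in> poly_space k) \<and> (\<forall>i<n. \<forall>j<n. ip K (e i) (e j) = of_bool (i = j))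
    \<and> (\<forall>f\<in>poly_space k. \<forall>x. f x = (\<Sum>j<n. ip K f (e j) *\<^sub>R e j x))"

lemma continuous_poly: "f \<in> poly_space k \<Longrightarrow> continuous_on S (f :: real^2 \<Rightarrow> 'b::euclidean_space)"
  using C1_fieldE(3)[OF C1_field_poly] continuous_on_subset by blast

lemma cell_onb_exists:
  assumes K: "2 simplex K"
  shows "\<exists>n (e :: nat \<Rightarrow> real^2 \<Rightarrow> 'b::euclidean_space). cell_onb k K n e"
  unfolding cell_onb_def poly_space_fspan
proof (rule fspan_orthonormal_basis)
  show "finite ({(i, j). i + j \<le> k} \<times> (Basis :: 'b set))" using finite_poly_index by simp
  show "compact K" by (rule triangle_topology(1)[OF K])
  show "continuous_on K ((\<lambda>((i, j), b) x::real^2. ((x $ 1) ^ i * (x $ 2) ^ j) *\<^sub>R b) z)"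
    if "z \<in> {(i, j). i + j \<le> k} \<times> (Basis :: 'b set)" for z
    by (cases z) (auto intro!: continuous_intros)
  show "f = (\<lambda>x. 0)"
    if "f \<in> fspan ({(i, j). i + j \<le> k} \<times> (Basis :: 'b set)) (\<lambda>((i, j), b) x. ((x $ 1) ^ i * (x $ 2) ^ j) *\<^sub>R b)" "ip K f f = 0" for f
    using ip_poly_eq_0[OF K _ that(2)] that(1) unfolding poly_space_fspan .
qed

lemma poly_space_sum:
  fixes f :: "'i \<Rightarrow> real^2 \<Rightarrow> 'b::euclidean_space"
  assumes "finite S" "\<And>j. j \<in> S \<Longrightarrow> f j \<in> poly_space k"
  shows "(\<lambda>x. \<Sum>j\<in>S. c j *\<^sub>R f j x) \<in> poly_space k"
  using assms unfolding poly_space_fspan by (rule fspan_sum)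

lemma poly_space_zero: "(\<lambda>x. 0) \<in> (poly_space k :: (real^2 \<Rightarrow> 'b::euclidean_space) set)"
  unfolding poly_space_fspan by (rule fspan_zero)

lemma cell_onb_sum:
  assumes K: "compact K" and e: "cell_onb k K n e" and i: "i < n"
  shows "ip K (\<lambda>x. \<Sum>j<n. d j *\<^sub>R e j x) (e i) = d i"
proof -
  have "ip K (\<lambda>x. \<Sum>j<n. d j *\<^sub>R e j x) (e i) = (\<Sum>j<n. d j * ip K (e j) (e i))"
    by (rule ip_sum_left[OF K]) (use e i continuous_poly in \<open>auto simp: cell_onb_def\<close>)
  also have "\<dots> = (\<Sum>j<n. d j * of_bool (j = i))" using e i unfolding cell_onb_def by (intro sum.cong) auto
  also have "\<dots> = d i" using i by (simp add: of_bool_def if_distrib sum.delta cong: if_cong)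
  finally show ?thesis .
qed

lemma cell_onb_ip:
  assumes K: "compact K" and e: "cell_onb k K n e" and f: "continuous_on K f"
  shows "ip K f (\<lambda>x. \<Sum>j<n. d j *\<^sub>R e j x) = (\<Sum>j<n. d j * ip K f (e j))"
proof -
  have "ip K (\<lambda>x. \<Sum>j<n. d j *\<^sub>R e j x) f = (\<Sum>j<n. d j * ip K (e j) f)"
    by (rule ip_sum_left[OF K _ _ f]) (use e continuous_poly in \<open>auto simp: cell_onb_def\<close>)
  then show ?thesis by (simp only: ip_commute[of K _ f])
qed

lemma cell_onb_rep: "cell_onb k K n e \<Longrightarrow> f \<in> poly_space k \<Longrightarrow> f = (\<lambda>x. \<Sum>j<n. ip K f (e j) *\<^sub>R e j x)"
  unfolding cell_onb_def by blast

text \<open>f may be any continuous function as long as g is polynomial: only the polynomial part of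
  f is seen by g.\<close>

lemma parseval:
  assumes K: "compact K" and e: "cell_onb k K n e" and f: "continuous_on K f" and g: "g \<in> poly_space k"
  shows "ip K f g = (\<Sum>j<n. ip K f (e j) * ip K g (e j))"
proof -
  have "ip K f g = ip K f (\<lambda>x. \<Sum>j<n. ip K g (e j) *\<^sub>R e j x)" using cell_onb_rep[OF e g] by simp
  also have "\<dots> = (\<Sum>j<n. ip K g (e j) * ip K f (e j))" by (rule cell_onb_ip[OF K e f])
  finally show ?thesis by (simp add: mult.commute)
qed

text \<open>The squared distance of f from its expansion p is nonnegative, and both mixed products
  equal the sum of squares.\<close>

lemma bessel:
  assumes K: "compact K" and e: "cell_onb k K n e" and f: "continuous_on K f"
  shows "(\<Sum>j<n. (ip K f (e j))\<^sup>2) \<le> ip K f f"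
proof -
  define p where "p = (\<lambda>x. \<Sum>j<n. ip K f (e j) *\<^sub>R e j x)"
  have p: "p \<in> poly_space k" unfolding p_def
    by (rule poly_space_sum) (use e in \<open>auto simp: cell_onb_def\<close>)
  have pc: "continuous_on K p" by (rule continuous_poly[OF p])
  have dc: "continuous_on K (\<lambda>x. f x - p x)" by (intro continuous_intros f pc)
  have pe: "ip K p (e j) = ip K f (e j)" if "j < n" for j unfolding p_def by (rule cell_onb_sum[OF K e that])
  have fp: "ip K f p = (\<Sum>j<n. (ip K f (e j))\<^sup>2)"
    unfolding parseval[OF K e f p] using pe by (intro sum.cong) (auto simp: power2_eq_square)
  have pp: "ip K p p = (\<Sum>j<n. (ip K f (e j))\<^sup>2)"
    unfolding parseval[OF K e pc p] using pe by (intro sum.cong) (auto simp: power2_eq_square)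
  have "0 \<le> ip K (\<lambda>x. f x - p x) (\<lambda>x. f x - p x)" by (rule ip_nonneg)
  also have "\<dots> = ip K f (\<lambda>x. f x - p x) - ip K p (\<lambda>x. f x - p x)" by (rule ip_diff_left[OF K f pc dc])
  also have "ip K f (\<lambda>x. f x - p x) = ip K f f - ip K f p" by (rule ip_diff_right[OF K f pc f])
  also have "ip K p (\<lambda>x. f x - p x) = ip K p f - ip K p p" by (rule ip_diff_right[OF K f pc pc])
  finally show ?thesis using fp pp ip_commute[of K f p] by simp
qed

lemma dg_inner_ip: "dg_inner Th v w = (\<Sum>K\<in>Th. ip K (v K) (w K))"
  unfolding dg_inner_def ip_def ..

lemma dg_norm_sq: "(dg_norm Th w)\<^sup>2 = (\<Sum>K\<in>Th. ip K (w K) (w K))"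
  unfolding dg_norm_def dg_inner_ip by (simp add: sum_nonneg ip_nonneg)

lemma dg_norm_sq_coeffs:
  assumes "\<And>K. K \<in> Th \<Longrightarrow> compact K" "\<And>K. K \<in> Th \<Longrightarrow> cell_onb k K (n K) (e K)" "w \<in> dg_space k Th"
  shows "(dg_norm Th w)\<^sup>2 = (\<Sum>K\<in>Th. \<Sum>i<n K. (ip K (w K) (e K i))\<^sup>2)"
  unfolding dg_norm_sq
proof (rule sum.cong[OF refl])
  fix K assume K: "K \<in> Th"
  have w: "w K \<in> poly_space k" using assms(3) K unfolding dg_space_def by auto
  show "ip K (w K) (w K) = (\<Sum>i<n K. (ip K (w K) (e K i))\<^sup>2)"
    using parseval[OF assms(1)[OF K] assms(2)[OF K] continuous_poly[OF w] w] by (simp add: power2_eq_square)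
qed

text \<open>The projection is the cellwise expansion w of f in the bases, which turns the definite
  description into an explicit function. A competitor has the same coefficients on each cell, hence
  equals w.\<close>

lemma L2_projection_norm_sq:
  assumes fin: "finite Th" and K: "\<And>K. K \<in> Th \<Longrightarrow> compact K"
    and e: "\<And>K. K \<in> Th \<Longrightarrow> cell_onb k K (n K) (e K)"
    and f: "\<And>K. K \<in> Th \<Longrightarrow> continuous_on K (f K)"
  shows "(dg_norm Th (L2_projection k Th f))\<^sup>2 = (\<Sum>K\<in>Th. \<Sum>i<n K. (ip K (f K) (e K i))\<^sup>2)"
proof -
  define w where "w = restrict (\<lambda>K x. \<Sum>i<n K. ip K (f K) (e K i) *\<^sub>R e K i x) Th"
  have wK: "w K = (\<lambda>x. \<Sum>i<n K. ip K (f K) (e K i) *\<^sub>R e K i x)" if "K \<in> Th" for K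
    unfolding w_def using that by simp
  have w: "w \<in> dg_space k Th"
    unfolding dg_space_def
  proof (rule PiE_I)
    fix K assume K: "K \<in> Th"
    show "w K \<in> poly_space k" unfolding wK[OF K]
      by (rule poly_space_sum) (use e[OF K] in \<open>auto simp: cell_onb_def\<close>)
  qed (simp add: w_def)
  have we: "ip K (w K) (e K i) = ip K (f K) (e K i)" if "K \<in> Th" "i < n K" for K i
    unfolding wK[OF that(1)] by (rule cell_onb_sum[OF K[OF that(1)] e[OF that(1)] that(2)])
  have P: "L2_projection k Th f = w"
    unfolding L2_projection_def
  proof (rule the_equality)
    show "w \<in> dg_space k Th \<and> (\<forall>\<phi>\<in>dg_space k Th. dg_inner Th w \<phi> = dg_inner Th f \<phi>)"
    proof (intro conjI ballI w)
      fix \<phi> :: "'a piecewise" assume \<phi>: "\<phi> \<in> dg_space k Th"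
      show "dg_inner Th w \<phi> = dg_inner Th f \<phi>"
        unfolding dg_inner_ip
      proof (rule sum.cong[OF refl])
        fix L assume L: "L \<in> Th"
        have pL: "\<phi> L \<in> poly_space k" "w L \<in> poly_space k" using \<phi> w L unfolding dg_space_def by auto
        show "ip L (w L) (\<phi> L) = ip L (f L) (\<phi> L)"
          unfolding parseval[OF K[OF L] e[OF L] f[OF L] pL(1)] parseval[OF K[OF L] e[OF L] continuous_poly[OF pL(2)] pL(1)]
          using we[OF L] by (intro sum.cong) auto
      qed
    qed
    fix v assume v: "v \<in> dg_space k Th \<and> (\<forall>\<phi>\<in>dg_space k Th. dg_inner Th v \<phi> = dg_inner Th f \<phi>)"
    have "v L = w L" if L: "L \<in> Th" for L
    proof -
      have vL: "v L \<in> poly_space k" using v L unfolding dg_space_def by auto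
      have "ip L (v L) (e L i) = ip L (f L) (e L i)" if i: "i < n L" for i
      proof -
        \<comment> \<open>This test function is supported on one cell and isolates one
          coefficient.\<close>
        define \<phi> :: "'a piecewise" where "\<phi> = restrict (\<lambda>K. if K = L then e L i else (\<lambda>x. 0)) Th"
        have \<phi>: "\<phi> \<in> dg_space k Th"
          unfolding dg_space_def
        proof (rule PiE_I)
          fix K assume "K \<in> Th"
          moreover have "e L i \<in> poly_space k" using e[OF L] i unfolding cell_onb_def by blast
          ultimately show "\<phi> K \<in> poly_space k"
            unfolding \<phi>_def by (cases "K = L") (simp_all add: poly_space_zero)
        qed (simp add: \<phi>_def)
        have single: "dg_inner Th u \<phi> = ip L (u L) (e L i)" for u :: "'a piecewise"
        proof -
          have "dg_inner Th u \<phi> = (\<Sum>K\<in>Th. if K = L then ip L (u L) (e L i) else 0)"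
            unfolding dg_inner_ip \<phi>_def by (intro sum.cong) (auto simp: ip_def)
          then show ?thesis using fin L by simp
        qed
        show ?thesis using v \<phi> single by metis
      qed
      then show "v L = w L" using cell_onb_rep[OF e[OF L] vL] unfolding wK[OF L] by simp
    qed
    \<comment> \<open>Members of \<open>dg_space\<close> are extensional, so equality also has to be
      checked off the mesh, where both are \<open>undefined\<close>.\<close>
    moreover have "v K = undefined" "w K = undefined" if "K \<notin> Th" for K
      using v that unfolding dg_space_def by (auto simp: PiE_def extensional_def w_def)
    ultimately show "v = w" by (metis ext)
  qed
  have "(dg_norm Th w)\<^sup>2 = (\<Sum>K\<in>Th. \<Sum>i<n K. (ip K (w K) (e K i))\<^sup>2)"
    by (rule dg_norm_sq_coeffs[where k=k, OF K e w])
  also have "\<dots> = (\<Sum>K\<in>Th. \<Sum>i<n K. (ip K (f K) (e K i))\<^sup>2)"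
    by (intro sum.cong refl) (simp only: we lessThan_iff)
  finally show ?thesis unfolding P .
qed

section \<open>Coefficients of adapted solutions and bounds for the source\<close>

lemma poly_interpolation:
  "\<exists>n y b (l :: nat \<Rightarrow> real^2 \<Rightarrow> 'b::euclidean_space). (\<forall>j<n. l j \<in> poly_space k) \<and>
    (\<forall>f\<in>poly_space k. \<forall>x. f x = (\<Sum>j<n. (f (y j) \<bullet> b j) *\<^sub>R l j x))"
  unfolding poly_space_fspan by (rule fspan_interpolation) (simp add: finite_poly_index)

text \<open>Adaptedness and continuity are known for point values only; interpolation expresses the
  coefficients by finitely many of them.\<close>

lemma dg_process_coeff:
  assumes bm: "brownian_motion M Fil W" and X: "dg_process M Fil k Th X" and K: "K \<in> Th" "compact K" and e: "e \<in> poly_space k"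
  shows "\<And>s. 0 \<le> s \<Longrightarrow> (\<lambda>\<omega>. ip K (X s \<omega> K) e) \<in> borel_measurable (Fil s)"
    "\<And>\<omega>. \<omega> \<in> space M \<Longrightarrow> continuous_on {0..} (\<lambda>s. ip K (X s \<omega> K) e)"
proof -
  interpret brownian_motion M Fil W by fact
  obtain n y b and l :: "nat \<Rightarrow> real^2 \<Rightarrow> 'b" where int: "(\<forall>j<n. l j \<in> poly_space k) \<and>
    (\<forall>f\<in>poly_space k. \<forall>x. f x = (\<Sum>j<n. (f (y j) \<bullet> b j) *\<^sub>R l j x))"
    using poly_interpolation[where k=k and 'b='b] by (elim exE) (rule that)
  have l: "l j \<in> poly_space k" if "j < n" for j using int that by auto
  have rep: "f x = (\<Sum>j<n. (f (y j) \<bullet> b j) *\<^sub>R l j x)" if "f \<in> poly_space k" for f x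
    by (rule bspec[OF conjunct2[OF int] that, THEN spec])
  have eq: "ip K (X s \<omega> K) e = (\<Sum>j<n. (X s \<omega> K (y j) \<bullet> b j) * ip K (l j) e)" if "0 \<le> s" "\<omega> \<in> space M" for s \<omega>
  proof -
    have Xp: "X s \<omega> K \<in> poly_space k" using X K that unfolding dg_process_def dg_space_def by auto
    have "X s \<omega> K = (\<lambda>x. \<Sum>j<n. (X s \<omega> K (y j) \<bullet> b j) *\<^sub>R l j x)" by (rule ext) (rule rep[OF Xp])
    then have "ip K (X s \<omega> K) e = ip K (\<lambda>x. \<Sum>j<n. (X s \<omega> K (y j) \<bullet> b j) *\<^sub>R l j x) e"
      by (rule arg_cong[where f="\<lambda>h. ip K h e"])
    also have "\<dots> = (\<Sum>j<n. (X s \<omega> K (y j) \<bullet> b j) * ip K (l j) e)"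
      by (rule ip_sum_left[OF K(2)]) (use l continuous_poly e in auto)
    finally show ?thesis .
  qed
  show "(\<lambda>\<omega>. ip K (X s \<omega> K) e) \<in> borel_measurable (Fil s)" if s: "0 \<le> s" for s
  proof -
    have "(\<lambda>\<omega>. X s \<omega> K x) \<in> borel_measurable (Fil s)" for x using X K s unfolding dg_process_def by auto
    then have "(\<lambda>\<omega>. \<Sum>j<n. (X s \<omega> K (y j) \<bullet> b j) * ip K (l j) e) \<in> borel_measurable (Fil s)"
      by (intro borel_measurable_sum borel_measurable_times borel_measurable_inner borel_measurable_const)
    then show ?thesis using measurable_cong[of "Fil s" "\<lambda>\<omega>. ip K (X s \<omega> K) e" "\<lambda>\<omega>. \<Sum>j<n. (X s \<omega> K (y j) \<bullet> b j) * ip K (l j) e" borel]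
      eq[OF s] space_F by simp
  qed
  show "continuous_on {0..} (\<lambda>s. ip K (X s \<omega> K) e)" if w: "\<omega> \<in> space M" for \<omega>
  proof -
    have c: "continuous_on {0..} (\<lambda>s. X s \<omega> K x)" for x using X K w unfolding dg_process_def by auto
    have "continuous_on {0..} (\<lambda>s. \<Sum>j<n. (X s \<omega> K (y j) \<bullet> b j) * ip K (l j) e)" by (intro continuous_intros c)
    then show ?thesis by (rule continuous_on_cong[THEN iffD1, rotated 2]) (use eq w in auto)
  qed
qed

lemma has_ito_integral_cong:
  assumes "\<And>\<omega>. \<omega> \<in> space M \<Longrightarrow> I \<omega> = I' \<omega>" "has_ito_integral M Fil W H t I"
  shows "has_ito_integral M Fil W H t I'"
proof -
  have m: "I \<in> borel_measurable M \<longleftrightarrow> I' \<in> borel_measurable M" by (rule measurable_cong[OF assms(1)])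
  have s: "{\<omega> \<in> space M. ennreal \<epsilon> < ennreal \<bar>f \<omega> - I \<omega>\<bar>} = {\<omega> \<in> space M. ennreal \<epsilon> < ennreal \<bar>f \<omega> - I' \<omega>\<bar>}" for \<epsilon> f
    using assms(1) by auto
  show ?thesis using assms(2) unfolding has_ito_integral_def to_zero_in_prob_def m s .
qed

lemma continuous_superpose:
  assumes F: "smooth_coeff D F" and "K \<subseteq> D" "0 \<le> s" and e: "continuous_on K (e K)" and u: "continuous_on K (u K)"
  shows "continuous_on K (superpose F s e u K)"
proof -
  obtain S g where S: "D \<times> {0..} \<times> UNIV \<times> UNIV \<subseteq> S" "\<forall>j. Ck_on j S g"
    "\<forall>x\<in>D \<times> {0..} \<times> UNIV \<times> UNIV. g x = (case x of (x, t, e, u) \<Rightarrow> F x t e u)"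
    using F unfolding smooth_coeff_def smooth_on_def by blast
  have g: "continuous_on S g" using S(2)[rule_format, of 0] by simp
  have "continuous_on K (\<lambda>x. g (x, s, e K x, u K x))"
    by (rule continuous_on_compose2[OF g]) (use S(1) assms in \<open>auto intro!: continuous_intros\<close>)
  moreover have "g (x, s, e K x, u K x) = superpose F s e u K x" if "x \<in> K" for x
    using S(3) that assms(2,3) unfolding superpose_def by auto
  ultimately show ?thesis using continuous_on_cong[of K K] by (metis (mono_tags, lifting))
qed

text \<open>The squares of |F| and |G| add up to at most the square of their sum, and the factor 3
  comes from squaring the three terms of the growth bound.\<close>

lemma linear_growth_ip:
  fixes F :: "real^2 \<Rightarrow> real \<Rightarrow> real \<Rightarrow> real^2 \<Rightarrow> real" and G :: "real^2 \<Rightarrow> real \<Rightarrow> real \<Rightarrow> real^2 \<Rightarrow> real^2"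
  assumes g: "\<And>x s e u. x \<in> D \<Longrightarrow> 0 \<le> s \<Longrightarrow> \<bar>F x s e u\<bar> + norm (G x s e u) \<le> C * (1 + \<bar>e\<bar> + norm u)"
    and K: "compact K" "K \<subseteq> D" and s: "0 \<le> s" and e: "continuous_on K (e K)" and u: "continuous_on K (u K)"
    and Fc: "continuous_on K (superpose F s e u K)" and Gc: "continuous_on K (superpose G s e u K)"
  shows "ip K (superpose F s e u K) (superpose F s e u K) + ip K (superpose G s e u K) (superpose G s e u K)
    \<le> 3 * C\<^sup>2 * (ip K (\<lambda>x. 1::real) (\<lambda>x. 1) + ip K (e K) (e K) + ip K (u K) (u K))"
proof -
  let ?F = "superpose F s e u K" and ?G = "superpose G s e u K"
  have pt: "?F x \<bullet> ?F x + ?G x \<bullet> ?G x \<le> 3 * C\<^sup>2 * (1 * 1 + e K x \<bullet> e K x + u K x \<bullet> u K x)" if "x \<in> K" for x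
  proof -
    define a where "a = \<bar>?F x\<bar>"
    define b where "b = norm (?G x)"
    have ab: "0 \<le> a" "0 \<le> b" unfolding a_def b_def by auto
    have "a + b \<le> C * (1 + \<bar>e K x\<bar> + norm (u K x))"
      unfolding a_def b_def superpose_def using g that K(2) s by auto
    then have "(a + b)\<^sup>2 \<le> (C * (1 + \<bar>e K x\<bar> + norm (u K x)))\<^sup>2" using ab by (intro power_mono) auto
    also have "\<dots> = C\<^sup>2 * (1 + \<bar>e K x\<bar> + norm (u K x))\<^sup>2" by (simp add: power_mult_distrib)
    also have "\<dots> \<le> C\<^sup>2 * (3 * 1\<^sup>2 + 3 * \<bar>e K x\<bar>\<^sup>2 + 3 * (norm (u K x))\<^sup>2)"
      by (intro mult_left_mono sq_add3_le) simp
    finally have "(a + b)\<^sup>2 \<le> 3 * C\<^sup>2 * (1 * 1 + e K x \<bullet> e K x + u K x \<bullet> u K x)"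
      by (simp add: power2_norm_eq_inner[symmetric] power2_eq_square[of "e K x", symmetric] algebra_simps)
    moreover have "a\<^sup>2 + b\<^sup>2 \<le> (a + b)\<^sup>2" using ab by (simp add: power2_sum)
    moreover have "?F x \<bullet> ?F x + ?G x \<bullet> ?G x = a\<^sup>2 + b\<^sup>2"
      unfolding a_def b_def by (simp add: dot_square_norm power2_eq_square)
    ultimately show ?thesis by simp
  qed
  have i1: "set_integrable lborel K (\<lambda>x. (1::real) \<bullet> 1)" by (rule ip_integrable[OF K(1)]) auto
  note i = ip_integrable[OF K(1) Fc Fc] ip_integrable[OF K(1) Gc Gc] i1 ip_integrable[OF K(1) e e] ip_integrable[OF K(1) u u]
  have "ip K ?F ?F + ip K ?G ?G = (LINT x:K|lborel. ?F x \<bullet> ?F x + ?G x \<bullet> ?G x)"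
    unfolding ip_def by (rule set_integral_add(2)[symmetric, OF i(1,2)])
  also have "\<dots> \<le> (LINT x:K|lborel. 3 * C\<^sup>2 * ((1::real) \<bullet> 1 + e K x \<bullet> e K x + u K x \<bullet> u K x))"
    by (rule set_integral_mono) (use i pt in \<open>auto intro!: set_integral_add(1) set_integrable_mult_right\<close>)
  also have "\<dots> = 3 * C\<^sup>2 * (ip K (\<lambda>x. 1::real) (\<lambda>x. 1) + ip K (e K) (e K) + ip K (u K) (u K))"
    unfolding ip_def using set_integral_add(2)[OF set_integral_add(1)[OF i(3,4)] i(5)] set_integral_add(2)[OF i(3,4)] by simp
  finally show ?thesis .
qed

section \<open>The energy inequality\<close>

text \<open>The growth constant C is fixed as a parameter, because it enters the constant of the
  linear system derived below.\<close>

locale dg_scheme = brownian_motion M Fil W + dg_flux \<Lambda> D Th r \<alpha> \<beta>\<^sub>1 \<beta>\<^sub>2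
  for M :: "'a measure" and Fil W \<Lambda> D Th r \<alpha> \<beta>\<^sub>1 \<beta>\<^sub>2 +
  fixes k :: nat and F :: "real^2 \<Rightarrow> real \<Rightarrow> real \<Rightarrow> real^2 \<Rightarrow> real" and G :: "real^2 \<Rightarrow> real \<Rightarrow> real \<Rightarrow> real^2 \<Rightarrow> real^2"
    and E0 :: "real piecewise" and U0 :: "(real^2) piecewise"
    and E :: "real \<Rightarrow> 'a \<Rightarrow> real piecewise" and U :: "real \<Rightarrow> 'a \<Rightarrow> (real^2) piecewise" and C :: real
  assumes F_smooth: "smooth_coeff D F" and G_smooth: "smooth_coeff D G"
    and FG_growth: "\<And>x s e u. x \<in> D \<Longrightarrow> 0 \<le> s \<Longrightarrow> \<bar>F x s e u\<bar> + norm (G x s e u) \<le> C * (1 + \<bar>e\<bar> + norm u)"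
    and solution: "dg_solution M Fil W \<Lambda> Th k r \<alpha> \<beta>\<^sub>1 \<beta>\<^sub>2 F G E0 U0 E U"
begin

definition nE :: "(real^2) set \<Rightarrow> nat" where
  "nE K = (SOME n. \<exists>e :: nat \<Rightarrow> real^2 \<Rightarrow> real. cell_onb k K n e)"
definition eE :: "(real^2) set \<Rightarrow> nat \<Rightarrow> real^2 \<Rightarrow> real" where
  "eE K = (SOME e. cell_onb k K (nE K) e)"
definition nU :: "(real^2) set \<Rightarrow> nat" where
  "nU K = (SOME n. \<exists>e :: nat \<Rightarrow> real^2 \<Rightarrow> real^2. cell_onb k K n e)"
definition eU :: "(real^2) set \<Rightarrow> nat \<Rightarrow> real^2 \<Rightarrow> real^2" where
  "eU K = (SOME e. cell_onb k K (nU K) e)"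

lemma onb: "K \<in> Th \<Longrightarrow> cell_onb k K (nE K) (eE K)" "K \<in> Th \<Longrightarrow> cell_onb k K (nU K) (eU K)"
proof -
  assume "K \<in> Th"
  then have s: "2 simplex K" by (rule cells_triangle)
  have "\<exists>e. cell_onb k K (nE K) (e :: nat \<Rightarrow> real^2 \<Rightarrow> real)"
    unfolding nE_def by (rule someI_ex) (rule cell_onb_exists[OF s])
  then show "cell_onb k K (nE K) (eE K)" unfolding eE_def by (rule someI_ex)
  have "\<exists>e. cell_onb k K (nU K) (e :: nat \<Rightarrow> real^2 \<Rightarrow> real^2)"
    unfolding nU_def by (rule someI_ex) (rule cell_onb_exists[OF s])
  then show "cell_onb k K (nU K) (eU K)" unfolding eU_def by (rule someI_ex)
qed

lemma onb_poly: "K \<in> Th \<Longrightarrow> i < nE K \<Longrightarrow> eE K i \<in> poly_space k" "K \<in> Th \<Longrightarrow> i < nU K \<Longrightarrow> eU K i \<in> poly_space k"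
  using onb unfolding cell_onb_def by blast+

lemma compact_cell: "K \<in> Th \<Longrightarrow> compact K"
  using triangle_topology(1) cells_triangle by blast

text \<open>One index set for the whole system: \<open>Inl\<close> marks coefficients of E and
  \<open>Inr\<close> those of U, each with its cell and basis index.\<close>

definition J :: "((real^2) set \<times> nat + (real^2) set \<times> nat) set" where
  "J = Sigma Th (\<lambda>K. {..<nE K}) <+> Sigma Th (\<lambda>K. {..<nU K})"

lemma finite_J: "finite J"
  unfolding J_def using finite_cells by simp

lemma J_cases:
  assumes "j \<in> J"
  obtains (E) K i where "j = Inl (K, i)" "K \<in> Th" "i < nE K" | (U) K i where "j = Inr (K, i)" "K \<in> Th" "i < nU K"
  using assms unfolding J_def by (auto elim!: PlusE)

lemma sum_J: "(\<Sum>j\<in>J. g j) = (\<Sum>K\<in>Th. \<Sum>i<nE K. g (Inl (K, i))) + (\<Sum>K\<in>Th. \<Sum>i<nU K. g (Inr (K, i)))"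
  for g :: "_ \<Rightarrow> 'c::comm_monoid_add"
proof -
  have "(\<Sum>j\<in>J. g j) = sum (g \<circ> Inl) (Sigma Th (\<lambda>K. {..<nE K})) + sum (g \<circ> Inr) (Sigma Th (\<lambda>K. {..<nU K}))"
    unfolding J_def using finite_cells by (intro sum.Plus) auto
  also have "sum (g \<circ> Inl) (Sigma Th (\<lambda>K. {..<nE K})) = (\<Sum>K\<in>Th. \<Sum>i<nE K. g (Inl (K, i)))"
    using sum.Sigma[of Th "\<lambda>K. {..<nE K}" "\<lambda>K i. g (Inl (K, i))"] finite_cells by (simp add: case_prod_unfold o_def)
  also have "sum (g \<circ> Inr) (Sigma Th (\<lambda>K. {..<nU K})) = (\<Sum>K\<in>Th. \<Sum>i<nU K. g (Inr (K, i)))"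
    using sum.Sigma[of Th "\<lambda>K. {..<nU K}" "\<lambda>K i. g (Inr (K, i))"] finite_cells by (simp add: case_prod_unfold o_def)
  finally show ?thesis .
qed

definition coeffs :: "real piecewise \<Rightarrow> (real^2) piecewise \<Rightarrow> (real^2) set \<times> nat + (real^2) set \<times> nat \<Rightarrow> real" where
  "coeffs e u j = (case j of Inl z \<Rightarrow> ip (fst z) (e (fst z)) (eE (fst z) (snd z)) | Inr z \<Rightarrow> ip (fst z) (u (fst z)) (eU (fst z) (snd z)))"

definition a where "a j s \<omega> = coeffs (E s \<omega>) (U s \<omega>) j"

definition H where "H j s \<omega> = coeffs (superpose F s (E s \<omega>) (U s \<omega>)) (superpose G s (E s \<omega>) (U s \<omega>)) j"

text \<open>\<open>basis1 j\<close> and \<open>basis2 j\<close> together form the j-th basis element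
  of the product space: one component is zero, and the other lives on a single cell.\<close>

definition basis1 :: "(real^2) set \<times> nat + (real^2) set \<times> nat \<Rightarrow> real piecewise" where
  "basis1 j K x = (case j of Inl z \<Rightarrow> if K = fst z then eE (fst z) (snd z) x else 0 | Inr z \<Rightarrow> 0)"

definition basis2 :: "(real^2) set \<times> nat + (real^2) set \<times> nat \<Rightarrow> (real^2) piecewise" where
  "basis2 j K x = (case j of Inl z \<Rightarrow> 0 | Inr z \<Rightarrow> if K = fst z then eU (fst z) (snd z) x else 0)"

text \<open>Entry (j, l) is the drift caused by the basis pair l, tested with the basis function j;
  it couples only cells that share a face, though this sparsity is left implicit.\<close>

definition A where
  "A j l = (case j of Inl z \<Rightarrow> drift1 (basis1 l) (basis2 l) (fst z) (eE (fst z) (snd z))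
     | Inr z \<Rightarrow> drift2 (basis1 l) (basis2 l) (fst z) (eU (fst z) (snd z)))"

definition area where "area = (\<Sum>K\<in>Th. ip K (\<lambda>x. 1::real) (\<lambda>x. 1))"

lemma area_nonneg: "0 \<le> area" unfolding area_def by (intro sum_nonneg ip_nonneg)

lemma in_dg_space:
  assumes "0 \<le> s" "\<omega> \<in> space M"
  shows "E s \<omega> \<in> dg_space k Th" "U s \<omega> \<in> dg_space k Th"
  using solution assms unfolding dg_solution_def dg_process_def by auto

lemma in_poly_space:
  assumes "0 \<le> s" "\<omega> \<in> space M" "K \<in> Th"
  shows "E s \<omega> K \<in> poly_space k" "U s \<omega> K \<in> poly_space k"
  using in_dg_space[OF assms(1,2)] assms(3) unfolding dg_space_def by auto

lemma continuous_basis: "j \<in> J \<Longrightarrow> K \<in> Th \<Longrightarrow> continuous_on UNIV (basis1 j K)" "j \<in> J \<Longrightarrow> K \<in> Th \<Longrightarrow> continuous_on UNIV (basis2 j K)"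
proof -
  assume j: "j \<in> J" and K: "K \<in> Th"
  show "continuous_on UNIV (basis1 j K)"
    using j
  proof (cases rule: J_cases)
    case (E L i)
    then show ?thesis using continuous_poly[OF onb_poly(1)[OF E(2,3)]]
      by (cases "K = L") (simp_all add: basis1_def[abs_def])
  qed (simp add: basis1_def[abs_def])
  show "continuous_on UNIV (basis2 j K)"
    using j
  proof (cases rule: J_cases)
    case (U L i)
    then show ?thesis using continuous_poly[OF onb_poly(2)[OF U(2,3)]]
      by (cases "K = L") (simp_all add: basis2_def[abs_def])
  qed (simp add: basis2_def[abs_def])
qed

text \<open>Basis pairs of other cells vanish on K, so the sum over all indices collapses to the
  expansion in the basis of K.\<close>

lemma expansion:
  assumes s: "0 \<le> s" "\<omega> \<in> space M" and K: "K \<in> Th"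
  shows "E s \<omega> K x = (\<Sum>l\<in>J. a l s \<omega> *\<^sub>R basis1 l K x)" "U s \<omega> K x = (\<Sum>l\<in>J. a l s \<omega> *\<^sub>R basis2 l K x)"
proof -
  have "(\<Sum>l\<in>J. a l s \<omega> *\<^sub>R basis1 l K x)
    = (\<Sum>L\<in>Th. if L = K then (\<Sum>i<nE L. ip L (E s \<omega> L) (eE L i) *\<^sub>R eE L i x) else 0)"
    unfolding sum_J by (simp add: basis1_def a_def coeffs_def) (intro sum.cong, auto)
  also have "\<dots> = (\<Sum>i<nE K. ip K (E s \<omega> K) (eE K i) *\<^sub>R eE K i x)" using K finite_cells by simp
  also have "\<dots> = E s \<omega> K x"
    using onb(1)[OF K] in_poly_space(1)[OF s K] unfolding cell_onb_def by metis
  finally show "E s \<omega> K x = (\<Sum>l\<in>J. a l s \<omega> *\<^sub>R basis1 l K x)" by (rule sym)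
  have "(\<Sum>l\<in>J. a l s \<omega> *\<^sub>R basis2 l K x)
    = (\<Sum>L\<in>Th. if L = K then (\<Sum>i<nU L. ip L (U s \<omega> L) (eU L i) *\<^sub>R eU L i x) else 0)"
    unfolding sum_J by (simp add: basis2_def a_def coeffs_def) (intro sum.cong, auto)
  also have "\<dots> = (\<Sum>i<nU K. ip K (U s \<omega> K) (eU K i) *\<^sub>R eU K i x)" using K finite_cells by simp
  also have "\<dots> = U s \<omega> K x"
    using onb(2)[OF K] in_poly_space(2)[OF s K] unfolding cell_onb_def by metis
  finally show "U s \<omega> K x = (\<Sum>l\<in>J. a l s \<omega> *\<^sub>R basis2 l K x)" by (rule sym)
qed

lemma drift_matrix:
  assumes s: "0 \<le> s" "\<omega> \<in> space M" and K: "K \<in> Th"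
  shows "i < nE K \<Longrightarrow> drift1 (E s \<omega>) (U s \<omega>) K (eE K i) = (\<Sum>l\<in>J. A (Inl (K, i)) l * a l s \<omega>)"
    "i < nU K \<Longrightarrow> drift2 (E s \<omega>) (U s \<omega>) K (eU K i) = (\<Sum>l\<in>J. A (Inr (K, i)) l * a l s \<omega>)"
proof -
  have z: "C1_field (\<lambda>x::real^2. 0::'c::euclidean_space)" by (rule C1_field_poly[OF poly_space_zero])
  note lin = drift_linear[where E="E s \<omega>" and U="U s \<omega>" and a="\<lambda>l. a l s \<omega>" and eb=basis1 and ub=basis2,
      OF K finite_J _ _ continuous_basis expansion[OF s]]
  show "drift1 (E s \<omega>) (U s \<omega>) K (eE K i) = (\<Sum>l\<in>J. A (Inl (K, i)) l * a l s \<omega>)" if "i < nE K"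
    using lin(1)[OF C1_field_poly[OF onb_poly(1)[OF K that]] z] unfolding A_def by simp
  show "drift2 (E s \<omega>) (U s \<omega>) K (eU K i) = (\<Sum>l\<in>J. A (Inr (K, i)) l * a l s \<omega>)" if "i < nU K"
    using lin(2)[OF z C1_field_poly[OF onb_poly(2)[OF K that]]] unfolding A_def by simp
qed

lemma norm_coeffs:
  assumes "e \<in> dg_space k Th" "u \<in> dg_space k Th"
  shows "(dg_norm Th e)\<^sup>2 + (dg_norm Th u)\<^sup>2 = (\<Sum>j\<in>J. (coeffs e u j)\<^sup>2)"
  unfolding sum_J coeffs_def
  using dg_norm_sq_coeffs[where n=nE and e=eE and k=k, OF compact_cell onb(1) assms(1)]
    dg_norm_sq_coeffs[where n=nU and e=eU and k=k, OF compact_cell onb(2) assms(2)] by simp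

lemma continuous_source:
  assumes s: "0 \<le> s" "\<omega> \<in> space M" and K: "K \<in> Th"
  shows "continuous_on K (superpose F s (E s \<omega>) (U s \<omega>) K)" "continuous_on K (superpose G s (E s \<omega>) (U s \<omega>) K)"
proof -
  have KD: "K \<subseteq> D" using K D_eq by blast
  note c = continuous_poly[OF in_poly_space(1)[OF s K]] continuous_poly[OF in_poly_space(2)[OF s K]]
  show "continuous_on K (superpose F s (E s \<omega>) (U s \<omega>) K)"
    by (rule continuous_superpose[where e="E s \<omega>" and u="U s \<omega>", OF F_smooth KD s(1) c])
  show "continuous_on K (superpose G s (E s \<omega>) (U s \<omega>) K)"
    by (rule continuous_superpose[where e="E s \<omega>" and u="U s \<omega>", OF G_smooth KD s(1) c])
qed

lemma projection_coeffs:
  assumes s: "0 \<le> s" "\<omega> \<in> space M"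
  shows "(dg_norm Th (L2_projection k Th (superpose F s (E s \<omega>) (U s \<omega>))))\<^sup>2
     + (dg_norm Th (L2_projection k Th (superpose G s (E s \<omega>) (U s \<omega>))))\<^sup>2 = (\<Sum>j\<in>J. (H j s \<omega>)\<^sup>2)"
  unfolding sum_J H_def coeffs_def
  using L2_projection_norm_sq[where n=nE and e=eE and k=k, OF finite_cells compact_cell onb(1) continuous_source(1)[OF s]]
    L2_projection_norm_sq[where n=nU and e=eU and k=k, OF finite_cells compact_cell onb(2) continuous_source(2)[OF s]] by simp

text \<open>Bessel bounds the coefficients by the norm of the source, and linear growth bounds that
  by the area plus the energy. The product form is the shape demanded by
  \<open>linear_sde\<close>.\<close>

lemma source_growth:
  assumes s: "0 \<le> s" "\<omega> \<in> space M"
  shows "(\<Sum>j\<in>J. (H j s \<omega>)\<^sup>2) \<le> 3 * C\<^sup>2 * (1 + area) * (1 + (\<Sum>j\<in>J. (a j s \<omega>)\<^sup>2))"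
proof -
  let ?F = "superpose F s (E s \<omega>) (U s \<omega>)" and ?G = "superpose G s (E s \<omega>) (U s \<omega>)"
  let ?n = "\<Sum>j\<in>J. (a j s \<omega>)\<^sup>2"
  have n: "?n = (\<Sum>K\<in>Th. ip K (E s \<omega> K) (E s \<omega> K) + ip K (U s \<omega> K) (U s \<omega> K))"
    using norm_coeffs[OF in_dg_space[OF s]] unfolding a_def dg_norm_sq by (simp add: sum.distrib)
  have "(\<Sum>j\<in>J. (H j s \<omega>)\<^sup>2) = (\<Sum>K\<in>Th. (\<Sum>i<nE K. (ip K (?F K) (eE K i))\<^sup>2) + (\<Sum>i<nU K. (ip K (?G K) (eU K i))\<^sup>2))"
    unfolding sum_J H_def coeffs_def by (simp add: sum.distrib)
  also have "\<dots> \<le> (\<Sum>K\<in>Th. 3 * C\<^sup>2 * (ip K (\<lambda>x. 1::real) (\<lambda>x. 1) + ip K (E s \<omega> K) (E s \<omega> K) + ip K (U s \<omega> K) (U s \<omega> K)))"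
  proof (rule sum_mono)
    fix K assume K: "K \<in> Th"
    have "(\<Sum>i<nE K. (ip K (?F K) (eE K i))\<^sup>2) + (\<Sum>i<nU K. (ip K (?G K) (eU K i))\<^sup>2) \<le> ip K (?F K) (?F K) + ip K (?G K) (?G K)"
      by (intro add_mono bessel[OF compact_cell[OF K] onb(1)[OF K]] bessel[OF compact_cell[OF K] onb(2)[OF K]] continuous_source[OF s K])
    also have "\<dots> \<le> 3 * C\<^sup>2 * (ip K (\<lambda>x. 1::real) (\<lambda>x. 1) + ip K (E s \<omega> K) (E s \<omega> K) + ip K (U s \<omega> K) (U s \<omega> K))"
    proof (rule linear_growth_ip[where D=D and e="E s \<omega>" and u="U s \<omega>"])
      show "\<And>x s e u. x \<in> D \<Longrightarrow> 0 \<le> s \<Longrightarrow> \<bar>F x s e u\<bar> + norm (G x s e u) \<le> C * (1 + \<bar>e\<bar> + norm u)"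
        by (rule FG_growth)
      show "K \<subseteq> D" using K D_eq by blast
    qed (intro compact_cell K s continuous_source[OF s K] continuous_poly[OF in_poly_space(1)[OF s K]]
        continuous_poly[OF in_poly_space(2)[OF s K]])+
    finally show "(\<Sum>i<nE K. (ip K (?F K) (eE K i))\<^sup>2) + (\<Sum>i<nU K. (ip K (?G K) (eU K i))\<^sup>2)
      \<le> 3 * C\<^sup>2 * (ip K (\<lambda>x. 1::real) (\<lambda>x. 1) + ip K (E s \<omega> K) (E s \<omega> K) + ip K (U s \<omega> K) (U s \<omega> K))" .
  qed
  also have "\<dots> = 3 * C\<^sup>2 * (area + ?n)"
    unfolding n area_def by (simp add: sum.distrib sum_distrib_left distrib_left)
  also have "\<dots> \<le> 3 * C\<^sup>2 * ((1 + area) * (1 + ?n))"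
  proof (rule mult_left_mono)
    have "0 \<le> area * ?n" using area_nonneg by (intro mult_nonneg_nonneg sum_nonneg) auto
    then show "area + ?n \<le> (1 + area) * (1 + ?n)" by (simp add: algebra_simps)
  qed simp
  finally show ?thesis by (simp add: mult.assoc)
qed

lemma dg_sde: "linear_sde M Fil W J a H A (coeffs E0 U0) (3 * C\<^sup>2 * (1 + area))"
proof (intro linear_sde.intro linear_sde_axioms.intro)
  show "brownian_motion M Fil W" by (rule brownian_motion_axioms)
  show "finite J" by (rule finite_J)
  show "0 \<le> 3 * C\<^sup>2 * (1 + area)" using area_nonneg by simp
  have pE: "dg_process M Fil k Th E" and pU: "dg_process M Fil k Th U" using solution unfolding dg_solution_def by auto
  show "(\<Sum>j\<in>J. (H j s \<omega>)\<^sup>2) \<le> 3 * C\<^sup>2 * (1 + area) * (1 + (\<Sum>j\<in>J. (a j s \<omega>)\<^sup>2))" if "0 \<le> s" "\<omega> \<in> space M" for s \<omega>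
    by (rule source_growth[OF that])
  fix j assume j: "j \<in> J"
  show "AE \<omega> in M. a j 0 \<omega> = coeffs E0 U0 j"
  proof -
    have "AE \<omega> in M. E 0 \<omega> = E0 \<and> U 0 \<omega> = U0" using solution unfolding dg_solution_def by blast
    then show ?thesis by eventually_elim (simp add: a_def)
  qed
  show "continuous_on {0..} (\<lambda>s. a j s \<omega>)" if w: "\<omega> \<in> space M" for \<omega>
    using j
  proof (cases rule: J_cases)
    case (E K i)
    then show ?thesis unfolding a_def coeffs_def
      using dg_process_coeff(2)[OF brownian_motion_axioms pE E(2) compact_cell[OF E(2)] onb_poly(1)[OF E(2,3)] w] by simp
  next
    case (U K i)
    then show ?thesis unfolding a_def coeffs_def
      using dg_process_coeff(2)[OF brownian_motion_axioms pU U(2) compact_cell[OF U(2)] onb_poly(2)[OF U(2,3)] w] by simp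
  qed
  fix s :: real assume s: "0 \<le> s"
  show "a j s \<in> borel_measurable (Fil s)"
    using j
  proof (cases rule: J_cases)
    case (E K i)
    then show ?thesis unfolding a_def[abs_def] coeffs_def
      using dg_process_coeff(1)[OF brownian_motion_axioms pE E(2) compact_cell[OF E(2)] onb_poly(1)[OF E(2,3)] s] by simp
  next
    case (U K i)
    then show ?thesis unfolding a_def[abs_def] coeffs_def
      using dg_process_coeff(1)[OF brownian_motion_axioms pU U(2) compact_cell[OF U(2)] onb_poly(2)[OF U(2,3)] s] by simp
  qed
  show "has_ito_integral M Fil W (H j) s (\<lambda>\<omega>. a j s \<omega> - a j 0 \<omega> + (LINT u:{0..s}|lborel. \<Sum>l\<in>J. A j l * a l u \<omega>))"
    using j
  proof (cases rule: J_cases)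
    case (E K i)
    \<comment> \<open>The equation on K sees the test function on K only, so the same polynomial may
      be taken on all cells; \<open>restrict\<close> makes it a member of
      \<open>dg_space\<close>.\<close>
    define \<phi> :: "real piecewise" where "\<phi> = restrict (\<lambda>_. eE K i) Th"
    have \<phi>: "\<phi> \<in> dg_space k Th" unfolding dg_space_def \<phi>_def using onb_poly(1)[OF E(2,3)] by simp
    have \<phi>K: "\<phi> K = eE K i" unfolding \<phi>_def using E(2) by simp
    have Hj: "H j = (\<lambda>s \<omega>. LINT x:K|lborel. superpose F s (E s \<omega>) (U s \<omega>) K x * eE K i x)"
      unfolding E(1) H_def[abs_def] coeffs_def ip_def by simp
    have ito: "has_ito_integral M Fil W (\<lambda>s \<omega>. LINT x:K|lborel. superpose F s (E s \<omega>) (U s \<omega>) K x * eE K i x) s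
          (\<lambda>\<omega>. (LINT x:K|lborel. (E s \<omega> K x - E 0 \<omega> K x) * eE K i x)
             + (LINT s:{0..s}|lborel. drift1 (E s \<omega>) (U s \<omega>) K (eE K i)))"
      using solution \<phi> E(2) s unfolding dg_solution_def drift1_def \<phi>K[symmetric] by blast
    show ?thesis unfolding Hj
    proof (rule has_ito_integral_cong[OF _ ito])
      fix \<omega> assume w: "\<omega> \<in> space M"
      have c: "continuous_on K (E u \<omega> K)" if "0 \<le> u" for u
        by (rule continuous_poly[OF in_poly_space(1)[OF that w E(2)]])
      have "(LINT x:K|lborel. (E s \<omega> K x - E 0 \<omega> K x) * eE K i x) = ip K (\<lambda>x. E s \<omega> K x - E 0 \<omega> K x) (eE K i)"
        unfolding ip_def by simp
      also have "\<dots> = a j s \<omega> - a j 0 \<omega>"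
        unfolding ip_diff_left[OF compact_cell[OF E(2)] c[OF s] c[OF order_refl] continuous_poly[OF onb_poly(1)[OF E(2,3)]]]
        by (simp add: a_def coeffs_def E(1))
      finally have 1: "(LINT x:K|lborel. (E s \<omega> K x - E 0 \<omega> K x) * eE K i x) = a j s \<omega> - a j 0 \<omega>" .
      have 2: "(LINT u:{0..s}|lborel. drift1 (E u \<omega>) (U u \<omega>) K (eE K i)) = (LINT u:{0..s}|lborel. \<Sum>l\<in>J. A j l * a l u \<omega>)"
        by (rule set_lebesgue_integral_cong) (auto simp: drift_matrix(1)[OF _ w E(2,3)] E(1))
      show "(LINT x:K|lborel. (E s \<omega> K x - E 0 \<omega> K x) * eE K i x) + (LINT s:{0..s}|lborel. drift1 (E s \<omega>) (U s \<omega>) K (eE K i))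
        = a j s \<omega> - a j 0 \<omega> + (LINT u:{0..s}|lborel. \<Sum>l\<in>J. A j l * a l u \<omega>)"
        unfolding 1 2 ..
    qed
  next
    case (U K i)
    define \<phi> :: "(real^2) piecewise" where "\<phi> = restrict (\<lambda>_. eU K i) Th"
    have \<phi>: "\<phi> \<in> dg_space k Th" unfolding dg_space_def \<phi>_def using onb_poly(2)[OF U(2,3)] by simp
    have \<phi>K: "\<phi> K = eU K i" unfolding \<phi>_def using U(2) by simp
    have Hj: "H j = (\<lambda>s \<omega>. LINT x:K|lborel. superpose G s (E s \<omega>) (U s \<omega>) K x \<bullet> eU K i x)"
      unfolding U(1) H_def[abs_def] coeffs_def ip_def by simp
    have ito: "has_ito_integral M Fil W (\<lambda>s \<omega>. LINT x:K|lborel. superpose G s (E s \<omega>) (U s \<omega>) K x \<bullet> eU K i x) s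
          (\<lambda>\<omega>. (LINT x:K|lborel. (U s \<omega> K x - U 0 \<omega> K x) \<bullet> eU K i x)
             + (LINT s:{0..s}|lborel. drift2 (E s \<omega>) (U s \<omega>) K (eU K i)))"
      using solution \<phi> U(2) s unfolding dg_solution_def drift2_def \<phi>K[symmetric] by blast
    show ?thesis unfolding Hj
    proof (rule has_ito_integral_cong[OF _ ito])
      fix \<omega> assume w: "\<omega> \<in> space M"
      have c: "continuous_on K (U u \<omega> K)" if "0 \<le> u" for u
        by (rule continuous_poly[OF in_poly_space(2)[OF that w U(2)]])
      have "(LINT x:K|lborel. (U s \<omega> K x - U 0 \<omega> K x) \<bullet> eU K i x) = ip K (\<lambda>x. U s \<omega> K x - U 0 \<omega> K x) (eU K i)"
        unfolding ip_def by simp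
      also have "\<dots> = a j s \<omega> - a j 0 \<omega>"
        unfolding ip_diff_left[OF compact_cell[OF U(2)] c[OF s] c[OF order_refl] continuous_poly[OF onb_poly(2)[OF U(2,3)]]]
        by (simp add: a_def coeffs_def U(1))
      finally have 1: "(LINT x:K|lborel. (U s \<omega> K x - U 0 \<omega> K x) \<bullet> eU K i x) = a j s \<omega> - a j 0 \<omega>" .
      have 2: "(LINT u:{0..s}|lborel. drift2 (E u \<omega>) (U u \<omega>) K (eU K i)) = (LINT u:{0..s}|lborel. \<Sum>l\<in>J. A j l * a l u \<omega>)"
        by (rule set_lebesgue_integral_cong) (auto simp: drift_matrix(2)[OF _ w U(2,3)] U(1))
      show "(LINT x:K|lborel. (U s \<omega> K x - U 0 \<omega> K x) \<bullet> eU K i x) + (LINT s:{0..s}|lborel. drift2 (E s \<omega>) (U s \<omega>) K (eU K i))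
        = a j s \<omega> - a j 0 \<omega> + (LINT u:{0..s}|lborel. \<Sum>l\<in>J. A j l * a l u \<omega>)"
        unfolding 1 2 ..
    qed
  qed
qed

text \<open>Weighting the equations with the coefficients amounts to testing the scheme with the
  solution itself, so that \<open>energy_dissipation\<close> evaluates the quadratic form of
  A.\<close>

lemma energy_flux:
  assumes s: "0 \<le> s" "\<omega> \<in> space M"
  shows "(\<Sum>j\<in>J. a j s \<omega> * (\<Sum>l\<in>J. A j l * a l s \<omega>))
    = (1/2) * (\<Sum>(K, e)\<in>edges. edge_integral e (edge_loss (E s \<omega>) (U s \<omega>) K e))"
proof -
  note C1 = C1_field_poly[OF in_poly_space(1)[OF s]] C1_field_poly[OF in_poly_space(2)[OF s]]
  have c: "\<And>K. K \<in> Th \<Longrightarrow> continuous_on UNIV (E s \<omega> K)" "\<And>K. K \<in> Th \<Longrightarrow> continuous_on UNIV (U s \<omega> K)"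
    using in_poly_space[OF s] continuous_poly by blast+
  have "(\<Sum>j\<in>J. a j s \<omega> * (\<Sum>l\<in>J. A j l * a l s \<omega>))
    = (\<Sum>K\<in>Th. \<Sum>i<nE K. ip K (E s \<omega> K) (eE K i) * drift1 (E s \<omega>) (U s \<omega>) K (eE K i))
     + (\<Sum>K\<in>Th. \<Sum>i<nU K. ip K (U s \<omega> K) (eU K i) * drift2 (E s \<omega>) (U s \<omega>) K (eU K i))"
    unfolding sum_J[of "\<lambda>j. a j s \<omega> * (\<Sum>l\<in>J. A j l * a l s \<omega>)"]
    by (intro arg_cong2[where f="(+)"] sum.cong refl) (simp_all add: drift_matrix[OF s] a_def coeffs_def)
  also have "\<dots> = (\<Sum>K\<in>Th. drift1 (E s \<omega>) (U s \<omega>) K (E s \<omega> K) + drift2 (E s \<omega>) (U s \<omega>) K (U s \<omega> K))"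
    unfolding sum.distrib
  proof (intro arg_cong2[where f="(+)"] sum.cong refl)
    fix K assume K: "K \<in> Th"
    have "drift1 (E s \<omega>) (U s \<omega>) K (\<lambda>x. \<Sum>i<nE K. ip K (E s \<omega> K) (eE K i) *\<^sub>R eE K i x)
      = (\<Sum>i<nE K. ip K (E s \<omega> K) (eE K i) * drift1 (E s \<omega>) (U s \<omega>) K (eE K i))"
      by (rule drift1_test_sum[OF K _ _ c]) (use onb_poly(1)[OF K] C1_field_poly in auto)
    then show "(\<Sum>i<nE K. ip K (E s \<omega> K) (eE K i) * drift1 (E s \<omega>) (U s \<omega>) K (eE K i)) = drift1 (E s \<omega>) (U s \<omega>) K (E s \<omega> K)"
      unfolding cell_onb_rep[OF onb(1)[OF K] in_poly_space(1)[OF s K], symmetric] by (rule sym)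
    have "drift2 (E s \<omega>) (U s \<omega>) K (\<lambda>x. \<Sum>i<nU K. ip K (U s \<omega> K) (eU K i) *\<^sub>R eU K i x)
      = (\<Sum>i<nU K. ip K (U s \<omega> K) (eU K i) * drift2 (E s \<omega>) (U s \<omega>) K (eU K i))"
      by (rule drift2_test_sum[OF K _ _ c]) (use onb_poly(2)[OF K] C1_field_poly in auto)
    then show "(\<Sum>i<nU K. ip K (U s \<omega> K) (eU K i) * drift2 (E s \<omega>) (U s \<omega>) K (eU K i)) = drift2 (E s \<omega>) (U s \<omega>) K (U s \<omega> K)"
      unfolding cell_onb_rep[OF onb(2)[OF K] in_poly_space(2)[OF s K], symmetric] by (rule sym)
  qed
  also have "\<dots> = (1/2) * (\<Sum>(K, e)\<in>edges. edge_integral e (edge_loss (E s \<omega>) (U s \<omega>) K e))"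
    by (rule energy_dissipation[OF C1])
  finally show ?thesis .
qed

text \<open>The initial data are not assumed to lie in the discrete space. They coincide almost
  surely with the solution at time 0, hence for at least one outcome, and the solution does lie
  there.\<close>

lemma initial_norm: "(dg_norm Th E0)\<^sup>2 + (dg_norm Th U0)\<^sup>2 = (\<Sum>j\<in>J. (coeffs E0 U0 j)\<^sup>2)"
proof -
  have "AE \<omega> in M. E 0 \<omega> = E0 \<and> U 0 \<omega> = U0" using solution unfolding dg_solution_def by blast
  then have "AE \<omega> in M. \<omega> \<in> space M \<and> E 0 \<omega> = E0 \<and> U 0 \<omega> = U0" using AE_space by eventually_elim simp
  moreover have "ae_filter M \<noteq> bot" unfolding ae_filter_eq_bot_iff by (simp add: emeasure_space_1)
  ultimately obtain \<omega> where "\<omega> \<in> space M" "E 0 \<omega> = E0" "U 0 \<omega> = U0" using eventually_happens' by blast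
  then show ?thesis using norm_coeffs[OF in_dg_space[of 0 \<omega>]] by simp
qed

end

text \<open>The integrability claims give the comparison its content: Bochner integrals of
  nonintegrable functions are 0 by convention.\<close>

theorem theorem3p2:
  fixes M :: "'a measure" and Fil :: "real \<Rightarrow> 'a measure" and W :: "real \<Rightarrow> 'a \<Rightarrow> real"
    and \<Lambda> D :: "(real^2) set" and Th :: "(real^2) set set" and k :: nat
    and r :: "real^2" and \<sigma> \<kappa> \<alpha> \<beta>\<^sub>1 \<beta>\<^sub>2 t :: real
    and F :: "real^2 \<Rightarrow> real \<Rightarrow> real \<Rightarrow> real^2 \<Rightarrow> real"
    and G :: "real^2 \<Rightarrow> real \<Rightarrow> real \<Rightarrow> real^2 \<Rightarrow> real^2"
    and E0 :: "real piecewise" and U0 :: "(real^2) piecewise"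
    and E :: "real \<Rightarrow> 'a \<Rightarrow> real piecewise" and U :: "real \<Rightarrow> 'a \<Rightarrow> (real^2) piecewise"
  assumes "brownian_motion M Fil W"
    and "periodic_mesh \<Lambda> D Th" and "quasi_uniform \<sigma> Th"
    and "norm r = 1" and "\<kappa> > 0"
    and "\<And>K e. K \<in> Th \<Longrightarrow> e facet_of K \<Longrightarrow> \<kappa> \<le> \<bar>r \<bullet> outer_normal K e\<bar>"
    and "smooth_coeff D F" and "smooth_coeff D G"
    and "lipschitz_coeff D F" and "lipschitz_coeff D G"
    and "linear_growth D F G"
    and "\<beta>\<^sub>1 \<ge> 0" and "\<beta>\<^sub>2 \<ge> 0"
    and "dg_solution M Fil W \<Lambda> Th k r \<alpha> \<beta>\<^sub>1 \<beta>\<^sub>2 F G E0 U0 E U"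
    and "t \<ge> 0"
  shows "let PF = (\<lambda>\<tau> \<omega>. L2_projection k Th (superpose F \<tau> (E \<tau> \<omega>) (U \<tau> \<omega>)));
             PG = (\<lambda>\<tau> \<omega>. L2_projection k Th (superpose G \<tau> (E \<tau> \<omega>) (U \<tau> \<omega>)));
             energy = (\<lambda>\<omega>. (dg_norm Th (E t \<omega>))\<^sup>2 + (dg_norm Th (U t \<omega>))\<^sup>2);
             source = (\<lambda>\<tau> \<omega>. (dg_norm Th (PF \<tau> \<omega>))\<^sup>2 + (dg_norm Th (PG \<tau> \<omega>))\<^sup>2)
         in integrable M energy
          \<and> (\<forall>\<tau>\<in>{0..t}. integrable M (source \<tau>))
          \<and> set_integrable lborel {0..t} (\<lambda>\<tau>. \<integral>\<omega>. source \<tau> \<omega> \<partial>M)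
          \<and> (\<integral>\<omega>. energy \<omega> \<partial>M)
              \<le> (dg_norm Th E0)\<^sup>2 + (dg_norm Th U0)\<^sup>2
                + (LINT \<tau>:{0..t}|lborel. (\<integral>\<omega>. source \<tau> \<omega> \<partial>M))
          \<and> (\<beta>\<^sub>1 = 0 \<and> \<beta>\<^sub>2 = 0 \<longrightarrow>
              (\<integral>\<omega>. energy \<omega> \<partial>M)
              = (dg_norm Th E0)\<^sup>2 + (dg_norm Th U0)\<^sup>2
                + (LINT \<tau>:{0..t}|lborel. (\<integral>\<omega>. source \<tau> \<omega> \<partial>M)))"
proof -
  obtain C where C: "\<forall>x\<in>D. \<forall>t\<ge>0. \<forall>e u. \<bar>F x t e u\<bar> + norm (G x t e u) \<le> C * (1 + \<bar>e\<bar> + norm u)"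
    using \<open>linear_growth D F G\<close> unfolding linear_growth_def by blast
  interpret B: brownian_motion M Fil W by fact
  interpret P: periodic_mesh \<Lambda> D Th by fact
  interpret S: dg_scheme M Fil W \<Lambda> D Th r \<alpha> \<beta>\<^sub>1 \<beta>\<^sub>2 k F G E0 U0 E U C
    by unfold_locales (use assms C in auto)
  interpret L: linear_sde M Fil W S.J S.a S.H S.A "S.coeffs E0 U0" "3 * C\<^sup>2 * (1 + S.area)"
    by (rule S.dg_sde)
  define energy where "energy = (\<lambda>\<omega>. (dg_norm Th (E t \<omega>))\<^sup>2 + (dg_norm Th (U t \<omega>))\<^sup>2)"
  define source where "source = (\<lambda>\<tau> \<omega>. (dg_norm Th (L2_projection k Th (superpose F \<tau> (E \<tau> \<omega>) (U \<tau> \<omega>))))\<^sup>2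
    + (dg_norm Th (L2_projection k Th (superpose G \<tau> (E \<tau> \<omega>) (U \<tau> \<omega>))))\<^sup>2)"
  note t = \<open>t \<ge> 0\<close>
  have en: "energy \<omega> = (\<Sum>j\<in>S.J. (S.a j t \<omega>)\<^sup>2)" if "\<omega> \<in> space M" for \<omega>
    unfolding energy_def S.a_def by (rule S.norm_coeffs[OF S.in_dg_space[OF t that]])
  have so: "source \<tau> \<omega> = (\<Sum>j\<in>S.J. (S.H j \<tau> \<omega>)\<^sup>2)" if "\<omega> \<in> space M" "0 \<le> \<tau>" for \<tau> \<omega>
    unfolding source_def by (rule S.projection_coeffs[OF that(2,1)])
  have e1: "integrable M energy"
    using L.energy(1)[OF t] by (rule Bochner_Integration.integrable_cong[THEN iffD2, OF refl en, rotated]) simp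
  have ien: "(\<integral>\<omega>. energy \<omega> \<partial>M) = (\<integral>\<omega>. (\<Sum>j\<in>S.J. (S.a j t \<omega>)\<^sup>2) \<partial>M)"
    by (rule Bochner_Integration.integral_cong[OF refl en])
  have iso: "(\<integral>\<omega>. source \<tau> \<omega> \<partial>M) = (\<integral>\<omega>. (\<Sum>j\<in>S.J. (S.H j \<tau> \<omega>)\<^sup>2) \<partial>M)" if "0 \<le> \<tau>" for \<tau>
    by (rule Bochner_Integration.integral_cong[OF refl so[OF _ that]])
  have e3: "integrable M (source \<tau>)" if "0 \<le> \<tau>" for \<tau>
    using L.energy(2)[OF t that]
    by (rule Bochner_Integration.integrable_cong[THEN iffD2, OF refl so[OF _ that], rotated]) simp
  have e4: "set_integrable lborel {0..t} (\<lambda>\<tau>. \<integral>\<omega>. source \<tau> \<omega> \<partial>M)"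
    using L.energy(3)[OF t] by (subst set_integrable_cong[OF refl refl iso]) auto
  have e5: "(LINT \<tau>:{0..t}|lborel. (\<integral>\<omega>. source \<tau> \<omega> \<partial>M)) = (LINT \<tau>:{0..t}|lborel. (\<integral>\<omega>. (\<Sum>j\<in>S.J. (S.H j \<tau> \<omega>)\<^sup>2) \<partial>M))"
    by (rule set_lebesgue_integral_cong) (auto simp: iso)
  have pos: "0 \<le> (\<Sum>j\<in>S.J. S.a j s \<omega> * (\<Sum>l\<in>S.J. S.A j l * S.a l s \<omega>))" if "0 \<le> s" "\<omega> \<in> space M" for s \<omega>
  proof -
    have "0 \<le> edge_integral e (S.edge_loss (E s \<omega>) (U s \<omega>) K e)" for K e
      unfolding S.edge_loss_def using \<open>\<beta>\<^sub>1 \<ge> 0\<close> \<open>\<beta>\<^sub>2 \<ge> 0\<close> by (intro edge_integral_nonneg) simp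
    then show ?thesis unfolding S.energy_flux[OF that] by (auto intro!: sum_nonneg)
  qed
  have zero: "(\<Sum>j\<in>S.J. S.a j s \<omega> * (\<Sum>l\<in>S.J. S.A j l * S.a l s \<omega>)) = 0"
    if "\<beta>\<^sub>1 = 0 \<and> \<beta>\<^sub>2 = 0" "0 \<le> s" "\<omega> \<in> space M" for s \<omega>
  proof -
    have "edge_integral e (S.edge_loss (E s \<omega>) (U s \<omega>) K e) = 0" for K e
      unfolding S.edge_loss_def using that(1) edge_integral_cmult[of e 0 "\<lambda>x. 0"] by simp
    then show ?thesis unfolding S.energy_flux[OF that(2,3)] by (simp add: case_prod_unfold)
  qed
  have le: "(\<integral>\<omega>. energy \<omega> \<partial>M) \<le> (dg_norm Th E0)\<^sup>2 + (dg_norm Th U0)\<^sup>2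
      + (LINT \<tau>:{0..t}|lborel. (\<integral>\<omega>. source \<tau> \<omega> \<partial>M))"
    unfolding S.initial_norm e5 ien by (rule L.energy(4)[OF t pos])
  have eq: "(\<integral>\<omega>. energy \<omega> \<partial>M) = (dg_norm Th E0)\<^sup>2 + (dg_norm Th U0)\<^sup>2
      + (LINT \<tau>:{0..t}|lborel. (\<integral>\<omega>. source \<tau> \<omega> \<partial>M))" if "\<beta>\<^sub>1 = 0 \<and> \<beta>\<^sub>2 = 0"
    unfolding S.initial_norm e5 ien by (rule L.energy(5)[OF t zero[OF that]])
  have "integrable M energy \<and> (\<forall>\<tau>\<in>{0..t}. integrable M (source \<tau>))
      \<and> set_integrable lborel {0..t} (\<lambda>\<tau>. \<integral>\<omega>. source \<tau> \<omega> \<partial>M)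
      \<and> (\<integral>\<omega>. energy \<omega> \<partial>M) \<le> (dg_norm Th E0)\<^sup>2 + (dg_norm Th U0)\<^sup>2
          + (LINT \<tau>:{0..t}|lborel. (\<integral>\<omega>. source \<tau> \<omega> \<partial>M))
      \<and> (\<beta>\<^sub>1 = 0 \<and> \<beta>\<^sub>2 = 0 \<longrightarrow> (\<integral>\<omega>. energy \<omega> \<partial>M) = (dg_norm Th E0)\<^sup>2 + (dg_norm Th U0)\<^sup>2
          + (LINT \<tau>:{0..t}|lborel. (\<integral>\<omega>. source \<tau> \<omega> \<partial>M)))"
    using e1 e3 e4 le eq by (intro conjI ballI impI) simp_all
  then show ?thesis unfolding Let_def energy_def source_def .
qed

end
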